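(* Let $(X_i)_{i\ge1}$ be i.i.d. real random variables with $\mathbb E X_1^2\in(0,\infty)$. Assume that $X_1$ is non-lattice and that there exist $\lambda>0$ and $\delta>0$ such that $\mathbb E X_1e^{\lambda X_1}=0$ and $\mathbb E|X_1|^{2+\delta}e^{\lambda X_1}<\infty$. Let $(\alpha_n)_{n\ge1}$ be any sequence of positive numbers satisfying $\lim_{n\to\infty}\alpha_n=0$. Then, as $n\to\infty$, uniformly in $x\in[0,\alpha_n\sqrt n]$, $$\mathbb P(\tau_x>n)\sim\frac{2V_\lambda(x)\,e^{n\Lambda(\lambda)+\lambda x}}{\sqrt{2\pi}\,\sigma_\lambda^3\,n^{3/2}}\int_{\mathbb R_+}e^{-\lambda t}V_\lambda^*(t)\,dt.$$
   Context: Notation: $\mathbb R_+=[0,\infty)$; $S_n=\sum_{i=1}^nX_i$, $S_n^*=-S_n$; for $x\ge0$, $\tau_x=\inf\{k\ge1:\ x+S_k<0\}$, $\tau_x^*=\inf\{k\ge1:\ x+S_k^*<0\}$, with $\inf\emptyset=\infty$. A random variable $X$ is non-lattice if for all $h>0$ and $a\in[0,h)$, $\mathbb P(X\in h\mathbb Z+a)\ne1$. $\Lambda(\lambda)=\log\mathbb E e^{\lambda X_1}$. $\mathbb P_\lambda$ (with expectation $\mathbb E_\lambda$) is the probability measure under which $(X_i)$ are i.i.d. with law $\mathbb P_\lambda(X_1\in dx)=e^{\lambda x-\Lambda(\lambda)}\mathbb P(X_1\in dx)$. $\sigma_\lambda^2=\mathbb E_\lambda X_1^2=e^{-\Lambda(\lambda)}\mathbb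 E(X_1^2e^{\lambda X_1})$, $\sigma_\lambda>0$. For $x\ge0$, $V_\lambda(x)=-\mathbb E_\lambda S_{\tau_x}$ and $V_\lambda^*(x)=-\mathbb E_\lambda S^*_{\tau^*_x}$. Uniform asymptotic equivalence: $a_n(\theta)\sim b_n(\theta)$ uniformly in $\theta\in A_n$ as $n\to\infty$ means $\lim_{n\to\infty}\sup_{\theta\in A_n}\left|\frac{a_n(\theta)}{b_n(\theta)}-1\right|=0$. *)

theory Defs
  imports "HOL-Probability.Probability"
begin

definition walk :: "(nat \<Rightarrow> 'a \<Rightarrow> real) \<Rightarrow> nat \<Rightarrow> 'a \<Rightarrow> real" where
  "walk X n \<omega> = (\<Sum>i=1..n. X i \<omega>)"

definition dual_walk :: "(nat \<Rightarrow> 'a \<Rightarrow> real) \<Rightarrow> nat \<Rightarrow> 'a \<Rightarrow> real" where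
  "dual_walk X n \<omega> = - walk X n \<omega>"

text \<open>The infimum is taken in \<^typ>\<open>enat\<close>, so it is \<open>\<infinity>\<close> on paths that never exit.\<close>

definition exit_time :: "(nat \<Rightarrow> 'a \<Rightarrow> real) \<Rightarrow> real \<Rightarrow> 'a \<Rightarrow> enat" where
  "exit_time S x \<omega> = Inf (enat ` {k. k \<ge> 1 \<and> x + S k \<omega> < 0})"

definition non_lattice :: "'a measure \<Rightarrow> ('a \<Rightarrow> real) \<Rightarrow> bool" where
  "non_lattice M Y \<longleftrightarrow>
    (\<forall>h>0. \<forall>a\<in>{0..<h}. measure M {\<omega> \<in> space M. \<exists>k::int. Y \<omega> = h * of_int k + a} \<noteq> 1)"

text \<open>In the next definitions \<open>\<mu>\<close> is the law of \<open>X\<^sub>1\<close> on the real line.\<close>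

definition log_mgf :: "real measure \<Rightarrow> real \<Rightarrow> real" where
  "log_mgf \<mu> l = ln (\<integral>y. exp (l * y) \<partial>\<mu>)"

definition tilted_law :: "real measure \<Rightarrow> real \<Rightarrow> real measure" where
  "tilted_law \<mu> l = density \<mu> (\<lambda>y. ennreal (exp (l * y - log_mgf \<mu> l)))"

text \<open>
  An i.i.d. sequence with the tilted law is realised as the coordinate process on the infinite
  product space. The tilted measure cannot in general be put on the original probability space
  (the laws of the two infinite sequences are mutually singular unless the tilt is trivial), and
  all quantities below depend only on the law of the sequence.
\<close>

definition tilted_measure :: "real measure \<Rightarrow> real \<Rightarrow> (nat \<Rightarrow> real) measure" where
  "tilted_measure \<mu> l = PiM {1..} (\<lambda>_. tilted_law \<mu> l)"

definition coord :: "nat \<Rightarrow> (nat \<Rightarrow> real) \<Rightarrow> real" where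
  "coord i \<omega> = \<omega> i"

definition tilted_sd :: "real measure \<Rightarrow> real \<Rightarrow> real" where
  "tilted_sd \<mu> l = sqrt (\<integral>\<omega>. (coord 1 \<omega>)\<^sup>2 \<partial>tilted_measure \<mu> l)"

text \<open>
  The value \<open>0\<close> at infinite times is a convention; for a walk with centred increments of positive
  finite variance the exit time is almost surely finite.
\<close>

definition stopped_value :: "(nat \<Rightarrow> 'a \<Rightarrow> real) \<Rightarrow> ('a \<Rightarrow> enat) \<Rightarrow> 'a \<Rightarrow> real" where
  "stopped_value S T \<omega> = (case T \<omega> of enat k \<Rightarrow> S k \<omega> | \<infinity> \<Rightarrow> 0)"

definition V :: "real measure \<Rightarrow> real \<Rightarrow> real \<Rightarrow> real" where
  "V \<mu> l x = - (\<integral>\<omega>. stopped_value (walk coord) (exit_time (walk coord) x) \<omega> \<partial>tilted_measure \<mu> l)"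

definition V_dual :: "real measure \<Rightarrow> real \<Rightarrow> real \<Rightarrow> real" where
  "V_dual \<mu> l x =
    - (\<integral>\<omega>. stopped_value (dual_walk coord) (exit_time (dual_walk coord) x) \<omega> \<partial>tilted_measure \<mu> l)"

text \<open>
  The supremum is taken in \<^typ>\<open>ereal\<close>, so an unbounded family has supremum \<open>\<infinity>\<close>. If \<open>b n \<theta> = 0\<close>
  for some \<open>\<theta> \<in> A n\<close>, then the supremum is at least \<open>1\<close>, because division by zero yields zero.
\<close>

definition unif_asymp_equiv :: "(nat \<Rightarrow> 'p \<Rightarrow> real) \<Rightarrow> (nat \<Rightarrow> 'p \<Rightarrow> real) \<Rightarrow> (nat \<Rightarrow> 'p set) \<Rightarrow> bool" where
  "unif_asymp_equiv a b A \<longleftrightarrow>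
    (\<lambda>n. SUP \<theta>\<in>A n. ereal \<bar>a n \<theta> / b n \<theta> - 1\<bar>) \<longlonglongrightarrow> 0"

end

theory Submission
  imports Defs "HOL-Real_Asymp.Real_Asymp" "HOL-Computational_Algebra.Formal_Power_Series"
begin

unbundle no vec_syntax
unbundle fps_syntax

text \<open>
  Under the exponential change of measure the walk is centred, and
  \<open>P(\<tau>\<^sub>x > n) = e\<^bsup>n\<Lambda> + \<lambda>x\<^esup> E\<^sub>\<lambda>(e\<^bsup>-\<lambda>(x + S\<^sub>n)\<^esup>; \<tau>\<^sub>x > n)\<close>. Splitting the path at its minimum writes this
  expectation as a convolution in \<open>n\<close> of a descending and an ascending sequence, each of order
  \<open>n\<^bsup>-3/2\<^esup>\<close>; so one factor always carries the asymptotics while the other one is summed. The rate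
  \<open>n\<^bsup>-3/2\<^esup>\<close> for a single sequence \<open>w\<close> comes from Spitzer's identity, which expresses \<open>n w\<^sub>n\<close> as a
  convolution of \<open>w\<close> with expectations of the unrestricted walk, and these are of exact order
  \<open>n\<^bsup>-1/2\<^esup>\<close> by a local limit theorem. The local limit theorem is needed only for the function
  \<open>e\<^bsup>-\<lambda>u\<^esup>\<close> on \<open>u \<ge> 0\<close>, and is obtained by Fourier inversion after smoothing with the Fejer kernel.
  Mean ladder heights turn the sums over \<open>n\<close> into \<open>V\<^sub>\<lambda>\<close> and \<open>V\<^sub>\<lambda>\<^sup>*\<close>, and the constant is found from
  the fact that the product of the two mean ladder heights is \<open>\<sigma>\<^sub>\<lambda>\<^sup>2 / 2\<close>.
\<close>

section \<open>The convolution semiring of finite measures on the line\<close>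

text \<open>Two obstacles shape the proof. The first is uniformity in x up to o(sqrt n): errors may
  be a small multiple of 1 + x, the convolution lemmas fix their thresholds before this scale and
  the sequences are known, and since a multiple of the renewal function dominates 1 + x, the errors
  become relative at the end. The second is that exact constants need crude bounds beforehand, as
  dominated sums require n^(-3/2) as an upper bound. These bounds are bootstrapped: concentration of
  the unrestricted walk and a martingale bound give survival probabilities of order n^(-1/2),
  concentration over half of the time then gives 1/n for local quantities, and Spitzer's identity
  improves this to n^(-3/2).

  Finite measures are made a type so that generating functions become formal power series over a
  semiring.\<close>

typedef fmeas = "{A :: real measure. sets A = sets borel \<and> finite_measure A}"
  morphisms mea Abs_fmeas
  by (rule exI[of _ "null_measure borel"]) (auto intro!: finite_measureI)

lemma sets_mea [simp, measurable_cong]: "sets (mea A) = sets borel"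
  using mea[of A] by simp

lemma space_mea [simp]: "space (mea A) = UNIV"
  using sets_eq_imp_space_eq[OF sets_mea[of A]] by simp

lemma finite_mea [simp]: "finite_measure (mea A)"
  using mea[of A] by simp

lemma sigma_finite_mea [simp]: "sigma_finite_measure (mea A)"
  using finite_mea[of A] by (rule finite_measure.sigma_finite_measure)

lemma emeasure_mea_finite [simp]: "emeasure (mea A) E \<noteq> \<infinity>" "emeasure (mea A) E \<noteq> top"
  using finite_measure.emeasure_finite[OF finite_mea, of A E] by auto

lemma measurable_mea [simp]:
  "measurable (mea A) N = measurable borel N"
  by (rule measurable_cong_sets) simp_all

abbreviation nni :: "fmeas \<Rightarrow> (real \<Rightarrow> ennreal) \<Rightarrow> ennreal" where
  "nni A f \<equiv> integral\<^sup>N (mea A) f"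

abbreviation ev :: "fmeas \<Rightarrow> (real \<Rightarrow> real) \<Rightarrow> real" where
  "ev A f \<equiv> integral\<^sup>L (mea A) f"

lemma fmeas_eqI:
  assumes "\<And>f. f \<in> borel_measurable borel \<Longrightarrow> nni A f = nni B f"
  shows "A = B"
proof -
  have "mea A = mea B"
  proof (rule measure_eqI)
    fix E assume "E \<in> sets (mea A)"
    then have E: "E \<in> sets borel" by simp
    then have "nni A (indicator E) = nni B (indicator E)" by (intro assms) auto
    then show "emeasure (mea A) E = emeasure (mea B) E" using E by simp
  qed simp
  then show ?thesis by (simp add: mea_inject)
qed

definition sum_measure :: "real measure \<Rightarrow> real measure \<Rightarrow> real measure" where
  "sum_measure A B = measure_of UNIV (sets borel) (\<lambda>E. emeasure A E + emeasure B E)"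

lemma sets_sum_measure [simp]: "sets (sum_measure A B) = sets borel"
  unfolding sum_measure_def by (subst sets_measure_of) (auto simp: sets.sigma_sets_eq[of borel, simplified])

lemma emeasure_sum_measure:
  assumes "sets A = sets borel" "sets B = sets borel" "E \<in> sets borel"
  shows "emeasure (sum_measure A B) E = emeasure A E + emeasure B E"
  unfolding sum_measure_def
proof (rule emeasure_measure_of_sigma)
  show "sigma_algebra UNIV (sets (borel :: real measure))"
    using sets.sigma_algebra_axioms[of "borel :: real measure"] by simp
  show "positive (sets borel) (\<lambda>E. emeasure A E + emeasure B E)"
    by (simp add: positive_def)
  show "countably_additive (sets borel) (\<lambda>E. emeasure A E + emeasure B E)"
  proof (rule countably_additiveI)
    fix F :: "nat \<Rightarrow> real set"
    assume F: "range F \<subseteq> sets borel" "disjoint_family F"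
    have "(\<Sum>i. emeasure A (F i) + emeasure B (F i)) = (\<Sum>i. emeasure A (F i)) + (\<Sum>i. emeasure B (F i))"
      by (simp add: suminf_add)
    also have "\<dots> = emeasure A (\<Union>i. F i) + emeasure B (\<Union>i. F i)"
      using F assms by (simp add: suminf_emeasure)
    finally show "(\<Sum>i. emeasure A (F i) + emeasure B (F i)) = emeasure A (\<Union> (range F)) + emeasure B (\<Union> (range F))" .
  qed
qed fact

lemma nn_integral_sum_measure:
  assumes A[measurable_cong]: "sets A = sets borel" and B[measurable_cong]: "sets B = sets borel"
    and "f \<in> borel_measurable borel"
  shows "integral\<^sup>N (sum_measure A B) f = integral\<^sup>N A f + integral\<^sup>N B f"
  using assms(3)
proof induction
  case (cong f g)
  then have "f = g" by auto
  with cong show ?case by simp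
next
  case (set E)
  then show ?case by (simp add: emeasure_sum_measure assms A B)
next
  case (mult u c)
  have [measurable]: "u \<in> borel_measurable (sum_measure A B)"
    using mult by (simp add: measurable_cong_sets[OF sets_sum_measure refl])
  show ?case using mult by (simp add: nn_integral_cmult measurable_cong_sets[OF A refl] measurable_cong_sets[OF B refl] distrib_left)
next
  case (add u v)
  have [measurable]: "u \<in> borel_measurable (sum_measure A B)" "v \<in> borel_measurable (sum_measure A B)"
    using add by (simp_all add: measurable_cong_sets[OF sets_sum_measure refl])
  show ?case using add by (simp add: nn_integral_add measurable_cong_sets[OF A refl] measurable_cong_sets[OF B refl] ac_simps)
next
  case (seq U)
  have [measurable]: "U i \<in> borel_measurable (sum_measure A B)" for i
    using seq by (simp add: measurable_cong_sets[OF sets_sum_measure refl])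
  have m: "U i \<in> borel_measurable A" "U i \<in> borel_measurable B" for i
    using seq by (simp_all add: measurable_cong_sets[OF A refl] measurable_cong_sets[OF B refl])
  have U: "incseq U" by fact
  have inc: "incseq (\<lambda>i. integral\<^sup>N A (U i))" "incseq (\<lambda>i. integral\<^sup>N B (U i))"
    using U by (auto intro!: incseq_SucI nn_integral_mono simp: incseq_Suc_iff le_fun_def)
  have "integral\<^sup>N (sum_measure A B) (\<lambda>x. SUP i. U i x) = (SUP i. integral\<^sup>N (sum_measure A B) (U i))"
    by (rule nn_integral_monotone_convergence_SUP[OF U]) simp
  also have "\<dots> = (SUP i. integral\<^sup>N A (U i) + integral\<^sup>N B (U i))"
    using seq by simp
  also have "\<dots> = (SUP i. integral\<^sup>N A (U i)) + (SUP i. integral\<^sup>N B (U i))"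
    using inc by (rule ennreal_SUP_add)
  also have "\<dots> = integral\<^sup>N A (\<lambda>x. SUP i. U i x) + integral\<^sup>N B (\<lambda>x. SUP i. U i x)"
    using m by (simp add: nn_integral_monotone_convergence_SUP[OF U])
  finally show ?case by (simp add: SUP_apply image_comp)
qed

section \<open>Addition, convolution and the semiring axioms\<close>

instantiation fmeas :: "{zero, one, plus, times}"
begin

definition "0 = Abs_fmeas (null_measure borel)"
definition "1 = Abs_fmeas (return borel 0)"
definition "A + B = Abs_fmeas (sum_measure (mea A) (mea B))"
definition "A * B = Abs_fmeas (mea A \<star> mea B)"

instance ..

end

lemma mea_zero: "mea 0 = null_measure borel"
  unfolding zero_fmeas_def by (subst Abs_fmeas_inverse) (auto intro!: finite_measureI)

lemma mea_one: "mea 1 = return borel 0"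
  unfolding one_fmeas_def
  by (subst Abs_fmeas_inverse) (auto intro!: prob_space_return[THEN prob_space.finite_measure])

lemma mea_plus: "mea (A + B) = sum_measure (mea A) (mea B)"
  unfolding plus_fmeas_def
  by (subst Abs_fmeas_inverse) (auto intro!: finite_measureI simp: emeasure_sum_measure sets_eq_imp_space_eq[OF sets_sum_measure])

lemma mea_times: "mea (A * B) = (mea A \<star> mea B)"
  unfolding times_fmeas_def
  by (subst Abs_fmeas_inverse) (auto intro!: convolution_finite)

lemma nni_zero [simp]: "nni 0 f = 0"
  by (simp add: mea_zero)

lemma nni_one [simp]: "f \<in> borel_measurable borel \<Longrightarrow> nni 1 f = f 0"
  by (simp add: mea_one nn_integral_return)

lemma nni_plus [simp]: "f \<in> borel_measurable borel \<Longrightarrow> nni (A + B) f = nni A f + nni B f"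
  by (simp add: mea_plus nn_integral_sum_measure)

lemma nni_times: "f \<in> borel_measurable borel \<Longrightarrow> nni (A * B) f = (\<integral>\<^sup>+x. \<integral>\<^sup>+y. f (x + y) \<partial>mea B \<partial>mea A)"
  by (simp add: mea_times nn_integral_convolution)

lemma measurable_nni_shift [measurable]:
  assumes [measurable]: "f \<in> borel_measurable borel"
  shows "(\<lambda>x. nni B (\<lambda>y. f (x + y))) \<in> borel_measurable borel"
proof -
  interpret sigma_finite_measure "mea B" by simp
  have "(\<lambda>x. \<integral>\<^sup>+y. (case_prod (\<lambda>x y. f (x + y))) (x, y) \<partial>mea B) \<in> borel_measurable borel"
    by (rule borel_measurable_nn_integral_fst) measurable
  then show ?thesis by simp
qed

instance fmeas :: comm_semiring_1
proof
  fix A B C :: fmeas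
  show "A + B + C = A + (B + C)" by (rule fmeas_eqI) (simp add: ac_simps)
  show "A + B = B + A" by (rule fmeas_eqI) (simp add: ac_simps)
  show "0 + A = A" by (rule fmeas_eqI) simp
  show "A * B * C = A * (B * C)"
    by (simp add: mea_inject[symmetric] mea_times convolution_associative)
  show "A * B = B * A"
    by (simp add: mea_inject[symmetric] mea_times convolution_commutative)
  show "1 * A = A" by (rule fmeas_eqI) (simp add: nni_times)
  show "(A + B) * C = A * C + B * C"
    by (rule fmeas_eqI) (simp add: nni_times)
  show "0 * A = 0" by (rule fmeas_eqI) (simp add: nni_times)
  show "A * 0 = 0" by (rule fmeas_eqI) (simp add: nni_times)
  have "nni 0 (\<lambda>_. 1) \<noteq> nni 1 (\<lambda>_. 1)" by (simp del: nn_integral_const)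
  then show "(0 :: fmeas) \<noteq> 1" by metis
qed

text \<open>Finiteness of the measures enters here: \<open>a + b = a + c\<close> in
  \<open>ennreal\<close> can be cancelled only for finite \<open>a\<close>. Cancellation is the
  substitute for subtraction in all the algebra of generating series below.\<close>

instance fmeas :: cancel_semigroup_add
proof
  fix A B C :: fmeas
  have *: "B = C" if "A + B = A + C" for A
  proof -
    have "mea B = mea C"
    proof (rule measure_eqI)
      fix E assume "E \<in> sets (mea B)"
      then have E: "E \<in> sets borel" by simp
      have "emeasure (mea A) E + emeasure (mea B) E = emeasure (mea A) E + emeasure (mea C) E"
        using nni_plus[of "indicator E" A B] nni_plus[of "indicator E" A C] that E by simp
      then show "emeasure (mea B) E = emeasure (mea C) E" by (simp add: ennreal_add_left_cancel)
    qed simp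
    then show ?thesis by (simp add: mea_inject)
  qed
  show "A + B = A + C \<Longrightarrow> B = C" by (rule *)
  show "B + A = C + A \<Longrightarrow> B = C" by (rule *[of A]) (simp add: add.commute)
qed

lemma nni_sum: "f \<in> borel_measurable borel \<Longrightarrow> nni (\<Sum>i\<in>I. A i) f = (\<Sum>i\<in>I. nni (A i) f)"
  by (induction I rule: infinite_finite_induct) auto

lemma nni_of_nat_mult: "f \<in> borel_measurable borel \<Longrightarrow> nni (of_nat n * A) f = of_nat n * nni A f"
  by (induction n) (auto simp: algebra_simps)

section \<open>Restriction to a set and concentration on a set\<close>

definition restr :: "real set \<Rightarrow> fmeas \<Rightarrow> fmeas" where
  "restr D A = Abs_fmeas (density (mea A) (indicator D))"

lemma mea_restr: "D \<in> sets borel \<Longrightarrow> mea (restr D A) = density (mea A) (indicator D)"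
  unfolding restr_def
proof (subst Abs_fmeas_inverse, safe)
  assume [measurable]: "D \<in> sets borel"
  show "finite_measure (density (mea A) (indicator D))"
  proof (rule finite_measureI)
    have "emeasure (density (mea A) (indicator D)) UNIV = emeasure (mea A) D"
      by (subst emeasure_density) auto
    then show "emeasure (density (mea A) (indicator D)) (space (density (mea A) (indicator D))) \<noteq> \<infinity>"
      by simp
  qed
qed auto

lemma nni_restr: "D \<in> sets borel \<Longrightarrow> f \<in> borel_measurable borel \<Longrightarrow>
    nni (restr D A) f = nni A (\<lambda>x. indicator D x * f x)"
  by (simp add: mea_restr nn_integral_density)

lemma restr_zero [simp]: "D \<in> sets borel \<Longrightarrow> restr D 0 = 0"
  by (rule fmeas_eqI) (simp add: nni_restr)

lemma restr_add: "D \<in> sets borel \<Longrightarrow> restr D (A + B) = restr D A + restr D B"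
  by (rule fmeas_eqI) (simp add: nni_restr)

lemma restr_of_nat_mult: "D \<in> sets borel \<Longrightarrow> restr D (of_nat n * A) = of_nat n * restr D A"
  by (rule fmeas_eqI) (simp add: nni_restr nni_of_nat_mult)

lemma restr_UNIV [simp]: "restr UNIV A = A"
  by (rule fmeas_eqI) (simp add: nni_restr)

lemma restr_split: "D \<in> sets borel \<Longrightarrow> restr D A + restr (- D) A = A"
proof (rule fmeas_eqI)
  fix f :: "real \<Rightarrow> ennreal" assume [measurable]: "D \<in> sets borel" "f \<in> borel_measurable borel"
  have "nni A (\<lambda>x. indicator D x * f x) + nni A (\<lambda>x. indicator (- D) x * f x) = nni A f"
    by (subst nn_integral_add[symmetric]) (auto intro!: nn_integral_cong split: split_indicator)
  then show "nni (restr D A + restr (- D) A) f = nni A f"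
    by (simp add: nni_restr)
qed

definition concentrated :: "fmeas \<Rightarrow> real set \<Rightarrow> bool" where
  "concentrated A D \<longleftrightarrow> D \<in> sets borel \<and> (AE x in mea A. x \<in> D)"

lemma concentrated_nni_cong:
  assumes "concentrated A D" "\<And>x. x \<in> D \<Longrightarrow> f x = g x"
  shows "nni A f = nni A g"
  using assms by (intro nn_integral_cong_AE) (auto simp: concentrated_def)

lemma concentrated_iff: "D \<in> sets borel \<Longrightarrow> concentrated A D \<longleftrightarrow> nni A (indicator (- D)) = 0"
  unfolding concentrated_def by (subst nn_integral_0_iff_AE) (auto simp: indicator_def)

lemma concentrated_restr: "D \<in> sets borel \<Longrightarrow> concentrated (restr D A) D"
  by (subst concentrated_iff) (auto simp: nni_restr simp flip: indicator_inter_arith simp del: nn_integral_indicator)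

lemma concentrated_zero [simp]: "D \<in> sets borel \<Longrightarrow> concentrated 0 D"
  by (subst concentrated_iff) auto

lemma concentrated_one [simp]: "D \<in> sets borel \<Longrightarrow> 0 \<in> D \<Longrightarrow> concentrated 1 D"
  by (subst concentrated_iff) (auto simp del: nn_integral_indicator)

lemma concentrated_add: "concentrated A D \<Longrightarrow> concentrated B D \<Longrightarrow> concentrated (A + B) D"
  by (metis (no_types, lifting) concentrated_iff concentrated_def nni_plus add.right_neutral borel_measurable_indicator borel_comp)

lemma concentrated_sum: "D \<in> sets borel \<Longrightarrow> (\<And>i. i \<in> I \<Longrightarrow> concentrated (A i) D) \<Longrightarrow> concentrated (\<Sum>i\<in>I. A i) D"
  by (induction I rule: infinite_finite_induct) (auto intro: concentrated_add)

lemma concentrated_times: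
  assumes "concentrated A D" "concentrated B E" "F \<in> sets borel" "\<And>x y. x \<in> D \<Longrightarrow> y \<in> E \<Longrightarrow> x + y \<in> F"
  shows "concentrated (A * B) F"
proof -
  have "nni (A * B) (indicator (- F)) = (\<integral>\<^sup>+x. \<integral>\<^sup>+y. indicator (- F) (x + y) \<partial>mea B \<partial>mea A)"
    using assms by (simp add: nni_times del: nn_integral_indicator)
  also have "\<dots> = (\<integral>\<^sup>+x. 0 \<partial>mea A)"
  proof (rule concentrated_nni_cong[OF assms(1)])
    fix x assume "x \<in> D"
    then have "(\<integral>\<^sup>+y. indicator (- F) (x + y) \<partial>mea B) = (\<integral>\<^sup>+y. 0 \<partial>mea B)"
      using assms by (intro concentrated_nni_cong[OF assms(2)]) auto
    then show "(\<integral>\<^sup>+y. indicator (- F) (x + y) \<partial>mea B) = (0::ennreal)" by simp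
  qed
  finally show ?thesis using assms(3) by (simp add: concentrated_iff del: nn_integral_indicator)
qed

lemma restr_concentrated: "concentrated A D \<Longrightarrow> restr D A = A"
proof (rule fmeas_eqI)
  fix f :: "real \<Rightarrow> ennreal" assume "concentrated A D" "f \<in> borel_measurable borel"
  then show "nni (restr D A) f = nni A f"
    by (subst nni_restr) (auto simp: concentrated_def intro!: concentrated_nni_cong[of A D])
qed

lemma restr_concentrated_disjoint:
  assumes "concentrated A E" "D \<in> sets borel" "D \<inter> E = {}"
  shows "restr D A = 0"
proof (rule fmeas_eqI)
  fix f :: "real \<Rightarrow> ennreal" assume "f \<in> borel_measurable borel"
  then have "nni (restr D A) f = nni A (\<lambda>x. indicator D x * f x)"
    using assms by (simp add: nni_restr)
  also have "\<dots> = nni A (\<lambda>_. 0)"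
    using assms by (intro concentrated_nni_cong[of A E]) (auto split: split_indicator)
  finally have "nni (restr D A) f = nni A (\<lambda>_. 0)" .
  then show "nni (restr D A) f = nni 0 f" by simp
qed

lemma concentrated_mono: "concentrated A D \<Longrightarrow> D \<subseteq> E \<Longrightarrow> E \<in> sets borel \<Longrightarrow> concentrated A E"
  unfolding concentrated_def by auto

section \<open>Wiener--Hopf factorisation and Spitzer's identity\<close>

text \<open>Law of the n-th position on the event that the positions at times 1 to n all lie in
  \<open>D\<close>; its mass is the probability of not having left. At time 0 it is the unit mass at
  0 even when 0 is not in \<open>D\<close>, which matters for the strict half-line
  \<open>{..<0}\<close>.\<close>

fun stay :: "fmeas \<Rightarrow> real set \<Rightarrow> nat \<Rightarrow> fmeas" where
  "stay \<nu> D 0 = 1"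
| "stay \<nu> D (Suc n) = restr D (stay \<nu> D n * \<nu>)"

text \<open>Law of the n-th position on the event that n is the first time outside \<open>D\<close>.
  For a half-line \<open>D\<close> the sum over n is a ladder height distribution.\<close>

fun leave :: "fmeas \<Rightarrow> real set \<Rightarrow> nat \<Rightarrow> fmeas" where
  "leave \<nu> D 0 = 0"
| "leave \<nu> D (Suc n) = restr (- D) (stay \<nu> D n * \<nu>)"

lemma leave_Suc_add_stay_Suc:
  "D \<in> sets borel \<Longrightarrow> stay \<nu> D (Suc n) + leave \<nu> D (Suc n) = stay \<nu> D n * \<nu>"
  by (simp add: restr_split)

lemma stay_UNIV: "stay \<nu> UNIV n = \<nu> ^ n"
  by (induction n) (auto simp: mult.commute)

lemma concentrated_stay: "D \<in> sets borel \<Longrightarrow> n > 0 \<Longrightarrow> concentrated (stay \<nu> D n) D"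
  by (cases n) (auto intro: concentrated_restr)

lemma concentrated_stay0: "D \<in> sets borel \<Longrightarrow> concentrated (stay \<nu> D n) (insert 0 D)"
  by (cases n) (auto intro: concentrated_restr concentrated_mono)

lemma concentrated_leave: "D \<in> sets borel \<Longrightarrow> concentrated (leave \<nu> D n) (- D)"
  by (cases n) (auto intro: concentrated_restr)

abbreviation stayF :: "fmeas \<Rightarrow> real set \<Rightarrow> fmeas fps" where
  "stayF \<nu> D \<equiv> Abs_fps (stay \<nu> D)"

abbreviation leaveF :: "fmeas \<Rightarrow> real set \<Rightarrow> fmeas fps" where
  "leaveF \<nu> D \<equiv> Abs_fps (leave \<nu> D)"

lemma stay_leave_fps:
  assumes "D \<in> sets borel"
  shows "stayF \<nu> D + leaveF \<nu> D = 1 + fps_X * fps_const \<nu> * stayF \<nu> D"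
proof (rule fps_ext)
  fix n
  show "(stayF \<nu> D + leaveF \<nu> D) $ n = (1 + fps_X * fps_const \<nu> * stayF \<nu> D) $ n"
  proof (cases n)
    case (Suc m)
    have "(fps_X * (fps_const \<nu> * stayF \<nu> D)) $ Suc m = stay \<nu> D m * \<nu>"
      by (simp add: mult.commute)
    then show ?thesis
      using leave_Suc_add_stay_Suc[OF assms, of \<nu> m] Suc by (simp add: mult.assoc del: stay.simps leave.simps)
  qed (simp add: mult.assoc)
qed

text \<open>
  The algebra of the factorisation, in a semiring where only cancellation is available: \<open>P\<close>, \<open>R\<close>
  are the generating series of staying in and of leaving a set, \<open>X\<close> is the step.
\<close>

lemma semiring_cross:
  fixes P R M S X :: "'s :: {comm_semiring_1, cancel_semigroup_add}"
  assumes "P + R = 1 + X * P" "M + S = 1 + X * M"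
  shows "R * M + P = M + P * S"
proof -
  \<comment> \<open>With subtraction, both \<open>(1 - R) * M\<close> and \<open>P * (1 - S)\<close>
    would equal \<open>P * (1 - X) * M\<close>.\<close>
  have a: "P * M + R * M = M + X * P * M"
    using arg_cong[OF assms(1), of "\<lambda>u. u * M"] by (simp add: distrib_right mult.assoc)
  have b: "P * M + P * S = P + X * P * M"
    using arg_cong[OF assms(2), of "\<lambda>u. P * u"] by (simp add: distrib_left ac_simps)
  have "(P * M + X * P * M) + (R * M + P) = (P * M + R * M) + (P + X * P * M)" by (simp add: ac_simps)
  also have "\<dots> = (M + X * P * M) + (P * M + P * S)" by (simp only: a b)
  also have "\<dots> = (P * M + X * P * M) + (M + P * S)" by (simp add: ac_simps)
  finally show ?thesis by (rule add_left_imp_eq)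
qed

text \<open>With subtraction: \<open>P * (1 - S) = Q\<close> and \<open>A * (1 - S) = 1\<close> give
  \<open>P = Q * A\<close>. Here \<open>P * A\<close> is expanded in two ways and the common term
  \<open>P * A * S\<close> is cancelled.\<close>

lemma semiring_factor:
  fixes P Q A S :: "'s :: {comm_semiring_1, cancel_semigroup_add}"
  assumes "P = Q + P * S" "A = 1 + A * S"
  shows "P = Q * A"
proof -
  have 1: "P * A = Q * A + P * A * S"
    by (subst assms(1)) (simp add: distrib_left distrib_right ac_simps)
  have 2: "P * A = P + P * A * S"
    by (subst assms(2)) (simp add: distrib_left distrib_right ac_simps)
  have "P + P * A * S = Q * A + P * A * S" using 1 2 by (rule trans[OF sym, rotated])
  then show ?thesis by (rule add_right_imp_eq)
qed

text \<open>With subtraction: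
  \<open>1 - R = P * (1 - X) = Q * A * (1 - X) = Q * (1 - L)\<close>.\<close>

lemma semiring_leave:
  fixes P Q A R L X :: "'s :: {comm_semiring_1, cancel_semigroup_add}"
  assumes 1: "P + R = 1 + X * P" and 2: "A + L = 1 + X * A" and 3: "P = Q * A"
  shows "R + Q = 1 + Q * L"
proof -
  have "P + (R + Q) = (P + R) + Q" by (simp add: ac_simps)
  also have "\<dots> = 1 + Q * (1 + X * A)" unfolding 1 unfolding 3 by (simp add: distrib_left distrib_right ac_simps)
  also have "\<dots> = P + (1 + Q * L)" unfolding 2[symmetric] unfolding 3 by (simp add: distrib_left distrib_right ac_simps)
  finally show ?thesis by (rule add_left_imp_eq)
qed

text \<open>With subtraction: multiplying \<open>P * (1 - X) = 1 - R\<close> by \<open>1 - S\<close>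
  and using \<open>P * (1 - S) = 1\<close> gives \<open>1 - X = (1 - R) * (1 - S)\<close>.\<close>

lemma semiring_wiener_hopf:
  fixes P R S X :: "'s :: {comm_semiring_1, cancel_semigroup_add}"
  assumes 1: "P = 1 + P * S" and 2: "P + R = 1 + X * P"
  shows "S + R = X + R * S"
proof -
  have 3: "P * S + R = X * P"
  proof -
    have "1 + (P * S + R) = (1 + P * S) + R" by (simp add: ac_simps)
    also have "\<dots> = 1 + X * P" by (simp only: 1[symmetric] 2)
    finally show ?thesis by (rule add_left_imp_eq)
  qed
  have 4: "X * P = X + X * P * S"
    by (subst 1) (simp add: distrib_left distrib_right ac_simps)
  have 5: "X * P * S = P * S * S + R * S"
    by (subst 3[symmetric]) (simp add: distrib_left distrib_right ac_simps)
  have 6: "P * S = S + P * S * S"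
    by (subst 1) (simp add: distrib_left distrib_right ac_simps)
  have "P * S * S + (S + R) = (S + P * S * S) + R" by (simp add: ac_simps)
  also have "\<dots> = P * S + R" by (simp only: 6[symmetric])
  also have "\<dots> = X + X * P * S" by (simp only: 3 4[symmetric])
  also have "\<dots> = P * S * S + (X + R * S)" by (simp only: 5) (simp add: ac_simps)
  finally show ?thesis by (rule add_left_imp_eq)
qed

lemma stay_leave_cross:
  assumes "D \<in> sets borel" "E \<in> sets borel"
  shows "leaveF \<nu> D * stayF \<nu> E + stayF \<nu> D = stayF \<nu> E + stayF \<nu> D * leaveF \<nu> E"
  by (rule semiring_cross[OF stay_leave_fps stay_leave_fps]) fact+

text \<open>The factorisation rests on two complementary sets, each closed under addition.
  Exchanging their roles (\<open>swap\<close>) covers the weak and the strict half-line at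
  once.\<close>

locale half_split =
  fixes A B :: "real set"
  assumes A [measurable, simp]: "A \<in> sets borel" and B: "B = - A"
    and add_A: "\<And>x y. x \<in> A \<Longrightarrow> y \<in> A \<Longrightarrow> x + y \<in> A"
    and add_B: "\<And>x y. x \<in> B \<Longrightarrow> y \<in> B \<Longrightarrow> x + y \<in> B"
begin

lemma B_sets [measurable, simp]: "B \<in> sets borel"
  by (simp add: B)

lemma swap: "half_split B A"
  using B add_A add_B by unfold_locales auto

lemma concentrated_leave_A: "concentrated (leave \<nu> A n) B"
  using concentrated_leave[OF A] B by simp

lemma concentrated_leave_B: "concentrated (leave \<nu> B n) A"
  using concentrated_leave[OF B_sets] B by simp

text \<open>The model is \<open>{- x..}\<close> with \<open>A = {0..}\<close> and x \<ge> 0: adding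
  an element of \<open>A\<close> does not lead out of \<open>D\<close>, adding an element of
  \<open>B\<close> does not lead back. Since 0 has to belong to \<open>D\<close>, a strict half-line
  is not of this kind.\<close>

definition admissible :: "real set \<Rightarrow> bool" where
  "admissible D \<longleftrightarrow> D \<in> sets borel \<and> 0 \<in> D \<and> (\<forall>x\<in>D. \<forall>y\<in>A. x + y \<in> D) \<and> (\<forall>x\<in>-D. \<forall>y\<in>B. x + y \<in> - D)"

lemma leave_times_stay_conc:
  assumes "D \<in> sets borel" "\<forall>x\<in>-D. \<forall>y\<in>B. x + y \<in> - D"
  shows "concentrated ((leaveF \<nu> D * stayF \<nu> B) $ n) (- D)"
  unfolding fps_mult_nth
proof (rule concentrated_sum)
  fix i
  show "concentrated (leaveF \<nu> D $ i * stayF \<nu> B $ (n - i)) (- D)"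
    unfolding fps_nth_Abs_fps
    by (rule concentrated_times[OF concentrated_leave[OF assms(1)] concentrated_stay0[OF B_sets]]) (use assms in auto)
qed (use assms in simp)

text \<open>The cross identity for the walks killed outside \<open>D\<close> and outside
  \<open>B\<close>, restricted to \<open>D\<close>. The term
  \<open>leaveF \<nu> D * stayF \<nu> B\<close> disappears because a walk that has left
  \<open>D\<close> and then moves by 0 or by an element of \<open>B\<close> remains outside;
  \<open>stayF \<nu> D * leaveF \<nu> B\<close> survives whole because leaving \<open>B\<close>
  means entering \<open>A\<close>.\<close>

lemma stay_eq:
  assumes "admissible D"
  shows "stayF \<nu> D = Abs_fps (\<lambda>n. restr D (stay \<nu> B n)) + stayF \<nu> D * leaveF \<nu> B"
proof (rule fps_ext)
  fix n
  have D: "D \<in> sets borel" "0 \<in> D" "\<forall>x\<in>D. \<forall>y\<in>A. x + y \<in> D" "\<forall>x\<in>-D. \<forall>y\<in>B. x + y \<in> - D"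
    using assms by (auto simp: admissible_def)
  have c1: "concentrated (stay \<nu> D n) D" for n
    using concentrated_stay0[OF D(1)] D(2) by (simp add: insert_absorb)
  have c2: "concentrated ((stayF \<nu> D * leaveF \<nu> B) $ n) D"
    unfolding fps_mult_nth
  proof (rule concentrated_sum)
    fix i
    show "concentrated (stayF \<nu> D $ i * leaveF \<nu> B $ (n - i)) D"
      unfolding fps_nth_Abs_fps
      by (rule concentrated_times[OF c1 concentrated_leave_B]) (use D(1,3) in auto)
  qed (use D in simp)
  have "restr D ((leaveF \<nu> D * stayF \<nu> B + stayF \<nu> D) $ n)
      = restr D ((stayF \<nu> B + stayF \<nu> D * leaveF \<nu> B) $ n)"
    using stay_leave_cross[OF D(1) B_sets, of \<nu>] by simp
  then show "stayF \<nu> D $ n = (Abs_fps (\<lambda>n. restr D (stay \<nu> B n)) + stayF \<nu> D * leaveF \<nu> B) $ n"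
    using restr_concentrated_disjoint[OF leave_times_stay_conc[OF D(1,4)] D(1), of \<nu> n]
      restr_concentrated[OF c1, of n] restr_concentrated[OF c2] D(1)
    by (simp add: restr_add)
qed

text \<open>A renewal equation: staying in \<open>A\<close> is described by sums of ladder heights
  through \<open>A\<close>, whose law is \<open>leaveF \<nu> B\<close>. Classically this is duality
  by time reversal; here it is read off from the cross identity. As 0 need not lie in
  \<open>A\<close>, the set \<open>A\<close> may fail to be admissible, and the coefficient at time
  0 is treated separately.\<close>

lemma stay_A_renewal: "stayF \<nu> A = 1 + stayF \<nu> A * leaveF \<nu> B"
proof (rule fps_ext)
  fix n
  show "stayF \<nu> A $ n = (1 + stayF \<nu> A * leaveF \<nu> B) $ n"
  proof (cases n)
    case 0
    then show ?thesis by (simp add: fps_mult_nth)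
  next
    case (Suc m)
    have c1: "concentrated ((stayF \<nu> A * leaveF \<nu> B) $ n) A"
      unfolding fps_mult_nth
    proof (rule concentrated_sum)
      fix i assume "i \<in> {0..n}"
      show "concentrated (stayF \<nu> A $ i * leaveF \<nu> B $ (n - i)) A"
        unfolding fps_nth_Abs_fps
        by (rule concentrated_times[OF concentrated_stay0[OF A] concentrated_leave_B A]) (auto intro: add_A)
    qed simp
    have c2: "concentrated ((leaveF \<nu> A * stayF \<nu> B) $ n) B"
      using leave_times_stay_conc[OF A, of \<nu> n] add_B B by auto
    have c3: "concentrated (stay \<nu> A n) A" "concentrated (stay \<nu> B n) B"
      using concentrated_stay[OF A, of n \<nu>] concentrated_stay[OF B_sets, of n \<nu>] Suc by simp_all
    have d: "A \<inter> B = {}" using B by auto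
    have "restr A ((leaveF \<nu> A * stayF \<nu> B + stayF \<nu> A) $ n)
        = restr A ((stayF \<nu> B + stayF \<nu> A * leaveF \<nu> B) $ n)"
      using stay_leave_cross[OF A B_sets, of \<nu>] by simp
    then show ?thesis
      using restr_concentrated_disjoint[OF c2 A d] restr_concentrated_disjoint[OF c3(2) A d]
        restr_concentrated[OF c3(1)] restr_concentrated[OF c1] Suc
      by (simp add: restr_add del: stay.simps)
  qed
qed

text \<open>For \<open>A = {0..}\<close> this is the decomposition at the minimum: by time reversal
  the first factor describes a minimum that still lies in \<open>D\<close>, and the second the path
  after it, which never goes below its starting point.\<close>

lemma stay_factorisation:
  assumes "admissible D"
  shows "stayF \<nu> D = Abs_fps (\<lambda>n. restr D (stay \<nu> B n)) * stayF \<nu> A"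
  by (rule semiring_factor[OF stay_eq stay_A_renewal]) fact

lemma power_factorisation: "Abs_fps (\<lambda>n. \<nu> ^ n) = stayF \<nu> B * stayF \<nu> A"
proof -
  have "admissible UNIV" by (simp add: admissible_def)
  from stay_factorisation[OF this, of \<nu>] show ?thesis
    by (simp add: stay_UNIV[abs_def])
qed

text \<open>For \<open>A = {0..}\<close>: the exit from \<open>D\<close> happens at a new minimum,
  reached from an earlier minimum inside \<open>D\<close> by one ladder height of law
  \<open>leaveF \<nu> A\<close>.\<close>

lemma leave_factorisation:
  assumes "admissible D"
  shows "leaveF \<nu> D + Abs_fps (\<lambda>n. restr D (stay \<nu> B n)) = 1 + Abs_fps (\<lambda>n. restr D (stay \<nu> B n)) * leaveF \<nu> A"
  by (rule semiring_leave[OF stay_leave_fps stay_leave_fps[OF A] stay_factorisation[OF assms]])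
     (use assms in \<open>simp add: admissible_def\<close>)

lemma wiener_hopf: "leaveF \<nu> B + leaveF \<nu> A = fps_X * fps_const \<nu> + leaveF \<nu> A * leaveF \<nu> B"
  by (rule semiring_wiener_hopf[OF stay_A_renewal stay_leave_fps[OF A]])

text \<open>In Spitzer's formula the series of \<open>stay\<close> is the exponential of the series
  with coefficients \<open>restr C (\<nu> ^ n) / n\<close>. The identity is used in differentiated
  form, as the semiring has no division by n; this is the formal derivative of the exponent times
  the variable.\<close>

definition restrF :: "fmeas \<Rightarrow> real set \<Rightarrow> fmeas fps" where
  "restrF \<nu> C = Abs_fps (\<lambda>n. if n = 0 then 0 else restr C (\<nu> ^ n))"

lemma restrF_nth: "restrF \<nu> C $ n = (if n = 0 then 0 else restr C (\<nu> ^ n))"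
  by (simp add: restrF_def)

text \<open>
  Both sides of Spitzer's identity for \<open>A\<close> and \<open>B\<close> are recovered together from the power
  factorisation: the coefficients below \<open>n\<close> cancel by induction, and at \<open>n\<close> the two identities
  live on disjoint sets.
\<close>

lemma spitzer_both:
  shows "of_nat n * stay \<nu> A n = (restrF \<nu> A * stayF \<nu> A) $ n \<and> of_nat n * stay \<nu> B n = (restrF \<nu> B * stayF \<nu> B) $ n"
proof (induction n rule: less_induct)
  case (less n)
  define DA DB where "DA = Abs_fps (\<lambda>n. of_nat n * stay \<nu> A n)" and "DB = Abs_fps (\<lambda>n. of_nat n * stay \<nu> B n)"
  let ?P = "stayF \<nu> A" and ?M = "stayF \<nu> B" and ?G = "Abs_fps (\<lambda>n. \<nu> ^ n)"
  define QA QB where "QA = restrF \<nu> A * ?P" and "QB = restrF \<nu> B * ?M"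
  show ?case
  proof (cases "n = 0")
    case True
    then show ?thesis by (simp add: restrF_nth)
  next
    case False
    have G: "?G = ?M * ?P" by (rule power_factorisation)
    have q: "(restrF \<nu> A + restrF \<nu> B) $ k = (if k = 0 then 0 else \<nu> ^ k)" for k
      using restr_split[OF A, of "\<nu> ^ k"] B by (simp add: restrF_nth)
    \<comment> \<open>Each of the n nonzero terms is
      \<open>\<nu> ^ k * \<nu> ^ (n - k) = \<nu> ^ n\<close>, so the sum is n times the coefficient
      of \<open>?G\<close>.\<close>
    have "((restrF \<nu> A + restrF \<nu> B) * ?G) $ n = (\<Sum>k=0..n. if k = 0 then 0 else \<nu> ^ n)"
      unfolding fps_mult_nth q by (intro sum.cong) (auto simp flip: power_add)
    also have "\<dots> = (\<Sum>k=1..n. \<nu> ^ n)"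
      by (rule sum.mono_neutral_cong_right) auto
    also have "\<dots> = of_nat n * ?G $ n" by simp
    also have "\<dots> = (\<Sum>k=0..n. of_nat n * (?M $ k * ?P $ (n - k)))"
      unfolding G fps_mult_nth by (simp add: sum_distrib_left)
    \<comment> \<open>Leibniz rule for the derivation that multiplies the n-th coefficient by
      n.\<close>
    also have "\<dots> = (\<Sum>k=0..n. DB $ k * ?P $ (n - k) + ?M $ k * DA $ (n - k))"
    proof (rule sum.cong)
      fix k assume k: "k \<in> {0..n}"
      then have "of_nat n = (of_nat k + of_nat (n - k) :: fmeas)" by (simp flip: of_nat_add)
      then show "of_nat n * (?M $ k * ?P $ (n - k)) = DB $ k * ?P $ (n - k) + ?M $ k * DA $ (n - k)"
        by (simp add: DA_def DB_def algebra_simps)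
    qed simp
    also have "\<dots> = (DA * ?M) $ n + (DB * ?P) $ n"
      by (simp add: sum.distrib fps_mult_nth mult.commute[of DA ?M] add.commute)
    finally have "(DA * ?M) $ n + (DB * ?P) $ n = (QA * ?M) $ n + (QB * ?P) $ n"
      unfolding QA_def QB_def G by (simp add: algebra_simps)
    then have m: "(\<Sum>k<n. DA $ k * ?M $ (n - k) + DB $ k * ?P $ (n - k)) + (DA $ n + DB $ n)
        = (\<Sum>k<n. QA $ k * ?M $ (n - k) + QB $ k * ?P $ (n - k)) + (QA $ n + QB $ n)"
      by (simp add: fps_mult_nth atLeast0AtMost sum.distrib algebra_simps flip: lessThan_Suc_atMost)
    have s: "(\<Sum>k<n. DA $ k * ?M $ (n - k) + DB $ k * ?P $ (n - k))
        = (\<Sum>k<n. QA $ k * ?M $ (n - k) + QB $ k * ?P $ (n - k))"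
      using less by (intro sum.cong) (auto simp: DA_def DB_def QA_def QB_def)
    have eq: "DA $ n + DB $ n = QA $ n + QB $ n"
      using m unfolding s by (rule add_left_imp_eq)
    have cQA: "concentrated (QA $ n) A"
      unfolding QA_def fps_mult_nth
    proof (rule concentrated_sum)
      fix i
      have "concentrated (restrF \<nu> A $ i) A" by (auto simp: restrF_nth intro: concentrated_restr)
      then show "concentrated (restrF \<nu> A $ i * ?P $ (n - i)) A"
        unfolding fps_nth_Abs_fps
        by (rule concentrated_times[OF _ concentrated_stay0[OF A] A]) (auto intro: add_A)
    qed simp
    have cQB: "concentrated (QB $ n) B"
      unfolding QB_def fps_mult_nth
    proof (rule concentrated_sum)
      fix i
      have "concentrated (restrF \<nu> B $ i) B" by (auto simp: restrF_nth intro: concentrated_restr)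
      then show "concentrated (restrF \<nu> B $ i * ?M $ (n - i)) B"
        unfolding fps_nth_Abs_fps
        by (rule concentrated_times[OF _ concentrated_stay0[OF B_sets] B_sets]) (auto intro: add_B)
    qed simp
    have cn: "concentrated (stay \<nu> A n) A" "concentrated (stay \<nu> B n) B"
      using False by (auto intro: concentrated_stay)
    have d: "A \<inter> B = {}" "B \<inter> A = {}" using B by auto
    have "restr A (DA $ n + DB $ n) = restr A (QA $ n + QB $ n)" "restr B (DA $ n + DB $ n) = restr B (QA $ n + QB $ n)"
      using eq by simp_all
    then show ?thesis
      using restr_concentrated[OF cQA] restr_concentrated[OF cQB] restr_concentrated[OF cn(1)] restr_concentrated[OF cn(2)]
        restr_concentrated_disjoint[OF cQA B_sets d(2)] restr_concentrated_disjoint[OF cQB A d(1)]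
        restr_concentrated_disjoint[OF cn(1) B_sets d(2)] restr_concentrated_disjoint[OF cn(2) A d(1)]
      by (simp add: restr_add restr_of_nat_mult DA_def DB_def QA_def QB_def)
  qed
qed

lemma spitzer:
  "of_nat n * stay \<nu> A n = (\<Sum>k=1..n. restr A (\<nu> ^ k) * stay \<nu> A (n - k))"
proof -
  have "of_nat n * stay \<nu> A n = (\<Sum>k=0..n. (if k = 0 then 0 else restr A (\<nu> ^ k)) * stay \<nu> A (n - k))"
    using spitzer_both[of n \<nu>] by (simp add: fps_mult_nth restrF_nth)
  also have "\<dots> = (\<Sum>k=1..n. restr A (\<nu> ^ k) * stay \<nu> A (n - k))"
    by (rule sum.mono_neutral_cong_right) auto
  finally show ?thesis .
qed

end

section \<open>Real integrals of bounded functions\<close>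

text \<open>The integrands for which real and nonnegative integrals agree against every finite
  measure, so that semiring identities turn into identities of real numbers without integrability
  conditions.\<close>

definition nonneg_bounded :: "(real \<Rightarrow> real) \<Rightarrow> bool" where
  "nonneg_bounded f \<longleftrightarrow> f \<in> borel_measurable borel \<and> (\<exists>C. \<forall>x. 0 \<le> f x \<and> f x \<le> C)"

lemma nonneg_boundedI: "f \<in> borel_measurable borel \<Longrightarrow> (\<And>x. 0 \<le> f x) \<Longrightarrow> (\<And>x. f x \<le> C) \<Longrightarrow> nonneg_bounded f"
  unfolding nonneg_bounded_def by auto

lemma nonneg_bounded_measurable [measurable_dest]: "nonneg_bounded f \<Longrightarrow> f \<in> borel_measurable borel"
  unfolding nonneg_bounded_def by auto

lemma nonneg_boundedD: "nonneg_bounded f \<Longrightarrow> 0 \<le> f x"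
  unfolding nonneg_bounded_def by auto

lemma integrable_bounded:
  fixes f :: "real \<Rightarrow> 'b :: {banach, second_countable_topology}"
  shows "f \<in> borel_measurable borel \<Longrightarrow> (\<And>x. norm (f x) \<le> C) \<Longrightarrow> integrable (mea A) f"
  by (rule finite_measure.integrable_const_bound[OF finite_mea, of _ C]) auto

lemma nonneg_bounded_integrable: "nonneg_bounded f \<Longrightarrow> integrable (mea A) f"
  unfolding nonneg_bounded_def by (auto intro!: integrable_bounded)

lemma ennreal_ev: "nonneg_bounded f \<Longrightarrow> ennreal (ev A f) = nni A (\<lambda>x. ennreal (f x))"
  by (subst nn_integral_eq_integral) (auto intro: nonneg_bounded_integrable nonneg_boundedD)

lemma ev_nonneg: "nonneg_bounded f \<Longrightarrow> 0 \<le> ev A f"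
  by (intro integral_nonneg_AE) (auto intro: nonneg_boundedD)

lemma ev_eq_enn2real: "nonneg_bounded f \<Longrightarrow> ev A f = enn2real (nni A (\<lambda>x. ennreal (f x)))"
  by (simp add: ennreal_ev[symmetric] ev_nonneg)

lemma nonneg_bounded_const [simp]: "0 \<le> c \<Longrightarrow> nonneg_bounded (\<lambda>_. c)"
  by (auto simp: nonneg_bounded_def)

lemma nonneg_bounded_indicator [simp]: "E \<in> sets borel \<Longrightarrow> nonneg_bounded (indicator E)"
  by (rule nonneg_boundedI[of _ 1]) (auto simp: indicator_def)

lemma nonneg_bounded_mult: "nonneg_bounded f \<Longrightarrow> nonneg_bounded g \<Longrightarrow> nonneg_bounded (\<lambda>x. f x * g x)"
proof -
  assume "nonneg_bounded f" "nonneg_bounded g"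
  then obtain C D where "\<forall>x. 0 \<le> f x \<and> f x \<le> C" "\<forall>x. 0 \<le> g x \<and> g x \<le> D"
    and [measurable]: "f \<in> borel_measurable borel" "g \<in> borel_measurable borel"
    unfolding nonneg_bounded_def by auto
  then show ?thesis by (intro nonneg_boundedI[of _ "C * D"]) (auto intro!: mult_mono order_trans[of 0 "f _" C])
qed

lemma nonneg_bounded_add: "nonneg_bounded f \<Longrightarrow> nonneg_bounded g \<Longrightarrow> nonneg_bounded (\<lambda>x. f x + g x)"
proof -
  assume "nonneg_bounded f" "nonneg_bounded g"
  then obtain C D where "\<forall>x. 0 \<le> f x \<and> f x \<le> C" "\<forall>x. 0 \<le> g x \<and> g x \<le> D"
    and [measurable]: "f \<in> borel_measurable borel" "g \<in> borel_measurable borel"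
    unfolding nonneg_bounded_def by auto
  then show ?thesis by (intro nonneg_boundedI[of _ "C + D"]) (auto intro!: add_mono)
qed

lemma nonneg_bounded_compose:
  "nonneg_bounded f \<Longrightarrow> g \<in> borel_measurable borel \<Longrightarrow> nonneg_bounded (\<lambda>x. f (g x))"
  unfolding nonneg_bounded_def by auto

lemma nonneg_bounded_shift [intro]:
  "nonneg_bounded f \<Longrightarrow> nonneg_bounded (\<lambda>y. f (x + y))" "nonneg_bounded f \<Longrightarrow> nonneg_bounded (\<lambda>y. f (y + x))"
  by (auto intro: nonneg_bounded_compose)

abbreviation mass :: "fmeas \<Rightarrow> real" where "mass A \<equiv> measure (mea A) UNIV"

lemma ev_const: "ev A (\<lambda>_. c) = c * mass A"
  by simp

lemma ev_mono_conc:
  assumes "nonneg_bounded f" "nonneg_bounded g" "concentrated A D" "\<And>x. x \<in> D \<Longrightarrow> f x \<le> g x"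
  shows "ev A f \<le> ev A g"
  using assms by (intro integral_mono_AE nonneg_bounded_integrable) (auto simp: concentrated_def)

lemma ev_mono:
  assumes "nonneg_bounded f" "nonneg_bounded g" "\<And>x. f x \<le> g x"
  shows "ev A f \<le> ev A g"
  using assms by (intro integral_mono nonneg_bounded_integrable) auto

lemma ev_cong_conc:
  assumes "f \<in> borel_measurable borel" "g \<in> borel_measurable borel" "concentrated A D" "\<And>x. x \<in> D \<Longrightarrow> f x = g x"
  shows "ev A f = ev A g"
  using assms by (intro integral_cong_AE) (auto simp: concentrated_def)

lemma ev_le_mass:
  assumes "nonneg_bounded f" "\<And>x. f x \<le> C"
  shows "ev A f \<le> C * mass A"
proof -
  have "0 \<le> C" using assms nonneg_boundedD[OF assms(1), of 0] order_trans by blast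
  then show ?thesis using ev_mono[OF assms(1), of "\<lambda>_. C" A] assms(2) by (simp add: mult.commute)
qed

lemma nonneg_bounded_ev_shift [intro]:
  assumes "nonneg_bounded f" shows "nonneg_bounded (\<lambda>x. ev B (\<lambda>y. f (x + y)))"
proof -
  obtain C where C: "\<And>x. 0 \<le> f x" "\<And>x. f x \<le> C" and [measurable]: "f \<in> borel_measurable borel"
    using assms unfolding nonneg_bounded_def by auto
  have "(\<lambda>x. ev B (\<lambda>y. f (x + y))) = (\<lambda>x. enn2real (nni B (\<lambda>y. ennreal (f (x + y)))))"
    using assms by (subst ev_eq_enn2real) auto
  moreover have "(\<lambda>x. enn2real (nni B (\<lambda>y. ennreal (f (x + y))))) \<in> borel_measurable borel"
    by measurable
  ultimately show ?thesis
    by (intro nonneg_boundedI[of _ "C * mass B"]) (use assms C in \<open>auto intro!: ev_nonneg ev_le_mass\<close>)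
qed

lemma ev_zero [simp]: "ev 0 f = 0"
  by (simp add: mea_zero)

lemma ev_one [simp]: "f \<in> borel_measurable borel \<Longrightarrow> ev 1 f = f 0"
  by (simp add: mea_one integral_return)

lemma mass_one [simp]: "mass 1 = 1"
  by (simp add: mea_one measure_def)

lemma mass_zero [simp]: "mass 0 = 0"
  by (simp add: mea_zero)

lemma ev_plus: "nonneg_bounded f \<Longrightarrow> ev (A + B) f = ev A f + ev B f"
proof -
  assume f: "nonneg_bounded f"
  then have "ennreal (ev (A + B) f) = ennreal (ev A f + ev B f)"
    by (simp add: ennreal_ev ev_nonneg nonneg_bounded_measurable del: ennreal_plus flip: ennreal_plus[OF ev_nonneg ev_nonneg])
       (simp add: ennreal_ev ev_nonneg)
  then show ?thesis using f by (subst (asm) ennreal_inj) (auto intro: ev_nonneg add_nonneg_nonneg)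
qed

lemma ev_sum: "nonneg_bounded f \<Longrightarrow> ev (\<Sum>i\<in>I. A i) f = (\<Sum>i\<in>I. ev (A i) f)"
  by (induction I rule: infinite_finite_induct) (auto simp: ev_plus)

lemma ev_of_nat_mult: "nonneg_bounded f \<Longrightarrow> ev (of_nat n * A) f = real n * ev A f"
  by (induction n) (auto simp: ev_plus algebra_simps)

lemma ev_times: "nonneg_bounded f \<Longrightarrow> ev (A * B) f = ev A (\<lambda>x. ev B (\<lambda>y. f (x + y)))"
proof -
  assume f: "nonneg_bounded f"
  then have [measurable]: "f \<in> borel_measurable borel" by (rule nonneg_bounded_measurable)
  have "ennreal (ev (A * B) f) = nni A (\<lambda>x. nni B (\<lambda>y. ennreal (f (x + y))))"
    using f by (simp add: ennreal_ev nni_times)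
  also have "\<dots> = nni A (\<lambda>x. ennreal (ev B (\<lambda>y. f (x + y))))"
    using f by (simp add: ennreal_ev nonneg_bounded_shift)
  also have "\<dots> = ennreal (ev A (\<lambda>x. ev B (\<lambda>y. f (x + y))))"
    using f by (simp add: ennreal_ev nonneg_bounded_ev_shift)
  finally show ?thesis
    using f by (subst (asm) ennreal_inj) (auto intro: ev_nonneg)
qed

lemma ev_restr: "D \<in> sets borel \<Longrightarrow> f \<in> borel_measurable borel \<Longrightarrow> ev (restr D A) f = ev A (\<lambda>x. indicator D x * f x)"
proof -
  assume [measurable]: "D \<in> sets borel" "f \<in> borel_measurable borel"
  have "mea (restr D A) = density (mea A) (\<lambda>x. ennreal (indicator D x))"
    by (simp add: mea_restr ennreal_indicator)
  then show ?thesis by (simp add: integral_density)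
qed

lemma mass_plus: "mass (A + B) = mass A + mass B"
  using ev_plus[of "\<lambda>_. 1" A B] by simp

lemma mass_times: "mass (A * B) = mass A * mass B"
  using ev_times[of "\<lambda>_. 1" A B] by simp

lemma ev_restr_le: "D \<in> sets borel \<Longrightarrow> nonneg_bounded f \<Longrightarrow> ev (restr D A) f \<le> ev A f"
  by (subst ev_restr) (auto intro!: ev_mono nonneg_bounded_mult dest: nonneg_boundedD split: split_indicator)

text \<open>Applied to exponentials, which are multiplicative on a half-line: this is how a
  convolution of measures becomes a product of transforms.\<close>

lemma ev_times_mult_conc:
  assumes "nonneg_bounded f" "concentrated A D" "concentrated B D'"
    "\<And>x y. x \<in> D \<Longrightarrow> y \<in> D' \<Longrightarrow> f (x + y) = f x * f y"
  shows "ev (A * B) f = ev A f * ev B f"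
proof -
  have [measurable]: "f \<in> borel_measurable borel" using assms(1) by (rule nonneg_bounded_measurable)
  have "ev (A * B) f = ev A (\<lambda>x. ev B (\<lambda>y. f (x + y)))" by (rule ev_times[OF assms(1)])
  also have "\<dots> = ev A (\<lambda>x. f x * ev B f)"
  proof (rule ev_cong_conc[OF _ _ assms(2)])
    fix x assume x: "x \<in> D"
    have "ev B (\<lambda>y. f (x + y)) = ev B (\<lambda>y. f x * f y)"
      by (rule ev_cong_conc[OF _ _ assms(3)]) (use assms(4)[OF x] in auto)
    then show "ev B (\<lambda>y. f (x + y)) = f x * ev B f" by simp
  qed (use assms(1) in \<open>auto intro: nonneg_bounded_measurable\<close>)
  finally show ?thesis by simp
qed

lemma mass_stay_leave:
  assumes "D \<in> sets borel" "mass \<nu> = 1"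
  shows "mass (stay \<nu> D n) + (\<Sum>k\<le>n. mass (leave \<nu> D k)) = 1"
proof (induction n)
  case (Suc n)
  have "mass (stay \<nu> D (Suc n)) + mass (leave \<nu> D (Suc n)) = mass (stay \<nu> D n)"
    using leave_Suc_add_stay_Suc[OF assms(1), of \<nu> n] assms(2) by (simp add: mass_times flip: mass_plus)
  with Suc show ?case by (simp del: stay.simps leave.simps)
qed simp

lemma mass_stay_le_1: "D \<in> sets borel \<Longrightarrow> mass \<nu> = 1 \<Longrightarrow> mass (stay \<nu> D n) \<le> 1"
  using mass_stay_leave[of D \<nu> n] sum_nonneg[of "{..n}" "\<lambda>k. mass (leave \<nu> D k)"] by simp

lemma ev_stay_add_le:
  assumes "D \<in> sets borel" "nonneg_bounded f"
  shows "ev (stay \<nu> D (m + k)) f \<le> ev (stay \<nu> D m * \<nu> ^ k) f"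
  using assms(2)
proof (induction k arbitrary: f)
  case (Suc k)
  have "ev (stay \<nu> D (m + Suc k)) f \<le> ev (stay \<nu> D (m + k) * \<nu>) f"
    using ev_restr_le[OF assms(1) Suc.prems] by simp
  also have "\<dots> = ev (stay \<nu> D (m + k)) (\<lambda>x. ev \<nu> (\<lambda>y. f (x + y)))" by (rule ev_times[OF Suc.prems])
  also have "\<dots> \<le> ev (stay \<nu> D m * \<nu> ^ k) (\<lambda>x. ev \<nu> (\<lambda>y. f (x + y)))"
    by (rule Suc.IH) (use Suc.prems in auto)
  also have "\<dots> = ev (stay \<nu> D m * \<nu> ^ k * \<nu>) f" by (rule ev_times[OF Suc.prems, symmetric])
  finally show ?case by (simp add: ac_simps)
qed simp

text \<open>Killing is ignored during the last k steps and the Markov property is applied at time m.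
  With m and k about n/2, survival controls the first half of the time and concentration the
  second.\<close>

lemma ev_stay_markov:
  assumes "D \<in> sets borel" "nonneg_bounded f" "\<And>x. ev (\<nu> ^ k) (\<lambda>y. f (x + y)) \<le> K"
  shows "ev (stay \<nu> D (m + k)) f \<le> K * mass (stay \<nu> D m)"
proof -
  have "ev (stay \<nu> D (m + k)) f \<le> ev (stay \<nu> D m * \<nu> ^ k) f"
    by (rule ev_stay_add_le) fact+
  also have "\<dots> = ev (stay \<nu> D m) (\<lambda>x. ev (\<nu> ^ k) (\<lambda>y. f (x + y)))" by (rule ev_times) fact
  also have "\<dots> \<le> K * mass (stay \<nu> D m)"
    by (rule ev_le_mass) (use assms in auto)
  finally show ?thesis .
qed

section \<open>Sums with weights of order n to the power -3/2\<close>

lemma sum_inverse_sqrt_le: "(\<Sum>k=1..n. 1 / sqrt (real k)) \<le> 2 * sqrt (real n)"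
proof (induction n)
  case (Suc n)
  have "1 / sqrt (real (Suc n)) \<le> 2 * (sqrt (real (Suc n)) - sqrt (real n))"
  proof -
    have p: "0 < sqrt (real (Suc n)) + sqrt (real n)"
      by (rule add_pos_nonneg) auto
    have "(sqrt (real (Suc n)) - sqrt (real n)) * (sqrt (real (Suc n)) + sqrt (real n)) = 1"
      by (simp add: algebra_simps flip: power2_eq_square)
    then have "sqrt (real (Suc n)) - sqrt (real n) = 1 / (sqrt (real (Suc n)) + sqrt (real n))"
      using p by (simp add: field_simps)
    also have "\<dots> \<ge> 1 / (2 * sqrt (real (Suc n)))"
      using p by (intro divide_left_mono) auto
    finally show ?thesis by (simp add: field_simps)
  qed
  with Suc show ?case by simp
qed simp

lemma inverse_three_halves_telescope:
  assumes "j \<ge> 1"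
  shows "1 / (real (Suc j) * sqrt (real (Suc j))) \<le> 2 * (1 / sqrt (real j) - 1 / sqrt (real (Suc j)))"
proof -
  define a b where "a = sqrt (real j)" and "b = sqrt (real (Suc j))"
  have ab: "0 < a" "a \<le> b" "b * b = a * a + 1" "real (Suc j) = b * b"
    using assms by (auto simp: a_def b_def)
  have b: "0 < b" using ab by linarith
  have "(b - a) * (a + b) = 1" using ab by (simp add: algebra_simps)
  moreover have "(b - a) * (a + b) \<le> (b - a) * (2 * b)" using ab by (intro mult_left_mono) auto
  ultimately have "1 \<le> 2 * b * (b - a)" by (simp add: algebra_simps)
  then have "a \<le> 2 * b * (b - a) * b"
    using ab b mult_mono[of 1 "2 * b * (b - a)" a b] by simp
  then have "1 / (b * b * b) \<le> 2 * (1 / a - 1 / b)"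
    using ab(1) b by (simp add: field_simps)
  then show ?thesis unfolding ab(4) using b by (simp add: a_def b_def)
qed

lemma sum_inverse_three_halves_le:
  assumes "1 \<le> m"
  shows "(\<Sum>j\<in>{m<..n}. 1 / (real j * sqrt (real j))) \<le> 2 / sqrt (real m)"
proof -
  have "(\<Sum>j\<in>{m<..n}. 1 / (real j * sqrt (real j))) \<le> 2 / sqrt (real m) - 2 / sqrt (real n)" if "m \<le> n" for n
    using that
  proof (induction n rule: dec_induct)
    case (step n)
    have "{m<..Suc n} = insert (Suc n) {m<..n}" using step by auto
    then show ?case using step inverse_three_halves_telescope[of n] assms by (simp add: algebra_simps)
  qed simp
  note * = this
  have "0 \<le> 2 / sqrt (real n)" by simp
  then show ?thesis
    using *[of n] by (cases "m \<le> n") (linarith, simp)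
qed

lemma inverse_three_halves_mono:
  "0 < a \<Longrightarrow> a \<le> b \<Longrightarrow> 1 / (b * sqrt b) \<le> 1 / (a * sqrt (a::real))"
  by (intro divide_left_mono mult_mono) auto

text \<open>The convolution is split at k = n/2. For larger k the factor
  \<open>1 / sqrt (real k)\<close> is of order n^(-1/2) and \<open>w\<close> is summed; for smaller
  k the a priori bound gives \<open>w (n - k)\<close> of order 1/n and
  \<open>1 / sqrt (real k)\<close> is summed to order sqrt n. The assumption \<open>E\<close> is
  thereby improved by a factor of sqrt n.\<close>

lemma three_halves_bound:
  fixes w :: "nat \<Rightarrow> real"
  assumes w: "\<And>n. 0 \<le> w n" and K: "0 \<le> K"
    and rec: "real n * w n \<le> K * (\<Sum>k=1..n. w (n - k) / sqrt (real k))"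
    and W: "(\<Sum>j\<le>n. w j) \<le> W" and E: "\<And>n. n \<ge> 1 \<Longrightarrow> w n \<le> E / real n" and n: "n \<ge> 1"
  shows "w n \<le> K * (2 * W + 4 * E) / (real n * sqrt (real n))"
proof -
  have E0: "0 \<le> E" using E[of 1] w[of 1] by simp
  have W0: "0 \<le> W" using W sum_nonneg[of "{..n}" w] w by (auto intro: order_trans)
  have sn: "0 < sqrt (real n)" using n by simp
  \<comment> \<open>The sum of the bounds for the two ranges of k is used in both ranges, so the sum
    itself need not be split.\<close>
  have le: "w (n - k) / sqrt (real k) \<le> 2 * w (n - k) / sqrt (real n) + 2 * E / real n * (1 / sqrt (real k))"
    if k: "k \<in> {1..n}" for k
  proof (cases "2 * k \<ge> n")
    case True
    have "sqrt (real n) \<le> sqrt (4 * real k)" using True by simp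
    also have "\<dots> = 2 * sqrt (real k)" by (simp add: real_sqrt_mult)
    finally have "1 / sqrt (real k) \<le> 2 / sqrt (real n)" using k sn by (simp add: field_simps)
    then have "w (n - k) * (1 / sqrt (real k)) \<le> w (n - k) * (2 / sqrt (real n))"
      by (intro mult_left_mono w)
    moreover have "0 \<le> 2 * E / real n * (1 / sqrt (real k))" using E0 by simp
    ultimately show ?thesis by (simp add: mult.commute)
  next
    case False
    then have nk: "n - k \<ge> 1" "real n \<le> 2 * real (n - k)" using k by auto
    have "w (n - k) \<le> E / real (n - k)" by (rule E) fact
    also have "\<dots> \<le> 2 * E / real n" using nk n E0
      using mult_left_mono[OF nk(2) E0] by (simp add: field_simps)
    finally have "w (n - k) * (1 / sqrt (real k)) \<le> 2 * E / real n * (1 / sqrt (real k))"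
      by (intro mult_right_mono) auto
    moreover have "0 \<le> 2 * w (n - k) / sqrt (real n)" using w by simp
    ultimately show ?thesis by simp
  qed
  have "(\<Sum>k=1..n. w (n - k) / sqrt (real k))
      \<le> (\<Sum>k=1..n. 2 * w (n - k) / sqrt (real n) + 2 * E / real n * (1 / sqrt (real k)))"
    by (rule sum_mono) (rule le)
  also have "\<dots> = 2 / sqrt (real n) * (\<Sum>k=1..n. w (n - k)) + 2 * E / real n * (\<Sum>k=1..n. 1 / sqrt (real k))"
    by (simp add: sum.distrib sum_distrib_left sum_distrib_right sum_divide_distrib)
  also have "\<dots> \<le> 2 / sqrt (real n) * W + 2 * E / real n * (2 * sqrt (real n))"
  proof (intro add_mono mult_left_mono sum_inverse_sqrt_le)
    have "(\<Sum>k=1..n. w (n - k)) = (\<Sum>j<n. w j)"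
      by (rule sum.reindex_bij_witness[of _ "\<lambda>j. n - j" "\<lambda>k. n - k"]) auto
    also have "\<dots> \<le> (\<Sum>j\<le>n. w j)" by (rule sum_mono2) (auto simp: w)
    finally show "(\<Sum>k=1..n. w (n - k)) \<le> W" using W by simp
  qed (use E0 in auto)
  also have "\<dots> = (2 * W + 4 * E) / sqrt (real n)"
  proof -
    have "sqrt (real n) / real n = 1 / sqrt (real n)" by (simp add: sqrt_divide_self_eq inverse_eq_divide)
    then have "4 * E * (sqrt (real n) / real n) = 4 * E * (1 / sqrt (real n))" by (simp only:)
    then show ?thesis by (simp add: add_divide_distrib)
  qed
  finally have "K * (\<Sum>k=1..n. w (n - k) / sqrt (real k)) \<le> K * ((2 * W + 4 * E) / sqrt (real n))"
    using K by (rule mult_left_mono)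
  with rec have "real n * w n \<le> K * (2 * W + 4 * E) / sqrt (real n)" by simp
  then show ?thesis using n sn by (simp add: field_simps)
qed

text \<open>All bounds follow from \<open>1 \<le> (1 + \<kappa>)\<^sup>2 * (1 - \<kappa>)\<close>,
  whose right side is \<open>1 + \<kappa> * (1 - \<kappa> - \<kappa>\<^sup>2)\<close>.\<close>

lemma ratio_le:
  fixes \<kappa> n k :: real
  assumes "0 < \<kappa>" "\<kappa> \<le> 1/2" "(1 - \<kappa>) * n \<le> k" "0 < n"
  shows "n / k \<le> (1 + \<kappa>)\<^sup>2" and "sqrt n / sqrt k \<le> 1 + \<kappa>" and "0 < k"
    and "n * sqrt n / (k * sqrt k) \<le> (1 + \<kappa>) ^ 3"
proof -
  have "0 < (1 - \<kappa>) * n" using assms by (intro mult_pos_pos) auto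
  then show k: "0 < k" using assms(3) by linarith
  have "0 \<le> \<kappa> * (1 - \<kappa> - \<kappa>\<^sup>2)"
  proof (intro mult_nonneg_nonneg)
    have "\<kappa> * \<kappa> \<le> 1/2 * (1/2)" using assms by (intro mult_mono) auto
    then show "0 \<le> 1 - \<kappa> - \<kappa>\<^sup>2" using assms by (simp add: power2_eq_square)
  qed (use assms in auto)
  then have "1 \<le> (1 + \<kappa>)\<^sup>2 * (1 - \<kappa>)" by (simp add: power2_eq_square algebra_simps)
  then have "1 * n \<le> (1 + \<kappa>)\<^sup>2 * (1 - \<kappa>) * n" using assms(4) by (intro mult_right_mono) auto
  also have "\<dots> \<le> (1 + \<kappa>)\<^sup>2 * k" using mult_left_mono[OF assms(3), of "(1 + \<kappa>)\<^sup>2"] by (simp add: mult.assoc)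
  finally show r: "n / k \<le> (1 + \<kappa>)\<^sup>2" using k by (simp add: field_simps)
  have "sqrt n / sqrt k = sqrt (n / k)" by (simp add: real_sqrt_divide)
  also have "\<dots> \<le> sqrt ((1 + \<kappa>)\<^sup>2)" using r by (rule real_sqrt_le_mono)
  finally show s: "sqrt n / sqrt k \<le> 1 + \<kappa>" using assms by simp
  have "n * sqrt n / (k * sqrt k) = (n / k) * (sqrt n / sqrt k)" by simp
  also have "\<dots> \<le> (1 + \<kappa>)\<^sup>2 * (1 + \<kappa>)" using r s assms k by (intro mult_mono) auto
  finally show "n * sqrt n / (k * sqrt k) \<le> (1 + \<kappa>) ^ 3" by (simp add: power3_eq_cube power2_eq_square)
qed

lemma suminf_split_bound:
  fixes \<tau> w :: "nat \<Rightarrow> real"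
  assumes "\<And>j. \<bar>\<tau> j\<bar> \<le> C * w j" "\<And>n. (\<Sum>j<n. w j) \<le> W" "\<And>j. 0 \<le> w j" "0 \<le> C"
  shows "summable w" "summable \<tau>" "(\<Sum>j. w j) \<le> W"
proof -
  show w: "summable w"
    using assms by (intro summableI_nonneg_bounded[of w W]) auto
  show "summable \<tau>"
    by (rule summable_comparison_test'[of "\<lambda>j. C * w j" 0]) (use assms w in \<open>auto intro: summable_mult\<close>)
  show "(\<Sum>j. w j) \<le> W" using w assms by (intro suminf_le_const) auto
qed

lemma suminf_tail_le:
  fixes v :: "nat \<Rightarrow> real"
  assumes "summable v" "\<And>n. m < n \<Longrightarrow> (\<Sum>j\<in>{m<..n}. v j) \<le> T"
  shows "(\<Sum>j. v j) - (\<Sum>j\<le>m. v j) \<le> T"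
proof -
  have l: "(\<lambda>n. (\<Sum>j\<le>n. v j) - (\<Sum>j\<le>m. v j)) \<longlonglongrightarrow> (\<Sum>j. v j) - (\<Sum>j\<le>m. v j)"
    using assms(1) by (intro tendsto_diff tendsto_const summable_LIMSEQ')
  have "(\<Sum>j\<le>n. v j) - (\<Sum>j\<le>m. v j) \<le> T" if "m < n" for n
  proof -
    have "{..n} = {..m} \<union> {m<..n}" "{..m} \<inter> {m<..n} = {}" using that by auto
    then have "(\<Sum>j\<le>n. v j) = (\<Sum>j\<le>m. v j) + (\<Sum>j\<in>{m<..n}. v j)" by (simp add: sum.union_disjoint)
    then show ?thesis using assms(2)[OF that] by simp
  qed
  then show ?thesis
    by (intro LIMSEQ_le_const2[OF l] exI[of _ "Suc m"]) auto
qed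

text \<open>The term \<open>t j k\<close> behaves like \<open>\<tau> j / sqrt k\<close>, and the sum
  is governed by small j, where n - j is close to n. The scale \<open>L\<close> stands for 1 + x; as
  \<open>\<epsilon>'\<close>, \<open>\<eta>\<close> and \<open>N\<close> are chosen before
  \<open>L\<close> and the sequences, the limit is uniform in x. The condition
  \<open>L \<le> \<eta> * sqrt (real n)\<close> turns the bound on \<open>w\<close>, quadratic in
  \<open>L\<close>, into an error linear in \<open>L\<close>.\<close>

lemma conv_limit:
  fixes C \<epsilon> :: real
  assumes "0 < \<epsilon>" "1 \<le> C"
  shows "\<exists>\<epsilon>'>0. \<exists>\<eta>>0. \<exists>N. \<forall>L (t :: nat \<Rightarrow> nat \<Rightarrow> real) w \<tau> n.
    N \<le> n \<longrightarrow> 1 \<le> L \<longrightarrow> L \<le> \<eta> * sqrt (real n) \<longrightarrow> (\<forall>j. 0 \<le> w j) \<longrightarrow>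
    (\<forall>j k. 1 \<le> k \<longrightarrow> \<bar>t j k\<bar> \<le> C * w j / sqrt (real k)) \<longrightarrow>
    (\<forall>j k. n \<le> 2 * k \<longrightarrow> k \<le> n \<longrightarrow> \<bar>sqrt (real k) * t j k - \<tau> j\<bar> \<le> \<epsilon>' * w j) \<longrightarrow>
    (\<forall>j. \<bar>\<tau> j\<bar> \<le> C * w j) \<longrightarrow> (\<forall>m. (\<Sum>j<m. w j) \<le> C * L) \<longrightarrow>
    (\<forall>j\<ge>1. w j \<le> C * L\<^sup>2 / (real j * sqrt (real j))) \<longrightarrow>
    \<bar>sqrt (real n) * (\<Sum>j<n. t j (n - j)) - (\<Sum>j. \<tau> j)\<bar> \<le> \<epsilon> * L"
proof -
  \<comment> \<open>Error budget: \<open>\<epsilon> / 2\<close> for j \<le> m, one half of it from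
    \<open>\<kappa>\<close> and one half from \<open>\<epsilon>'\<close>;
    \<open>\<epsilon> / 4\<close> for m < j < n and \<open>\<epsilon> / 4\<close> for the tail of
    the limit series, both secured by \<open>\<eta>\<close>.\<close>
  define \<kappa> where "\<kappa> = min (1/2) (\<epsilon> / (4 * C\<^sup>2))"
  define \<epsilon>' where "\<epsilon>' = \<epsilon> / (8 * C)"
  define \<eta> where "\<eta> = min (\<epsilon> * (\<kappa> * sqrt \<kappa>) / (8 * C\<^sup>2)) (\<epsilon> * sqrt \<kappa> / (12 * C\<^sup>2))"
  \<comment> \<open>This makes \<open>\<kappa> * real n\<close> at least 2, so its integer part
    \<open>m\<close> is at least 1 and at least half of it.\<close>
  define N where "N = nat \<lceil>2 / \<kappa>\<rceil> + 1"
  have C: "0 < C" using assms by simp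
  have \<kappa>: "0 < \<kappa>" "\<kappa> \<le> 1/2" "\<kappa> * C\<^sup>2 \<le> \<epsilon> / 4"
  proof -
    show "0 < \<kappa>" "\<kappa> \<le> 1/2" using assms C by (auto simp: \<kappa>_def)
    have "\<kappa> \<le> \<epsilon> / (4 * C\<^sup>2)" by (simp add: \<kappa>_def)
    then show "\<kappa> * C\<^sup>2 \<le> \<epsilon> / 4" using C by (simp add: field_simps)
  qed
  have e': "0 < \<epsilon>'" "\<epsilon>' * C = \<epsilon> / 8" using assms C by (auto simp: \<epsilon>'_def)
  have eta: "0 < \<eta>" "2 * C\<^sup>2 * \<eta> / (\<kappa> * sqrt \<kappa>) \<le> \<epsilon> / 4" "3 * C\<^sup>2 * \<eta> / sqrt \<kappa> \<le> \<epsilon> / 4"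
  proof -
    show "0 < \<eta>" using assms C \<kappa> by (auto simp: \<eta>_def)
    have "\<eta> \<le> \<epsilon> * (\<kappa> * sqrt \<kappa>) / (8 * C\<^sup>2)" "\<eta> \<le> \<epsilon> * sqrt \<kappa> / (12 * C\<^sup>2)" by (simp_all add: \<eta>_def)
    then show "2 * C\<^sup>2 * \<eta> / (\<kappa> * sqrt \<kappa>) \<le> \<epsilon> / 4" "3 * C\<^sup>2 * \<eta> / sqrt \<kappa> \<le> \<epsilon> / 4"
      using C \<kappa>(1) by (simp_all add: field_simps)
  qed
  have main: "\<bar>sqrt (real n) * (\<Sum>j<n. t j (n - j)) - (\<Sum>j. \<tau> j)\<bar> \<le> \<epsilon> * L"
    if n: "N \<le> n" and L: "1 \<le> L" "L \<le> \<eta> * sqrt (real n)" and w: "\<forall>j. 0 \<le> w j"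
      and t1: "\<forall>j k. 1 \<le> k \<longrightarrow> \<bar>t j k\<bar> \<le> C * w j / sqrt (real k)"
      and t2: "\<forall>j k. n \<le> 2 * k \<longrightarrow> k \<le> n \<longrightarrow> \<bar>sqrt (real k) * t j k - \<tau> j\<bar> \<le> \<epsilon>' * w j"
      and tau: "\<forall>j. \<bar>\<tau> j\<bar> \<le> C * w j" and W: "\<forall>m. (\<Sum>j<m. w j) \<le> C * L"
      and w3: "\<forall>j\<ge>1. w j \<le> C * L\<^sup>2 / (real j * sqrt (real j))"
    for L t w \<tau> and n :: nat
  proof -
    have "2 / \<kappa> \<le> real N" unfolding N_def by linarith
    with n have "2 / \<kappa> \<le> real n" by linarith
    then have kn: "2 \<le> \<kappa> * real n" using \<kappa>(1) by (simp add: field_simps)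
    have n0: "0 < real n" using kn \<kappa>(1) by (cases "n = 0") auto
    have sn: "0 < sqrt (real n)" using n0 by simp
    define m where "m = nat \<lfloor>\<kappa> * real n\<rfloor>"
    have m: "real m \<le> \<kappa> * real n" "\<kappa> * real n < real m + 1" using kn by (auto simp: m_def)
    have m2: "\<kappa> * real n / 2 \<le> real m" "1 \<le> m" using m kn by linarith+
    have "\<kappa> * real n \<le> 1/2 * real n" using \<kappa> by (intro mult_right_mono) auto
    then have mn: "m < n" using m(1) n0 by linarith
    note S = suminf_split_bound[of \<tau> C w "C * L"]
    have sw: "summable w" "summable \<tau>" using S tau W w C by auto
    have 1: "\<bar>sqrt (real n) * t j (n - j) - \<tau> j\<bar> \<le> (2 * \<epsilon>' + \<kappa> * C) * w j" if j: "j \<le> m" for j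
    proof -
      have jn: "(1 - \<kappa>) * real n \<le> real (n - j)" using j m(1) mn by (simp add: of_nat_diff algebra_simps)
      note r = ratio_le[OF \<kappa>(1,2) jn n0]
      have "real n \<le> 2 * ((1 - \<kappa>) * real n)" using \<kappa> n0 mult_right_mono[of 1 "2 * (1 - \<kappa>)" "real n"] by simp
      then have h: "n \<le> 2 * (n - j)" using jn by linarith
      let ?q = "sqrt (real n) / sqrt (real (n - j))" and ?x = "sqrt (real (n - j)) * t j (n - j)"
      have q1: "1 \<le> ?q" using r(3) by (simp add: field_simps)
      have "sqrt (real n) * t j (n - j) - \<tau> j = ?q * (?x - \<tau> j) + (?q - 1) * \<tau> j"
        using r(3) by (simp add: field_simps)
      also have "\<bar>\<dots>\<bar> \<le> ?q * \<bar>?x - \<tau> j\<bar> + (?q - 1) * \<bar>\<tau> j\<bar>"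
        using q1 by (intro order_trans[OF abs_triangle_ineq]) (simp add: abs_mult)
      also have "\<dots> \<le> 2 * (\<epsilon>' * w j) + \<kappa> * (C * w j)"
        using t2 h tau w r(2) q1 \<kappa> e'(1) by (intro add_mono mult_mono) auto
      finally show ?thesis by (simp add: algebra_simps)
    qed
    have "\<bar>sqrt (real n) * (\<Sum>j\<le>m. t j (n - j)) - (\<Sum>j\<le>m. \<tau> j)\<bar> = \<bar>\<Sum>j\<le>m. sqrt (real n) * t j (n - j) - \<tau> j\<bar>"
      by (simp add: sum_subtractf sum_distrib_left)
    also have "\<dots> \<le> (\<Sum>j\<le>m. (2 * \<epsilon>' + \<kappa> * C) * w j)"
      by (rule order_trans[OF sum_abs]) (intro sum_mono 1, simp)
    also have "\<dots> = (2 * \<epsilon>' + \<kappa> * C) * (\<Sum>j<Suc m. w j)" by (simp add: sum_distrib_left lessThan_Suc_atMost)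
    also have "\<dots> \<le> (2 * \<epsilon>' + \<kappa> * C) * (C * L)" using W e' \<kappa> C by (intro mult_left_mono) (auto simp del: sum.lessThan_Suc)
    also have "\<dots> = (2 * (\<epsilon>' * C) + \<kappa> * C\<^sup>2) * L" by (simp add: algebra_simps power2_eq_square)
    also have "\<dots> \<le> (\<epsilon> / 4 + \<epsilon> / 4) * L" using e' \<kappa>(3) L by (intro mult_right_mono add_mono) auto
    finally have I1: "\<bar>sqrt (real n) * (\<Sum>j\<le>m. t j (n - j)) - (\<Sum>j\<le>m. \<tau> j)\<bar> \<le> \<epsilon> / 2 * L" by simp
    have L2: "L\<^sup>2 / sqrt (real n) \<le> \<eta> * L"
      using mult_left_mono[OF L(2), of L] L(1) sn by (simp add: field_simps power2_eq_square)
    have "\<bar>t j (n - j)\<bar> \<le> C * (C * L\<^sup>2 / (\<kappa> * real n * sqrt (\<kappa> * real n))) * (1 / sqrt (real (n - j)))"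
      if j: "j \<in> {m<..<n}" for j
    proof -
      have jn: "\<kappa> * real n \<le> real j" "1 \<le> j" using j m(2) by auto
      have "w j \<le> C * L\<^sup>2 * (1 / (real j * sqrt (real j)))" using w3 jn by simp
      also have "\<dots> \<le> C * L\<^sup>2 * (1 / (\<kappa> * real n * sqrt (\<kappa> * real n)))"
        using jn kn C by (intro mult_left_mono inverse_three_halves_mono) auto
      finally have "C * w j * (1 / sqrt (real (n - j))) \<le> C * (C * L\<^sup>2 / (\<kappa> * real n * sqrt (\<kappa> * real n))) * (1 / sqrt (real (n - j)))"
        using C by (intro mult_right_mono mult_left_mono) auto
      moreover have "\<bar>t j (n - j)\<bar> \<le> C * w j * (1 / sqrt (real (n - j)))"
        using t1[rule_format, of "n - j" j] j by (simp add: Suc_le_eq)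
      ultimately show ?thesis by linarith
    qed
    then have "(\<Sum>j\<in>{m<..<n}. \<bar>t j (n - j)\<bar>)
      \<le> (\<Sum>j\<in>{m<..<n}. C * (C * L\<^sup>2 / (\<kappa> * real n * sqrt (\<kappa> * real n))) * (1 / sqrt (real (n - j))))"
      by (rule sum_mono)
    also have "\<dots> = C * (C * L\<^sup>2 / (\<kappa> * real n * sqrt (\<kappa> * real n))) * (\<Sum>j\<in>{m<..<n}. 1 / sqrt (real (n - j)))"
      by (simp add: sum_distrib_left)
    also have "\<dots> \<le> C * (C * L\<^sup>2 / (\<kappa> * real n * sqrt (\<kappa> * real n))) * (2 * sqrt (real n))"
    proof (rule mult_left_mono)
      have "(\<Sum>j\<in>{m<..<n}. 1 / sqrt (real (n - j))) \<le> (\<Sum>j\<in>{0..<n}. 1 / sqrt (real (n - j)))"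
        by (rule sum_mono2) auto
      also have "\<dots> = (\<Sum>k=1..n. 1 / sqrt (real k))"
        by (rule sum.reindex_bij_witness[of _ "\<lambda>k. n - k" "\<lambda>k. n - k"]) auto
      finally show "(\<Sum>j\<in>{m<..<n}. 1 / sqrt (real (n - j))) \<le> 2 * sqrt (real n)"
        using sum_inverse_sqrt_le[of n] by linarith
    qed (use C \<kappa> in auto)
    finally have "sqrt (real n) * (\<Sum>j\<in>{m<..<n}. \<bar>t j (n - j)\<bar>)
      \<le> sqrt (real n) * (C * (C * L\<^sup>2 / (\<kappa> * real n * sqrt (\<kappa> * real n))) * (2 * sqrt (real n)))"
      using sn by (intro mult_left_mono) auto
    also have "\<dots> = 2 * C\<^sup>2 / (\<kappa> * sqrt \<kappa>) * (L\<^sup>2 / sqrt (real n))"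
      using sn n0 \<kappa>(1) by (simp add: field_simps power2_eq_square real_sqrt_mult)
    also have "\<dots> \<le> 2 * C\<^sup>2 / (\<kappa> * sqrt \<kappa>) * (\<eta> * L)" using L2 \<kappa> by (intro mult_left_mono) auto
    also have "\<dots> = (2 * C\<^sup>2 * \<eta> / (\<kappa> * sqrt \<kappa>)) * L" by simp
    also have "\<dots> \<le> \<epsilon> / 4 * L" using eta L by (intro mult_right_mono) auto
    finally have I2: "sqrt (real n) * (\<Sum>j\<in>{m<..<n}. \<bar>t j (n - j)\<bar>) \<le> \<epsilon> / 4 * L" .
    have tail: "(\<Sum>j\<in>{m<..q}. w j) \<le> C * L\<^sup>2 * (2 / sqrt (real m))" for q
    proof -
      have "(\<Sum>j\<in>{m<..q}. w j) \<le> (\<Sum>j\<in>{m<..q}. C * L\<^sup>2 * (1 / (real j * sqrt (real j))))"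
        using w3 m2(2) by (intro sum_mono) auto
      also have "\<dots> = C * L\<^sup>2 * (\<Sum>j\<in>{m<..q}. 1 / (real j * sqrt (real j)))" by (simp add: sum_distrib_left)
      also have "\<dots> \<le> C * L\<^sup>2 * (2 / sqrt (real m))"
        using C by (intro mult_left_mono sum_inverse_three_halves_le m2) auto
      finally show ?thesis .
    qed
    have "sqrt (\<kappa> * real n / 2) \<le> sqrt (real m)" using m2 by simp
    \<comment> \<open>As 4 \<le> 9/2, the bound \<open>m \<ge> \<kappa> * real n / 2\<close> yields
      one in terms of \<open>sqrt \<kappa> * sqrt (real n)\<close> with the rational factor
      2/3.\<close>
    moreover have "sqrt (\<kappa> * real n / 2) * 3 \<ge> 2 * (sqrt \<kappa> * sqrt (real n))"
    proof -
      have "2 * (sqrt \<kappa> * sqrt (real n)) = sqrt (4 * (\<kappa> * real n))" by (simp add: real_sqrt_mult)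
      also have "\<dots> \<le> sqrt (9 * (\<kappa> * real n / 2))" using \<kappa> by (intro real_sqrt_le_mono) auto
      also have "\<dots> = 3 * sqrt (\<kappa> * real n / 2)" by (subst real_sqrt_mult) simp
      finally show ?thesis by simp
    qed
    ultimately have "2 * (sqrt \<kappa> * sqrt (real n)) \<le> 3 * sqrt (real m)" by linarith
    then have sm: "2 / sqrt (real m) \<le> 3 / (sqrt \<kappa> * sqrt (real n))"
      using m2(2) \<kappa>(1) sn by (simp add: field_simps)
    have "\<bar>(\<Sum>j. \<tau> j) - (\<Sum>j\<le>m. \<tau> j)\<bar> = \<bar>\<Sum>j. \<tau> (j + Suc m)\<bar>"
      using suminf_split_initial_segment[OF sw(2), of "Suc m"] by (simp add: lessThan_Suc_atMost)
    also have "\<dots> \<le> (\<Sum>j. C * w (j + Suc m))"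
    proof (rule order_trans[OF summable_rabs suminf_le])
      have "summable (\<lambda>j. C * w (j + Suc m))" using sw(1) by (intro summable_mult) (simp only: summable_iff_shift)
      then show "summable (\<lambda>j. C * w (j + Suc m))" .
      then show "summable (\<lambda>j. \<bar>\<tau> (j + Suc m)\<bar>)"
        by (rule summable_comparison_test'[of _ 0]) (use tau in auto)
      then show "summable (\<lambda>j. \<bar>\<tau> (j + Suc m)\<bar>)" .
    qed (use tau in auto)
    also have "\<dots> = C * ((\<Sum>j. w j) - (\<Sum>j\<le>m. w j))"
      using suminf_split_initial_segment[OF sw(1), of "Suc m"] sw(1)
      by (subst suminf_mult) (simp_all only: summable_iff_shift lessThan_Suc_atMost add_diff_cancel_right')
    also have "\<dots> \<le> C * (C * L\<^sup>2 * (2 / sqrt (real m)))"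
      using C by (intro mult_left_mono suminf_tail_le sw tail) auto
    also have "\<dots> \<le> C * (C * L\<^sup>2 * (3 / (sqrt \<kappa> * sqrt (real n))))"
      using C sm by (intro mult_left_mono) auto
    also have "\<dots> = 3 * C\<^sup>2 / sqrt \<kappa> * (L\<^sup>2 / sqrt (real n))" by (simp add: power2_eq_square)
    also have "\<dots> \<le> 3 * C\<^sup>2 / sqrt \<kappa> * (\<eta> * L)" using L2 \<kappa> by (intro mult_left_mono) auto
    also have "\<dots> = (3 * C\<^sup>2 * \<eta> / sqrt \<kappa>) * L" by simp
    also have "\<dots> \<le> \<epsilon> / 4 * L" using eta L by (intro mult_right_mono) auto
    finally have I3: "\<bar>(\<Sum>j. \<tau> j) - (\<Sum>j\<le>m. \<tau> j)\<bar> \<le> \<epsilon> / 4 * L" .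
    have "{..<n} = {..m} \<union> {m<..<n}" "{..m} \<inter> {m<..<n} = {}" using mn by auto
    then have sp: "(\<Sum>j<n. t j (n - j)) = (\<Sum>j\<le>m. t j (n - j)) + (\<Sum>j\<in>{m<..<n}. t j (n - j))"
      by (simp add: sum.union_disjoint)
    have "sqrt (real n) * \<bar>\<Sum>j\<in>{m<..<n}. t j (n - j)\<bar> \<le> sqrt (real n) * (\<Sum>j\<in>{m<..<n}. \<bar>t j (n - j)\<bar>)"
      using sn by (intro mult_left_mono sum_abs) auto
    with I2 have I2': "\<bar>sqrt (real n) * (\<Sum>j\<in>{m<..<n}. t j (n - j))\<bar> \<le> \<epsilon> / 4 * L"
      by (simp add: abs_mult)
    have "sqrt (real n) * (\<Sum>j<n. t j (n - j)) - (\<Sum>j. \<tau> j)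
      = (sqrt (real n) * (\<Sum>j\<le>m. t j (n - j)) - (\<Sum>j\<le>m. \<tau> j)) + sqrt (real n) * (\<Sum>j\<in>{m<..<n}. t j (n - j))
        - ((\<Sum>j. \<tau> j) - (\<Sum>j\<le>m. \<tau> j))"
      unfolding sp by (simp add: algebra_simps)
    with I1 I2' I3 show ?thesis by (simp add: abs_if split: if_splits)
  qed
  show ?thesis
    by (rule exI[of _ \<epsilon>'], rule conjI[OF e'(1)], rule exI[of _ \<eta>], rule conjI[OF eta(1)], rule exI[of _ N])
       (intro allI impI, rule main, assumption+)
qed

text \<open>When both sequences are of order n^(-3/2), one of the two indices has to be small:
  either \<open>a\<close> or \<open>u\<close> carries the rate, at an index close to n, and the
  other one is summed. In the middle range both indices are large; multiplied by n^(3/2) it is of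
  order 1/sqrt m, a tail sum of one of the sequences.\<close>

lemma conv_two_sided:
  fixes C \<epsilon> :: real
  assumes "0 < \<epsilon>" "1 \<le> C"
  shows "\<exists>\<epsilon>'>0. \<exists>\<kappa>>0. \<exists>N. \<forall>L (u :: nat \<Rightarrow> real) a \<Psi> A n.
    N \<le> n \<longrightarrow> 1 \<le> L \<longrightarrow> (\<forall>k. 0 \<le> u k) \<longrightarrow> (\<forall>j. 0 \<le> a j) \<longrightarrow>
    (\<forall>k. \<kappa> * real n \<le> real k \<longrightarrow> \<bar>real k * sqrt (real k) * u k - \<Psi>\<bar> \<le> \<epsilon>' * L) \<longrightarrow>
    (\<forall>j. \<kappa> * real n \<le> real j \<longrightarrow> \<bar>real j * sqrt (real j) * a j - A\<bar> \<le> \<epsilon>') \<longrightarrow>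
    0 \<le> \<Psi> \<longrightarrow> \<Psi> \<le> C * L \<longrightarrow> 0 \<le> A \<longrightarrow> A \<le> C \<longrightarrow>
    (\<forall>m. (\<Sum>j<m. u j) \<le> C * L) \<longrightarrow> (\<forall>m. (\<Sum>j<m. a j) \<le> C) \<longrightarrow>
    \<bar>real n * sqrt (real n) * (\<Sum>k\<le>n. u k * a (n - k)) - (A * (\<Sum>k. u k) + \<Psi> * (\<Sum>j. a j))\<bar> \<le> \<epsilon> * L"
proof -
  define \<kappa> where "\<kappa> = min (1/4) (\<epsilon> / (80 * C\<^sup>2))"
  \<comment> \<open>The cap \<open>C\<close> keeps the rescaled terms of \<open>u\<close> below
    \<open>2 * C * L\<close>, and those of \<open>a\<close> below \<open>2 * C\<close>.\<close>
  define \<epsilon>' where "\<epsilon>' = min C (\<epsilon> / (64 * C))"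
  \<comment> \<open>A lower bound for \<open>sqrt (real m)\<close> that brings the middle range and
    both tails below \<open>\<epsilon> / 8 * L\<close>; \<open>N\<close> is then large enough to
    force \<open>R\<^sup>2 \<le> real m\<close>.\<close>
  define R where "R = 64 * C\<^sup>2 / (\<epsilon> * (\<kappa> * sqrt \<kappa>))"
  define N where "N = nat \<lceil>2 * (1 + R\<^sup>2) / \<kappa>\<rceil> + 1"
  have C: "0 < C" using assms by simp
  have \<kappa>: "0 < \<kappa>" "\<kappa> \<le> 1/4" "\<kappa> * C\<^sup>2 \<le> \<epsilon> / 80"
  proof -
    show "0 < \<kappa>" "\<kappa> \<le> 1/4" using assms C by (auto simp: \<kappa>_def)
    have "\<kappa> \<le> \<epsilon> / (80 * C\<^sup>2)" by (simp add: \<kappa>_def)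
    then show "\<kappa> * C\<^sup>2 \<le> \<epsilon> / 80" using C by (simp add: field_simps)
  qed
  have e': "0 < \<epsilon>'" "\<epsilon>' \<le> C" "\<epsilon>' * C \<le> \<epsilon> / 64"
  proof -
    show "0 < \<epsilon>'" "\<epsilon>' \<le> C" using assms C by (auto simp: \<epsilon>'_def)
    have "\<epsilon>' \<le> \<epsilon> / (64 * C)" by (simp add: \<epsilon>'_def)
    then show "\<epsilon>' * C \<le> \<epsilon> / 64" using C by (simp add: field_simps)
  qed
  have kk: "0 < \<kappa> * sqrt \<kappa>" "\<kappa> * sqrt \<kappa> \<le> 1"
    using \<kappa> by (auto intro!: mult_le_one)
  have R: "0 < R" using assms C kk by (simp add: R_def)
  have main: "\<bar>real n * sqrt (real n) * (\<Sum>k\<le>n. u k * a (n - k)) - (A * (\<Sum>k. u k) + \<Psi> * (\<Sum>j. a j))\<bar> \<le> \<epsilon> * L"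
    if n: "N \<le> n" and L: "1 \<le> L" and u: "\<forall>k. 0 \<le> u k" and a: "\<forall>k. 0 \<le> a k"
      and u1: "\<forall>k. \<kappa> * real n \<le> real k \<longrightarrow> \<bar>real k * sqrt (real k) * u k - \<Psi>\<bar> \<le> \<epsilon>' * L"
      and a1: "\<forall>j. \<kappa> * real n \<le> real j \<longrightarrow> \<bar>real j * sqrt (real j) * a j - A\<bar> \<le> \<epsilon>'"
      and P: "0 \<le> \<Psi>" "\<Psi> \<le> C * L" and A: "0 \<le> A" "A \<le> C"
      and U: "\<forall>m. (\<Sum>j<m. u j) \<le> C * L" and As: "\<forall>m. (\<Sum>j<m. a j) \<le> C"
    for L u a \<Psi> A and n :: nat
  proof -
    have "2 * (1 + R\<^sup>2) / \<kappa> \<le> real N" unfolding N_def by linarith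
    with n have "2 * (1 + R\<^sup>2) / \<kappa> \<le> real n" by linarith
    then have kn: "2 * (1 + R\<^sup>2) \<le> \<kappa> * real n" using \<kappa>(1) by (simp add: field_simps)
    define Q where "Q = R\<^sup>2"
    have Q: "0 \<le> Q" by (simp add: Q_def)
    note kn = kn[folded Q_def]
    have kn2: "2 \<le> \<kappa> * real n" using kn Q by (simp add: distrib_left)
    have n0: "0 < real n" using kn2 \<kappa>(1) by (cases "n = 0") auto
    have sn: "0 < sqrt (real n)" using n0 by simp
    define m where "m = nat \<lfloor>\<kappa> * real n\<rfloor>"
    have m: "real m \<le> \<kappa> * real n" "\<kappa> * real n < real m + 1" using kn2 by (auto simp: m_def)
    have m2: "R\<^sup>2 \<le> real m" "1 \<le> m" using m kn kn2 Q unfolding Q_def[symmetric] distrib_left by linarith+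
    have "\<kappa> * real n \<le> 1/4 * real n" using \<kappa> by (intro mult_right_mono) auto
    then have mn: "m + m < n" using m(1) n0 by linarith
    have "R \<le> sqrt (real m)" using m2(1) R by (simp add: real_le_rsqrt)
    then have "1 / sqrt (real m) \<le> 1 / R" using R m2(2) by (intro divide_left_mono) auto
    also have "1 / R = \<epsilon> * (\<kappa> * sqrt \<kappa>) / (64 * C\<^sup>2)" by (simp add: R_def)
    finally have sm: "1 / sqrt (real m) \<le> \<epsilon> * (\<kappa> * sqrt \<kappa>) / (64 * C\<^sup>2)" .
    have sm1: "8 * C\<^sup>2 / (\<kappa> * sqrt \<kappa>) * (1 / sqrt (real m)) \<le> \<epsilon> / 8"
      using mult_left_mono[OF sm, of "8 * C\<^sup>2 / (\<kappa> * sqrt \<kappa>)"] kk C \<kappa>(1) by simp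
    have "8 * C\<^sup>2 * (1 / sqrt (real m)) \<le> 8 * C\<^sup>2 / (\<kappa> * sqrt \<kappa>) * (1 / sqrt (real m))"
    proof (rule mult_right_mono)
      have "8 * C\<^sup>2 * (\<kappa> * sqrt \<kappa>) \<le> 8 * C\<^sup>2 * 1" using kk by (intro mult_left_mono) auto
      then show "8 * C\<^sup>2 \<le> 8 * C\<^sup>2 / (\<kappa> * sqrt \<kappa>)" using kk by (simp add: field_simps)
    qed simp
    with sm1 have sm2: "8 * C\<^sup>2 * (1 / sqrt (real m)) \<le> \<epsilon> / 8" by linarith
    have su: "summable u" "summable a"
      using u U by (auto intro: summableI_nonneg_bounded) (use a As in \<open>auto intro: summableI_nonneg_bounded\<close>)
    have P3: "(1 + \<kappa>) ^ 3 \<le> 4" "(1 + \<kappa>) ^ 3 - 1 \<le> 5 * \<kappa>"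
    proof -
      have k2: "\<kappa> * \<kappa> \<le> 1/4 * \<kappa>" using \<kappa> by (intro mult_right_mono) auto
      have k3: "\<kappa> * \<kappa> * \<kappa> \<le> 1/4 * \<kappa> * 1" using k2 \<kappa> by (intro mult_mono) auto
      have "(1 + \<kappa>) ^ 3 = 1 + 3 * \<kappa> + 3 * (\<kappa> * \<kappa>) + \<kappa> * \<kappa> * \<kappa>"
        by (simp add: power3_eq_cube algebra_simps)
      then show "(1 + \<kappa>) ^ 3 - 1 \<le> 5 * \<kappa>" "(1 + \<kappa>) ^ 3 \<le> 4" using k2 k3 \<kappa> by linarith+
    qed
    have near: "\<bar>real n * sqrt (real n) * v (n - k) - V\<bar> \<le> (4 * \<epsilon>' + 5 * \<kappa> * C) * L'"
      if k: "k \<le> m" and v: "\<forall>k. \<kappa> * real n \<le> real k \<longrightarrow> \<bar>real k * sqrt (real k) * v k - V\<bar> \<le> \<epsilon>' * L'"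
        and V: "0 \<le> V" "V \<le> C * L'" "0 \<le> L'" for k v V L'
    proof -
      have jn: "(1 - \<kappa>) * real n \<le> real (n - k)" using k m(1) mn by (simp add: of_nat_diff algebra_simps)
      have \<kappa>2: "\<kappa> \<le> 1/2" using \<kappa> by simp
      note r = ratio_le[OF \<kappa>(1) \<kappa>2 jn n0]
      have "\<kappa> * real n \<le> (1 - \<kappa>) * real n" using \<kappa> by (intro mult_right_mono) auto
      then have vk: "\<bar>real (n - k) * sqrt (real (n - k)) * v (n - k) - V\<bar> \<le> \<epsilon>' * L'" using v jn by auto
      define q where "q = real n * sqrt (real n) / (real (n - k) * sqrt (real (n - k)))"
      define x where "x = real (n - k) * sqrt (real (n - k)) * v (n - k)"
      have q: "1 \<le> q" "q \<le> 4" "q - 1 \<le> 5 * \<kappa>"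
      proof -
        have "real (n - k) * sqrt (real (n - k)) \<le> real n * sqrt (real n)" by (intro mult_mono) auto
        then show "1 \<le> q" unfolding q_def using r(3) by (simp add: field_simps)
        show "q \<le> 4" by (rule order_trans[OF r(4)[folded q_def] P3(1)])
        show "q - 1 \<le> 5 * \<kappa>" by (rule order_trans[OF diff_right_mono[OF r(4)[folded q_def]] P3(2)])
      qed
      have "q * x = real n * sqrt (real n) * v (n - k)"
        using r(3) by (simp add: q_def x_def)
      then have "real n * sqrt (real n) * v (n - k) - V = q * (x - V) + (q - 1) * V"
        by (simp add: algebra_simps)
      also have "\<bar>\<dots>\<bar> \<le> q * \<bar>x - V\<bar> + (q - 1) * V"
        using q(1) V by (intro order_trans[OF abs_triangle_ineq]) (simp add: abs_mult)
      also have "\<dots> \<le> 4 * (\<epsilon>' * L') + (5 * \<kappa>) * (C * L')"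
        using q vk V \<kappa> e' by (intro add_mono mult_mono) (auto simp: x_def)
      finally show ?thesis by (simp add: algebra_simps)
    qed
    have tail: "(\<Sum>j\<in>{m<..q}. v j) \<le> 4 * C * L' * (1 / sqrt (real m))"
      if v: "\<forall>k. \<kappa> * real n \<le> real k \<longrightarrow> \<bar>real k * sqrt (real k) * v k - V\<bar> \<le> \<epsilon>' * L'"
        and V: "0 \<le> V" "V \<le> C * L'" "0 \<le> L'" for v V L' q
    proof -
      have "(\<Sum>j\<in>{m<..q}. v j) \<le> (\<Sum>j\<in>{m<..q}. 2 * C * L' * (1 / (real j * sqrt (real j))))"
      proof (rule sum_mono)
        fix j assume "j \<in> {m<..q}"
        then have j: "\<kappa> * real n \<le> real j" "0 < j" using m(2) by auto
        then have "real j * sqrt (real j) * v j \<le> V + \<epsilon>' * L'" using v by (auto simp: abs_le_iff)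
        also have "\<dots> \<le> C * L' + C * L'" using V e' by (intro add_mono mult_right_mono) auto
        finally show "v j \<le> 2 * C * L' * (1 / (real j * sqrt (real j)))" using j(2) by (simp add: field_simps)
      qed
      also have "\<dots> = 2 * C * L' * (\<Sum>j\<in>{m<..q}. 1 / (real j * sqrt (real j)))" by (simp add: sum_distrib_left)
      also have "\<dots> \<le> 2 * C * L' * (2 / sqrt (real m))"
        using C V by (intro mult_left_mono sum_inverse_three_halves_le m2) auto
      finally show ?thesis by simp
    qed
    have tailu: "(\<Sum>j\<in>{m<..q}. u j) \<le> 4 * C * L * (1 / sqrt (real m))" for q
      using tail[OF u1] P L by simp
    have taila: "(\<Sum>j\<in>{m<..q}. a j) \<le> 4 * C * (1 / sqrt (real m))" for q
      using tail[of a A 1 q] a1 A by simp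
    let ?n = "real n * sqrt (real n)"
    define e where "e = 4 * \<epsilon>' + 5 * \<kappa> * C"
    have e: "0 \<le> e" "e * C \<le> \<epsilon> / 8"
    proof -
      show "0 \<le> e" using e' \<kappa> C by (simp add: e_def)
      have "e * C = 4 * (\<epsilon>' * C) + 5 * (\<kappa> * C\<^sup>2)" by (simp add: e_def algebra_simps power2_eq_square)
      then show "e * C \<le> \<epsilon> / 8" using e'(3) \<kappa>(3) by linarith
    qed
    have I1: "\<bar>?n * (\<Sum>k\<le>m. u k * a (n - k)) - A * (\<Sum>k\<le>m. u k)\<bar> \<le> \<epsilon> / 8 * L"
    proof -
      have "?n * (\<Sum>k\<le>m. u k * a (n - k)) - A * (\<Sum>k\<le>m. u k) = (\<Sum>k\<le>m. u k * (?n * a (n - k) - A))"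
        by (simp add: sum_subtractf sum_distrib_left algebra_simps)
      also have "\<bar>\<dots>\<bar> \<le> (\<Sum>k\<le>m. u k * e)"
      proof (rule order_trans[OF sum_abs sum_mono])
        fix k assume "k \<in> {..m}"
        then have "\<bar>?n * a (n - k) - A\<bar> \<le> e" using near[of k a A 1] a1 A by (simp add: e_def)
        then show "\<bar>u k * (?n * a (n - k) - A)\<bar> \<le> u k * e" using u by (simp add: abs_mult mult_left_mono)
      qed
      also have "\<dots> = e * (\<Sum>k<Suc m. u k)" by (simp add: sum_distrib_left lessThan_Suc_atMost mult.commute)
      also have "\<dots> \<le> e * (C * L)" using U e(1) by (intro mult_left_mono) (auto simp del: sum.lessThan_Suc)
      also have "\<dots> \<le> \<epsilon> / 8 * L" using mult_right_mono[OF e(2), of L] L by (simp add: mult.assoc)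
      finally show ?thesis .
    qed
    have I2: "\<bar>?n * (\<Sum>j\<le>m. u (n - j) * a j) - \<Psi> * (\<Sum>j\<le>m. a j)\<bar> \<le> \<epsilon> / 8 * L"
    proof -
      have "?n * (\<Sum>j\<le>m. u (n - j) * a j) - \<Psi> * (\<Sum>j\<le>m. a j) = (\<Sum>j\<le>m. a j * (?n * u (n - j) - \<Psi>))"
        by (simp add: sum_subtractf sum_distrib_left algebra_simps)
      also have "\<bar>\<dots>\<bar> \<le> (\<Sum>j\<le>m. a j * (e * L))"
      proof (rule order_trans[OF sum_abs sum_mono])
        fix j assume "j \<in> {..m}"
        then have "\<bar>?n * u (n - j) - \<Psi>\<bar> \<le> e * L" using near[of j u \<Psi> L] u1 P L by (simp add: e_def)
        then show "\<bar>a j * (?n * u (n - j) - \<Psi>)\<bar> \<le> a j * (e * L)" using a by (simp add: abs_mult mult_left_mono)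
      qed
      also have "\<dots> = e * L * (\<Sum>k<Suc m. a k)" by (simp add: sum_distrib_left lessThan_Suc_atMost mult.commute)
      also have "\<dots> \<le> e * L * C" using As e(1) L by (intro mult_left_mono) (auto simp del: sum.lessThan_Suc)
      also have "\<dots> \<le> \<epsilon> / 8 * L" using mult_right_mono[OF e(2), of L] L by (simp add: ac_simps)
      finally show ?thesis .
    qed
    have I3: "A * ((\<Sum>k. u k) - (\<Sum>k\<le>m. u k)) \<le> \<epsilon> / 8 * L" "0 \<le> A * ((\<Sum>k. u k) - (\<Sum>k\<le>m. u k))"
    proof -
      have "A * ((\<Sum>k. u k) - (\<Sum>k\<le>m. u k)) \<le> C * (4 * C * L * (1 / sqrt (real m)))"
        using A L C by (intro mult_mono suminf_tail_le su tailu) (auto intro!: sum_le_suminf simp: u su)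
      also have "\<dots> = (8 * C\<^sup>2 * (1 / sqrt (real m))) * (L / 2)" by (simp add: power2_eq_square)
      also have "\<dots> \<le> \<epsilon> / 8 * (L / 2)" using sm2 L by (intro mult_right_mono) auto
      also have "\<dots> \<le> \<epsilon> / 8 * L" using L assms by (intro mult_left_mono) auto
      finally show "A * ((\<Sum>k. u k) - (\<Sum>k\<le>m. u k)) \<le> \<epsilon> / 8 * L" .
      show "0 \<le> A * ((\<Sum>k. u k) - (\<Sum>k\<le>m. u k))"
        using A u su by (intro mult_nonneg_nonneg) (auto intro!: sum_le_suminf)
    qed
    have I4: "\<Psi> * ((\<Sum>k. a k) - (\<Sum>k\<le>m. a k)) \<le> \<epsilon> / 8 * L" "0 \<le> \<Psi> * ((\<Sum>k. a k) - (\<Sum>k\<le>m. a k))"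
    proof -
      have "\<Psi> * ((\<Sum>k. a k) - (\<Sum>k\<le>m. a k)) \<le> (C * L) * (4 * C * (1 / sqrt (real m)))"
        using P L C by (intro mult_mono suminf_tail_le su taila) (auto intro!: sum_le_suminf simp: a su)
      also have "\<dots> = (8 * C\<^sup>2 * (1 / sqrt (real m))) * (L / 2)" by (simp add: power2_eq_square)
      also have "\<dots> \<le> \<epsilon> / 8 * (L / 2)" using sm2 L by (intro mult_right_mono) auto
      also have "\<dots> \<le> \<epsilon> / 8 * L" using L assms by (intro mult_left_mono) auto
      finally show "\<Psi> * ((\<Sum>k. a k) - (\<Sum>k\<le>m. a k)) \<le> \<epsilon> / 8 * L" .
      show "0 \<le> \<Psi> * ((\<Sum>k. a k) - (\<Sum>k\<le>m. a k))"
        using P a su by (intro mult_nonneg_nonneg) (auto intro!: sum_le_suminf)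
    qed
    have I5: "?n * (\<Sum>k\<in>{m<..<n-m}. u k * a (n - k)) \<le> \<epsilon> / 8 * L"
    proof -
      have "u k \<le> 2 * C * L * (1 / (\<kappa> * real n * sqrt (\<kappa> * real n)))" if "k \<in> {m<..<n-m}" for k
      proof -
        have k: "\<kappa> * real n \<le> real k" "0 < k" using that m(2) by auto
        then have "real k * sqrt (real k) * u k \<le> \<Psi> + \<epsilon>' * L" using u1 by (auto simp: abs_le_iff)
        also have "\<dots> \<le> C * L + C * L" using P e' L by (intro add_mono mult_right_mono) auto
        finally have "u k \<le> 2 * C * L * (1 / (real k * sqrt (real k)))" using k(2) by (simp add: field_simps)
        also have "\<dots> \<le> 2 * C * L * (1 / (\<kappa> * real n * sqrt (\<kappa> * real n)))"
          using C L k kn2 by (intro mult_left_mono inverse_three_halves_mono) auto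
        finally show ?thesis .
      qed
      then have "(\<Sum>k\<in>{m<..<n-m}. u k * a (n - k))
          \<le> (\<Sum>k\<in>{m<..<n-m}. 2 * C * L * (1 / (\<kappa> * real n * sqrt (\<kappa> * real n))) * a (n - k))"
        using a by (intro sum_mono mult_right_mono) auto
      also have "\<dots> = 2 * C * L * (1 / (\<kappa> * real n * sqrt (\<kappa> * real n))) * (\<Sum>k\<in>{m<..<n-m}. a (n - k))"
        by (simp add: sum_distrib_left)
      also have "\<dots> \<le> 2 * C * L * (1 / (\<kappa> * real n * sqrt (\<kappa> * real n))) * (4 * C * (1 / sqrt (real m)))"
      proof (rule mult_left_mono)
        have "(\<Sum>k\<in>{m<..<n-m}. a (n - k)) = (\<Sum>j\<in>{m<..<n-m}. a j)"
          by (rule sum.reindex_bij_witness[of _ "\<lambda>k. n - k" "\<lambda>k. n - k"]) auto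
        also have "\<dots> \<le> (\<Sum>j\<in>{m<..n}. a j)" by (rule sum_mono2) (auto simp: a)
        also have "\<dots> \<le> 4 * C * (1 / sqrt (real m))" by (rule taila)
        finally show "(\<Sum>k\<in>{m<..<n-m}. a (n - k)) \<le> 4 * C * (1 / sqrt (real m))" .
      qed (use C L \<kappa> in simp)
      finally have "(\<Sum>k\<in>{m<..<n-m}. u k * a (n - k))
          \<le> 2 * C * L * (1 / (\<kappa> * real n * sqrt (\<kappa> * real n))) * (4 * C * (1 / sqrt (real m)))" .
      then have "?n * (\<Sum>k\<in>{m<..<n-m}. u k * a (n - k))
          \<le> ?n * (2 * C * L * (1 / (\<kappa> * real n * sqrt (\<kappa> * real n))) * (4 * C * (1 / sqrt (real m))))"
        by (intro mult_left_mono) auto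
      also have "\<dots> = (8 * C\<^sup>2 / (\<kappa> * sqrt \<kappa>) * (1 / sqrt (real m))) * L"
        using n0 sn \<kappa>(1) by (simp add: real_sqrt_mult power2_eq_square ac_simps)
      also have "\<dots> \<le> \<epsilon> / 8 * L" using sm1 L by (intro mult_right_mono) auto
      finally show ?thesis .
    qed
    have I6: "0 \<le> ?n * (\<Sum>k\<in>{m<..<n-m}. u k * a (n - k))"
      using u a by (intro mult_nonneg_nonneg sum_nonneg) auto
    have "{..n} = {..m} \<union> {m<..<n-m} \<union> {n-m..n}" using mn by auto
    then have "(\<Sum>k\<le>n. u k * a (n - k))
        = (\<Sum>k\<in>{..m} \<union> {m<..<n-m}. u k * a (n - k)) + (\<Sum>k\<in>{n-m..n}. u k * a (n - k))"
      using mn by (simp only:) (rule sum.union_disjoint, auto)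
    also have "(\<Sum>k\<in>{..m} \<union> {m<..<n-m}. u k * a (n - k))
        = (\<Sum>k\<le>m. u k * a (n - k)) + (\<Sum>k\<in>{m<..<n-m}. u k * a (n - k))"
      by (rule sum.union_disjoint) auto
    also have "(\<Sum>k\<in>{n-m..n}. u k * a (n - k)) = (\<Sum>j\<le>m. u (n - j) * a j)"
      by (rule sum.reindex_bij_witness[of _ "\<lambda>k. n - k" "\<lambda>k. n - k"]) (use mn in auto)
    finally have sp: "?n * (\<Sum>k\<le>n. u k * a (n - k)) = ?n * (\<Sum>k\<le>m. u k * a (n - k))
        + ?n * (\<Sum>k\<in>{m<..<n-m}. u k * a (n - k)) + ?n * (\<Sum>j\<le>m. u (n - j) * a j)"
      by (simp add: algebra_simps)
    have "\<epsilon> / 8 * L \<ge> 0" "\<epsilon> * L = 8 * (\<epsilon> / 8 * L)" using assms L by auto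
    then show ?thesis
      using I1 I2 I3 I4 I5 I6 unfolding sp abs_le_iff right_diff_distrib
      by linarith
  qed
  show ?thesis
    by (rule exI[of _ \<epsilon>'], rule conjI[OF e'(1)], rule exI[of _ \<kappa>], rule conjI[OF \<kappa>(1)], rule exI[of _ N])
       (intro allI impI, rule main, assumption+)
qed

section \<open>Estimates for the ladder structure\<close>

text \<open>
  The sign \<open>\<epsilon>\<close> lets the weak ascending and the strict descending ladder structures share their
  proofs: \<open>\<epsilon> y\<close> is the distance from the origin into the half-line \<open>A\<close>.
\<close>

locale ladder = half_split A B for A B +
  fixes \<nu> :: fmeas and \<epsilon> Cc :: real
  assumes mass_nu [simp]: "mass \<nu> = 1"
    and sq_int: "integrable (mea \<nu>) (\<lambda>y. y\<^sup>2)"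
    and mean0: "ev \<nu> (\<lambda>y. y) = 0"
    and sq_pos: "0 < ev \<nu> (\<lambda>y. y\<^sup>2)"
    and eps: "\<epsilon> = 1 \<or> \<epsilon> = -1"
    and eps_A: "\<And>y. y \<in> A \<Longrightarrow> 0 \<le> \<epsilon> * y"
    and eps_B: "\<And>y. y \<in> B \<Longrightarrow> \<epsilon> * y \<le> 0"
    and conc: "\<And>k x a. 1 \<le> k \<Longrightarrow> 0 \<le> x \<Longrightarrow> ev (\<nu> ^ k) (indicator {a..a + x}) \<le> Cc * (1 + x) / sqrt (real k)"
    and Cc: "0 < Cc"
begin

lemma id_int: "integrable (mea \<nu>) (\<lambda>y. y)"
  by (rule finite_measure.square_integrable_imp_integrable[OF finite_mea _ sq_int]) simp

lemma abs_eps [simp]: "\<bar>\<epsilon> * y\<bar> = \<bar>y\<bar>"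
  using eps by auto

text \<open>A centred law that charges only the closed half-line opposite to \<open>A\<close> is the
  point mass at 0, which the positive second moment excludes.\<close>

lemma positive_part: "\<exists>h>0. 0 < measure (mea \<nu>) {y. h \<le> \<epsilon> * y}"
proof (rule ccontr)
  assume "\<not> ?thesis"
  then have z: "measure (mea \<nu>) {y. h \<le> \<epsilon> * y} = 0" if "h > 0" for h
    using that measure_nonneg[of "mea \<nu>" "{y. h \<le> \<epsilon> * y}"] by (auto simp: order_le_less)
  have "AE y in mea \<nu>. \<forall>n::nat. \<not> (1 / real (Suc n) \<le> \<epsilon> * y)"
  proof (subst AE_all_countable, rule allI)
    fix n
    have "emeasure (mea \<nu>) {y. 1 / real (Suc n) \<le> \<epsilon> * y} = 0"
      using z[of "1 / real (Suc n)"] by (simp add: finite_measure.emeasure_eq_measure[OF finite_mea])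
    then show "AE y in mea \<nu>. \<not> 1 / real (Suc n) \<le> \<epsilon> * y"
      by (subst AE_iff_measurable[OF _ refl]) auto
  qed
  then have neg: "AE y in mea \<nu>. \<epsilon> * y \<le> 0"
  proof eventually_elim
    case (elim y)
    show ?case
    proof (rule ccontr)
      assume "\<not> \<epsilon> * y \<le> 0"
      then obtain n where "inverse (real (Suc n)) < \<epsilon> * y"
        using reals_Archimedean[of "\<epsilon> * y"] by auto
      with elim[rule_format, of n] show False by (simp add: inverse_eq_divide)
    qed
  qed
  have "integral\<^sup>L (mea \<nu>) (\<lambda>y. - (\<epsilon> * y)) = 0"
    using mean0 by simp
  moreover have "AE y in mea \<nu>. 0 \<le> - (\<epsilon> * y)" using neg by eventually_elim simp
  moreover have "integrable (mea \<nu>) (\<lambda>y. - (\<epsilon> * y))" using id_int by simp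
  ultimately have "AE y in mea \<nu>. - (\<epsilon> * y) = 0"
    using integral_nonneg_eq_0_iff_AE by blast
  then have "AE y in mea \<nu>. y\<^sup>2 = 0" by (rule eventually_mono) (use eps in auto)
  then have "ev \<nu> (\<lambda>y. y\<^sup>2) = ev \<nu> (\<lambda>y. 0)" by (intro integral_cong_AE) auto
  with sq_pos show False by simp
qed

section \<open>Laplace transforms and linear growth of the renewal measure\<close>

abbreviation ramp :: "real \<Rightarrow> real" where "ramp y \<equiv> max 0 (\<epsilon> * y)"

text \<open>The Laplace kernel in the depth inside \<open>A\<close>; clipping the depth at 0 keeps
  the function bounded on the opposite half-line.\<close>

definition damp :: "real \<Rightarrow> real \<Rightarrow> real" where "damp b y = exp (- b * ramp y)"

lemma nonneg_bounded_damp: "0 \<le> b \<Longrightarrow> nonneg_bounded (damp b)"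
  unfolding damp_def by (rule nonneg_boundedI[of _ 1]) auto

lemma damp_le_1: "0 \<le> b \<Longrightarrow> damp b y \<le> 1"
  unfolding damp_def by simp

lemma damp_add: "0 \<le> \<epsilon> * x \<Longrightarrow> 0 \<le> \<epsilon> * y \<Longrightarrow> damp b (x + y) = damp b x * damp b y"
  unfolding damp_def by (simp add: distrib_left max_absorb2 flip: exp_add)

lemma eps_A0: "y \<in> insert 0 A \<Longrightarrow> 0 \<le> \<epsilon> * y"
  using eps_A by auto

text \<open>The first step alone produces the gap: with positive probability it leads at least
  \<open>h\<close> deep into \<open>A\<close>, where the transform falls short of 1 by at least
  \<open>b * h * exp (- h)\<close>. Hence n has to be at least 1.\<close>

lemma exit_transform_le:
  "\<exists>c>0. \<forall>b n. 0 < b \<longrightarrow> b \<le> 1 \<longrightarrow> 1 \<le> n \<longrightarrow> (\<Sum>k\<le>n. ev (leave \<nu> B k) (damp b)) \<le> 1 - c * b"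
proof -
  obtain h where h: "h > 0" "0 < measure (mea \<nu>) {y. h \<le> \<epsilon> * y}" using positive_part by auto
  define c where "c = measure (mea \<nu>) {y. h \<le> \<epsilon> * y} * (h * exp (- h))"
  have "(\<Sum>k\<le>n. ev (leave \<nu> B k) (damp b)) \<le> 1 - c * b" if b: "0 < b" "b \<le> 1" and n: "1 \<le> n" for b n
  proof -
    have nb: "nonneg_bounded (damp b)" using b by (intro nonneg_bounded_damp) auto
    have nb1: "nonneg_bounded (\<lambda>y. 1 - damp b y)"
      using nonneg_bounded_measurable[OF nb] b
      by (intro nonneg_boundedI[of _ 1]) (auto simp: damp_le_1 nonneg_boundedD[OF nb])
    have sp: "ev (leave \<nu> B k) (damp b) = mass (leave \<nu> B k) - ev (leave \<nu> B k) (\<lambda>y. 1 - damp b y)" for k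
      by (subst Bochner_Integration.integral_diff) (auto intro: nonneg_bounded_integrable nb)
    have "c * b \<le> ev (leave \<nu> B 1) (\<lambda>y. 1 - damp b y)"
    proof -
      have "b * h * exp (- h) \<le> 1 - exp (- (b * h))"
      proof -
        have "b * h * exp (- h) \<le> b * h * exp (- (b * h))"
          using b h by (intro mult_left_mono) (auto simp: mult_le_cancel_right1)
        also have "\<dots> \<le> (exp (b * h) - 1) * exp (- (b * h))"
          using exp_ge_add_one_self[of "b * h"] by (intro mult_right_mono) (linarith, simp)
        also have "\<dots> = 1 - exp (- (b * h))" by (simp add: algebra_simps flip: exp_add)
        finally show ?thesis .
      qed
      note bh = this
      have "c * b = ev \<nu> (\<lambda>y. b * h * exp (- h) * indicator {y. h \<le> \<epsilon> * y} y)"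
        by (simp add: c_def)
      also have "\<dots> \<le> ev \<nu> (\<lambda>y. indicator A y * (1 - damp b y))"
      proof (rule ev_mono)
        fix y
        show "b * h * exp (- h) * indicator {y. h \<le> \<epsilon> * y} y \<le> indicator A y * (1 - damp b y)"
        proof (cases "h \<le> \<epsilon> * y")
          case True
          then have "y \<in> A" using eps_B[of y] h(1) B by (cases "y \<in> A") auto
          moreover have "damp b y \<le> exp (- (b * h))"
            unfolding damp_def using True b h by (auto intro!: mult_left_mono)
          ultimately show ?thesis using True bh by simp
        next
          case False
          then show ?thesis using damp_le_1[of b y] b by (auto simp: indicator_def)
        qed
      qed (use b h nb1 in \<open>auto intro!: nonneg_bounded_mult\<close>)
      also have "\<dots> = ev (leave \<nu> B 1) (\<lambda>y. 1 - damp b y)"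
        using nonneg_bounded_measurable[OF nb1] by (simp add: ev_restr B)
      finally show ?thesis .
    qed
    also have "\<dots> \<le> (\<Sum>k\<le>n. ev (leave \<nu> B k) (\<lambda>y. 1 - damp b y))"
      using n by (intro member_le_sum) (auto intro: ev_nonneg nb1)
    finally have "c * b \<le> (\<Sum>k\<le>n. ev (leave \<nu> B k) (\<lambda>y. 1 - damp b y))" .
    moreover have "(\<Sum>k\<le>n. mass (leave \<nu> B k)) \<le> 1"
      using mass_stay_leave[OF B_sets mass_nu, of n] measure_nonneg[of "mea (stay \<nu> B n)" UNIV] by linarith
    ultimately show ?thesis unfolding sp by (simp add: sum_subtractf)
  qed
  then show ?thesis using h by (intro exI[of _ c]) (auto simp: c_def)
qed

text \<open>On transforms the renewal equation reads \<open>P = 1 + P * S\<close>, so P is at most 1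
  divided by the gap \<open>c * b\<close> of S. Partial sums replace limits: the triangle i + j
  \<le> n lies in a square, which gives the inequality in the right direction and no question of
  convergence arises.\<close>

lemma renewal_transform_le:
  "\<exists>C>0. \<forall>b n. 0 < b \<longrightarrow> b \<le> 1 \<longrightarrow> (\<Sum>k\<le>n. ev (stay \<nu> A k) (damp b)) \<le> C / b"
proof -
  obtain c where c: "c > 0" "\<And>b n. 0 < b \<Longrightarrow> b \<le> 1 \<Longrightarrow> 1 \<le> n \<Longrightarrow> (\<Sum>k\<le>n. ev (leave \<nu> B k) (damp b)) \<le> 1 - c * b"
    using exit_transform_le by auto
  have main: "(\<Sum>k\<le>n. ev (stay \<nu> A k) (damp b)) \<le> 1 / c / b" if b: "0 < b" "b \<le> 1" and n: "1 \<le> n" for b n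
  proof -
    have nb: "nonneg_bounded (damp b)" using b by (intro nonneg_bounded_damp) auto
    define P S where "P = (\<lambda>k. ev (stay \<nu> A k) (damp b))" and "S = (\<lambda>k. ev (leave \<nu> B k) (damp b))"
    have PS: "0 \<le> P k" "0 \<le> S k" for k unfolding P_def S_def by (auto intro: ev_nonneg nb)
    have rec: "P k = (if k = 0 then 1 else 0) + (\<Sum>i\<le>k. P i * S (k - i))" for k
    proof -
      have "stay \<nu> A k = (1 + stayF \<nu> A * leaveF \<nu> B) $ k"
        using arg_cong[OF stay_A_renewal[of \<nu>], of "\<lambda>f. f $ k"] by simp
      also have "\<dots> = (if k = 0 then 1 else 0) + (\<Sum>i\<le>k. stay \<nu> A i * leave \<nu> B (k - i))"
        by (simp add: fps_mult_nth atLeast0AtMost)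
      finally have "P k = ev (if k = 0 then 1 else 0) (damp b) + ev (\<Sum>i\<le>k. stay \<nu> A i * leave \<nu> B (k - i)) (damp b)"
        unfolding P_def by (simp only: ev_plus[OF nb])
      also have "ev (\<Sum>i\<le>k. stay \<nu> A i * leave \<nu> B (k - i)) (damp b) = (\<Sum>i\<le>k. P i * S (k - i))"
        unfolding ev_sum[OF nb] P_def S_def
        by (intro sum.cong refl ev_times_mult_conc[OF nb concentrated_stay0[OF A] concentrated_leave_B])
           (auto intro!: damp_add eps_A eps_A0)
      also have "ev (if k = 0 then 1 else 0) (damp b) = (if k = 0 then 1 else 0)"
        using nonneg_bounded_measurable[OF nb] by (auto simp: damp_def)
      finally show ?thesis .
    qed
    have "(\<Sum>k\<le>n. P k) = (\<Sum>k\<le>n. (if k = 0 then 1 else 0) + (\<Sum>i\<le>k. P i * S (k - i)))"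
      by (subst rec) simp
    also have "\<dots> = 1 + (\<Sum>k\<le>n. \<Sum>i\<le>k. P i * S (k - i))"
      by (simp add: sum.distrib)
    also have "(\<Sum>k\<le>n. \<Sum>i\<le>k. P i * S (k - i)) = (\<Sum>(i,j)\<in>{(i,j). i + j \<le> n}. P i * S j)"
      by (rule sum.triangle_reindex_eq[symmetric])
    also have "\<dots> \<le> (\<Sum>(i,j)\<in>{..n} \<times> {..n}. P i * S j)"
      by (rule sum_mono2) (auto simp: PS)
    also have "\<dots> = (\<Sum>i\<le>n. P i) * (\<Sum>j\<le>n. S j)"
      by (simp add: sum_product sum.cartesian_product)
    also have "\<dots> \<le> (\<Sum>i\<le>n. P i) * (1 - c * b)"
      using c(2)[OF b n] unfolding S_def by (intro mult_left_mono sum_nonneg PS)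
    finally have "(\<Sum>k\<le>n. P k) * (c * b) \<le> 1" by (simp add: algebra_simps)
    then show ?thesis using c(1) b unfolding P_def by (simp add: field_simps)
  qed
  have "(\<Sum>k\<le>n. ev (stay \<nu> A k) (damp b)) \<le> 1 / c / b" if b: "0 < b" "b \<le> 1" for b n
  proof -
    have "(\<Sum>k\<le>n. ev (stay \<nu> A k) (damp b)) \<le> (\<Sum>k\<le>Suc n. ev (stay \<nu> A k) (damp b))"
      by (rule sum_mono2) (use b nonneg_bounded_damp[of b] in \<open>auto intro!: ev_nonneg simp del: stay.simps\<close>)
    with main[OF b, of "Suc n"] show ?thesis by linarith
  qed
  then show ?thesis using c(1) by (intro exI[of _ "1 / c"]) auto
qed

definition below :: "real \<Rightarrow> real \<Rightarrow> real" where "below x y = indicator {y. \<epsilon> * y \<le> x} y"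

lemma below_sets [measurable, simp]: "{y. \<epsilon> * y \<le> x} \<in> sets borel"
  by measurable

lemma nonneg_bounded_below [simp]: "nonneg_bounded (below x)"
  unfolding below_def[abs_def] by simp

lemma measurable_below [measurable]: "below x \<in> borel_measurable borel"
  by (rule nonneg_bounded_measurable) simp

text \<open>Transform bound at \<open>b = 1 / (1 + x)\<close>: with this choice
  \<open>damp b\<close> is at least \<open>exp (- 1)\<close> at all points counted by
  \<open>below x\<close>.\<close>

lemma renewal_le: "\<exists>C>0. \<forall>x n. 0 \<le> x \<longrightarrow> (\<Sum>k\<le>n. ev (stay \<nu> A k) (below x)) \<le> C * (1 + x)"
proof -
  obtain C where C: "C > 0" "\<And>b n. 0 < b \<Longrightarrow> b \<le> 1 \<Longrightarrow> (\<Sum>k\<le>n. ev (stay \<nu> A k) (damp b)) \<le> C / b"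
    using renewal_transform_le by auto
  have "(\<Sum>k\<le>n. ev (stay \<nu> A k) (below x)) \<le> exp 1 * C * (1 + x)" if x: "0 \<le> x" for x n
  proof -
    define b where "b = 1 / (1 + x)"
    have b: "0 < b" "b \<le> 1" "b * x \<le> 1" using x by (auto simp: b_def field_simps)
    have nb: "nonneg_bounded (damp b)" using b by (intro nonneg_bounded_damp) auto
    have "ev (stay \<nu> A k) (below x) \<le> ev (stay \<nu> A k) (\<lambda>y. exp 1 * damp b y)" for k
    proof (rule ev_mono)
      show "nonneg_bounded (\<lambda>y. exp 1 * damp b y)" using nb by (intro nonneg_bounded_mult) auto
      fix y
      show "below x y \<le> exp 1 * damp b y"
      proof (cases "\<epsilon> * y \<le> x")
        case True
        then have "b * ramp y \<le> b * x" using b x by (intro mult_left_mono) auto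
        then have "b * ramp y \<le> 1" using b(3) by (rule order_trans)
        then have "1 \<le> exp (1 - b * ramp y)" by simp
        also have "\<dots> = exp 1 * damp b y" by (simp add: damp_def flip: exp_add)
        finally show ?thesis using True by (simp add: below_def)
      qed (simp add: below_def damp_def)
    qed simp
    then have "(\<Sum>k\<le>n. ev (stay \<nu> A k) (below x)) \<le> (\<Sum>k\<le>n. ev (stay \<nu> A k) (\<lambda>y. exp 1 * damp b y))"
      by (rule sum_mono)
    also have "\<dots> = exp 1 * (\<Sum>k\<le>n. ev (stay \<nu> A k) (damp b))" by (simp add: sum_distrib_left)
    also have "\<dots> \<le> exp 1 * (C / b)" using C(2)[OF b(1,2)] by (intro mult_left_mono) auto
    finally show ?thesis by (simp add: b_def mult.assoc)
  qed
  then show ?thesis using C(1) by (intro exI[of _ "exp 1 * C"]) auto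
qed

section \<open>First moments of the exit position\<close>

lemma below_eq: "below x y = (if \<epsilon> * y \<le> x then 1 else 0)"
  by (simp add: below_def indicator_def)

lemma abs_exit_le:
  assumes "0 \<le> \<epsilon> * x" "x + w \<in> B"
  shows "\<bar>x + w\<bar> \<le> \<bar>w\<bar>" "\<epsilon> * x \<le> \<bar>w\<bar>"
proof -
  have "\<epsilon> * (x + w) \<le> 0" by (rule eps_B[OF assms(2)])
  then show "\<bar>x + w\<bar> \<le> \<bar>w\<bar>" "\<epsilon> * x \<le> \<bar>w\<bar>"
    using eps assms(1) by auto
qed

text \<open>A step \<open>w\<close> from \<open>A\<close> into \<open>B\<close> is at least as long
  as the depth before it and as the overshoot after it. So the overshoot is at most
  \<open>\<bar>w\<bar>\<close>, and the position before the step is counted by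
  \<open>below \<bar>w\<bar>\<close>.\<close>

lemma nni_leave_le:
  "nni (leave \<nu> A (Suc k)) (\<lambda>y. ennreal \<bar>y\<bar>)
    \<le> (\<integral>\<^sup>+w. ennreal (\<bar>w\<bar> * ev (stay \<nu> A k) (below \<bar>w\<bar>)) \<partial>mea \<nu>)"
proof -
  interpret P: finite_measure "mea (stay \<nu> A k)" by simp
  interpret N: finite_measure "mea \<nu>" by simp
  interpret pair_sigma_finite "mea (stay \<nu> A k)" "mea \<nu>" ..
  have "nni (leave \<nu> A (Suc k)) (\<lambda>y. ennreal \<bar>y\<bar>)
      = (\<integral>\<^sup>+x. \<integral>\<^sup>+w. indicator B (x + w) * ennreal \<bar>x + w\<bar> \<partial>mea \<nu> \<partial>mea (stay \<nu> A k))"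
    by (simp add: nni_restr nni_times flip: B)
  also have "\<dots> \<le> (\<integral>\<^sup>+x. \<integral>\<^sup>+w. ennreal (\<bar>w\<bar> * below \<bar>w\<bar> x) \<partial>mea \<nu> \<partial>mea (stay \<nu> A k))"
  proof (rule nn_integral_mono_AE)
    have "AE x in mea (stay \<nu> A k). x \<in> insert 0 A"
      using concentrated_stay0[OF A, of \<nu> k] by (simp add: concentrated_def)
    then show "AE x in mea (stay \<nu> A k). (\<integral>\<^sup>+w. indicator B (x + w) * ennreal \<bar>x + w\<bar> \<partial>mea \<nu>)
        \<le> (\<integral>\<^sup>+w. ennreal (\<bar>w\<bar> * below \<bar>w\<bar> x) \<partial>mea \<nu>)"
    proof eventually_elim
      case (elim x)
      show ?case
        using abs_exit_le[OF eps_A0[OF elim]]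
        by (intro nn_integral_mono) (auto simp: indicator_def below_eq)
    qed
  qed
  also have "\<dots> = (\<integral>\<^sup>+w. \<integral>\<^sup>+x. ennreal (\<bar>w\<bar> * below \<bar>w\<bar> x) \<partial>mea (stay \<nu> A k) \<partial>mea \<nu>)"
    by (rule Fubini'[symmetric]) (simp add: below_eq[abs_def] split_beta')
  also have "\<dots> = (\<integral>\<^sup>+w. ennreal (\<bar>w\<bar> * ev (stay \<nu> A k) (below \<bar>w\<bar>)) \<partial>mea \<nu>)"
    by (simp add: ennreal_mult ennreal_ev nn_integral_cmult ev_nonneg nonneg_boundedD)
  finally show ?thesis .
qed

text \<open>Summed over the exit time, the linear growth of the renewal measure leaves a multiple of
  \<open>\<bar>w\<bar> * (1 + \<bar>w\<bar>)\<close> under the integral. This is where the second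
  moment of the step makes the mean exit height finite.\<close>

lemma sum_nni_leave_le:
  "\<exists>C>0. \<forall>n. (\<Sum>k\<le>n. nni (leave \<nu> A k) (\<lambda>y. ennreal \<bar>y\<bar>)) \<le> ennreal C"
proof -
  obtain C where C: "C > 0" "\<And>x n. 0 \<le> x \<Longrightarrow> (\<Sum>k\<le>n. ev (stay \<nu> A k) (below x)) \<le> C * (1 + x)"
    using renewal_le by auto
  define D where "D = ev \<nu> (\<lambda>w. C * (\<bar>w\<bar> + w\<^sup>2))"
  have int: "integrable (mea \<nu>) (\<lambda>w. C * (\<bar>w\<bar> + w\<^sup>2))"
    using id_int sq_int by auto
  have D: "0 \<le> D" unfolding D_def using C(1) by (intro integral_nonneg_AE) auto
  have "(\<Sum>k\<le>n. nni (leave \<nu> A k) (\<lambda>y. ennreal \<bar>y\<bar>)) \<le> ennreal D" for n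
  proof (cases n)
    case (Suc m)
    have "(\<Sum>k\<le>n. nni (leave \<nu> A k) (\<lambda>y. ennreal \<bar>y\<bar>)) = (\<Sum>k\<le>m. nni (leave \<nu> A (Suc k)) (\<lambda>y. ennreal \<bar>y\<bar>))"
      unfolding Suc by (subst sum.atMost_Suc_shift) simp
    also have "\<dots> \<le> (\<Sum>k\<le>m. \<integral>\<^sup>+w. ennreal (\<bar>w\<bar> * ev (stay \<nu> A k) (below \<bar>w\<bar>)) \<partial>mea \<nu>)"
      by (intro sum_mono nni_leave_le)
    also have "\<dots> = (\<integral>\<^sup>+w. (\<Sum>k\<le>m. ennreal (\<bar>w\<bar> * ev (stay \<nu> A k) (below \<bar>w\<bar>))) \<partial>mea \<nu>)"
    proof (rule nn_integral_sum[symmetric])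
      fix k
      interpret P: sigma_finite_measure "mea (stay \<nu> A k)" by simp
      have "(\<lambda>w. \<integral>x. below \<bar>w\<bar> x \<partial>mea (stay \<nu> A k)) \<in> borel_measurable borel"
        by (rule P.borel_measurable_lebesgue_integral) (simp add: below_eq[abs_def] split_beta')
      then show "(\<lambda>w. ennreal (\<bar>w\<bar> * ev (stay \<nu> A k) (below \<bar>w\<bar>))) \<in> borel_measurable (mea \<nu>)"
        by simp
    qed
    also have "\<dots> \<le> (\<integral>\<^sup>+w. ennreal (C * (\<bar>w\<bar> + w\<^sup>2)) \<partial>mea \<nu>)"
    proof (rule nn_integral_mono)
      fix w
      have "(\<Sum>k\<le>m. ennreal (\<bar>w\<bar> * ev (stay \<nu> A k) (below \<bar>w\<bar>))) = ennreal (\<bar>w\<bar> * (\<Sum>k\<le>m. ev (stay \<nu> A k) (below \<bar>w\<bar>)))"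
        by (simp add: sum_distrib_left ev_nonneg)
      also have "\<dots> \<le> ennreal (\<bar>w\<bar> * (C * (1 + \<bar>w\<bar>)))"
        by (intro ennreal_leI mult_left_mono C) auto
      also have "\<bar>w\<bar> * (C * (1 + \<bar>w\<bar>)) = C * (\<bar>w\<bar> + w\<^sup>2)"
        by (simp add: algebra_simps power2_eq_square)
      finally show "(\<Sum>k\<le>m. ennreal (\<bar>w\<bar> * ev (stay \<nu> A k) (below \<bar>w\<bar>))) \<le> ennreal (C * (\<bar>w\<bar> + w\<^sup>2))" .
    qed
    also have "\<dots> = ennreal D"
      unfolding D_def using C(1) by (intro nn_integral_eq_integral int) auto
    finally show ?thesis .
  qed simp
  then have "(\<Sum>k\<le>n. nni (leave \<nu> A k) (\<lambda>y. ennreal \<bar>y\<bar>)) \<le> ennreal (D + 1)" for n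
    by (rule order_trans) (simp add: ennreal_leI)
  then show ?thesis using D by (intro exI[of _ "D + 1"]) auto
qed

lemma nni_pos_part_eq:
  "0 \<le> a \<Longrightarrow> nni \<nu> (\<lambda>w. ennreal (a + \<epsilon> * w)) = ennreal a + nni \<nu> (\<lambda>w. ennreal (- (a + \<epsilon> * w)))"
proof -
  assume a: "0 \<le> a"
  have int: "integrable (mea \<nu>) (\<lambda>w. a + \<epsilon> * w)"
    using id_int by (intro Bochner_Integration.integrable_add finite_measure.integrable_const) auto
  have "ev \<nu> (\<lambda>w. a + \<epsilon> * w) = a"
    using id_int mean0 by (subst Bochner_Integration.integral_add)
      (auto intro!: finite_measure.integrable_const)
  then have *: "a = enn2real (nni \<nu> (\<lambda>w. ennreal (a + \<epsilon> * w))) - enn2real (nni \<nu> (\<lambda>w. ennreal (- (a + \<epsilon> * w))))"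
    using real_lebesgue_integral_def[OF int] by simp
  have f: "nni \<nu> (\<lambda>w. ennreal (a + \<epsilon> * w)) \<noteq> \<infinity>" "nni \<nu> (\<lambda>w. ennreal (- (a + \<epsilon> * w))) \<noteq> \<infinity>"
    using real_integrable_def[of "mea \<nu>" "\<lambda>w. a + \<epsilon> * w"] int by auto
  then obtain p q where pq: "nni \<nu> (\<lambda>w. ennreal (a + \<epsilon> * w)) = ennreal p" "0 \<le> p"
      "nni \<nu> (\<lambda>w. ennreal (- (a + \<epsilon> * w))) = ennreal q" "0 \<le> q"
    by (metis ennreal_cases infinity_ennreal_def)
  then show ?thesis using * a by (simp add: ennreal_plus[symmetric] del: ennreal_plus)
qed

text \<open>Optional stopping at time n for the centred walk: the expected depth of the survivors
  balances what the exits have carried to the other side. Nonnegative integrals of positive and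
  negative parts let the identity be proved before any finiteness is known.\<close>

lemma nni_stay_eq:
  "nni (stay \<nu> A n) (\<lambda>y. ennreal (\<epsilon> * y)) = (\<Sum>k\<le>n. nni (leave \<nu> A k) (\<lambda>y. ennreal \<bar>y\<bar>))"
proof (induction n)
  case (Suc n)
  have "nni (stay \<nu> A (Suc n)) (\<lambda>y. ennreal (\<epsilon> * y))
      = (\<integral>\<^sup>+x. \<integral>\<^sup>+w. indicator A (x + w) * ennreal (\<epsilon> * (x + w)) \<partial>mea \<nu> \<partial>mea (stay \<nu> A n))"
    by (simp add: nni_restr nni_times)
  also have "\<dots> = (\<integral>\<^sup>+x. \<integral>\<^sup>+w. ennreal (\<epsilon> * x + \<epsilon> * w) \<partial>mea \<nu> \<partial>mea (stay \<nu> A n))"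
  proof (intro nn_integral_cong)
    fix x w show "indicator A (x + w) * ennreal (\<epsilon> * (x + w)) = ennreal (\<epsilon> * x + \<epsilon> * w)"
      using eps_B[of "x + w"] B by (cases "x + w \<in> A") (auto simp: distrib_left ennreal_neg)
  qed
  also have "\<dots> = (\<integral>\<^sup>+x. (ennreal (\<epsilon> * x) + \<integral>\<^sup>+w. indicator B (x + w) * ennreal \<bar>x + w\<bar> \<partial>mea \<nu>) \<partial>mea (stay \<nu> A n))"
  proof (rule concentrated_nni_cong[OF concentrated_stay0[OF A]])
    fix x assume "x \<in> insert 0 A"
    then have "nni \<nu> (\<lambda>w. ennreal (\<epsilon> * x + \<epsilon> * w)) = ennreal (\<epsilon> * x) + nni \<nu> (\<lambda>w. ennreal (- (\<epsilon> * x + \<epsilon> * w)))"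
      by (intro nni_pos_part_eq eps_A0)
    also have "nni \<nu> (\<lambda>w. ennreal (- (\<epsilon> * x + \<epsilon> * w))) = (\<integral>\<^sup>+w. indicator B (x + w) * ennreal \<bar>x + w\<bar> \<partial>mea \<nu>)"
    proof (rule nn_integral_cong)
      fix w
      have "\<bar>\<epsilon> * (x + w)\<bar> = \<bar>x + w\<bar>" by (rule abs_eps)
      then show "ennreal (- (\<epsilon> * x + \<epsilon> * w)) = indicator B (x + w) * ennreal \<bar>x + w\<bar>"
        using eps_B[of "x + w"] eps_A[of "x + w"] B
        by (cases "x + w \<in> A") (auto simp: distrib_left ennreal_neg)
    qed
    finally show "nni \<nu> (\<lambda>w. ennreal (\<epsilon> * x + \<epsilon> * w)) = ennreal (\<epsilon> * x) + (\<integral>\<^sup>+w. indicator B (x + w) * ennreal \<bar>x + w\<bar> \<partial>mea \<nu>)" .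
  qed
  also have "\<dots> = nni (stay \<nu> A n) (\<lambda>x. ennreal (\<epsilon> * x)) + nni (leave \<nu> A (Suc n)) (\<lambda>y. ennreal \<bar>y\<bar>)"
    by (subst nn_integral_add) (auto simp: nni_restr nni_times simp flip: B)
  finally show ?case using Suc by simp
qed simp

lemma nni_stay_le: "\<exists>C>0. \<forall>n. nni (stay \<nu> A n) (\<lambda>y. ennreal (\<epsilon> * y)) \<le> ennreal C"
  unfolding nni_stay_eq by (rule sum_nni_leave_le)

end

section \<open>Decay in time of the laws of staying in a half-line\<close>

context ladder
begin

text \<open>Unlike \<open>below\<close>, this cuts out a bounded interval, to which the
  concentration bound applies; against the laws of staying in \<open>A\<close> the two have the same
  integral.\<close>

definition strip :: "real \<Rightarrow> real \<Rightarrow> real" where "strip x = indicator {y. 0 \<le> \<epsilon> * y \<and> \<epsilon> * y \<le> x}"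

lemma strip_eq: "strip x y = (if 0 \<le> \<epsilon> * y \<and> \<epsilon> * y \<le> x then 1 else 0)"
  by (simp add: strip_def indicator_def)

lemma nonneg_bounded_strip [simp]: "nonneg_bounded (strip x)"
  unfolding strip_def by (rule nonneg_bounded_indicator) measurable

lemma ev_below_eq_strip: "ev (stay \<nu> A n) (below x) = ev (stay \<nu> A n) (strip x)"
  by (rule ev_cong_conc[OF _ _ concentrated_stay0[OF A]])
     (auto simp: below_eq strip_eq dest: eps_A intro: nonneg_bounded_measurable)

lemma strip_conc:
  assumes "1 \<le> k" "0 \<le> x"
  shows "ev (\<nu> ^ k) (\<lambda>s. strip x (y + s)) \<le> Cc * (1 + x) / sqrt (real k)"
proof -
  define a where "a = (if \<epsilon> = 1 then - y else - x - y)"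
  have "(\<lambda>s. strip x (y + s)) = indicator {a..a + x}"
    using eps by (auto simp: fun_eq_iff strip_eq a_def indicator_def)
  then show ?thesis using conc[OF assms] by simp
qed

lemma mass_above_le:
  assumes "0 < b" "nni (stay \<nu> A n) (\<lambda>y. ennreal (\<epsilon> * y)) \<le> ennreal C" "0 \<le> C"
  shows "mass (stay \<nu> A n) \<le> ev (stay \<nu> A n) (strip b) + C / b"
proof -
  let ?g = "\<lambda>y. indicator {y. b < \<epsilon> * y} y :: real"
  have g: "nonneg_bounded ?g" by (rule nonneg_bounded_indicator) measurable
  have "mass (stay \<nu> A n) = ev (stay \<nu> A n) (\<lambda>_. 1)" by simp
  also have "\<dots> = ev (stay \<nu> A n) (\<lambda>y. strip b y + ?g y)"
    by (rule ev_cong_conc[OF _ _ concentrated_stay0[OF A]])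
       (use g in \<open>auto simp: strip_eq indicator_def dest: eps_A intro!: nonneg_bounded_measurable nonneg_bounded_add\<close>)
  also have "\<dots> = ev (stay \<nu> A n) (strip b) + ev (stay \<nu> A n) ?g"
    by (rule Bochner_Integration.integral_add) (auto intro!: nonneg_bounded_integrable g)
  also have "ev (stay \<nu> A n) ?g \<le> C / b"
  proof -
    have "ennreal (b * ev (stay \<nu> A n) ?g) = nni (stay \<nu> A n) (\<lambda>y. ennreal (b * ?g y))"
      using ennreal_ev[OF nonneg_bounded_mult[OF nonneg_bounded_const[of b] g], of "stay \<nu> A n"] assms(1)
      by simp
    also have "\<dots> \<le> nni (stay \<nu> A n) (\<lambda>y. ennreal (\<epsilon> * y))"
      using assms(1) by (intro nn_integral_mono) (auto simp: indicator_def intro!: ennreal_leI)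
    also have "\<dots> \<le> ennreal C" by fact
    finally have "b * ev (stay \<nu> A n) ?g \<le> C" using assms(3) by (simp add: ennreal_le_iff)
    then show ?thesis using assms(1) by (simp add: field_simps)
  qed
  finally show ?thesis by simp
qed

text \<open>The constants are rational upper bounds: 3/2 for sqrt 2, as \<open>k\<close> is at least
  n/2, and 9/5 for sqrt 3, as \<open>n div 2\<close> is at least n/3 for n \<ge> 2.\<close>

lemma sqrt_half_bounds:
  assumes "2 \<le> n"
  defines "m \<equiv> n div 2" and "k \<equiv> n - n div 2"
  shows "1 \<le> m" "1 \<le> k" "m + k = n" "1 / sqrt (real k) \<le> 3 / 2 / sqrt (real n)" "1 / sqrt (real m) \<le> 9 / 5 / sqrt (real n)"
    "real n \<le> 2 * real k"
proof -
  show mk: "1 \<le> m" "1 \<le> k" "m + k = n" using assms by (auto simp: m_def k_def)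
  have "n \<le> 2 * k" unfolding k_def by simp
  then show k: "real n \<le> 2 * real k" by linarith
  have "n \<le> 3 * m" unfolding m_def using assms(1) by simp
  then have m: "real n \<le> 3 * real m" by linarith
  have "sqrt (real n) \<le> sqrt ((3/2)\<^sup>2 * real k)" using k by (intro real_sqrt_le_mono) (simp add: power2_eq_square)
  then have "sqrt (real n) \<le> 3/2 * sqrt (real k)" by (simp add: real_sqrt_mult)
  then show "1 / sqrt (real k) \<le> 3 / 2 / sqrt (real n)" using mk assms(1) by (simp add: field_simps)
  have "sqrt (real n) \<le> sqrt ((9/5)\<^sup>2 * real m)" using m by (intro real_sqrt_le_mono) (simp add: power2_eq_square)
  then have "sqrt (real n) \<le> 9/5 * sqrt (real m)" by (simp add: real_sqrt_mult)
  then show "1 / sqrt (real m) \<le> 9 / 5 / sqrt (real n)" using mk assms(1) by (simp add: field_simps)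
qed

text \<open>
  On the event of staying in \<open>A\<close> the mean of \<open>\<epsilon> S\<^sub>n\<close> is bounded, so \<open>S\<^sub>n\<close> is mostly within a small
  multiple of \<open>\<surd>n\<close> of the origin; by concentration over the second half of the time this costs a
  constant factor, which gives a contraction between the times \<open>n/2\<close> and \<open>n\<close>.
\<close>

lemma mass_stay_le: "\<exists>L>0. \<forall>n\<ge>1. mass (stay \<nu> A n) \<le> L / sqrt (real n)"
proof -
  obtain C where C: "C > 0" "\<And>n. nni (stay \<nu> A n) (\<lambda>y. ennreal (\<epsilon> * y)) \<le> ennreal C"
    using nni_stay_le by auto
  \<comment> \<open>With this \<open>e\<close> and with \<open>n0\<close>, the concentration factor
    over the second half is at most 3/2 * (1/6 + 1/8) < 1/2. Passing from sqrt m to sqrt n costs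
    9/5, so the induction returns 9/10 of \<open>L\<close>; the remaining tenth pays for
    \<open>C / b\<close> because \<open>L\<close> is at least \<open>10 * K\<close>.\<close>
  define e where "e = 1 / (8 * Cc)"
  define K where "K = C / e"
  define n0 where "n0 = nat \<lceil>(6 * Cc)\<^sup>2\<rceil> + 2"
  define L where "L = max (sqrt (real n0)) (10 * K)"
  have e: "0 < e" using Cc by (simp add: e_def)
  have K: "0 < K" using C e by (simp add: K_def)
  have L: "0 < L" "sqrt (real n0) \<le> L" "10 * K \<le> L" using K by (auto simp: L_def)
  have "1 \<le> n \<longrightarrow> mass (stay \<nu> A n) \<le> L / sqrt (real n)" for n
  proof (induction n rule: less_induct)
    case (less n)
    show ?case
    proof (cases "n < n0")
      case True
      show ?thesis
      proof
        assume n: "1 \<le> n"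
        have "sqrt (real n) \<le> L" using True L(2) by (intro order_trans[OF _ L(2)]) simp
        then have "1 \<le> L / sqrt (real n)" using n by (simp add: field_simps)
        with mass_stay_le_1[OF A mass_nu, of n] show "mass (stay \<nu> A n) \<le> L / sqrt (real n)" by linarith
      qed
    next
      case False
      then have n2: "2 \<le> n" by (simp add: n0_def)
      define m k where "m = n div 2" and "k = n - n div 2"
      note h = sqrt_half_bounds[OF n2, folded m_def k_def]
      have sn: "0 < sqrt (real n)" using n2 by simp
      have s6: "6 * Cc \<le> sqrt (real n)"
      proof (rule real_le_rsqrt)
        have "(6 * Cc)\<^sup>2 \<le> real n0" unfolding n0_def by linarith
        then show "(6 * Cc)\<^sup>2 \<le> real n" using False by linarith
      qed
      define b where "b = e * sqrt (real n)"
      have b: "0 < b" using e sn by (simp add: b_def)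
      have "ev (stay \<nu> A (m + k)) (strip b) \<le> (Cc * (1 + b) / sqrt (real k)) * mass (stay \<nu> A m)"
        by (rule ev_stay_markov[OF A nonneg_bounded_strip strip_conc]) (use h(2) b in auto)
      also have "\<dots> \<le> (1/2) * (L / sqrt (real m))"
      proof (rule mult_mono)
        have "Cc * (1 + b) * (1 / sqrt (real k)) \<le> Cc * (1 + b) * (3 / 2 / sqrt (real n))"
          using h(4) Cc b by (intro mult_left_mono) auto
        also have "\<dots> = 3/2 * (Cc / sqrt (real n)) + 3/2 * (Cc * e)" using sn by (simp add: b_def field_simps)
        also have "\<dots> \<le> 3/2 * (1/6) + 3/2 * (1/8)"
          using s6 sn Cc by (intro add_mono mult_left_mono) (auto simp: e_def field_simps)
        also have "\<dots> \<le> (1/2::real)" by simp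
        finally show "Cc * (1 + b) / sqrt (real k) \<le> 1/2" by simp
        show "mass (stay \<nu> A m) \<le> L / sqrt (real m)"
          using less[of m] h(1,2,3) by auto
      qed auto
      also have "\<dots> \<le> (1/2) * (L * (9 / 5 / sqrt (real n)))"
        using mult_left_mono[OF h(5), of L] L(1) by simp
      finally have "ev (stay \<nu> A n) (strip b) \<le> 9/10 * (L / sqrt (real n))" using h(3) by simp
      moreover have "C / b \<le> 1/10 * (L / sqrt (real n))"
      proof -
        have "C / b = K / sqrt (real n)" by (simp add: K_def b_def)
        also have "\<dots> \<le> (L / 10) / sqrt (real n)" using L sn by (intro divide_right_mono) auto
        finally show ?thesis by simp
      qed
      ultimately show ?thesis
        using mass_above_le[OF b C(2), of n] C(1) by simp
    qed
  qed
  then show ?thesis using L(1) by auto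
qed

text \<open>Survival over the first half of the time and concentration over the second contribute
  n^(-1/2) each. \<open>K\<close> is chosen before \<open>f\<close>, so the bound is uniform over
  all integrands with the same concentration constant \<open>c\<close>.\<close>

lemma ev_stay_le:
  "\<exists>K>0. \<forall>f c n. 1 \<le> n \<longrightarrow> nonneg_bounded f \<longrightarrow> 0 \<le> c \<longrightarrow>
    (\<forall>k y. 1 \<le> k \<longrightarrow> ev (\<nu> ^ k) (\<lambda>s. f (y + s)) \<le> c / sqrt (real k)) \<longrightarrow> ev (stay \<nu> A n) f \<le> K * c / real n"
proof -
  obtain L where L: "0 < L" "\<And>n. 1 \<le> n \<Longrightarrow> mass (stay \<nu> A n) \<le> L / sqrt (real n)"
    using mass_stay_le by auto
  have "ev (stay \<nu> A n) f \<le> (3 * L + 1) * c / real n"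
    if n: "1 \<le> n" and f: "nonneg_bounded f" "0 \<le> c"
      "\<And>k y. 1 \<le> k \<Longrightarrow> ev (\<nu> ^ k) (\<lambda>s. f (y + s)) \<le> c / sqrt (real k)" for f c n
  proof (cases "n = 1")
    case True
    have "ev (stay \<nu> A (0 + 1)) f \<le> (c / sqrt (real 1)) * mass (stay \<nu> A 0)"
      by (rule ev_stay_markov[OF A f(1) f(3)]) simp
    also have "\<dots> \<le> (3 * L + 1) * c" using L f by (simp add: algebra_simps)
    finally show ?thesis using True by simp
  next
    case False
    then have n2: "2 \<le> n" using n by simp
    define m k where "m = n div 2" and "k = n - n div 2"
    note h = sqrt_half_bounds[OF n2, folded m_def k_def]
    have "ev (stay \<nu> A (m + k)) f \<le> (c / sqrt (real k)) * mass (stay \<nu> A m)"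
      by (rule ev_stay_markov[OF A f(1) f(3)[OF h(2)]])
    also have "\<dots> \<le> (c * (3 / 2 / sqrt (real n))) * (L * (9 / 5 / sqrt (real n)))"
    proof (rule mult_mono)
      show "c / sqrt (real k) \<le> c * (3 / 2 / sqrt (real n))" using mult_left_mono[OF h(4) f(2)] by simp
      have "mass (stay \<nu> A m) \<le> L * (1 / sqrt (real m))" using L(2)[OF h(1)] by simp
      also have "\<dots> \<le> L * (9 / 5 / sqrt (real n))" using h(5) L(1) by (intro mult_left_mono) auto
      finally show "mass (stay \<nu> A m) \<le> L * (9 / 5 / sqrt (real n))" .
    qed (use f in auto)
    also have "\<dots> = 27 / 10 * L * c / real n" using n2 by simp
    also have "\<dots> \<le> (3 * L + 1) * c / real n"
      using L(1) f(2) by (intro divide_right_mono mult_right_mono) auto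
    finally show ?thesis using h(3) by simp
  qed
  then show ?thesis using L(1) by (intro exI[of _ "3 * L + 1"]) auto
qed

lemma ev_spitzer:
  assumes "nonneg_bounded f"
  shows "real n * ev (stay \<nu> A n) f
    = (\<Sum>k=1..n. ev (stay \<nu> A (n - k)) (\<lambda>y. ev (\<nu> ^ k) (\<lambda>z. indicator A z * f (y + z))))"
proof -
  have [measurable]: "f \<in> borel_measurable borel" using assms by (rule nonneg_bounded_measurable)
  have "real n * ev (stay \<nu> A n) f = ev (\<Sum>k=1..n. stay \<nu> A (n - k) * restr A (\<nu> ^ k)) f"
    using spitzer[of n \<nu>] ev_of_nat_mult[OF assms, of n "stay \<nu> A n"] by (simp add: mult.commute)
  also have "\<dots> = (\<Sum>k=1..n. ev (stay \<nu> A (n - k)) (\<lambda>y. ev (\<nu> ^ k) (\<lambda>z. indicator A z * f (y + z))))"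
    by (simp add: ev_sum[OF assms] ev_times[OF assms] ev_restr)
  finally show ?thesis .
qed

text \<open>Spitzer's identity closes on \<open>below x\<close>: depths in \<open>A\<close> add up,
  so the k-step factor vanishes unless the earlier position is already counted by
  \<open>below x\<close>, and is otherwise at most a concentration bound. This bound, linear in 1 +
  x, times the linear renewal bound gives the square.\<close>

lemma ev_below_le:
  "\<exists>C>0. \<forall>x n. 0 \<le> x \<longrightarrow> 1 \<le> n \<longrightarrow> ev (stay \<nu> A n) (below x) \<le> C * (1 + x)\<^sup>2 / (real n * sqrt (real n))"
proof -
  obtain U where U: "U > 0" "\<And>x n. 0 \<le> x \<Longrightarrow> (\<Sum>k\<le>n. ev (stay \<nu> A k) (below x)) \<le> U * (1 + x)"
    using renewal_le by auto
  obtain K where K: "K > 0" "\<And>f c n. \<lbrakk>1 \<le> n; nonneg_bounded f; 0 \<le> c;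
      \<And>k y. 1 \<le> k \<Longrightarrow> ev (\<nu> ^ k) (\<lambda>s. f (y + s)) \<le> c / sqrt (real k)\<rbrakk> \<Longrightarrow> ev (stay \<nu> A n) f \<le> K * c / real n"
    using ev_stay_le by metis
  have "ev (stay \<nu> A n) (below x) \<le> (Cc * (2 * U + 4 * (K * Cc))) * (1 + x)\<^sup>2 / (real n * sqrt (real n))"
    if x: "0 \<le> x" and n: "1 \<le> n" for x n
  proof -
    define w where "w = (\<lambda>n. ev (stay \<nu> A n) (below x))"
    have "w n \<le> Cc * (1 + x) * (2 * (U * (1 + x)) + 4 * (K * Cc * (1 + x))) / (real n * sqrt (real n))"
    proof (rule three_halves_bound)
      show "0 \<le> w n" for n unfolding w_def by (intro ev_nonneg) simp
      show "(\<Sum>j\<le>n. w j) \<le> U * (1 + x)" unfolding w_def by (rule U(2)[OF x])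
      show "w n \<le> K * Cc * (1 + x) / real n" if "1 \<le> n" for n
        unfolding w_def ev_below_eq_strip mult.assoc
        by (rule K(2)[OF that nonneg_bounded_strip]) (use Cc x strip_conc in auto)
      have "real n * w n = (\<Sum>k=1..n. ev (stay \<nu> A (n - k)) (\<lambda>y. ev (\<nu> ^ k) (\<lambda>z. indicator A z * below x (y + z))))"
        unfolding w_def by (rule ev_spitzer) simp
      also have "\<dots> \<le> (\<Sum>k=1..n. ev (stay \<nu> A (n - k)) (\<lambda>y. Cc * (1 + x) / sqrt (real k) * below x y))"
      proof (rule sum_mono)
        fix k assume k: "k \<in> {1..n}"
        have c0: "0 \<le> Cc * (1 + x) / sqrt (real k)" using Cc x by simp
        have [measurable]: "below x \<in> borel_measurable borel" by (rule measurable_below)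
        have nb: "nonneg_bounded (\<lambda>y. ev (\<nu> ^ k) (\<lambda>z. indicator A z * below x (y + z)))"
        proof -
          have "(\<lambda>y. ev (\<nu> ^ k) (\<lambda>z. indicator A z * below x (y + z))) = (\<lambda>y. ev (restr A (\<nu> ^ k)) (\<lambda>z. below x (y + z)))"
            by (simp add: ev_restr)
          then show ?thesis using nonneg_bounded_ev_shift[OF nonneg_bounded_below] by simp
        qed
        show "ev (stay \<nu> A (n - k)) (\<lambda>y. ev (\<nu> ^ k) (\<lambda>z. indicator A z * below x (y + z)))
          \<le> ev (stay \<nu> A (n - k)) (\<lambda>y. Cc * (1 + x) / sqrt (real k) * below x y)"
        proof (rule ev_mono_conc[OF nb _ concentrated_stay0[OF A]])
          show "nonneg_bounded (\<lambda>y. Cc * (1 + x) / sqrt (real k) * below x y)"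
            using c0 by (intro nonneg_bounded_mult) auto
          fix y assume "y \<in> insert 0 A"
          then have y: "0 \<le> \<epsilon> * y" by (rule eps_A0)
          show "ev (\<nu> ^ k) (\<lambda>z. indicator A z * below x (y + z)) \<le> Cc * (1 + x) / sqrt (real k) * below x y"
          proof (cases "\<epsilon> * y \<le> x")
            case True
            have "ev (\<nu> ^ k) (\<lambda>z. indicator A z * below x (y + z)) \<le> ev (\<nu> ^ k) (\<lambda>z. strip x (0 + z))"
            proof (rule ev_mono)
              show "nonneg_bounded (\<lambda>z. indicator A z * below x (y + z))"
                by (intro nonneg_bounded_mult) (auto intro: nonneg_bounded_shift)
              show "indicator A z * below x (y + z) \<le> strip x (0 + z)" for z
                using y eps_A[of z] by (auto simp: indicator_def below_eq strip_eq distrib_left)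
            qed auto
            also have "\<dots> \<le> Cc * (1 + x) / sqrt (real k)" by (rule strip_conc) (use k x in auto)
            finally show ?thesis using True by (simp add: below_eq)
          next
            case False
            have "(\<lambda>z. indicator A z * below x (y + z)) = (\<lambda>z. 0)"
            proof
              fix z show "indicator A z * below x (y + z) = 0"
                using False eps_A[of z] by (auto simp: indicator_def below_eq distrib_left)
            qed
            then have "ev (\<nu> ^ k) (\<lambda>z. indicator A z * below x (y + z)) = 0" by (simp only:) simp
            then show ?thesis using False by (simp add: below_eq)
          qed
        qed
      qed
      also have "\<dots> = Cc * (1 + x) * (\<Sum>k=1..n. w (n - k) / sqrt (real k))"
        by (simp add: w_def sum_distrib_left)
      finally show "real n * w n \<le> Cc * (1 + x) * (\<Sum>k=1..n. w (n - k) / sqrt (real k))" .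
    qed (use Cc x n in auto)
    also have "\<dots> = (Cc * (2 * U + 4 * (K * Cc))) * (1 + x)\<^sup>2 / (real n * sqrt (real n))"
      by (simp add: power2_eq_square algebra_simps)
    finally show ?thesis by (simp add: w_def)
  qed
  then show ?thesis using U(1) K(1) Cc by (intro exI[of _ "Cc * (2 * U + 4 * (K * Cc))"]) (auto intro!: mult_pos_pos add_pos_pos)
qed

lemma mass_leave_sums: "(\<lambda>k. mass (leave \<nu> A k)) sums 1"
proof -
  obtain L where L: "0 < L" "\<And>n. 1 \<le> n \<Longrightarrow> mass (stay \<nu> A n) \<le> L / sqrt (real n)"
    using mass_stay_le by auto
  have "(\<lambda>n. mass (stay \<nu> A n)) \<longlonglongrightarrow> 0"
  proof (rule tendsto_sandwich[OF _ _ tendsto_const])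
    show "\<forall>\<^sub>F n in sequentially. mass (stay \<nu> A n) \<le> L / sqrt (real n)"
      using L(2) by (auto intro: eventually_sequentiallyI[of 1])
    show "(\<lambda>n. L / sqrt (real n)) \<longlonglongrightarrow> 0" by real_asymp
  qed simp
  then have "(\<lambda>n. 1 - mass (stay \<nu> A n)) \<longlonglongrightarrow> 1 - 0" by (intro tendsto_intros)
  moreover have "1 - mass (stay \<nu> A n) = (\<Sum>k\<le>n. mass (leave \<nu> A k))" for n
    using mass_stay_leave[OF A mass_nu, of n] by simp
  ultimately show ?thesis by (simp add: sums_def_le)
qed

end

section \<open>The Fejer kernel\<close>

text \<open>The value at 0 is the continuous extension. This is the Fourier transform of the
  triangle function \<open>tri\<close>: a nonnegative integrable kernel whose own transform has
  compact support.\<close>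

definition fejer :: "real \<Rightarrow> real" where
  "fejer u = (if u = 0 then 1 else 2 * (1 - cos u) / u\<^sup>2)"

lemma fejer_eq_sinc: "fejer u = (sinc (u / 2))\<^sup>2"
proof (cases "u = 0")
  case False
  have "cos u = 1 - 2 * (sin (u / 2))\<^sup>2"
    using cos_double_sin[of "u / 2"] by simp
  then show ?thesis using False by (simp add: fejer_def power_divide)
qed (simp add: fejer_def)

lemma fejer_nonneg [simp]: "0 \<le> fejer u"
  unfolding fejer_eq_sinc by simp

lemma fejer_even: "fejer (- u) = fejer u"
  by (simp add: fejer_def)

lemma isCont_fejer: "isCont fejer u"
proof -
  have "isCont (\<lambda>u. sinc (u / 2)) u"
    using isCont_o2[of u "\<lambda>u. u / 2" sinc] isCont_sinc[of "u / 2"] by auto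
  then have "isCont (\<lambda>u. (sinc (u / 2))\<^sup>2) u" by (intro continuous_intros)
  then show ?thesis unfolding fejer_eq_sinc[abs_def] .
qed

lemma measurable_fejer [measurable]: "fejer \<in> borel_measurable borel"
  by (intro borel_measurable_continuous_onI continuous_at_imp_continuous_on ballI isCont_fejer)

lemma half_mult_fejer: "u / 2 * fejer u = (1 - cos u) / u"
proof (cases "u = 0")
  case False
  have "u / 2 * (2 * a / u\<^sup>2) = a / u" for a using False by (simp add: power2_eq_square)
  from this[of "1 - cos u"] show ?thesis using False unfolding fejer_def by simp
qed simp

text \<open>\<open>u / 2 * fejer u\<close> is \<open>(1 - cos u) / u\<close>, which vanishes at
  infinity. Subtracted from the sine integral it leaves an antiderivative of half the kernel, so the
  known limit pi/2 of \<open>Si\<close> gives the total mass.\<close>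

lemma DERIV_Si_minus_fejer: "((\<lambda>u. Si u - u / 2 * fejer u) has_real_derivative fejer u / 2) (at u)"
proof (cases "u = 0")
  case True
  have "((\<lambda>u. u / 2 * fejer u) has_real_derivative 1 / 2) (at 0)"
    unfolding CARAT_DERIV
  proof (intro exI[of _ "\<lambda>u. fejer u / 2"] conjI)
    show "isCont (\<lambda>u. fejer u / 2) 0" by (intro continuous_intros isCont_fejer) simp
  qed (auto simp: fejer_def)
  then have "((\<lambda>u. Si u - u / 2 * fejer u) has_real_derivative sinc 0 - 1 / 2) (at 0)"
    by (intro DERIV_diff DERIV_Si)
  then show ?thesis using True by (simp add: fejer_def)
next
  case False
  have "((\<lambda>u. Si u - (1 - cos u) / u) has_real_derivative sinc u - (sin u * u - (1 - cos u) * 1) / (u * u)) (at u)"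
    using False by (intro DERIV_diff DERIV_Si DERIV_divide) (auto intro!: derivative_eq_intros)
  also have "sinc u - (sin u * u - (1 - cos u) * 1) / (u * u) = fejer u / 2"
    using False by (simp add: fejer_def field_simps power2_eq_square)
  finally have "((\<lambda>u. Si u - (1 - cos u) / u) has_real_derivative fejer u / 2) (at u)" .
  then show ?thesis
    by (rule has_field_derivative_transform_within_open[of _ _ _ "- {0}"])
       (use False in \<open>auto simp: half_mult_fejer simp del: times_divide_eq_left\<close>)
qed

lemma fejer_integral: "has_bochner_integral lborel fejer (2 * pi)"
proof -
  have lim: "((\<lambda>u. Si u - u / 2 * fejer u) \<longlongrightarrow> pi / 2 - 0) at_top"
  proof (intro tendsto_diff Si_at_top)
    show "((\<lambda>u. u / 2 * fejer u) \<longlongrightarrow> 0) at_top"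
    proof (rule Lim_null_comparison)
      show "\<forall>\<^sub>F u in at_top. norm (u / 2 * fejer u) \<le> 2 / u"
        using eventually_gt_at_top[of 0]
      proof eventually_elim
        case (elim u)
        have "\<bar>1 - cos u\<bar> \<le> 2" using cos_le_one[of u] cos_ge_minus_one[of u] by linarith
        then have "\<bar>1 - cos u\<bar> / u \<le> 2 / u" using elim by (intro divide_right_mono) auto
        then show ?case unfolding half_mult_fejer using elim by simp
      qed
      show "((\<lambda>u::real. 2 / u) \<longlongrightarrow> 0) at_top"
        by (intro tendsto_divide_0[OF tendsto_const] filterlim_at_top_imp_at_infinity filterlim_ident)
    qed
  qed
  have "(\<integral>\<^sup>+x. ennreal (fejer x / 2) * indicator {0..} x \<partial>lborel) = ennreal (pi / 2 - 0 - (Si 0 - 0 / 2 * fejer 0))"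
    by (rule nn_integral_FTC_atLeast[OF _ DERIV_Si_minus_fejer _ lim]) auto
  also have "Si 0 = 0" by (simp add: Si_def zero_ereal_def[symmetric])
  finally have "(\<integral>\<^sup>+x. ennreal (indicator {0..} x *\<^sub>R (fejer x / 2)) \<partial>lborel) = ennreal (pi / 2)"
    by (subst nn_integral_cong[where v = "\<lambda>x. ennreal (fejer x / 2) * indicator {0..} x"])
       (auto simp: indicator_def half_mult_fejer simp del: times_divide_eq_left)
  then have "has_bochner_integral lborel (\<lambda>x. indicator {0..} x *\<^sub>R (fejer x / 2)) (pi / 2)"
    by (intro has_bochner_integral_nn_integral) auto
  then have "has_bochner_integral lborel (\<lambda>x. fejer x / 2) (2 *\<^sub>R (pi / 2))"
    by (rule has_bochner_integral_even_function) (simp add: fejer_even)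
  then have "has_bochner_integral lborel (\<lambda>x. 2 * (fejer x / 2)) (2 * (2 *\<^sub>R (pi / 2)))"
    by (rule has_bochner_integral_mult_right)
  then show ?thesis by simp
qed

section \<open>The triangle function and the rescaled kernel\<close>

definition tri :: "real \<Rightarrow> real" where "tri s = max 0 (1 - \<bar>s\<bar>)"

lemma tri_bounds: "0 \<le> tri s" "tri s \<le> 1" "1 < \<bar>s\<bar> \<Longrightarrow> tri s = 0"
  by (auto simp: tri_def)

lemma measurable_tri [measurable]: "tri \<in> borel_measurable borel"
  unfolding tri_def[abs_def] by measurable

lemma integrable_tri: "integrable lborel tri"
proof (rule Bochner_Integration.integrable_bound)
  show "integrable lborel (indicator {-1..1::real} :: real \<Rightarrow> real)" by (simp add: integrable_indicator_iff)
  show "AE x in lborel. norm (tri x) \<le> norm (indicator {-1..1} x :: real)"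
    by (auto simp: tri_def indicator_def)
qed simp

lemma tri_cos_integral: "has_bochner_integral lborel (\<lambda>s. tri s * cos (s * u)) (fejer u)"
proof -
  have "has_bochner_integral lborel (\<lambda>s. (1 - s) * cos (s * u) * indicator {0..1} s) (fejer u / 2)"
  proof (cases "u = 0")
    case True
    have "has_bochner_integral lborel (\<lambda>s. (1 - s) * indicator {0..1} s) ((1 - 1\<^sup>2 / 2) - (0 - 0\<^sup>2 / 2 :: real))"
      by (rule has_bochner_integral_FTC_Icc_real) (auto intro!: derivative_eq_intros continuous_intros)
    then show ?thesis using True by (simp add: fejer_def)
  next
    case False
    define F where "F = (\<lambda>s. (1 - s) * sin (s * u) / u - cos (s * u) / u\<^sup>2)"
    have "has_bochner_integral lborel (\<lambda>s. (1 - s) * cos (s * u) * indicator {0..1} s) (F 1 - F 0)"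
      using False unfolding F_def
      by (intro has_bochner_integral_FTC_Icc_real)
         (auto intro!: derivative_eq_intros continuous_intros simp: field_simps power2_eq_square)
    also have "F 1 - F 0 = fejer u / 2" using False by (simp add: F_def fejer_def diff_divide_distrib)
    finally show ?thesis .
  qed
  also have "(\<lambda>s. (1 - s) * cos (s * u) * indicator {0..1} s) = (\<lambda>s. indicator {0..} s *\<^sub>R (tri s * cos (s * u)))"
    by (auto simp: fun_eq_iff indicator_def tri_def)
  finally have "has_bochner_integral lborel (\<lambda>s. tri s * cos (s * u)) (2 *\<^sub>R (fejer u / 2))"
    by (rule has_bochner_integral_even_function) (auto simp: tri_def)
  then show ?thesis by simp
qed

lemma tri_iexp_integral: "has_bochner_integral lborel (\<lambda>s. complex_of_real (tri s) * iexp (s * u)) (complex_of_real (fejer u))"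
proof -
  have int: "integrable lborel (\<lambda>s. complex_of_real (tri s) * iexp (s * u))"
    by (rule Bochner_Integration.integrable_bound[OF integrable_tri]) (auto simp: norm_mult tri_bounds)
  let ?I = "integral\<^sup>L lborel (\<lambda>s. complex_of_real (tri s) * iexp (s * u))"
  have "Re ?I = integral\<^sup>L lborel (\<lambda>s. tri s * cos (s * u))"
    by (subst integral_Re[symmetric, OF int]) (simp add: Re_exp Im_exp mult.commute)
  then have re: "Re ?I = fejer u"
    using tri_cos_integral[of u] by (simp add: has_bochner_integral_integral_eq)
  have im: "Im ?I = integral\<^sup>L lborel (\<lambda>s. tri s * sin (s * u))"
    by (subst integral_Im[symmetric, OF int]) (simp add: Re_exp Im_exp mult.commute)
  also have "\<dots> = integral\<^sup>L lborel (\<lambda>s. - (tri s * sin (s * u)))"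
    by (subst lborel_integral_real_affine[of "-1" _ 0]) (auto simp: tri_def)
  also have "\<dots> = - integral\<^sup>L lborel (\<lambda>s. tri s * sin (s * u))" by simp
  finally have "Im ?I = 0" using im by simp
  with re have "?I = complex_of_real (fejer u)" by (simp add: complex_eq_iff)
  with int show ?thesis by (simp add: has_bochner_integral_iff)
qed

text \<open>As \<open>T\<close> grows this concentrates at 0, with total mass 2 pi instead of 1
  (divided out only in the local limit theorem) and Fourier transform supported in [-T, T].\<close>

definition fejerT :: "real \<Rightarrow> real \<Rightarrow> real" where "fejerT T z = T * fejer (T * z)"

lemma fejerT_nonneg: "0 < T \<Longrightarrow> 0 \<le> fejerT T z"
  by (simp add: fejerT_def)

lemma fejerT_integral: "0 < T \<Longrightarrow> has_bochner_integral lborel (fejerT T) (2 * pi)"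
proof -
  assume T: "0 < T"
  have "has_bochner_integral lborel (\<lambda>z. fejer (0 + T * z)) (2 * pi /\<^sub>R \<bar>T\<bar>)"
    using fejer_integral T by (subst lborel_has_bochner_integral_real_affine_iff[symmetric]) auto
  then have "has_bochner_integral lborel (\<lambda>z. T * fejer (0 + T * z)) (T * (2 * pi /\<^sub>R \<bar>T\<bar>))"
    by (rule has_bochner_integral_mult_right)
  then show ?thesis using T by (simp add: fejerT_def[abs_def] mult.assoc[symmetric])
qed

lemma fejerT_fourier:
  "0 < T \<Longrightarrow> has_bochner_integral lborel (\<lambda>s. complex_of_real (tri (s / T)) * iexp (s * z)) (complex_of_real (fejerT T z))"
proof -
  assume T: "0 < T"
  have "has_bochner_integral lborel (\<lambda>s. complex_of_real (tri ((0 + T * s) / T)) * iexp ((0 + T * s) * z)) (complex_of_real (fejerT T z) /\<^sub>R \<bar>T\<bar>)"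
  proof -
    have e: "complex_of_real (fejerT T z) /\<^sub>R \<bar>T\<bar> = complex_of_real (fejer (T * z))"
      using T by (simp add: fejerT_def scaleR_conv_of_real)
    have "(\<lambda>s. complex_of_real (tri ((0 + T * s) / T)) * iexp ((0 + T * s) * z)) = (\<lambda>s. complex_of_real (tri s) * iexp (s * (T * z)))"
      using T by (simp add: ac_simps)
    then show ?thesis using tri_iexp_integral[of "T * z"] unfolding e by simp
  qed
  then show ?thesis using T
    by (subst lborel_has_bochner_integral_real_affine_iff[of T _ _ 0]) auto
qed

definition fejer_core :: "real \<Rightarrow> real \<Rightarrow> real" where
  "fejer_core T h = integral\<^sup>L lborel (\<lambda>z. indicator {-h..h} z * fejerT T z)"

lemma integrable_fejerT_restr:
  "0 < T \<Longrightarrow> E \<in> sets borel \<Longrightarrow> integrable lborel (\<lambda>z. indicator E z * fejerT T z)"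
  using integrable_mult_indicator[of E lborel "fejerT T"] has_bochner_integral_iff[of lborel "fejerT T"] fejerT_integral[of T]
  by simp

lemma fejer_core_tendsto: "0 < h \<Longrightarrow> ((\<lambda>T. fejer_core T h) \<longlongrightarrow> 2 * pi) at_top"
proof -
  assume h: "0 < h"
  have eq: "fejer_core T h = integral\<^sup>L lborel (\<lambda>u. indicator {-(T * h)..T * h} u * fejer u)" if T: "0 < T" for T
  proof -
    have "(\<integral>u. indicator {-(T * h)..T * h} u * fejer u \<partial>lborel) = \<bar>T\<bar> *\<^sub>R (\<integral>z. indicator {-(T * h)..T * h} (0 + T * z) * fejer (0 + T * z) \<partial>lborel)"
      by (rule lborel_integral_real_affine) (use T in simp)
    also have "\<dots> = (\<integral>z. indicator {-h..h} z * fejerT T z \<partial>lborel)"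
    proof -
      have "indicator {-(T * h)..T * h} (T * z) = (indicator {-h..h} z :: real)" for z
        using T mult_le_cancel_left_pos[OF T, of "-h" z] mult_le_cancel_left_pos[OF T, of z h] by (auto simp: indicator_def)
      then show ?thesis using T by (simp add: fejerT_def mult.left_commute flip: integral_mult_right_zero)
    qed
    finally show ?thesis by (simp add: fejer_core_def)
  qed
  have "((\<lambda>T. integral\<^sup>L lborel (\<lambda>u. indicator {-(T * h)..T * h} u * fejer u)) \<longlongrightarrow> integral\<^sup>L lborel fejer) at_top"
  proof (rule integral_dominated_convergence_at_top[where w = fejer])
    show "integrable lborel fejer" using fejer_integral by (simp add: has_bochner_integral_iff)
    show "AE u in lborel. ((\<lambda>T. indicator {-(T * h)..T * h} u * fejer u) \<longlongrightarrow> fejer u) at_top"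
    proof (rule AE_I2)
      fix u
      have "\<forall>\<^sub>F T in at_top. indicator {-(T * h)..T * h} u * fejer u = fejer u"
        using eventually_ge_at_top[of "\<bar>u\<bar> / h"]
      proof eventually_elim
        case (elim T)
        then have "\<bar>u\<bar> \<le> T * h" using h by (simp add: field_simps)
        then show ?case by (auto simp: indicator_def)
      qed
      then show "((\<lambda>T. indicator {-(T * h)..T * h} u * fejer u) \<longlongrightarrow> fejer u) at_top"
        by (rule tendsto_eventually)
    qed
    show "\<forall>\<^sub>F T in at_top. AE u in lborel. norm (indicator {-(T * h)..T * h} u * fejer u) \<le> fejer u"
      by (auto intro!: always_eventually simp: indicator_def)
  qed auto
  then have "((\<lambda>T. integral\<^sup>L lborel (\<lambda>u. indicator {-(T * h)..T * h} u * fejer u)) \<longlongrightarrow> 2 * pi) at_top"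
    using fejer_integral by (simp add: has_bochner_integral_integral_eq)
  then show ?thesis
    by (rule Lim_transform_eventually) (use eventually_gt_at_top[of 0] in eventually_elim, simp add: eq)
qed

section \<open>The one-sided exponential and its Fourier transform\<close>

definition expo :: "real \<Rightarrow> real \<Rightarrow> real" where "expo l u = indicator {0..} u * exp (- l * u)"

lemma expo_eq: "expo l u = (if 0 \<le> u then exp (- l * u) else 0)"
  by (simp add: expo_def indicator_def)

lemma nonneg_bounded_expo: "0 \<le> l \<Longrightarrow> nonneg_bounded (expo l)"
  unfolding expo_def[abs_def] by (rule nonneg_boundedI[of _ 1]) (auto simp: indicator_def)

lemma measurable_expo [measurable]: "expo l \<in> borel_measurable borel"
  unfolding expo_def[abs_def] by measurable

lemma expo_nonneg [simp]: "0 \<le> expo l u" by (simp add: expo_eq)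

lemma expo_le_1: "0 \<le> l \<Longrightarrow> expo l u \<le> 1" by (simp add: expo_eq)

text \<open>The only jump of \<open>expo l\<close> is upwards, at 0, so a move to the right by at
  most \<open>h\<close> loses at most the factor \<open>exp (- l * h)\<close>. This one-sided
  regularity takes the place of continuity when the smoothing is undone.\<close>

lemma expo_ge: "0 \<le> l \<Longrightarrow> u \<le> v \<Longrightarrow> v - u \<le> h \<Longrightarrow> exp (- l * h) * expo l u \<le> expo l v"
proof (cases "0 \<le> u")
  case True
  assume "0 \<le> l" "u \<le> v" "v - u \<le> h"
  then have "l * (v - u) \<le> l * h" by (intro mult_left_mono)
  then have "- l * h + - l * u \<le> - l * v" by (simp add: algebra_simps)
  then have "exp (- l * h) * exp (- l * u) \<le> exp (- l * v)" by (simp only: exp_add[symmetric] exp_le_cancel_iff)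
  then show ?thesis using True \<open>u \<le> v\<close> by (simp only: expo_eq if_True) simp
qed (simp add: expo_eq)

lemma expo_integral:
  assumes l: "0 < l"
  shows "has_bochner_integral lborel (expo l) (1 / l)"
proof -
  have "(\<integral>\<^sup>+x. ennreal (exp (- l * x)) * indicator {0..} x \<partial>lborel) = ennreal (0 - (- exp (- l * 0) / l))"
  proof (rule nn_integral_FTC_atLeast)
    show "((\<lambda>x. - exp (- l * x) / l) \<longlongrightarrow> 0) at_top" using l by real_asymp
  qed (use l in \<open>auto intro!: derivative_eq_intros\<close>)
  then have "(\<integral>\<^sup>+x. ennreal (expo l x) \<partial>lborel) = ennreal (1 / l)"
    by (simp add: expo_def ennreal_mult' ennreal_indicator mult.commute)
  then show ?thesis using l by (intro has_bochner_integral_nn_integral) auto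
qed

lemma expo_fourier:
  assumes l: "0 < l"
  shows "integrable lborel (\<lambda>u. complex_of_real (expo l u) * iexp (- s * u))"
    "integral\<^sup>L lborel (\<lambda>u. complex_of_real (expo l u) * iexp (- s * u)) = 1 / (complex_of_real l + \<i> * complex_of_real s)"
proof -
  show int: "integrable lborel (\<lambda>u. complex_of_real (expo l u) * iexp (- s * u))"
  proof (rule Bochner_Integration.integrable_bound)
    show "integrable lborel (expo l)" using expo_integral[OF l] by (simp add: has_bochner_integral_iff)
    show "AE u in lborel. norm (complex_of_real (expo l u) * iexp (- s * u)) \<le> norm (expo l u)"
      by (rule AE_I2) (simp only: norm_mult norm_exp_i_times norm_of_real, simp)
  qed measurable
  define c where "c = complex_of_real l + \<i> * complex_of_real s"
  have c0: "c \<noteq> 0" using l by (simp add: c_def complex_eq_iff)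
  have eq: "(\<lambda>u. complex_of_real (expo l u) * iexp (- s * u)) = (\<lambda>u. indicator {0..} u *\<^sub>R exp (- c * complex_of_real u))"
  proof
    fix u :: real
    have "complex_of_real (exp (- l * u)) * iexp (- s * u) = exp (- c * complex_of_real u)"
      unfolding exp_of_real[symmetric] mult_exp_exp by (rule arg_cong[of _ _ exp]) (simp add: c_def algebra_simps)
    then show "complex_of_real (expo l u) * iexp (- s * u) = indicator {0..} u *\<^sub>R exp (- c * complex_of_real u)"
      by (cases "0 \<le> u") (simp_all only: expo_eq if_True if_False indicator_simps atLeast_iff scaleR_one of_real_0 mult_zero_left scaleR_zero_left not_False_eq_True)
  qed
  have setint: "set_integrable lborel {0..} (\<lambda>u. exp (- c * complex_of_real u))"
    using int unfolding eq set_integrable_def .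
  have "integral\<^sup>L lborel (\<lambda>u. complex_of_real (expo l u) * iexp (- s * u)) = (LBINT u:{0..}. exp (- c * complex_of_real u))"
    unfolding eq set_lebesgue_integral_def ..
  also have "\<dots> = (LBINT u:{0<..}. exp (- c * complex_of_real u))"
    unfolding set_lebesgue_integral_def
    by (intro integral_cong_AE) (auto intro!: AE_I[of _ _ "{0}"] simp: indicator_def)
  also have "\<dots> = (LBINT u=0..\<infinity>. exp (- c * complex_of_real u))"
    by (simp add: interval_lebesgue_integral_0_infty)
  also have "\<dots> = 0 - (- 1 / c)"
  proof (rule interval_integral_FTC_integrable[where F = "\<lambda>u. - exp (- c * complex_of_real u) / c"])
    show "((\<lambda>u. - exp (- c * complex_of_real u) / c) has_vector_derivative exp (- c * complex_of_real x)) (at x)" for x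
      using c0 by (auto intro!: derivative_eq_intros has_vector_derivative_real_field)
    show "set_integrable lborel (einterval 0 \<infinity>) (\<lambda>u. exp (- c * complex_of_real u))"
      by (rule set_integrable_subset[OF setint]) (auto simp: einterval_def)
    show "(((\<lambda>u. - exp (- c * complex_of_real u) / c) \<circ> real_of_ereal) \<longlongrightarrow> - 1 / c) (at_right 0)"
    proof -
      have "((\<lambda>u. - exp (- c * complex_of_real u) / c) \<longlongrightarrow> - exp (- c * complex_of_real 0) / c) (at_right 0)"
        by (intro tendsto_intros c0) 
      then show ?thesis by (simp add: zero_ereal_def ereal_tendsto_simps)
    qed
    show "(((\<lambda>u. - exp (- c * complex_of_real u) / c) \<circ> real_of_ereal) \<longlongrightarrow> 0) (at_left \<infinity>)"
    proof -
      have "((\<lambda>u. - exp (- c * complex_of_real u) / c) \<longlongrightarrow> 0) at_top"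
      proof (rule tendsto_norm_zero_cancel)
        have "norm (- exp (- c * complex_of_real u) / c) = exp (- l * u) / norm c" for u
          by (simp add: norm_divide c_def)
        moreover have "((\<lambda>u. exp (- l * u) / norm c) \<longlongrightarrow> 0) at_top"
          using l by (intro tendsto_divide_zero) real_asymp
        ultimately show "((\<lambda>u. norm (- exp (- c * complex_of_real u) / c)) \<longlongrightarrow> 0) at_top" by simp
      qed
      then show ?thesis by (simp add: ereal_tendsto_simps)
    qed
  qed auto
  finally show "integral\<^sup>L lborel (\<lambda>u. complex_of_real (expo l u) * iexp (- s * u)) = 1 / (complex_of_real l + \<i> * complex_of_real s)"
    by (simp add: c_def)
qed

section \<open>Characteristic functions of a centred non-lattice law\<close>

lemma char_times: "char (mea (A * B)) t = char (mea A) t * char (mea B) t"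
proof -
  interpret A: finite_measure "mea A" by simp
  interpret B: finite_measure "mea B" by simp
  interpret AB: pair_sigma_finite "mea A" "mea B" ..
  interpret P: finite_measure "mea A \<Otimes>\<^sub>M mea B"
    by (rule finite_measure_pair_measure) simp_all
  have ms: "sets (mea A \<Otimes>\<^sub>M mea B) = sets (borel \<Otimes>\<^sub>M borel)" by (rule sets_pair_measure_cong) simp_all
  have [measurable]: "(\<lambda>p. fst p + snd p) \<in> borel_measurable (mea A \<Otimes>\<^sub>M mea B)"
    by (subst measurable_cong_sets[OF ms refl]) measurable
  have int: "integrable (mea A \<Otimes>\<^sub>M mea B) (\<lambda>p. iexp (t * (fst p + snd p)))"
    by (rule P.integrable_const_bound[of _ 1]) (auto simp del: of_real_mult of_real_add)
  have "char (mea (A * B)) t = (\<integral>p. iexp (t * (fst p + snd p)) \<partial>(mea A \<Otimes>\<^sub>M mea B))"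
    unfolding char_def mea_times convolution_def
    by (subst integral_distr) (auto simp: split_beta' simp del: of_real_mult of_real_add)
  also have "\<dots> = (\<integral>x. \<integral>y. iexp (t * (x + y)) \<partial>mea B \<partial>mea A)"
    using AB.integral_fst'[OF int] by simp
  also have "\<dots> = (\<integral>x. iexp (t * x) * char (mea B) t \<partial>mea A)"
    unfolding char_def
    by (intro Bochner_Integration.integral_cong refl)
       (simp add: distrib_left exp_add flip: integral_mult_right_zero)
  also have "\<dots> = char (mea A) t * char (mea B) t"
    by (simp add: char_def)
  finally show ?thesis .
qed

lemma char_one: "char (mea 1) t = 1"
  by (simp add: char_def mea_one integral_return)

lemma char_power: "char (mea (A ^ n)) t = char (mea A) t ^ n"
  by (induction n) (simp_all add: char_one char_times)

text \<open>The step law after tilting. The non-lattice condition has the form used in Fourier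
  analysis; \<open>non_lattice_char\<close> derives it from the definition by lattices.\<close>

locale walk_law =
  fixes \<nu> :: fmeas
  assumes mass_nu [simp]: "mass \<nu> = 1"
    and sq_int: "integrable (mea \<nu>) (\<lambda>y. y\<^sup>2)"
    and mean0: "ev \<nu> (\<lambda>y. y) = 0"
    and sq_pos: "0 < ev \<nu> (\<lambda>y. y\<^sup>2)"
    and nonlattice: "\<And>t. t \<noteq> 0 \<Longrightarrow> norm (char (mea \<nu>) t) < 1"
begin

lemma id_int: "integrable (mea \<nu>) (\<lambda>y. y)"
  by (rule finite_measure.square_integrable_imp_integrable[OF finite_mea _ sq_int]) simp

sublocale law: real_distribution "mea \<nu>"
proof (intro real_distribution.intro prob_spaceI)
  have "emeasure (mea \<nu>) UNIV = 1"
    using mass_nu finite_measure.emeasure_eq_measure[OF finite_mea, of \<nu> UNIV] by simp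
  then show "emeasure (mea \<nu>) (space (mea \<nu>)) = 1" by simp
  show "real_distribution_axioms (mea \<nu>)" by unfold_locales simp_all
qed

abbreviation phi :: "real \<Rightarrow> complex" where "phi \<equiv> char (mea \<nu>)"

definition s2 :: real where "s2 = ev \<nu> (\<lambda>y. y\<^sup>2)"

lemma s2_pos: "0 < s2" using sq_pos by (simp add: s2_def)

text \<open>Error term in the second-order expansion of the characteristic function under a finite
  second moment; the minimum allows dominated convergence where a third moment may be
  infinite.\<close>

definition remainder :: "real \<Rightarrow> real" where
  "remainder t = ev \<nu> (\<lambda>x. min (6 * x\<^sup>2) (\<bar>t\<bar> * \<bar>x\<bar> ^ 3))"

lemma phi_approx: "norm (phi t - (1 - t\<^sup>2 * s2 / 2)) \<le> t\<^sup>2 / 6 * remainder t"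
  unfolding remainder_def
  by (rule law.char_approx3) (use id_int sq_int mean0 in \<open>auto simp: s2_def\<close>)

lemma remainder_tendsto:
  assumes "t \<longlonglongrightarrow> 0" shows "(\<lambda>n. remainder (t n)) \<longlonglongrightarrow> 0"
proof -
  have "(\<lambda>n. ev \<nu> (\<lambda>x. min (6 * x\<^sup>2) (\<bar>t n\<bar> * \<bar>x\<bar> ^ 3))) \<longlonglongrightarrow> ev \<nu> (\<lambda>x. 0)"
  proof (rule integral_dominated_convergence[where w = "\<lambda>x. 6 * x\<^sup>2"])
    show "AE x in mea \<nu>. (\<lambda>n. min (6 * x\<^sup>2) (\<bar>t n\<bar> * \<bar>x\<bar> ^ 3)) \<longlonglongrightarrow> 0"
    proof (rule AE_I2)
      fix x :: real
      have "(\<lambda>n. min (6 * x\<^sup>2) (\<bar>t n\<bar> * \<bar>x\<bar> ^ 3)) \<longlonglongrightarrow> min (6 * x\<^sup>2) (\<bar>0\<bar> * \<bar>x\<bar> ^ 3)"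
        by (intro tendsto_intros assms)
      then show "(\<lambda>n. min (6 * x\<^sup>2) (\<bar>t n\<bar> * \<bar>x\<bar> ^ 3)) \<longlonglongrightarrow> 0" by simp
    qed
  qed (use sq_int in \<open>auto simp: min_def\<close>)
  then show ?thesis by (simp add: remainder_def)
qed

lemma remainder_mono: "\<bar>t\<bar> \<le> \<bar>u\<bar> \<Longrightarrow> remainder t \<le> remainder u"
  unfolding remainder_def
proof (rule integral_mono)
  have "integrable (mea \<nu>) (\<lambda>x. min (6 * x\<^sup>2) (\<bar>t\<bar> * \<bar>x\<bar> ^ 3))" for t
    by (rule Bochner_Integration.integrable_bound[of _ "\<lambda>x. 6 * x\<^sup>2"]) (use sq_int in \<open>auto simp: min_def\<close>)
  then show "integrable (mea \<nu>) (\<lambda>x. min (6 * x\<^sup>2) (\<bar>t\<bar> * \<bar>x\<bar> ^ 3))" "integrable (mea \<nu>) (\<lambda>x. min (6 * x\<^sup>2) (\<bar>u\<bar> * \<bar>x\<bar> ^ 3))"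
    by auto
  show "min (6 * x\<^sup>2) (\<bar>t\<bar> * \<bar>x\<bar> ^ 3) \<le> min (6 * x\<^sup>2) (\<bar>u\<bar> * \<bar>x\<bar> ^ 3)" if "\<bar>t\<bar> \<le> \<bar>u\<bar>" for x
    using that by (intro min.mono mult_right_mono) auto
qed

lemma phi_gauss_near: "\<exists>d>0. \<forall>t. \<bar>t\<bar> \<le> d \<longrightarrow> norm (phi t) \<le> exp (- (s2 / 4) * t\<^sup>2)"
proof -
  have "(\<lambda>n. remainder (1 / real (Suc n))) \<longlonglongrightarrow> 0"
    by (rule remainder_tendsto) (rule LIMSEQ_inverse_real_of_nat[unfolded inverse_eq_divide])
  then have "\<forall>\<^sub>F n in sequentially. remainder (1 / real (Suc n)) < s2"
    using s2_pos by (auto dest: order_tendstoD)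
  then obtain n where n: "remainder (1 / real (Suc n)) < s2"
    by (auto simp: eventually_sequentially)
  \<comment> \<open>The first bound keeps the error below \<open>t\<^sup>2 / 6 * s2\<close>, the
    second keeps \<open>1 - t\<^sup>2 * s2 / 2\<close> nonnegative; 1/2 - 1/6 \<ge> 1/4 then gives
    the exponent.\<close>
  define d where "d = min (1 / real (Suc n)) (1 / sqrt s2)"
  have "norm (phi t) \<le> exp (- (s2 / 4) * t\<^sup>2)" if t: "\<bar>t\<bar> \<le> d" for t
  proof -
    have "remainder t \<le> s2" using remainder_mono[of t "1 / real (Suc n)"] t n by (simp add: d_def)
    have "\<bar>t\<bar> \<le> 1 / sqrt s2" using t by (simp add: d_def)
    then have "t\<^sup>2 \<le> (1 / sqrt s2)\<^sup>2" using abs_le_square_iff[of t "1 / sqrt s2"] s2_pos by simp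
    then have ts: "t\<^sup>2 * s2 \<le> 1" using s2_pos by (simp add: power_divide field_simps)
    have "norm (phi t) \<le> norm (phi t - (1 - t\<^sup>2 * s2 / 2)) + norm (complex_of_real (1 - t\<^sup>2 * s2 / 2))"
      using norm_triangle_sub[of "phi t" "complex_of_real (1 - t\<^sup>2 * s2 / 2)"] by simp
    also have "\<dots> \<le> t\<^sup>2 / 6 * s2 + (1 - t\<^sup>2 * s2 / 2)"
    proof (rule add_mono)
      show "norm (phi t - (1 - t\<^sup>2 * s2 / 2)) \<le> t\<^sup>2 / 6 * s2"
        using phi_approx[of t] mult_left_mono[OF \<open>remainder t \<le> s2\<close>, of "t\<^sup>2 / 6"] by simp
      show "norm (complex_of_real (1 - t\<^sup>2 * s2 / 2)) \<le> 1 - t\<^sup>2 * s2 / 2"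
        unfolding norm_of_real using ts by simp
    qed
    also have "\<dots> \<le> 1 + (- (s2 / 4) * t\<^sup>2)"
      using s2_pos by (simp add: field_simps)
    also have "\<dots> \<le> exp (- (s2 / 4) * t\<^sup>2)" by (rule exp_ge_add_one_self)
    finally show ?thesis .
  qed
  moreover have "0 < d" using s2_pos by (simp add: d_def)
  ultimately show ?thesis by blast
qed

text \<open>Near 0 the expansion gives the bound. On the compact rest of [-T, T] continuity and the
  non-lattice condition keep the modulus below some r < 1, and a small \<open>c\<close> absorbs r. A
  general non-lattice law allows no such bound on the whole line, hence the smoothing by a kernel of
  compactly supported transform.\<close>

lemma phi_gauss: "\<exists>c>0. \<forall>t. \<bar>t\<bar> \<le> T \<longrightarrow> norm (phi t) \<le> exp (- c * t\<^sup>2)"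
proof -
  obtain d where d: "d > 0" "\<And>t. \<bar>t\<bar> \<le> d \<Longrightarrow> norm (phi t) \<le> exp (- (s2 / 4) * t\<^sup>2)"
    using phi_gauss_near by auto
  show ?thesis
  proof (cases "T \<le> d")
    case True
    then show ?thesis using d s2_pos by (intro exI[of _ "s2 / 4"]) auto
  next
    case False
    define S where "S = {-T..-d} \<union> {d..T}"
    have "compact S" "S \<noteq> {}" using False by (auto simp: S_def intro!: compact_Un)
    moreover have "continuous_on S (\<lambda>t. norm (phi t))"
      by (intro continuous_on_norm continuous_at_imp_continuous_on ballI law.isCont_char)
    ultimately obtain u where u: "u \<in> S" "\<And>t. t \<in> S \<Longrightarrow> norm (phi t) \<le> norm (phi u)"
      by (meson continuous_attains_sup)
    \<comment> \<open>The maximum keeps \<open>r\<close> positive, so that it can be written as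
      \<open>exp (ln r)\<close> even if the characteristic function vanishes at
      \<open>u\<close>.\<close>
    define r where "r = max (1/2) (norm (phi u))"
    have "u \<noteq> 0" using u(1) d(1) by (auto simp: S_def)
    then have r: "0 < r" "r < 1" using nonlattice[of u] by (auto simp: r_def)
    have T: "0 < T" using False d(1) by linarith
    define c where "c = min (s2 / 4) (- ln r / T\<^sup>2)"
    have "ln r / T\<^sup>2 < 0" using r T by (intro divide_neg_pos) auto
    then have c: "0 < c" using s2_pos by (simp add: c_def)
    have "norm (phi t) \<le> exp (- c * t\<^sup>2)" if t: "\<bar>t\<bar> \<le> T" for t
    proof (cases "\<bar>t\<bar> \<le> d")
      case True
      have "norm (phi t) \<le> exp (- (s2 / 4) * t\<^sup>2)" by (rule d(2)[OF True])
      also have "\<dots> \<le> exp (- c * t\<^sup>2)"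
      proof -
        have "c \<le> s2 / 4" unfolding c_def by (rule min.cobounded1)
        then have "c * t\<^sup>2 \<le> s2 / 4 * t\<^sup>2" by (rule mult_right_mono) simp
        then show ?thesis by simp
      qed
      finally show ?thesis .
    next
      case False
      then have "t \<in> S" using t by (auto simp: S_def)
      then have "norm (phi t) \<le> r" using u(2) by (force simp: r_def)
      also have "r = exp (ln r)" using r by simp
      also have "\<dots> \<le> exp (- c * t\<^sup>2)"
      proof -
        have "t\<^sup>2 \<le> T\<^sup>2" using t T by (metis abs_ge_zero power2_abs power_mono)
        then have "c * t\<^sup>2 \<le> (- ln r / T\<^sup>2) * T\<^sup>2" using c by (intro mult_mono) (auto simp: c_def)
        then have "ln r \<le> - c * t\<^sup>2" using T by simp
        then show ?thesis by simp
      qed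
      finally show ?thesis .
    qed
    with c show ?thesis by blast
  qed
qed

text \<open>k-th powers of two numbers in the closed unit disc differ by at most k times the
  difference of the bases. That difference is \<open>t\<^sup>2 / k\<close> times a quantity tending
  to 0, so the k-th power may be taken of the quadratic expansion.\<close>

lemma phi_power_tendsto:
  "(\<lambda>k. phi (t / sqrt (real k)) ^ k) \<longlonglongrightarrow> complex_of_real (exp (- (s2 / 2) * t\<^sup>2))"
proof -
  define z where "z = (\<lambda>k::nat. 1 + (- (s2 / 2) * t\<^sup>2) / real k)"
  have lim: "(\<lambda>k. complex_of_real (z k ^ k)) \<longlonglongrightarrow> complex_of_real (exp (- (s2 / 2) * t\<^sup>2))"
    unfolding z_def by (intro tendsto_of_real tendsto_exp_limit_sequentially)
  have tt: "(\<lambda>k. t / sqrt (real k)) \<longlonglongrightarrow> 0" by real_asymp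
  have "(\<lambda>k. t\<^sup>2 / 6 * remainder (t / sqrt (real k))) \<longlonglongrightarrow> t\<^sup>2 / 6 * 0"
    by (intro tendsto_mult tendsto_const remainder_tendsto tt)
  then have r: "(\<lambda>k. t\<^sup>2 / 6 * remainder (t / sqrt (real k))) \<longlonglongrightarrow> 0" by simp
  have "(\<lambda>k. phi (t / sqrt (real k)) ^ k - complex_of_real (z k ^ k)) \<longlonglongrightarrow> 0"
  proof (rule Lim_null_comparison[OF _ r])
    have "\<forall>\<^sub>F k in sequentially. real k \<ge> max 1 (s2 * t\<^sup>2)"
      by (rule eventually_at_top_linorderI[of "nat \<lceil>max 1 (s2 * t\<^sup>2)\<rceil>"]) linarith
    then show "\<forall>\<^sub>F k in sequentially. norm (phi (t / sqrt (real k)) ^ k - complex_of_real (z k ^ k))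
        \<le> t\<^sup>2 / 6 * remainder (t / sqrt (real k))"
    proof eventually_elim
      case (elim k)
      then have k: "0 < real k" "s2 * t\<^sup>2 \<le> real k" by auto
      have zk: "z k = 1 - (t / sqrt (real k))\<^sup>2 * s2 / 2" using k by (simp add: z_def power_divide field_simps)
      have "0 \<le> (s2 / 2) * t\<^sup>2 / real k" "(s2 / 2) * t\<^sup>2 / real k \<le> 1"
        using k s2_pos by (auto simp: field_simps)
      then have "\<bar>z k\<bar> \<le> 1" by (simp add: z_def)
      then have "norm (phi (t / sqrt (real k)) ^ k - complex_of_real (z k) ^ k)
          \<le> real k * norm (phi (t / sqrt (real k)) - complex_of_real (z k))"
        by (intro norm_power_diff law.cmod_char_le_1) simp
      also have "\<dots> \<le> real k * ((t / sqrt (real k))\<^sup>2 / 6 * remainder (t / sqrt (real k)))"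
        using phi_approx[of "t / sqrt (real k)"] unfolding zk by (intro mult_left_mono) simp_all
      also have "\<dots> = t\<^sup>2 / 6 * remainder (t / sqrt (real k))" using k by (simp add: power_divide)
      finally show ?case by simp
    qed
  qed
  from tendsto_add[OF this lim] show ?thesis by simp
qed

end

section \<open>A local limit theorem\<close>

lemma gauss_integral:
  assumes c: "0 < c"
  shows "has_bochner_integral lborel (\<lambda>t::real. exp (- c * t\<^sup>2)) (sqrt (pi / c))"
proof -
  have "has_bochner_integral lborel (\<lambda>t::real. exp (- t\<^sup>2)) (2 *\<^sub>R (sqrt pi / 2))"
    by (rule has_bochner_integral_even_function[OF gaussian_moment_0]) simp
  then have "has_bochner_integral lborel (\<lambda>t::real. exp (- t\<^sup>2)) (sqrt pi)" by simp
  then have "has_bochner_integral lborel (\<lambda>t. exp (- (0 + sqrt c * t)\<^sup>2)) (sqrt pi /\<^sub>R \<bar>sqrt c\<bar>)"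
    using c by (subst lborel_has_bochner_integral_real_affine_iff[symmetric]) auto
  then show ?thesis using c by (simp add: power_mult_distrib real_sqrt_mult real_sqrt_inverse divide_inverse mult.commute)
qed

lemma abs_gauss_le:
  fixes t c :: real
  assumes c: "0 < c"
  shows "\<bar>t\<bar> * exp (- c * t\<^sup>2) \<le> (1 + 2 / c) * exp (- (c / 2) * t\<^sup>2)"
proof -
  have "\<bar>t\<bar> \<le> 1 + t\<^sup>2"
  proof (cases "\<bar>t\<bar> \<le> 1")
    case False
    then show ?thesis using mult_left_mono[of 1 "\<bar>t\<bar>" "\<bar>t\<bar>"] by (simp add: power2_eq_square)
  qed (use zero_le_power2[of t] in linarith)
  also have "\<dots> \<le> (1 + 2 / c) * (1 + (c / 2) * t\<^sup>2)"
    using c by (simp add: field_simps)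
  also have "\<dots> \<le> (1 + 2 / c) * exp ((c / 2) * t\<^sup>2)"
    using c exp_ge_add_one_self[of "(c / 2) * t\<^sup>2"] by (intro mult_left_mono) auto
  finally have "\<bar>t\<bar> * exp (- c * t\<^sup>2) \<le> ((1 + 2 / c) * exp ((c / 2) * t\<^sup>2)) * exp (- c * t\<^sup>2)"
    by (rule mult_right_mono) simp
  also have "\<dots> = (1 + 2 / c) * exp ((c / 2) * t\<^sup>2 + - c * t\<^sup>2)" by (simp only: exp_add mult.assoc)
  also have "(c / 2) * t\<^sup>2 + - c * t\<^sup>2 = - (c / 2) * t\<^sup>2" by simp
  finally show ?thesis .
qed

lemma iexp_minus_one_le: "norm (iexp x - 1) \<le> \<bar>x\<bar>"
  using iexp_approx1[of x 0] by simp

section \<open>Smoothing of the one-sided exponential\<close>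

definition smooth :: "real \<Rightarrow> real \<Rightarrow> real \<Rightarrow> real" where
  "smooth l T w = integral\<^sup>L lborel (\<lambda>z. expo l (w - z) * fejerT T z)"

text \<open>The Fourier density of \<open>smooth l T\<close>: the transform of \<open>expo l\<close>
  is \<open>1 / (l + \<i> * s)\<close>, and convolution with the kernel multiplies it by a triangle,
  which makes it compactly supported.\<close>

definition fejer_symbol :: "real \<Rightarrow> real \<Rightarrow> real \<Rightarrow> complex" where
  "fejer_symbol l T s = complex_of_real (tri (s / T)) / (complex_of_real l + \<i> * complex_of_real s)"

context
  fixes l :: real assumes l: "0 < l"
begin

lemma integrable_expo_mult:
  assumes "integrable lborel W"
  shows "integrable lborel (\<lambda>z. expo l (w - z) * W z)"
proof (rule Bochner_Integration.integrable_bound[OF assms])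
  show "AE x in lborel. norm (expo l (w - x) * W x) \<le> norm (W x)"
    using l by (auto simp: abs_mult intro!: mult_left_le_one_le expo_le_1)
qed (use assms in measurable)

lemma integrable_fejerT: "0 < T \<Longrightarrow> integrable lborel (fejerT T)"
  using fejerT_integral by (simp add: has_bochner_integral_iff)

lemma fejer_symbol_measurable [measurable]: "fejer_symbol l T \<in> borel_measurable borel"
  unfolding fejer_symbol_def[abs_def] by measurable

lemma denominator_norm_ge: "l \<le> norm (complex_of_real l + \<i> * complex_of_real s)"
  using complex_Re_le_cmod[of "complex_of_real l + \<i> * complex_of_real s"] by simp

lemma fejer_symbol_norm_le: "norm (fejer_symbol l T s) \<le> tri (s / T) / l"
  unfolding fejer_symbol_def norm_divide norm_of_real abs_of_nonneg[OF tri_bounds(1)]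
  using l denominator_norm_ge[of s] by (intro divide_left_mono) (auto simp: tri_bounds intro!: mult_pos_pos)

lemma fejer_symbol_norm_le': "norm (fejer_symbol l T s) \<le> 1 / l"
  using fejer_symbol_norm_le[of T s] divide_right_mono[OF tri_bounds(2), of l "s / T"] l by simp

lemma fejer_symbol_zero: "0 < T \<Longrightarrow> T < \<bar>s\<bar> \<Longrightarrow> fejer_symbol l T s = 0"
  by (simp add: fejer_symbol_def tri_bounds(3) field_simps)

lemma integrable_fejer_symbol: "0 < T \<Longrightarrow> integrable lborel (\<lambda>s. norm (fejer_symbol l T s))"
proof (rule Bochner_Integration.integrable_bound)
  assume T: "0 < T"
  show "integrable lborel (\<lambda>s. tri (0 + (1 / T) * s) / l)"
    using T by (intro integrable_divide lborel_integrable_real_affine integrable_tri) auto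
  show "AE s in lborel. norm (norm (fejer_symbol l T s)) \<le> norm (tri (0 + 1 / T * s) / l)"
    using fejer_symbol_norm_le l by (auto simp: tri_bounds)
qed simp

lemma expo_iexp_integral:
  "integral\<^sup>L lborel (\<lambda>z. complex_of_real (expo l (w - z)) * iexp (s * z)) = iexp (s * w) / (complex_of_real l + \<i> * complex_of_real s)"
proof -
  have "integral\<^sup>L lborel (\<lambda>z. complex_of_real (expo l (w - z)) * iexp (s * z))
     = \<bar>-1\<bar> *\<^sub>R integral\<^sup>L lborel (\<lambda>u. complex_of_real (expo l (w - (w + -1 * u))) * iexp (s * (w + -1 * u)))"
    by (rule lborel_integral_real_affine) simp
  also have "\<dots> = integral\<^sup>L lborel (\<lambda>u. iexp (s * w) * (complex_of_real (expo l u) * iexp (- s * u)))"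
    by (simp add: algebra_simps exp_add exp_diff exp_minus divide_inverse)
  also have "\<dots> = iexp (s * w) * integral\<^sup>L lborel (\<lambda>u. complex_of_real (expo l u) * iexp (- s * u))"
    by (rule integral_mult_right_zero)
  also have "\<dots> = iexp (s * w) * (1 / (complex_of_real l + \<i> * complex_of_real s))"
    by (simp only: expo_fourier(2)[OF l])
  finally show ?thesis by simp
qed

lemma smooth_fourier:
  assumes T: "0 < T"
  shows "complex_of_real (smooth l T w) = integral\<^sup>L lborel (\<lambda>s. fejer_symbol l T s * iexp (s * w))"
proof -
  define g where "g = (\<lambda>z s. complex_of_real (expo l (w - z)) * (complex_of_real (tri (s / T)) * iexp (s * z)))"
  have gm [measurable]: "(\<lambda>p. g (fst p) (snd p)) \<in> borel_measurable (lborel \<Otimes>\<^sub>M lborel)"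
    unfolding g_def by measurable
  have ng: "norm (g z s) = expo l (w - z) * tri (s / T)" for z s
    unfolding g_def norm_mult norm_exp_i_times norm_of_real by (simp add: tri_bounds)
  have it: "integrable lborel (\<lambda>s. tri (s / T))"
    using lborel_integrable_real_affine[OF integrable_tri, of "1 / T" 0] T by simp
  have ie: "integrable lborel (\<lambda>z. expo l (w - z))"
    using lborel_integrable_real_affine[of "expo l" "-1" w] expo_integral[OF l] by (simp add: has_bochner_integral_iff)
  have "integrable (lborel \<Otimes>\<^sub>M lborel) (\<lambda>p. g (fst p) (snd p))"
  proof (rule lborel_pair.Fubini_integrable[OF gm])
    show "integrable lborel (\<lambda>z. \<integral>s. norm (g (fst (z, s)) (snd (z, s))) \<partial>lborel)"
      using ie by (simp add: ng)
    show "AE z in lborel. integrable lborel (\<lambda>s. g (fst (z, s)) (snd (z, s)))"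
    proof (rule AE_I2)
      fix z
      have "integrable lborel (\<lambda>s. expo l (w - z) * tri (s / T))" using it by simp
      then show "integrable lborel (\<lambda>s. g (fst (z, s)) (snd (z, s)))"
      proof (rule Bochner_Integration.integrable_bound)
        show "(\<lambda>s. g (fst (z, s)) (snd (z, s))) \<in> borel_measurable lborel"
          unfolding g_def by simp
        show "AE s in lborel. norm (g (fst (z, s)) (snd (z, s))) \<le> norm (expo l (w - z) * tri (s / T))"
          by (rule AE_I2) (simp only: ng fst_conv snd_conv, simp)
      qed
    qed
  qed
  then have int: "integrable (lborel \<Otimes>\<^sub>M lborel) (case_prod g)" by (simp add: split_beta')
  have "complex_of_real (smooth l T w) = (\<integral>z. complex_of_real (expo l (w - z)) * complex_of_real (fejerT T z) \<partial>lborel)"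
    unfolding smooth_def by (simp flip: integral_complex_of_real)
  also have "\<dots> = (\<integral>z. \<integral>s. g z s \<partial>lborel \<partial>lborel)"
    by (simp add: g_def has_bochner_integral_integral_eq[OF fejerT_fourier[OF T]] del: of_real_mult)
  also have "\<dots> = (\<integral>s. \<integral>z. g z s \<partial>lborel \<partial>lborel)"
    by (rule lborel_pair.Fubini_integral[OF int, symmetric])
  also have "\<dots> = (\<integral>s. fejer_symbol l T s * iexp (s * w) \<partial>lborel)"
  proof (rule Bochner_Integration.integral_cong[OF refl])
    fix s
    have "(\<integral>z. g z s \<partial>lborel) = (\<integral>z. complex_of_real (tri (s / T)) * (complex_of_real (expo l (w - z)) * iexp (s * z)) \<partial>lborel)"
      by (simp add: g_def mult.left_commute)
    also have "\<dots> = complex_of_real (tri (s / T)) * (iexp (s * w) / (complex_of_real l + \<i> * complex_of_real s))"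
      unfolding integral_mult_right_zero expo_iexp_integral ..
    finally show "(\<integral>z. g z s \<partial>lborel) = fejer_symbol l T s * iexp (s * w)"
      by (simp add: fejer_symbol_def)
  qed
  finally show ?thesis .
qed

text \<open>For z in [-h, h] the point \<open>w - z\<close> lies to the right of
  \<open>w - h\<close> by at most 2 h, so \<open>expo_ge\<close> applies; all other z only increase
  the integral.\<close>

lemma smooth_ge:
  assumes T: "0 < T" and h: "0 \<le> h"
  shows "exp (- 2 * l * h) * fejer_core T h * expo l (w - h) \<le> smooth l T w"
proof -
  have "exp (- 2 * l * h) * fejer_core T h * expo l (w - h)
      = integral\<^sup>L lborel (\<lambda>z. exp (- 2 * l * h) * expo l (w - h) * (indicator {-h..h} z * fejerT T z))"
    unfolding integral_mult_right_zero fejer_core_def by simp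
  also have "\<dots> \<le> smooth l T w"
    unfolding smooth_def
  proof (rule integral_mono)
    show "integrable lborel (\<lambda>z. exp (- 2 * l * h) * expo l (w - h) * (indicator {-h..h} z * fejerT T z))"
      using T by (intro integrable_mult_right integrable_fejerT_restr) auto
    show "integrable lborel (\<lambda>z. expo l (w - z) * fejerT T z)"
      using T by (intro integrable_expo_mult integrable_fejerT)
    fix z
    show "exp (- 2 * l * h) * expo l (w - h) * (indicator {-h..h} z * fejerT T z) \<le> expo l (w - z) * fejerT T z"
    proof (cases "z \<in> {-h..h}")
      case True
      then have "exp (- l * (2 * h)) * expo l (w - h) \<le> expo l (w - z)"
        using l by (intro expo_ge) auto
      then show ?thesis using True fejerT_nonneg[OF T, of z] by (simp add: mult_left_mono ac_simps)
    qed (use fejerT_nonneg[OF T, of z] in simp)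
  qed
  finally show ?thesis .
qed

text \<open>The counterpart, with \<open>w + h\<close> to the right of every \<open>w - z\<close>.
  The kernel outside [-h, h] has no pointwise bound by \<open>expo l (w + h)\<close>; it is kept as
  an integral and estimated after averaging over the walk.\<close>

lemma smooth_le:
  assumes T: "0 < T" and h: "0 \<le> h"
  shows "smooth l T w \<le> exp (2 * l * h) * (2 * pi) * expo l (w + h)
    + integral\<^sup>L lborel (\<lambda>z. expo l (w - z) * (indicator (- {-h..h}) z * fejerT T z))"
proof -
  have i1: "integrable lborel (\<lambda>z. exp (2 * l * h) * expo l (w + h) * fejerT T z)"
    using T by (intro integrable_mult_right integrable_fejerT)
  have i2: "integrable lborel (\<lambda>z. expo l (w - z) * (indicator (- {-h..h}) z * fejerT T z))"
    using T by (intro integrable_expo_mult integrable_fejerT_restr) auto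
  have "smooth l T w \<le> integral\<^sup>L lborel (\<lambda>z. exp (2 * l * h) * expo l (w + h) * fejerT T z + expo l (w - z) * (indicator (- {-h..h}) z * fejerT T z))"
    unfolding smooth_def
  proof (rule integral_mono)
    show "integrable lborel (\<lambda>z. expo l (w - z) * fejerT T z)"
      using T by (intro integrable_expo_mult integrable_fejerT)
    show "integrable lborel (\<lambda>z. exp (2 * l * h) * expo l (w + h) * fejerT T z + expo l (w - z) * (indicator (- {-h..h}) z * fejerT T z))"
      using i1 i2 by (rule Bochner_Integration.integrable_add)
    fix z
    show "expo l (w - z) * fejerT T z \<le> exp (2 * l * h) * expo l (w + h) * fejerT T z + expo l (w - z) * (indicator (- {-h..h}) z * fejerT T z)"
    proof (cases "z \<in> {-h..h}")
      case True
      then have "exp (- l * (2 * h)) * expo l (w - z) \<le> expo l (w + h)"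
        using l by (intro expo_ge) auto
      then have "exp (2 * l * h) * (exp (- l * (2 * h)) * expo l (w - z)) \<le> exp (2 * l * h) * expo l (w + h)"
        by (intro mult_left_mono) auto
      then have "expo l (w - z) \<le> exp (2 * l * h) * expo l (w + h)"
        by (simp add: exp_minus field_simps)
      then have "expo l (w - z) * fejerT T z \<le> exp (2 * l * h) * expo l (w + h) * fejerT T z"
        using fejerT_nonneg[OF T, of z] by (rule mult_right_mono)
      then show ?thesis using True by simp
    qed (use fejerT_nonneg[OF T, of z] in \<open>simp add: mult_nonneg_nonneg\<close>)
  qed
  also have "\<dots> = integral\<^sup>L lborel (\<lambda>z. exp (2 * l * h) * expo l (w + h) * fejerT T z)
      + integral\<^sup>L lborel (\<lambda>z. expo l (w - z) * (indicator (- {-h..h}) z * fejerT T z))"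
    by (rule Bochner_Integration.integral_add[OF i1 i2])
  also have "integral\<^sup>L lborel (\<lambda>z. exp (2 * l * h) * expo l (w + h) * fejerT T z) = exp (2 * l * h) * (2 * pi) * expo l (w + h)"
    using fejerT_integral[OF T] by (simp add: has_bochner_integral_integral_eq)
  finally show ?thesis .
qed

lemma smooth_tail_integral:
  assumes T: "0 < T"
  shows "integral\<^sup>L lborel (\<lambda>z. indicator (- {-h..h}) z * fejerT T z) = 2 * pi - fejer_core T h"
proof -
  have "integral\<^sup>L lborel (fejerT T) = integral\<^sup>L lborel (\<lambda>z. indicator {-h..h} z * fejerT T z + indicator (- {-h..h}) z * fejerT T z)"
    by (intro Bochner_Integration.integral_cong refl) (auto simp: indicator_def)
  also have "\<dots> = fejer_core T h + integral\<^sup>L lborel (\<lambda>z. indicator (- {-h..h}) z * fejerT T z)"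
    unfolding fejer_core_def
    by (rule Bochner_Integration.integral_add) (use T in \<open>auto intro: integrable_fejerT_restr\<close>)
  finally show ?thesis using fejerT_integral[OF T] by (simp add: has_bochner_integral_integral_eq)
qed

text \<open>Fubini for the far part of the kernel: after averaging over \<open>A\<close> the
  unsmoothed expectation reappears at the shifted points \<open>y - z\<close>.\<close>

lemma ev_swap_expo:
  assumes W: "integrable lborel W" "\<And>z. 0 \<le> W z"
  shows "ev A (\<lambda>s. \<integral>z. expo l (s + y - z) * W z \<partial>lborel) = (\<integral>z. ev A (\<lambda>s. expo l (s + (y - z))) * W z \<partial>lborel)"
    "nonneg_bounded (\<lambda>s. \<integral>z. expo l (s + y - z) * W z \<partial>lborel)"
    "integrable lborel (\<lambda>z. ev A (\<lambda>s. expo l (s + (y - z))) * W z)"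
proof -
  have Wm [measurable]: "W \<in> borel_measurable borel" using W(1) by simp
  interpret A: finite_measure "mea A" by simp
  interpret P: pair_sigma_finite "mea A" lborel ..
  define g where "g = (\<lambda>s z. expo l (s + y - z) * W z)"
  have ms: "sets (mea A \<Otimes>\<^sub>M lborel) = sets (borel \<Otimes>\<^sub>M borel)" by (rule sets_pair_measure_cong) simp_all
  have gm: "(\<lambda>p. g (fst p) (snd p)) \<in> borel_measurable (mea A \<Otimes>\<^sub>M lborel)"
    unfolding g_def by (subst measurable_cong_sets[OF ms refl]) measurable
  have gi: "integrable lborel (g s)" for s unfolding g_def by (rule integrable_expo_mult[OF W(1)])
  have gn: "0 \<le> g s z" "g s z \<le> W z" for s z
    using W(2)[of z] l by (auto simp: g_def intro!: mult_left_le_one_le expo_le_1)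
  have "(\<lambda>s. \<integral>z. g s z \<partial>lborel) \<in> borel_measurable borel"
  proof -
    have "(\<lambda>s. \<integral>z. (case_prod g) (s, z) \<partial>lborel) \<in> borel_measurable borel"
      by (rule lborel.borel_measurable_lebesgue_integral) (simp add: g_def split_beta')
    then show ?thesis by simp
  qed
  moreover have "0 \<le> (\<integral>z. g s z \<partial>lborel)" for s by (rule integral_nonneg_AE) (simp add: gn)
  moreover have "(\<integral>z. g s z \<partial>lborel) \<le> (\<integral>z. W z \<partial>lborel)" for s
    by (intro integral_mono gi W(1) gn)
  ultimately have nb: "nonneg_bounded (\<lambda>s. \<integral>z. g s z \<partial>lborel)"
    by (rule nonneg_boundedI)
  then show "nonneg_bounded (\<lambda>s. \<integral>z. expo l (s + y - z) * W z \<partial>lborel)" by (simp add: g_def)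
  have int: "integrable (mea A \<Otimes>\<^sub>M lborel) (case_prod g)"
  proof -
    have "integrable (mea A \<Otimes>\<^sub>M lborel) (\<lambda>p. g (fst p) (snd p))"
      by (rule P.Fubini_integrable[OF gm]) (use nonneg_bounded_integrable[OF nb] gi gn in auto)
    then show ?thesis by (simp add: split_beta')
  qed
  have "(\<integral>s. \<integral>z. g s z \<partial>lborel \<partial>mea A) = (\<integral>z. \<integral>s. g s z \<partial>mea A \<partial>lborel)"
    by (rule P.Fubini_integral[OF int, symmetric])
  then show "ev A (\<lambda>s. \<integral>z. expo l (s + y - z) * W z \<partial>lborel) = (\<integral>z. ev A (\<lambda>s. expo l (s + (y - z))) * W z \<partial>lborel)"
    by (simp add: g_def add_diff_eq)
  have "integrable lborel (\<lambda>z. \<integral>s. g s z \<partial>mea A)"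
    using P.integrable_snd[OF int] .
  then show "integrable lborel (\<lambda>z. ev A (\<lambda>s. expo l (s + (y - z))) * W z)"
    by (simp add: g_def add_diff_eq)
qed

end

lemma norm_integral_le:
  fixes f :: "'a \<Rightarrow> 'b :: {banach, second_countable_topology}"
  assumes "integrable M f" "integrable M g" "\<And>x. norm (f x) \<le> g x"
  shows "norm (integral\<^sup>L M f) \<le> integral\<^sup>L M g"
  using assms by (intro order_trans[OF integral_norm_bound integral_mono]) auto

section \<open>Expectations of the walk before and after smoothing\<close>

context walk_law
begin

definition smoothed :: "real \<Rightarrow> real \<Rightarrow> nat \<Rightarrow> real \<Rightarrow> real" where
  "smoothed l T k y = ev (\<nu> ^ k) (\<lambda>s. smooth l T (s + y))"

definition expo_ev :: "real \<Rightarrow> nat \<Rightarrow> real \<Rightarrow> real" where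
  "expo_ev l k y = ev (\<nu> ^ k) (\<lambda>s. expo l (s + y))"

context
  fixes l :: real assumes l: "0 < l"
begin

lemma nonneg_bounded_expo_shift: "nonneg_bounded (\<lambda>s. expo l (s + y))"
  by (rule nonneg_bounded_shift(2)[OF nonneg_bounded_expo]) (use l in simp)

lemma expo_ev_nonneg: "0 \<le> expo_ev l k y"
  unfolding expo_ev_def by (rule ev_nonneg[OF nonneg_bounded_expo_shift])

lemma smoothed_fourier:
  assumes T: "0 < T"
  shows "complex_of_real (smoothed l T k y) = integral\<^sup>L lborel (\<lambda>s. fejer_symbol l T s * iexp (s * y) * phi s ^ k)"
proof -
  interpret A: finite_measure "mea (\<nu> ^ k)" by simp
  interpret P: pair_sigma_finite "mea (\<nu> ^ k)" lborel ..
  define g where "g = (\<lambda>x s. fejer_symbol l T s * iexp (s * (x + y)))"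
  have ms: "sets (mea (\<nu> ^ k) \<Otimes>\<^sub>M lborel) = sets (borel \<Otimes>\<^sub>M borel)" by (rule sets_pair_measure_cong) simp_all
  note [measurable] = fejer_symbol_measurable[OF l]
  have gm: "(\<lambda>p. g (fst p) (snd p)) \<in> borel_measurable (mea (\<nu> ^ k) \<Otimes>\<^sub>M lborel)"
    unfolding g_def by (subst measurable_cong_sets[OF ms refl]) measurable
  have ng: "norm (g x s) = norm (fejer_symbol l T s)" for x s
    unfolding g_def norm_mult norm_exp_i_times by simp
  have int0: "integrable lborel (\<lambda>s. norm (fejer_symbol l T s))" by (rule integrable_fejer_symbol[OF l T])
  have "integrable (mea (\<nu> ^ k) \<Otimes>\<^sub>M lborel) (\<lambda>p. g (fst p) (snd p))"
  proof (rule P.Fubini_integrable[OF gm])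
    show "integrable (mea (\<nu> ^ k)) (\<lambda>x. \<integral>s. norm (g (fst (x, s)) (snd (x, s))) \<partial>lborel)"
      by (simp add: ng)
    show "AE x in mea (\<nu> ^ k). integrable lborel (\<lambda>s. g (fst (x, s)) (snd (x, s)))"
    proof (rule AE_I2)
      fix x
      show "integrable lborel (\<lambda>s. g (fst (x, s)) (snd (x, s)))"
        by (rule Bochner_Integration.integrable_bound[OF int0])
           (unfold fst_conv snd_conv ng, simp_all add: g_def)
    qed
  qed
  then have int: "integrable (mea (\<nu> ^ k) \<Otimes>\<^sub>M lborel) (case_prod g)" by (simp add: split_beta')
  have "complex_of_real (smoothed l T k y) = (\<integral>x. complex_of_real (smooth l T (x + y)) \<partial>mea (\<nu> ^ k))"
    unfolding smoothed_def by (rule integral_complex_of_real[symmetric])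
  also have "\<dots> = (\<integral>x. \<integral>s. g x s \<partial>lborel \<partial>mea (\<nu> ^ k))"
    unfolding smooth_fourier[OF l T] g_def ..
  also have "\<dots> = (\<integral>s. \<integral>x. g x s \<partial>mea (\<nu> ^ k) \<partial>lborel)"
    by (rule P.Fubini_integral[OF int, symmetric])
  also have "\<dots> = (\<integral>s. fejer_symbol l T s * iexp (s * y) * phi s ^ k \<partial>lborel)"
  proof (rule Bochner_Integration.integral_cong[OF refl])
    fix s
    have "(\<integral>x. g x s \<partial>mea (\<nu> ^ k)) = (\<integral>x. (fejer_symbol l T s * iexp (s * y)) * iexp (s * x) \<partial>mea (\<nu> ^ k))"
      by (simp add: g_def distrib_left exp_add ac_simps)
    also have "\<dots> = fejer_symbol l T s * iexp (s * y) * char (mea (\<nu> ^ k)) s"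
      unfolding integral_mult_right_zero char_def ..
    finally show "(\<integral>x. g x s \<partial>mea (\<nu> ^ k)) = fejer_symbol l T s * iexp (s * y) * phi s ^ k"
      by (simp add: char_power)
  qed
  finally show ?thesis .
qed

lemma smoothed_scaled:
  assumes T: "0 < T" and k: "1 \<le> k"
  shows "complex_of_real (sqrt (real k) * smoothed l T k y)
    = integral\<^sup>L lborel (\<lambda>t. fejer_symbol l T (t / sqrt (real k)) * iexp (t / sqrt (real k) * y) * phi (t / sqrt (real k)) ^ k)"
proof -
  have "integral\<^sup>L lborel (\<lambda>s. fejer_symbol l T s * iexp (s * y) * phi s ^ k)
     = \<bar>1 / sqrt (real k)\<bar> *\<^sub>R integral\<^sup>L lborel (\<lambda>t. fejer_symbol l T (0 + 1 / sqrt (real k) * t) * iexp ((0 + 1 / sqrt (real k) * t) * y) * phi (0 + 1 / sqrt (real k) * t) ^ k)"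
    by (rule lborel_integral_real_affine) (use k in simp)
  then show ?thesis
    using k unfolding of_real_mult smoothed_fourier[OF T] by (simp add: scaleR_conv_of_real)
qed

text \<open>A Gaussian bound independent of k. Beyond \<open>T\<close> the symbol vanishes; within
  the band the k-th power of \<open>exp (- c * (t / sqrt k)\<^sup>2)\<close> is again
  \<open>exp (- c * t\<^sup>2)\<close>.\<close>

lemma symbol_phi_bound:
  assumes T: "0 < T" and k: "1 \<le> k" and c: "0 < c" "\<And>t. \<bar>t\<bar> \<le> T \<Longrightarrow> norm (phi t) \<le> exp (- c * t\<^sup>2)"
  shows "norm (fejer_symbol l T (t / sqrt (real k))) * norm (phi (t / sqrt (real k))) ^ k \<le> 1 / l * exp (- c * t\<^sup>2)"
proof (cases "\<bar>t / sqrt (real k)\<bar> \<le> T")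
  case True
  have "norm (phi (t / sqrt (real k))) ^ k \<le> exp (- c * (t / sqrt (real k))\<^sup>2) ^ k"
    by (intro power_mono c(2) True) simp
  also have "\<dots> = exp (real k * (- c * (t / sqrt (real k))\<^sup>2))" by (rule exp_of_nat_mult[symmetric])
  also have "real k * (- c * (t / sqrt (real k))\<^sup>2) = - c * t\<^sup>2" using k by (simp add: power_divide)
  finally show ?thesis
    using fejer_symbol_norm_le'[OF l, of T "t / sqrt (real k)"] l by (intro mult_mono) auto
next
  case False
  then have "fejer_symbol l T (t / sqrt (real k)) = 0" using fejer_symbol_zero[OF l T, of "t / sqrt (real k)"] by simp
  then show ?thesis using l by simp
qed

lemma smoothed_bound:
  assumes T: "0 < T"
  shows "\<exists>C>0. \<forall>k\<ge>1. \<forall>y. smoothed l T k y \<le> C / sqrt (real k)"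
proof -
  obtain c where c: "0 < c" "\<And>t. \<bar>t\<bar> \<le> T \<Longrightarrow> norm (phi t) \<le> exp (- c * t\<^sup>2)"
    using phi_gauss[of T] by auto
  define C where "C = 1 / l * sqrt (pi / c)"
  have gi: "has_bochner_integral lborel (\<lambda>t. 1 / l * exp (- c * t\<^sup>2)) C"
    unfolding C_def by (rule has_bochner_integral_mult_right[OF gauss_integral[OF c(1)]])
  have "smoothed l T k y \<le> C / sqrt (real k)" if k: "1 \<le> k" for k y
  proof -
    let ?f = "\<lambda>t. fejer_symbol l T (t / sqrt (real k)) * iexp (t / sqrt (real k) * y) * phi (t / sqrt (real k)) ^ k"
    have "sqrt (real k) * smoothed l T k y \<le> norm (complex_of_real (sqrt (real k) * smoothed l T k y))"
      unfolding norm_of_real by (rule abs_ge_self)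
    also have "\<dots> = norm (integral\<^sup>L lborel ?f)" unfolding smoothed_scaled[OF T k] ..
    also have "\<dots> \<le> integral\<^sup>L lborel (\<lambda>t. 1 / l * exp (- c * t\<^sup>2))"
    proof (rule norm_integral_le)
      have nb: "norm (?f t) \<le> 1 / l * exp (- c * t\<^sup>2)" for t
        using symbol_phi_bound[OF T k c, of t] unfolding norm_mult norm_exp_i_times norm_power by simp
      note [measurable] = fejer_symbol_measurable[OF l]
      have i0: "integrable lborel (\<lambda>t. 1 / l * exp (- c * t\<^sup>2))" using gi by (simp add: has_bochner_integral_iff)
      show "integrable lborel ?f"
        by (rule Bochner_Integration.integrable_bound[OF i0])
           (measurable, use nb l in \<open>intro AE_I2\<close>, simp add: abs_mult)
      show "integrable lborel (\<lambda>t. 1 / l * exp (- c * t\<^sup>2))" by fact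
      show "norm (?f t) \<le> 1 / l * exp (- c * t\<^sup>2)" for t by (rule nb)
    qed
    also have "\<dots> = C" using gi by (rule has_bochner_integral_integral_eq)
    finally show ?thesis using k by (simp add: field_simps)
  qed
  moreover have "0 < C" using c l by (simp add: C_def)
  ultimately show ?thesis by auto
qed

text \<open>For y = 0 this is dominated convergence after the substitution s = t / sqrt k. A shift
  by at most \<open>\<eta> * sqrt (real k)\<close> multiplies the integrand by a phase that differs
  from 1 by at most \<open>\<eta> * \<bar>t\<bar>\<close>, so the limit is uniform over such
  y.\<close>

lemma smoothed_limit:
  assumes T: "0 < T" and e: "0 < e"
  shows "\<exists>\<eta>>0. \<exists>N. \<forall>k\<ge>N. \<forall>y. \<bar>y\<bar> \<le> \<eta> * sqrt (real k) \<longrightarrow> \<bar>sqrt (real k) * smoothed l T k y - sqrt (2 * pi / s2) / l\<bar> \<le> e"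
proof -
  obtain c where c: "0 < c" "\<And>t. \<bar>t\<bar> \<le> T \<Longrightarrow> norm (phi t) \<le> exp (- c * t\<^sup>2)"
    using phi_gauss[of T] by auto
  note [measurable] = fejer_symbol_measurable[OF l]
  let ?g = "\<lambda>k t. fejer_symbol l T (t / sqrt (real k)) * phi (t / sqrt (real k)) ^ k"
  let ?G = "\<lambda>t. 1 / l * exp (- c * t\<^sup>2)"
  have iG: "integrable lborel ?G" using gauss_integral[OF c(1)] by (simp add: has_bochner_integral_iff)
  have gb: "norm (?g k t) \<le> ?G t" if "1 \<le> k" for k t
    using symbol_phi_bound[OF T that c, of t] unfolding norm_mult norm_power .
  \<comment> \<open>The index is shifted because the Gaussian bound requires k \<ge> 1.\<close>
  have L1: "(\<lambda>k. integral\<^sup>L lborel (?g (Suc k))) \<longlonglongrightarrow> integral\<^sup>L lborel (\<lambda>t. complex_of_real (1 / l * exp (- (s2 / 2) * t\<^sup>2)))"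
  proof (rule integral_dominated_convergence[where w = ?G])
    show "AE t in lborel. (\<lambda>k. ?g (Suc k) t) \<longlonglongrightarrow> complex_of_real (1 / l * exp (- (s2 / 2) * t\<^sup>2))"
    proof (rule AE_I2)
      fix t :: real
      have tt: "(\<lambda>k. t / sqrt (real k)) \<longlonglongrightarrow> 0" by real_asymp
      have "isCont (fejer_symbol l T) 0"
        unfolding fejer_symbol_def tri_def using l T by (intro continuous_intros) auto
      then have "(\<lambda>k. fejer_symbol l T (t / sqrt (real k))) \<longlonglongrightarrow> fejer_symbol l T 0"
        by (rule isCont_tendsto_compose[OF _ tt])
      moreover have "fejer_symbol l T 0 = complex_of_real (1 / l)" by (simp add: fejer_symbol_def tri_def)
      ultimately have "(\<lambda>k. ?g k t) \<longlonglongrightarrow> complex_of_real (1 / l) * complex_of_real (exp (- (s2 / 2) * t\<^sup>2))"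
        by (intro tendsto_mult phi_power_tendsto) simp
      then have "(\<lambda>k. ?g k t) \<longlonglongrightarrow> complex_of_real (1 / l * exp (- (s2 / 2) * t\<^sup>2))" by (simp only: of_real_mult)
      then show "(\<lambda>k. ?g (Suc k) t) \<longlonglongrightarrow> complex_of_real (1 / l * exp (- (s2 / 2) * t\<^sup>2))"
        by (rule LIMSEQ_Suc)
    qed
    show "AE t in lborel. norm (?g (Suc k) t) \<le> ?G t" for k by (rule AE_I2) (rule gb, simp)
  qed (use iG in measurable)
  have L2: "integral\<^sup>L lborel (\<lambda>t. complex_of_real (1 / l * exp (- (s2 / 2) * t\<^sup>2))) = complex_of_real (sqrt (2 * pi / s2) / l)"
  proof -
    have "has_bochner_integral lborel (\<lambda>t. 1 / l * exp (- (s2 / 2) * t\<^sup>2)) (1 / l * sqrt (pi / (s2 / 2)))"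
      using s2_pos by (intro has_bochner_integral_mult_right gauss_integral) simp
    then have "integral\<^sup>L lborel (\<lambda>t. 1 / l * exp (- (s2 / 2) * t\<^sup>2)) = 1 / l * sqrt (pi / (s2 / 2))"
      by (rule has_bochner_integral_integral_eq)
    then show ?thesis unfolding integral_complex_of_real by (simp add: mult.commute)
  qed
  have "(\<lambda>k. integral\<^sup>L lborel (?g k)) \<longlonglongrightarrow> complex_of_real (sqrt (2 * pi / s2) / l)"
    by (rule LIMSEQ_imp_Suc) (rule L1[unfolded L2])
  then have "\<forall>\<^sub>F k in sequentially. dist (integral\<^sup>L lborel (?g k)) (complex_of_real (sqrt (2 * pi / s2) / l)) < e / 2"
    using e by (intro tendstoD) auto
  then obtain N where N: "\<And>k. N \<le> k \<Longrightarrow> dist (integral\<^sup>L lborel (?g k)) (complex_of_real (sqrt (2 * pi / s2) / l)) < e / 2"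
    by (auto simp: eventually_sequentially)
  \<comment> \<open>A bound for the integral of \<open>\<bar>t\<bar>\<close> against the dominating
    Gaussian, which is the price of the phase; \<open>\<eta>\<close> brings it down to
    \<open>e / 2\<close>.\<close>
  define H where "H = (1 + 2 / c) / l * sqrt (pi / (c / 2))"
  have H: "0 < H" unfolding H_def using c(1) l by (intro mult_pos_pos divide_pos_pos add_pos_pos) auto
  have iH: "has_bochner_integral lborel (\<lambda>t. (1 + 2 / c) / l * exp (- (c / 2) * t\<^sup>2)) H"
    unfolding H_def by (rule has_bochner_integral_mult_right[OF gauss_integral]) (use c in simp)
  define \<eta> where "\<eta> = e / (2 * H)"
  have eta: "0 < \<eta>" using e H by (simp add: \<eta>_def)
  have "\<bar>sqrt (real k) * smoothed l T k y - sqrt (2 * pi / s2) / l\<bar> \<le> e"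
    if k: "max 1 N \<le> k" and y: "\<bar>y\<bar> \<le> \<eta> * sqrt (real k)" for k y
  proof -
    have k1: "1 \<le> k" using k by simp
    let ?f = "\<lambda>t. fejer_symbol l T (t / sqrt (real k)) * iexp (t / sqrt (real k) * y) * phi (t / sqrt (real k)) ^ k"
    have fb: "norm (?f t) \<le> ?G t" for t
      using symbol_phi_bound[OF T k1 c, of t] unfolding norm_mult norm_exp_i_times norm_power by simp
    have if1: "integrable lborel ?f"
      by (rule Bochner_Integration.integrable_bound[OF iG])
         (measurable, use fb l in \<open>intro AE_I2\<close>, simp add: abs_mult)
    have ig1: "integrable lborel (?g k)"
      by (rule Bochner_Integration.integrable_bound[OF iG])
         (measurable, use gb[OF k1] l in \<open>intro AE_I2\<close>, simp add: abs_mult)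
    have "norm (integral\<^sup>L lborel ?f - integral\<^sup>L lborel (?g k)) = norm (integral\<^sup>L lborel (\<lambda>t. ?f t - ?g k t))"
      by (simp only: Bochner_Integration.integral_diff[OF if1 ig1])
    also have "\<dots> \<le> integral\<^sup>L lborel (\<lambda>t. \<eta> * ((1 + 2 / c) / l * exp (- (c / 2) * t\<^sup>2)))"
    proof (rule norm_integral_le)
      show "integrable lborel (\<lambda>t. ?f t - ?g k t)" by (rule Bochner_Integration.integrable_diff[OF if1 ig1])
      show "integrable lborel (\<lambda>t. \<eta> * ((1 + 2 / c) / l * exp (- (c / 2) * t\<^sup>2)))"
        by (rule integrable_mult_right[OF integrable.intros[OF iH]])
      fix t
      have "?f t - ?g k t = ?g k t * (iexp (t / sqrt (real k) * y) - 1)" by (simp add: algebra_simps)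
      then have "norm (?f t - ?g k t) = norm (?g k t) * norm (iexp (t / sqrt (real k) * y) - 1)"
        by (simp only: norm_mult)
      also have "\<dots> \<le> ?G t * (\<eta> * \<bar>t\<bar>)"
      proof (rule mult_mono)
        show "norm (?g k t) \<le> ?G t" by (rule gb[OF k1])
        have "norm (iexp (t / sqrt (real k) * y) - 1) \<le> \<bar>t / sqrt (real k) * y\<bar>" by (rule iexp_minus_one_le)
        also have "\<dots> = \<bar>t\<bar> * (\<bar>y\<bar> / sqrt (real k))" by (simp add: abs_mult)
        also have "\<dots> \<le> \<bar>t\<bar> * \<eta>" using y k1 by (intro mult_left_mono) (auto simp: field_simps)
        finally show "norm (iexp (t / sqrt (real k) * y) - 1) \<le> \<eta> * \<bar>t\<bar>" by (simp add: mult.commute)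
      qed (use l in auto)
      also have "\<dots> = \<eta> / l * (\<bar>t\<bar> * exp (- c * t\<^sup>2))" by simp
      also have "\<dots> \<le> \<eta> / l * ((1 + 2 / c) * exp (- (c / 2) * t\<^sup>2))"
        using eta l by (intro mult_left_mono abs_gauss_le c) auto
      finally show "norm (?f t - ?g k t) \<le> \<eta> * ((1 + 2 / c) / l * exp (- (c / 2) * t\<^sup>2))" by simp
    qed
    also have "\<dots> = \<eta> * H"
      using has_bochner_integral_integral_eq[OF iH] by (simp only: integral_mult_right_zero)
    also have "\<dots> = e / 2" using H by (simp add: \<eta>_def)
    finally have d1: "norm (integral\<^sup>L lborel ?f - integral\<^sup>L lborel (?g k)) \<le> e / 2" .
    have d2: "norm (integral\<^sup>L lborel (?g k) - complex_of_real (sqrt (2 * pi / s2) / l)) \<le> e / 2"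
      using N[of k] k by (simp add: dist_norm)
    have "\<bar>sqrt (real k) * smoothed l T k y - sqrt (2 * pi / s2) / l\<bar>
        = norm (complex_of_real (sqrt (real k) * smoothed l T k y) - complex_of_real (sqrt (2 * pi / s2) / l))"
      by (simp only: of_real_diff[symmetric] norm_of_real)
    also have "\<dots> = norm ((integral\<^sup>L lborel ?f - integral\<^sup>L lborel (?g k)) + (integral\<^sup>L lborel (?g k) - complex_of_real (sqrt (2 * pi / s2) / l)))"
      unfolding smoothed_scaled[OF T k1] by simp
    also have "\<dots> \<le> e / 2 + e / 2"
      by (rule order_trans[OF norm_triangle_ineq add_mono[OF d1 d2]])
    finally show ?thesis by simp
  qed
  with eta show ?thesis by blast
qed

lemma smooth_measurable: "nonneg_bounded (smooth l T)" if T: "0 < T" for T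
  using ev_swap_expo(2)[OF l integrable_fejerT[OF l T] fejerT_nonneg[OF T], of 0]
  by (simp add: smooth_def[abs_def])

lemma expo_ev_le_smoothed:
  assumes T: "0 < T" and h: "0 \<le> h"
  shows "exp (- 2 * l * h) * fejer_core T h * expo_ev l k y \<le> smoothed l T k (y + h)"
proof -
  have c0: "0 \<le> fejer_core T h"
    unfolding fejer_core_def using T by (intro integral_nonneg_AE AE_I2) (auto simp: fejerT_nonneg)
  have "exp (- 2 * l * h) * fejer_core T h * expo_ev l k y
      = ev (\<nu> ^ k) (\<lambda>s. exp (- 2 * l * h) * fejer_core T h * expo l (s + (y + h) - h))"
    unfolding expo_ev_def integral_mult_right_zero by (simp add: algebra_simps)
  also have "\<dots> \<le> smoothed l T k (y + h)"
    unfolding smoothed_def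
  proof (rule ev_mono)
    show "nonneg_bounded (\<lambda>s. exp (- 2 * l * h) * fejer_core T h * expo l (s + (y + h) - h))"
      using c0 nonneg_bounded_expo_shift[of "y + h - h"]
      by (intro nonneg_bounded_mult nonneg_bounded_const) (auto simp: add_diff_eq)
    show "nonneg_bounded (\<lambda>s. smooth l T (s + (y + h)))"
      using smooth_measurable[OF T] by (rule nonneg_bounded_shift)
    show "exp (- 2 * l * h) * fejer_core T h * expo l (s + (y + h) - h) \<le> smooth l T (s + (y + h))" for s
      by (rule smooth_ge[OF l T h])
  qed
  finally show ?thesis .
qed

text \<open>The far mass of the kernel is weighted by a bound \<open>K\<close> on the unsmoothed
  expectation itself. \<open>expo_ev_bound\<close> supplies it from the opposite inequality alone,
  so the argument is not circular.\<close>

lemma smoothed_le_expo_ev: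
  assumes T: "0 < T" and h: "0 \<le> h" and C: "\<And>y. expo_ev l k y \<le> K"
  shows "smoothed l T k (y - h) \<le> exp (2 * l * h) * (2 * pi) * expo_ev l k y + K * (2 * pi - fejer_core T h)"
proof -
  let ?W = "\<lambda>z. indicator (- {-h..h}) z * fejerT T z"
  have W: "integrable lborel ?W" "\<And>z. 0 \<le> ?W z"
    using integrable_fejerT_restr[OF T] fejerT_nonneg[OF T] by auto
  note sw1 = ev_swap_expo(1)[OF l W, where A = "\<nu> ^ k" and y = "y - h"]
  note sw2 = ev_swap_expo(2)[OF l W, where y = "y - h"]
  note sw3 = ev_swap_expo(3)[OF l W, where A = "\<nu> ^ k" and y = "y - h"]
  have nb1: "nonneg_bounded (\<lambda>s. exp (2 * l * h) * (2 * pi) * expo l (s + y))"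
    by (intro nonneg_bounded_mult nonneg_bounded_const nonneg_bounded_expo_shift) auto
  have "smoothed l T k (y - h) \<le> ev (\<nu> ^ k) (\<lambda>s. exp (2 * l * h) * (2 * pi) * expo l (s + y) + (\<integral>z. expo l (s + (y - h) - z) * ?W z \<partial>lborel))"
    unfolding smoothed_def
  proof (rule ev_mono)
    show "nonneg_bounded (\<lambda>s. smooth l T (s + (y - h)))"
      using smooth_measurable[OF T] by (rule nonneg_bounded_shift)
    show "nonneg_bounded (\<lambda>s. exp (2 * l * h) * (2 * pi) * expo l (s + y) + (\<integral>z. expo l (s + (y - h) - z) * ?W z \<partial>lborel))"
      by (rule nonneg_bounded_add[OF nb1 sw2])
    show "smooth l T (s + (y - h)) \<le> exp (2 * l * h) * (2 * pi) * expo l (s + y) + (\<integral>z. expo l (s + (y - h) - z) * ?W z \<partial>lborel)" for s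
      using smooth_le[OF l T h, of "s + (y - h)"] by (simp add: algebra_simps)
  qed
  also have "\<dots> = ev (\<nu> ^ k) (\<lambda>s. exp (2 * l * h) * (2 * pi) * expo l (s + y)) + ev (\<nu> ^ k) (\<lambda>s. \<integral>z. expo l (s + (y - h) - z) * ?W z \<partial>lborel)"
    by (rule Bochner_Integration.integral_add[OF nonneg_bounded_integrable[OF nb1] nonneg_bounded_integrable[OF sw2]])
  also have "ev (\<nu> ^ k) (\<lambda>s. exp (2 * l * h) * (2 * pi) * expo l (s + y)) = exp (2 * l * h) * (2 * pi) * expo_ev l k y"
    unfolding expo_ev_def by (rule integral_mult_right_zero)
  also have "ev (\<nu> ^ k) (\<lambda>s. \<integral>z. expo l (s + (y - h) - z) * ?W z \<partial>lborel) \<le> (\<integral>z. K * ?W z \<partial>lborel)"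
    unfolding sw1
  proof (rule integral_mono)
    show "integrable lborel (\<lambda>z. ev (\<nu> ^ k) (\<lambda>s. expo l (s + (y - h - z))) * ?W z)" by (rule sw3)
    show "integrable lborel (\<lambda>z. K * ?W z)" using W(1) by (rule integrable_mult_right)
    show "ev (\<nu> ^ k) (\<lambda>s. expo l (s + (y - h - z))) * ?W z \<le> K * ?W z" for z
      using C[of "y - h - z"] W(2)[of z] unfolding expo_ev_def by (rule mult_right_mono)
  qed
  also have "(\<integral>z. K * ?W z \<partial>lborel) = K * (2 * pi - fejer_core T h)"
    by (simp only: integral_mult_right_zero smooth_tail_integral[OF l T])
  finally show ?thesis by simp
qed

lemma expo_ev_bound: "\<exists>C>0. \<forall>k\<ge>1. \<forall>y. expo_ev l k y \<le> C / sqrt (real k)"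
proof -
  \<comment> \<open>More than half of the total mass 2 pi lies in [-1, 1]; any positive share would
    give a bound of this order.\<close>
  have "\<forall>\<^sub>F T in at_top. 0 < T \<and> pi < fejer_core T 1"
    by (intro eventually_conj eventually_gt_at_top order_tendstoD(1)[OF fejer_core_tendsto]) (auto simp: pi_gt_zero)
  then obtain T where T: "0 < T" "pi < fejer_core T 1"
    by (auto simp: eventually_at_top_linorder)
  obtain C where C: "C > 0" "\<And>k y. 1 \<le> k \<Longrightarrow> smoothed l T k y \<le> C / sqrt (real k)"
    using smoothed_bound[OF T(1)] by auto
  define r where "r = exp (- 2 * l * 1) * fejer_core T 1"
  have r: "0 < r" unfolding r_def using T(2) pi_gt_zero by (intro mult_pos_pos) (simp, linarith)
  have "expo_ev l k y \<le> C / r / sqrt (real k)" if k: "1 \<le> k" for k y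
  proof -
    have "r * expo_ev l k y \<le> C / sqrt (real k)"
      using expo_ev_le_smoothed[OF T(1), of 1 k y] C(2)[OF k, of "y + 1"] unfolding r_def by simp
    then show ?thesis using r k by (simp add: field_simps)
  qed
  then show ?thesis using C(1) r by (intro exI[of _ "C / r"]) auto
qed

text \<open>A single parameter d controls all errors: the shift h satisfies
  \<open>exp (2 * l * h) = 1 + d\<close>, the kernel mass outside [-h, h] is below d, and the
  smoothed limit holds up to d; as d tends to 0 the two one-sided bounds meet. The limit is the
  centred Gaussian density at 0, \<open>1 / sqrt (2 * pi * s2)\<close>, times the integral
  \<open>1 / l\<close> of \<open>expo l\<close>.\<close>

theorem local_limit:
  assumes e: "0 < e"
  shows "\<exists>\<eta>>0. \<exists>N. \<forall>k\<ge>N. \<forall>y. \<bar>y\<bar> \<le> \<eta> * sqrt (real k) \<longrightarrow> \<bar>sqrt (real k) * expo_ev l k y - 1 / (l * sqrt (2 * pi * s2))\<bar> \<le> e"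
proof -
  obtain C where C: "C > 0" "\<And>k y. 1 \<le> k \<Longrightarrow> expo_ev l k y \<le> C / sqrt (real k)"
    using expo_ev_bound by auto
  define g0 where "g0 = sqrt (2 * pi / s2) / l"
  define c0 where "c0 = 1 / (l * sqrt (2 * pi * s2))"
  have g0: "g0 / (2 * pi) = c0"
  proof -
    have "sqrt (2 * pi / s2) * sqrt (2 * pi * s2) = sqrt ((2 * pi / s2) * (2 * pi * s2))" by (simp only: real_sqrt_mult)
    also have "(2 * pi / s2) * (2 * pi * s2) = (2 * pi)\<^sup>2" using s2_pos by (simp add: power2_eq_square)
    also have "sqrt ((2 * pi)\<^sup>2) = 2 * pi" by (rule real_sqrt_unique[OF refl]) simp
    finally have "sqrt (2 * pi / s2) * sqrt (2 * pi * s2) = 2 * pi" .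
    then show ?thesis using l s2_pos unfolding g0_def c0_def by (simp add: field_simps)
  qed
  have p0: "pi \<noteq> 0" using pi_gt_zero by linarith
  have lim1: "((\<lambda>d. (1 + d) / (2 * pi - d) * (g0 + d)) \<longlongrightarrow> (1 + 0) / (2 * pi - 0) * (g0 + 0)) (at_right 0)"
    using p0 by (intro tendsto_intros) auto
  have lim2: "((\<lambda>d. (g0 - d - C * d) / ((1 + d) * (2 * pi))) \<longlongrightarrow> (g0 - 0 - C * 0) / ((1 + 0) * (2 * pi))) (at_right 0)"
    using p0 by (intro tendsto_intros) auto
  have "\<forall>\<^sub>F d in at_right 0. (1 + d) / (2 * pi - d) * (g0 + d) < c0 + e \<and> c0 - e < (g0 - d - C * d) / ((1 + d) * (2 * pi)) \<and> 0 < d \<and> d < 1"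
  proof (intro eventually_conj)
    show "\<forall>\<^sub>F d in at_right 0. (1 + d) / (2 * pi - d) * (g0 + d) < c0 + e"
      by (rule order_tendstoD(2)[OF lim1]) (use g0 e in simp)
    show "\<forall>\<^sub>F d in at_right 0. c0 - e < (g0 - d - C * d) / ((1 + d) * (2 * pi))"
      by (rule order_tendstoD(1)[OF lim2]) (use g0 e in simp)
    show "\<forall>\<^sub>F d in at_right 0. (0::real) < d" by (simp add: eventually_at_right_less)
    show "\<forall>\<^sub>F d in at_right 0. d < (1::real)" by (rule eventually_at_right_real[THEN eventually_mono, of 0 1]) auto
  qed
  then obtain d where d: "(1 + d) / (2 * pi - d) * (g0 + d) < c0 + e" "c0 - e < (g0 - d - C * d) / ((1 + d) * (2 * pi))" "0 < d" "d < 1"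
    using eventually_happens[of _ "at_right (0::real)"] by auto
  define h where "h = ln (1 + d) / (2 * l)"
  have h: "0 < h" "exp (2 * l * h) = 1 + d" using d l by (auto simp: h_def)
  have "\<forall>\<^sub>F T in at_top. 0 < T \<and> 2 * pi - d < fejer_core T h"
    using d(3) h(1) by (intro eventually_conj eventually_gt_at_top order_tendstoD(1)[OF fejer_core_tendsto]) auto
  then obtain T where T: "0 < T" "2 * pi - d < fejer_core T h"
    by (auto simp: eventually_at_top_linorder)
  obtain \<eta> N where \<eta>: "\<eta> > 0" "\<And>k y. N \<le> k \<Longrightarrow> \<bar>y\<bar> \<le> \<eta> * sqrt (real k) \<Longrightarrow> \<bar>sqrt (real k) * smoothed l T k y - g0\<bar> \<le> d"
    using smoothed_limit[OF T(1) d(3)] unfolding g0_def by auto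
  \<comment> \<open>From here on h is at most \<open>\<eta> / 2 * sqrt (real k)\<close>, so
    \<open>y + h\<close> and \<open>y - h\<close> stay in the range of the smoothed limit.\<close>
  define N' where "N' = max (max 1 N) (nat \<lceil>(2 * h / \<eta>)\<^sup>2\<rceil>)"
  have "\<bar>sqrt (real k) * expo_ev l k y - c0\<bar> \<le> e" if k: "N' \<le> k" and y: "\<bar>y\<bar> \<le> \<eta> / 2 * sqrt (real k)" for k y
  proof -
    have k1: "1 \<le> k" "N \<le> k" using k by (auto simp: N'_def)
    have "(2 * h / \<eta>)\<^sup>2 \<le> real k" using k unfolding N'_def by linarith
    then have "2 * h / \<eta> \<le> sqrt (real k)" by (rule real_le_rsqrt)
    then have "h \<le> \<eta> / 2 * sqrt (real k)" using \<eta>(1) by (simp add: field_simps)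
    then have yh: "\<bar>y + h\<bar> \<le> \<eta> * sqrt (real k)" "\<bar>y - h\<bar> \<le> \<eta> * sqrt (real k)"
      using y h(1) by linarith+
    define S where "S = sqrt (real k)"
    have S: "0 < S" using k1 by (simp add: S_def)
    define E where "E = S * expo_ev l k y"
    have E0: "0 \<le> E" using expo_ev_nonneg[of k y] S by (simp add: E_def)
    have em: "exp (- 2 * l * h) = 1 / (1 + d)"
      using h(2) exp_minus[of "2 * l * h"] by (simp add: inverse_eq_divide)
    have "1 / (1 + d) * fejer_core T h * E \<le> S * smoothed l T k (y + h)"
      using mult_left_mono[OF expo_ev_le_smoothed[OF T(1), of h k y], of S] h(1) S unfolding em E_def
      by (simp add: ac_simps)
    also have "\<dots> \<le> g0 + d" using \<eta>(2)[OF k1(2) yh(1)] unfolding S_def by linarith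
    finally have "1 / (1 + d) * fejer_core T h * E \<le> g0 + d" .
    moreover have "1 / (1 + d) * (2 * pi - d) * E \<le> 1 / (1 + d) * fejer_core T h * E"
      using T(2) d E0 by (intro mult_right_mono mult_left_mono) auto
    ultimately have u: "1 / (1 + d) * (2 * pi - d) * E \<le> g0 + d" by linarith
    have pd: "0 < 2 * pi - d" using d pi_gt3 by linarith
    have up: "E \<le> (1 + d) / (2 * pi - d) * (g0 + d)" using u pd d(3) by (simp add: field_simps)
    have "g0 - d \<le> S * smoothed l T k (y - h)" using \<eta>(2)[OF k1(2) yh(2)] unfolding S_def by linarith
    also have "\<dots> \<le> S * (exp (2 * l * h) * (2 * pi) * expo_ev l k y + C / S * (2 * pi - fejer_core T h))"
      unfolding S_def using h(1) C(2)[OF k1(1)] by (intro mult_left_mono smoothed_le_expo_ev T) auto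
    also have "\<dots> = (1 + d) * (2 * pi) * E + C * (2 * pi - fejer_core T h)"
      unfolding h(2) E_def using S by (simp add: field_simps)
    also have "\<dots> \<le> (1 + d) * (2 * pi) * E + C * d" using T(2) C(1) by (intro add_left_mono mult_left_mono) auto
    finally have lo: "(g0 - d - C * d) / ((1 + d) * (2 * pi)) \<le> E"
    proof (subst pos_divide_le_eq)
      show "0 < (1 + d) * (2 * pi)" using d pi_gt_zero by (intro mult_pos_pos) auto
    qed (simp add: algebra_simps)
    show ?thesis using up lo d(1,2) unfolding abs_le_iff E_def S_def by linarith
  qed
  then show ?thesis using \<eta>(1) unfolding c0_def by (intro exI[of _ "\<eta> / 2"] conjI exI[of _ N']) auto
qed

end

end

section \<open>Random walks stopped on leaving a half-line\<close>

lemma walk_Suc: "walk X (Suc n) \<omega> = walk X n \<omega> + X (Suc n) \<omega>"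
  by (simp add: walk_def)

lemma walk_cong: "(\<And>i. 1 \<le> i \<Longrightarrow> i \<le> n \<Longrightarrow> X i \<omega> = Y i \<omega>') \<Longrightarrow> walk X n \<omega> = walk Y n \<omega>'"
  unfolding walk_def by (rule sum.cong) auto

definition staying :: "real set \<Rightarrow> (nat \<Rightarrow> 'a \<Rightarrow> real) \<Rightarrow> nat \<Rightarrow> 'a \<Rightarrow> bool" where
  "staying D X n \<omega> \<longleftrightarrow> (\<forall>k\<in>{1..n}. walk X k \<omega> \<in> D)"

lemma staying_Suc: "staying D X (Suc n) \<omega> \<longleftrightarrow> staying D X n \<omega> \<and> walk X (Suc n) \<omega> \<in> D"
  by (auto simp: staying_def atLeastAtMostSuc_conv)

lemma staying_cong: "(\<And>i. 1 \<le> i \<Longrightarrow> i \<le> n \<Longrightarrow> X i \<omega> = Y i \<omega>') \<Longrightarrow> staying D X n \<omega> \<longleftrightarrow> staying D Y n \<omega>'"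
  unfolding staying_def by (intro ball_cong refl arg_cong[of _ _ "\<lambda>x. x \<in> D"] walk_cong) auto

lemma measurable_walk [measurable]:
  assumes "\<And>i. 1 \<le> i \<Longrightarrow> i \<le> n \<Longrightarrow> X i \<in> borel_measurable M"
  shows "walk X n \<in> borel_measurable M"
  unfolding walk_def[abs_def] by (rule borel_measurable_sum) (use assms in auto)

lemma measurable_staying:
  assumes "\<And>i. 1 \<le> i \<Longrightarrow> i \<le> n \<Longrightarrow> X i \<in> borel_measurable M" "D \<in> sets borel"
  shows "Measurable.pred M (staying D X n)"
proof -
  have w: "walk X k \<in> borel_measurable M" if "k \<in> {1..n}" for k
    using that assms by (intro measurable_walk) auto
  have "Measurable.pred M (\<lambda>\<omega>. walk X k \<omega> \<in> D)" if "k \<in> {1..n}" for k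
    using w[OF that] assms(2) by measurable
  then show ?thesis unfolding staying_def[abs_def] by (intro pred_intros_finite) auto
qed

lemma coord_measurable_PiM [measurable (raw)]: "i \<in> I \<Longrightarrow> coord i \<in> borel_measurable (PiM I (\<lambda>_. mea \<mu>))"
  unfolding coord_def[abs_def] using measurable_component_singleton[of i I "\<lambda>_. mea \<mu>"] by simp

context
  fixes \<mu> :: fmeas assumes mass_mu: "mass \<mu> = 1"
begin

lemma emeasure_mu: "emeasure (mea \<mu>) UNIV = 1"
  using mass_mu finite_measure.emeasure_eq_measure[OF finite_mea, of \<mu> UNIV] by simp

lemma prob_space_mu: "prob_space (mea \<mu>)"
  using emeasure_mu by (intro prob_spaceI) simp

text \<open>The induction step shared by \<open>stay\<close> and \<open>leave\<close>: the last
  coordinate is integrated first, as the earlier positions and the event of staying do not depend on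
  it.\<close>

lemma nn_integral_PiM_step:
  assumes D [measurable]: "D \<in> sets borel" and F: "F \<in> borel_measurable borel"
    and IH: "\<And>f. f \<in> borel_measurable borel \<Longrightarrow>
      (\<integral>\<^sup>+x. f (walk coord n x) * indicator {x. staying D coord n x} x \<partial>PiM {1..n} (\<lambda>_. mea \<mu>)) = nni (stay \<mu> D n) f"
  shows "(\<integral>\<^sup>+x. F (walk coord (Suc n) x) * indicator {x. staying D coord n x} x \<partial>PiM {1..Suc n} (\<lambda>_. mea \<mu>)) = nni (stay \<mu> D n * \<mu>) F"
proof -
  interpret product_sigma_finite "\<lambda>_::nat. mea \<mu>" by (rule product_sigma_finite.intro) simp
  have [measurable]: "F \<in> borel_measurable borel" by (rule F)
  have I: "{1..Suc n} = insert (Suc n) {1..n}" by auto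
  have m1: "walk coord (Suc n) \<in> borel_measurable (PiM (insert (Suc n) {1..n}) (\<lambda>_. mea \<mu>))"
    by (rule measurable_walk) (auto intro!: coord_measurable_PiM)
  have m2: "Measurable.pred (PiM (insert (Suc n) {1..n}) (\<lambda>_. mea \<mu>)) (staying D coord n)"
    by (rule measurable_staying) (auto intro!: coord_measurable_PiM)
  have "(\<integral>\<^sup>+x. F (walk coord (Suc n) x) * indicator {x. staying D coord n x} x \<partial>PiM {1..Suc n} (\<lambda>_. mea \<mu>))
    = (\<integral>\<^sup>+x. \<integral>\<^sup>+y. F (walk coord (Suc n) (x(Suc n := y))) * indicator {x. staying D coord n x} (x(Suc n := y)) \<partial>mea \<mu> \<partial>PiM {1..n} (\<lambda>_. mea \<mu>))"
    unfolding I
  proof (rule product_nn_integral_insert)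
    note [measurable] = m1 m2
    show "(\<lambda>x. F (walk coord (Suc n) x) * indicator {x. staying D coord n x} x) \<in> borel_measurable (PiM (insert (Suc n) {1..n}) (\<lambda>_. mea \<mu>))"
      unfolding indicator_def mem_Collect_eq by measurable
  qed auto
  also have "\<dots> = (\<integral>\<^sup>+x. nni \<mu> (\<lambda>y. F (walk coord n x + y)) * indicator {x. staying D coord n x} x \<partial>PiM {1..n} (\<lambda>_. mea \<mu>))"
  proof (rule nn_integral_cong)
    fix x
    have w: "walk coord n (x(Suc n := y)) = walk coord n x" for y
      by (rule walk_cong) (auto simp: coord_def)
    have s: "staying D coord n (x(Suc n := y)) = staying D coord n x" for y
      by (rule staying_cong) (auto simp: coord_def)
    have "(\<integral>\<^sup>+y. F (walk coord (Suc n) (x(Suc n := y))) * indicator {x. staying D coord n x} (x(Suc n := y)) \<partial>mea \<mu>)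
      = (\<integral>\<^sup>+y. F (walk coord n x + y) * indicator {x. staying D coord n x} x \<partial>mea \<mu>)"
      by (simp add: walk_Suc w s coord_def indicator_def)
    also have "\<dots> = nni \<mu> (\<lambda>y. F (walk coord n x + y)) * indicator {x. staying D coord n x} x"
      by (rule nn_integral_multc) simp
    finally show "(\<integral>\<^sup>+y. F (walk coord (Suc n) (x(Suc n := y))) * indicator {x. staying D coord n x} (x(Suc n := y)) \<partial>mea \<mu>)
      = nni \<mu> (\<lambda>y. F (walk coord n x + y)) * indicator {x. staying D coord n x} x" .
  qed
  also have "\<dots> = nni (stay \<mu> D n) (\<lambda>a. nni \<mu> (\<lambda>y. F (a + y)))"
    by (rule IH) measurable
  also have "\<dots> = nni (stay \<mu> D n * \<mu>) F"
    by (rule nni_times[symmetric]) measurable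
  finally show ?thesis .
qed

lemma nn_integral_PiM_stay:
  assumes D [measurable]: "D \<in> sets borel" and f: "f \<in> borel_measurable borel"
  shows "(\<integral>\<^sup>+x. f (walk coord n x) * indicator {x. staying D coord n x} x \<partial>PiM {1..n} (\<lambda>_. mea \<mu>)) = nni (stay \<mu> D n) f"
  using f
proof (induction n arbitrary: f)
  case 0
  interpret P: prob_space "PiM {1..0::nat} (\<lambda>_. mea \<mu>)" by (rule prob_space_PiM) (rule prob_space_mu)
  show ?case using P.emeasure_space_1 0 by (simp add: walk_def staying_def)
next
  case (Suc n)
  have [measurable]: "f \<in> borel_measurable borel" by (rule Suc.prems)
  have "(\<integral>\<^sup>+x. f (walk coord (Suc n) x) * indicator {x. staying D coord (Suc n) x} x \<partial>PiM {1..Suc n} (\<lambda>_. mea \<mu>))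
    = (\<integral>\<^sup>+x. (\<lambda>y. indicator D y * f y) (walk coord (Suc n) x) * indicator {x. staying D coord n x} x \<partial>PiM {1..Suc n} (\<lambda>_. mea \<mu>))"
    by (intro nn_integral_cong) (auto simp: staying_Suc indicator_def)
  also have "\<dots> = nni (stay \<mu> D n * \<mu>) (\<lambda>y. indicator D y * f y)"
    by (rule nn_integral_PiM_step[OF D _ Suc.IH]) measurable
  also have "\<dots> = nni (stay \<mu> D (Suc n)) f"
    by (simp add: nni_restr)
  finally show ?case .
qed

lemma nn_integral_PiM_leave:
  assumes D [measurable]: "D \<in> sets borel" and f [measurable]: "f \<in> borel_measurable borel"
  shows "(\<integral>\<^sup>+x. f (walk coord (Suc n) x) * indicator {x. staying D coord n x \<and> walk coord (Suc n) x \<notin> D} x \<partial>PiM {1..Suc n} (\<lambda>_. mea \<mu>))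
    = nni (leave \<mu> D (Suc n)) f"
proof -
  have "(\<integral>\<^sup>+x. f (walk coord (Suc n) x) * indicator {x. staying D coord n x \<and> walk coord (Suc n) x \<notin> D} x \<partial>PiM {1..Suc n} (\<lambda>_. mea \<mu>))
    = (\<integral>\<^sup>+x. (\<lambda>y. indicator (- D) y * f y) (walk coord (Suc n) x) * indicator {x. staying D coord n x} x \<partial>PiM {1..Suc n} (\<lambda>_. mea \<mu>))"
    by (intro nn_integral_cong) (auto simp: indicator_def)
  also have "\<dots> = nni (stay \<mu> D n * \<mu>) (\<lambda>y. indicator (- D) y * f y)"
    by (rule nn_integral_PiM_step[OF D _ nn_integral_PiM_stay[OF D]]) measurable
  also have "\<dots> = nni (leave \<mu> D (Suc n)) f"
    by (simp add: nni_restr)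
  finally show ?thesis .
qed

end

text \<open>Phrased by finite-dimensional laws, so that it covers both the given sequence on its own
  space and the coordinate process under the tilted product measure.\<close>

locale iid_walk = prob_space M for M :: "'a measure" +
  fixes X :: "nat \<Rightarrow> 'a \<Rightarrow> real" and \<mu> :: fmeas
  assumes X_meas: "\<And>i. 1 \<le> i \<Longrightarrow> X i \<in> borel_measurable M"
    and joint: "\<And>n. distr M (PiM {1..n} (\<lambda>_. borel)) (\<lambda>\<omega>. \<lambda>i\<in>{1..n}. X i \<omega>) = PiM {1..n} (\<lambda>_. mea \<mu>)"
    and mass_mu: "mass \<mu> = 1"
begin

lemma nn_integral_joint:
  assumes "F \<in> borel_measurable (PiM {1..n} (\<lambda>_. borel))"
  shows "(\<integral>\<^sup>+\<omega>. F (\<lambda>i\<in>{1..n}. X i \<omega>) \<partial>M) = (\<integral>\<^sup>+x. F x \<partial>PiM {1..n} (\<lambda>_. mea \<mu>))"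
  unfolding joint[symmetric]
  by (subst nn_integral_distr) (use assms X_meas in \<open>auto intro!: measurable_restrict\<close>)

lemma coord_measurable: "i \<in> I \<Longrightarrow> coord i \<in> borel_measurable (PiM I (\<lambda>_. borel))"
  unfolding coord_def[abs_def] by (rule measurable_component_singleton)

lemma walk_restrict: "k \<le> n \<Longrightarrow> walk coord k (\<lambda>i\<in>{1..n}. X i \<omega>) = walk X k \<omega>"
  by (rule walk_cong) (auto simp: coord_def)

lemma staying_restrict: "k \<le> n \<Longrightarrow> staying D coord k (\<lambda>i\<in>{1..n}. X i \<omega>) = staying D X k \<omega>"
  by (rule staying_cong) (auto simp: coord_def)

lemma nn_integral_stay:
  assumes D [measurable]: "D \<in> sets borel" and f [measurable]: "f \<in> borel_measurable borel"
  shows "(\<integral>\<^sup>+\<omega>. f (walk X n \<omega>) * indicator {\<omega>. staying D X n \<omega>} \<omega> \<partial>M) = nni (stay \<mu> D n) f"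
proof -
  have [measurable]: "walk coord n \<in> borel_measurable (PiM {1..n} (\<lambda>_. borel))" "Measurable.pred (PiM {1..n} (\<lambda>_. borel)) (staying D coord n)"
    by (auto intro!: measurable_walk measurable_staying coord_measurable)
  have "(\<integral>\<^sup>+\<omega>. f (walk X n \<omega>) * indicator {\<omega>. staying D X n \<omega>} \<omega> \<partial>M)
    = (\<integral>\<^sup>+\<omega>. (\<lambda>x. f (walk coord n x) * indicator {x. staying D coord n x} x) (\<lambda>i\<in>{1..n}. X i \<omega>) \<partial>M)"
    by (simp only: walk_restrict[OF order_refl] staying_restrict[OF order_refl] indicator_def mem_Collect_eq)
  also have "\<dots> = (\<integral>\<^sup>+x. f (walk coord n x) * indicator {x. staying D coord n x} x \<partial>PiM {1..n} (\<lambda>_. mea \<mu>))"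
    by (rule nn_integral_joint) (unfold indicator_def mem_Collect_eq, measurable)
  also have "\<dots> = nni (stay \<mu> D n) f" by (rule nn_integral_PiM_stay[OF mass_mu D f])
  finally show ?thesis .
qed

lemma nn_integral_leave:
  assumes D [measurable]: "D \<in> sets borel" and f [measurable]: "f \<in> borel_measurable borel"
  shows "(\<integral>\<^sup>+\<omega>. f (walk X (Suc n) \<omega>) * indicator {\<omega>. staying D X n \<omega> \<and> walk X (Suc n) \<omega> \<notin> D} \<omega> \<partial>M) = nni (leave \<mu> D (Suc n)) f"
proof -
  have [measurable]: "walk coord (Suc n) \<in> borel_measurable (PiM {1..Suc n} (\<lambda>_. borel))" "Measurable.pred (PiM {1..Suc n} (\<lambda>_. borel)) (staying D coord n)"
    by (auto intro!: measurable_walk measurable_staying coord_measurable)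
  have "(\<integral>\<^sup>+\<omega>. f (walk X (Suc n) \<omega>) * indicator {\<omega>. staying D X n \<omega> \<and> walk X (Suc n) \<omega> \<notin> D} \<omega> \<partial>M)
    = (\<integral>\<^sup>+\<omega>. (\<lambda>x. f (walk coord (Suc n) x) * indicator {x. staying D coord n x \<and> walk coord (Suc n) x \<notin> D} x) (\<lambda>i\<in>{1..Suc n}. X i \<omega>) \<partial>M)"
    by (simp only: walk_restrict[OF order_refl] staying_restrict[OF le_SucI[OF order_refl]] indicator_def mem_Collect_eq)
  also have "\<dots> = (\<integral>\<^sup>+x. f (walk coord (Suc n) x) * indicator {x. staying D coord n x \<and> walk coord (Suc n) x \<notin> D} x \<partial>PiM {1..Suc n} (\<lambda>_. mea \<mu>))"
    by (rule nn_integral_joint) (unfold indicator_def mem_Collect_eq, measurable)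
  also have "\<dots> = nni (leave \<mu> D (Suc n)) f" by (rule nn_integral_PiM_leave[OF mass_mu D f])
  finally show ?thesis .
qed

end

section \<open>Exit times and stopped values\<close>

lemma exit_time_eq:
  assumes "1 \<le> k" "x + S k \<omega> < 0" "\<And>j. 1 \<le> j \<Longrightarrow> j < k \<Longrightarrow> \<not> x + S j \<omega> < 0"
  shows "exit_time S x \<omega> = enat k"
  unfolding exit_time_def
proof (rule antisym)
  show "Inf (enat ` {k. 1 \<le> k \<and> x + S k \<omega> < 0}) \<le> enat k"
    using assms(1,2) by (intro Inf_lower) auto
  show "enat k \<le> Inf (enat ` {k. 1 \<le> k \<and> x + S k \<omega> < 0})"
  proof (rule Inf_greatest)
    fix y assume "y \<in> enat ` {k. 1 \<le> k \<and> x + S k \<omega> < 0}"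
    then obtain j where j: "y = enat j" "1 \<le> j" "x + S j \<omega> < 0" by auto
    then have "\<not> j < k" using assms(3)[of j] by auto
    then show "enat k \<le> y" using j(1) by simp
  qed
qed

lemma exit_time_infinity:
  assumes "\<And>j. 1 \<le> j \<Longrightarrow> \<not> x + S j \<omega> < 0"
  shows "exit_time S x \<omega> = \<infinity>"
proof -
  have "{k. k \<ge> 1 \<and> x + S k \<omega> < 0} = {}" using assms by auto
  then show ?thesis by (simp only: exit_time_def image_empty) (simp add: Inf_enat_def)
qed

lemma exit_time_cases:
  obtains (never) "\<And>j. 1 \<le> j \<Longrightarrow> \<not> x + S j \<omega> < 0" "exit_time S x \<omega> = \<infinity>"
  | (at) m where "x + S (Suc m) \<omega> < 0" "\<And>j. 1 \<le> j \<Longrightarrow> j \<le> m \<Longrightarrow> \<not> x + S j \<omega> < 0" "exit_time S x \<omega> = enat (Suc m)"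
proof (cases "\<exists>k\<ge>1. x + S k \<omega> < 0")
  case False
  then show ?thesis using exit_time_infinity[of x S \<omega>] never by blast
next
  case True
  define k where "k = (LEAST k. 1 \<le> k \<and> x + S k \<omega> < 0)"
  have k: "1 \<le> k" "x + S k \<omega> < 0"
    using LeastI_ex[of "\<lambda>k. 1 \<le> k \<and> x + S k \<omega> < 0"] True unfolding k_def by auto
  have k2: "\<not> x + S j \<omega> < 0" if "1 \<le> j" "j < k" for j
    using not_less_Least[of j "\<lambda>k. 1 \<le> k \<and> x + S k \<omega> < 0"] that unfolding k_def by blast
  obtain m where m: "k = Suc m" using k(1) by (cases k) auto
  show ?thesis
    using exit_time_eq[of k x S \<omega>] k k2 m by (intro at[of m]) auto
qed

lemma exit_time_gt_iff: "exit_time S x \<omega> > enat n \<longleftrightarrow> (\<forall>k\<in>{1..n}. \<not> x + S k \<omega> < 0)"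
proof (cases rule: exit_time_cases[of x S \<omega>])
  case (at m)
  show ?thesis
  proof (cases "n \<le> m")
    case True
    then show ?thesis using at by auto
  next
    case False
    then have "Suc m \<in> {1..n}" by auto
    then show ?thesis using at False by auto
  qed
qed auto

context iid_walk
begin

lemma ennreal_stopped_value:
  assumes e: "e = 1 \<or> e = -1" and S: "S = (\<lambda>k \<omega>. e * walk X k \<omega>)" and D: "D = {y. 0 \<le> x + e * y}"
  shows "ennreal \<bar>stopped_value S (exit_time S x) \<omega>\<bar>
    = (\<Sum>n. ennreal \<bar>walk X (Suc n) \<omega>\<bar> * indicator {\<omega>. staying D X n \<omega> \<and> walk X (Suc n) \<omega> \<notin> D} \<omega>)"
proof (cases rule: exit_time_cases[of x S \<omega>])
  case never
  then have "walk X (Suc n) \<omega> \<in> D" for n by (auto simp: D S not_less)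
  then have "indicator {\<omega>. staying D X n \<omega> \<and> walk X (Suc n) \<omega> \<notin> D} \<omega> = (0::ennreal)" for n by simp
  then show ?thesis using never(2) by (simp only: mult_zero_right stopped_value_def enat.case) simp
next
  case (at m)
  let ?t = "\<lambda>n. ennreal \<bar>walk X (Suc n) \<omega>\<bar> * indicator {\<omega>. staying D X n \<omega> \<and> walk X (Suc n) \<omega> \<notin> D} \<omega>"
  have inD: "walk X j \<omega> \<in> D" if "1 \<le> j" "j \<le> m" for j using at(2)[OF that] by (simp add: D S not_less)
  have out: "walk X (Suc m) \<omega> \<notin> D" using at(1) by (simp add: D S)
  have "?t n = 0" if "n \<noteq> m" for n
  proof (cases "n < m")
    case True
    then have "walk X (Suc n) \<omega> \<in> D" by (intro inD) auto
    then show ?thesis by simp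
  next
    case False
    then have "\<not> staying D X n \<omega>" using that out by (auto simp: staying_def intro!: bexI[of _ "Suc m"])
    then show ?thesis by simp
  qed
  then have "(\<Sum>n. ?t n) = (\<Sum>n\<in>{m}. ?t n)" by (intro suminf_finite) auto
  also have "\<dots> = ennreal \<bar>walk X (Suc m) \<omega>\<bar>"
    using inD out by (simp add: staying_def)
  finally show ?thesis using at(3) e by (auto simp: stopped_value_def S)
qed

lemma stopped_value_nonpos:
  assumes "0 \<le> x" shows "stopped_value S (exit_time S x) \<omega> \<le> 0"
  using assms by (cases rule: exit_time_cases[of x S \<omega>]) (auto simp: stopped_value_def)

text \<open>The stopped value is nonpositive, so its integral is that of an absolute value, which
  splits over the exit time into moments of \<open>leave\<close>. The sign \<open>e\<close> treats
  the walk and its dual together. Integrability is not presupposed: if the moments diverge, both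
  sides are 0 by convention.\<close>

lemma integral_stopped_value:
  assumes e: "e = 1 \<or> e = -1" and S: "S = (\<lambda>k \<omega>. e * walk X k \<omega>)" and D: "D = {y. 0 \<le> x + e * y}"
    and x: "0 \<le> x"
  shows "- (\<integral>\<omega>. stopped_value S (exit_time S x) \<omega> \<partial>M) = enn2real (\<Sum>n. nni (leave \<mu> D n) (\<lambda>y. ennreal \<bar>y\<bar>))"
proof -
  let ?Y = "stopped_value S (exit_time S x)"
  let ?t = "\<lambda>n \<omega>. ennreal \<bar>walk X (Suc n) \<omega>\<bar> * indicator {\<omega>. staying D X n \<omega> \<and> walk X (Suc n) \<omega> \<notin> D} \<omega>"
  have Db [measurable]: "D \<in> sets borel" unfolding D by measurable
  have tm [measurable]: "?t n \<in> borel_measurable M" for n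
  proof -
    have [measurable]: "walk X (Suc n) \<in> borel_measurable M" "Measurable.pred M (staying D X n)"
      by (auto intro!: measurable_walk measurable_staying X_meas)
    show ?thesis unfolding indicator_def mem_Collect_eq by measurable
  qed
  have abs: "ennreal \<bar>?Y \<omega>\<bar> = (\<Sum>n. ?t n \<omega>)" for \<omega> by (rule ennreal_stopped_value[OF e S D])
  have Y: "?Y = (\<lambda>\<omega>. - enn2real (\<Sum>n. ?t n \<omega>))"
  proof
    fix \<omega>
    have "enn2real (\<Sum>n. ?t n \<omega>) = \<bar>?Y \<omega>\<bar>" unfolding abs[symmetric] by simp
    then show "?Y \<omega> = - enn2real (\<Sum>n. ?t n \<omega>)" using stopped_value_nonpos[OF x, of S \<omega>] by simp
  qed
  have Ym: "?Y \<in> borel_measurable M" unfolding Y by measurable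
  have "- (\<integral>\<omega>. ?Y \<omega> \<partial>M) = (\<integral>\<omega>. \<bar>?Y \<omega>\<bar> \<partial>M)"
    using stopped_value_nonpos[OF x, of S] by (simp add: abs_of_nonpos)
  also have "\<dots> = enn2real (\<integral>\<^sup>+\<omega>. ennreal \<bar>?Y \<omega>\<bar> \<partial>M)"
    by (rule integral_eq_nn_integral) (use Ym in auto)
  also have "(\<integral>\<^sup>+\<omega>. ennreal \<bar>?Y \<omega>\<bar> \<partial>M) = (\<Sum>n. \<integral>\<^sup>+\<omega>. ?t n \<omega> \<partial>M)"
    unfolding abs by (rule nn_integral_suminf) measurable
  also have "\<dots> = (\<Sum>n. nni (leave \<mu> D (Suc n)) (\<lambda>y. ennreal \<bar>y\<bar>))"
    by (intro suminf_cong nn_integral_leave Db) simp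
  also have "\<dots> = (\<Sum>n. nni (leave \<mu> D n) (\<lambda>y. ennreal \<bar>y\<bar>))"
    using suminf_offset[of "\<lambda>n. nni (leave \<mu> D n) (\<lambda>y. ennreal \<bar>y\<bar>)" 1] by (simp del: leave.simps(2))
  finally show ?thesis .
qed

lemma measure_exit_time_gt:
  assumes S: "S = walk X" and D: "D = {y. 0 \<le> x + y}"
  shows "measure M {\<omega> \<in> space M. exit_time S x \<omega> > enat n} = mass (stay \<mu> D n)"
proof -
  have Db [measurable]: "D \<in> sets borel" unfolding D by measurable
  have [measurable]: "Measurable.pred M (staying D X n)"
    by (auto intro!: measurable_staying X_meas)
  have eq: "{\<omega> \<in> space M. exit_time S x \<omega> > enat n} = {\<omega> \<in> space M. staying D X n \<omega>}"
    by (auto simp: exit_time_gt_iff staying_def S D not_less)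
  have "emeasure M {\<omega> \<in> space M. staying D X n \<omega>} = (\<integral>\<^sup>+\<omega>. 1 * indicator {\<omega>. staying D X n \<omega>} \<omega> \<partial>M)"
    by (simp add: nn_integral_indicator'[symmetric] flip: nn_integral_indicator) (intro nn_integral_cong, simp add: indicator_def)
  also have "\<dots> = nni (stay \<mu> D n) (\<lambda>_. 1)"
    using nn_integral_stay[OF Db, of "\<lambda>_. 1" n] by simp
  finally have "emeasure M {\<omega> \<in> space M. staying D X n \<omega>} = emeasure (mea (stay \<mu> D n)) UNIV" by simp
  then show ?thesis unfolding eq measure_def by simp
qed

end

lemma iid_walk_indep_vars:
  assumes "prob_space M" "prob_space.indep_vars M (\<lambda>_. borel) X {1..}"
    and "\<And>i. i \<ge> 1 \<Longrightarrow> distr M borel (X i) = mea \<mu>" "mass \<mu> = 1"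
  shows "iid_walk M X \<mu>"
proof -
  interpret prob_space M by fact
  have rv: "X i \<in> borel_measurable M" if "1 \<le> i" for i
    using assms(2) that unfolding indep_vars_def by auto
  show ?thesis
  proof
    fix n
    show "distr M (PiM {1..n} (\<lambda>_. borel)) (\<lambda>\<omega>. \<lambda>i\<in>{1..n}. X i \<omega>) = PiM {1..n} (\<lambda>_. mea \<mu>)"
    proof (cases "n = 0")
      \<comment> \<open>The characterisation of independence by product laws is applied to nonempty
        index sets; over the empty set both measures are the point mass at the undefined
        function.\<close>
      case True
      have "distr M (PiM {} (\<lambda>_::nat. borel :: real measure)) (\<lambda>\<omega>. \<lambda>_. undefined) = PiM {} (\<lambda>_. mea \<mu>)"
      proof (rule measure_eqI)
        show "sets (distr M (PiM {} (\<lambda>_::nat. borel :: real measure)) (\<lambda>\<omega>. \<lambda>_. undefined)) = sets (PiM {} (\<lambda>_. mea \<mu>))"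
          by (simp add: sets_PiM_empty)
        fix E assume "E \<in> sets (distr M (PiM {} (\<lambda>_::nat. borel :: real measure)) (\<lambda>\<omega>. \<lambda>_. undefined))"
        then have "E = {} \<or> E = {\<lambda>_. undefined}" by (auto simp: sets_PiM_empty)
        then show "emeasure (distr M (PiM {} (\<lambda>_::nat. borel :: real measure)) (\<lambda>\<omega>. \<lambda>_. undefined)) E = emeasure (PiM {} (\<lambda>_. mea \<mu>)) E"
        proof
          assume "E = {\<lambda>_. undefined}"
          then show ?thesis
            by (subst emeasure_distr) (auto simp: sets_PiM_empty emeasure_space_1 PiM_empty measurable_def space_PiM)
        qed simp
      qed
      then show ?thesis using True by (simp add: restrict_def)
    next
      case False
      have "indep_vars (\<lambda>_. borel) X {1..n}" by (rule indep_vars_subset[OF assms(2)]) auto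
      then have "distr M (PiM {1..n} (\<lambda>_. borel)) (\<lambda>\<omega>. \<lambda>i\<in>{1..n}. X i \<omega>) = PiM {1..n} (\<lambda>i. distr M borel (X i))"
        using False rv by (subst indep_vars_iff_distr_eq_PiM'[symmetric]) auto
      also have "\<dots> = PiM {1..n} (\<lambda>_. mea \<mu>)" by (rule PiM_cong) (use assms(3) in auto)
      finally show ?thesis .
    qed
  qed (use rv assms(4) in auto)
qed

lemma iid_walk_coord:
  assumes "mass \<mu> = 1"
  shows "iid_walk (PiM {1..} (\<lambda>_. mea \<mu>)) coord \<mu>"
proof -
  have ps: "prob_space (mea \<mu>)" by (rule prob_space_mu[OF assms])
  interpret P: product_prob_space "\<lambda>_::nat. mea \<mu>" "{1..}"
    by (intro product_prob_space.intro product_sigma_finite.intro product_prob_space_axioms.intro) (simp_all add: ps)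
  show ?thesis
  proof
    fix n
    have eq: "(\<lambda>\<omega>. \<lambda>i\<in>{1..n}. coord i \<omega>) = (\<lambda>x. restrict x {1..n})"
      by (auto simp: coord_def)
    have "distr (PiM {1..} (\<lambda>_. mea \<mu>)) (PiM {1..n} (\<lambda>_. borel)) (\<lambda>x. restrict x {1..n})
      = distr (PiM {1..} (\<lambda>_. mea \<mu>)) (PiM {1..n} (\<lambda>_. mea \<mu>)) (\<lambda>x. restrict x {1..n})"
      by (rule distr_cong[OF refl sets_PiM_cong]) auto
    also have "\<dots> = PiM {1..n} (\<lambda>_. mea \<mu>)" by (rule P.distr_PiM_restrict_finite) auto
    finally show "distr (PiM {1..} (\<lambda>_. mea \<mu>)) (PiM {1..n} (\<lambda>_. borel)) (\<lambda>\<omega>. \<lambda>i\<in>{1..n}. coord i \<omega>) = PiM {1..n} (\<lambda>_. mea \<mu>)"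
      unfolding eq .
  qed (auto intro!: coord_measurable_PiM simp: assms)
qed

section \<open>Ladder heights of the walk\<close>

lemma half_split_nonneg: "half_split {0..} {..<0::real}"
  by unfold_locales auto

lemma tendsto_suminf_dominated:
  fixes f :: "nat \<Rightarrow> nat \<Rightarrow> real"
  assumes lim: "\<And>i. (\<lambda>n. f n i) \<longlonglongrightarrow> g i" and bd: "\<And>n i. \<bar>f n i\<bar> \<le> h i" and h: "summable h"
  shows "(\<lambda>n. \<Sum>i. f n i) \<longlonglongrightarrow> (\<Sum>i. g i)"
  by (rule tannerys_theorem[of "\<lambda>i n. f n i" g sequentially h, THEN conjunct2, THEN conjunct2])
     (use assms in \<open>auto intro!: always_eventually\<close>)

definition abs_moment :: "fmeas \<Rightarrow> real" where
  "abs_moment E = enn2real (nni E (\<lambda>y. ennreal \<bar>y\<bar>))"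

lemma abs_moment_nonneg [simp]: "0 \<le> abs_moment E"
  by (simp add: abs_moment_def)

lemma integrable_abs_iff: "integrable (mea E) (\<lambda>y. y) \<longleftrightarrow> nni E (\<lambda>y. ennreal \<bar>y\<bar>) \<noteq> \<infinity>"
  by (simp add: integrable_iff_bounded top.not_eq_extremum)

lemma abs_moment_eq: "abs_moment E = ev E (\<lambda>y. \<bar>y\<bar>)"
  unfolding abs_moment_def by (rule integral_eq_nn_integral[symmetric]) auto

lemma ennreal_abs_moment: "nni E (\<lambda>y. ennreal \<bar>y\<bar>) \<noteq> \<infinity> \<Longrightarrow> ennreal (abs_moment E) = nni E (\<lambda>y. ennreal \<bar>y\<bar>)"
  unfolding abs_moment_def by (simp add: less_top)

context walk_law
begin

text \<open>An interval of length x is covered by at most x + 1 unit intervals, and on a unit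
  interval \<open>exp 1\<close> times the exponential started at its left end is at least 1. So
  \<open>expo_ev_bound\<close> with parameter 1 suffices.\<close>

lemma interval_conc: "\<exists>C>0. \<forall>k\<ge>1. \<forall>x\<ge>0. \<forall>a. ev (\<nu> ^ k) (indicator {a..a + x}) \<le> C * (1 + x) / sqrt (real k)"
proof -
  obtain C where C: "C > 0" "\<And>k y. 1 \<le> k \<Longrightarrow> expo_ev 1 k y \<le> C / sqrt (real k)"
    using expo_ev_bound[of 1] by auto
  have "ev (\<nu> ^ k) (indicator {a..a + x}) \<le> exp 1 * C * (1 + x) / sqrt (real k)" if k: "1 \<le> k" and x: "0 \<le> x" for k x a
  proof -
    define m where "m = nat \<lfloor>x\<rfloor>"
    have nb: "nonneg_bounded (\<lambda>s. expo 1 (s + y))" for y by (rule nonneg_bounded_expo_shift) simp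
    have nbs: "nonneg_bounded (\<lambda>s. \<Sum>i\<le>m. expo 1 (s + (- a - real i)))" for m
    proof (induction m)
      case 0
      then show ?case using nb[of "- a"] by simp
    next
      case (Suc m)
      then show ?case unfolding sum.atMost_Suc by (rule nonneg_bounded_add[OF _ nb])
    qed
    have "ev (\<nu> ^ k) (indicator {a..a + x}) \<le> ev (\<nu> ^ k) (\<lambda>s. exp 1 * (\<Sum>i\<le>m. expo 1 (s + (- a - real i))))"
    proof (rule ev_mono)
      show "nonneg_bounded (\<lambda>s. exp 1 * (\<Sum>i\<le>m. expo 1 (s + (- a - real i))))"
        by (rule nonneg_bounded_mult[OF nonneg_bounded_const nbs]) simp
      fix s
      show "indicator {a..a + x} s \<le> exp 1 * (\<Sum>i\<le>m. expo 1 (s + (- a - real i)))"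
      proof (cases "s \<in> {a..a + x}")
        case True
        define i where "i = nat \<lfloor>s - a\<rfloor>"
        have i: "i \<le> m" "real i \<le> s - a" "s - a < real i + 1"
          using True by (auto simp: i_def m_def intro!: nat_mono floor_mono)
        have "1 \<le> exp 1 * expo 1 (s + (- a - real i))"
          using i by (simp add: expo_eq flip: exp_add)
        also have "\<dots> \<le> exp 1 * (\<Sum>i\<le>m. expo 1 (s + (- a - real i)))"
          using i(1) by (intro mult_left_mono member_le_sum) auto
        finally show ?thesis using True by simp
      qed (simp add: sum_nonneg)
    qed simp
    also have "\<dots> = exp 1 * (\<Sum>i\<le>m. expo_ev 1 k (- a - real i))"
      unfolding expo_ev_def
      by (simp add: Bochner_Integration.integral_sum nonneg_bounded_integrable[OF nb])
    also have "\<dots> \<le> exp 1 * (\<Sum>i\<le>m. C / sqrt (real k))"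
      by (intro mult_left_mono sum_mono C(2) k) auto
    also have "\<dots> = exp 1 * C * (1 + real m) / sqrt (real k)" by (simp add: algebra_simps add_divide_distrib)
    also have "\<dots> \<le> exp 1 * C * (1 + x) / sqrt (real k)"
      using C(1) x by (intro divide_right_mono mult_left_mono) (auto simp: m_def)
    finally show ?thesis .
  qed
  then show ?thesis using C(1) by (intro exI[of _ "exp 1 * C"]) auto
qed

text \<open>Chosen by \<open>SOME\<close> because the two sublocale declarations below need a fixed
  term for the constant.\<close>

definition conc_const :: real where
  "conc_const = (SOME C. C > 0 \<and> (\<forall>k\<ge>1. \<forall>x\<ge>0. \<forall>a. ev (\<nu> ^ k) (indicator {a..a + x}) \<le> C * (1 + x) / sqrt (real k)))"

lemma conc_const: "conc_const > 0 \<and> (\<forall>k\<ge>1. \<forall>x\<ge>0. \<forall>a. ev (\<nu> ^ k) (indicator {a..a + x}) \<le> conc_const * (1 + x) / sqrt (real k))"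
  unfolding conc_const_def by (rule someI_ex) (use interval_conc in blast)

text \<open>\<open>asc\<close> follows the walk while it stays nonnegative, so its exit heights are
  the strict descending ladder heights; the exits in \<open>desc\<close> are the weak ascending
  ones.\<close>

sublocale asc: ladder "{0..}" "{..<0}" \<nu> 1 conc_const
proof -
  interpret half_split "{0..}" "{..<0::real}" by (rule half_split_nonneg)
  show "ladder {0..} {..<0} \<nu> 1 conc_const"
    by unfold_locales (use sq_int mean0 sq_pos conc_const in auto)
qed

sublocale desc: ladder "{..<0}" "{0..}" \<nu> "-1" conc_const
proof -
  interpret half_split "{..<0::real}" "{0..}" by (rule half_split.swap[OF half_split_nonneg])
  show "ladder {..<0} {0..} \<nu> (-1) conc_const"
    by unfold_locales (use sq_int mean0 sq_pos conc_const in auto)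
qed

end

section \<open>Mean exit heights and their transforms near the origin\<close>

context ladder
begin

lemma leave_moment_finite: "nni (leave \<nu> A n) (\<lambda>y. ennreal \<bar>y\<bar>) \<noteq> \<infinity>"
proof -
  obtain C where C: "\<And>n. (\<Sum>k\<le>n. nni (leave \<nu> A k) (\<lambda>y. ennreal \<bar>y\<bar>)) \<le> ennreal C" using sum_nni_leave_le by auto
  have "nni (leave \<nu> A n) (\<lambda>y. ennreal \<bar>y\<bar>) \<le> (\<Sum>k\<le>n. nni (leave \<nu> A k) (\<lambda>y. ennreal \<bar>y\<bar>))"
    by (rule member_le_sum) auto
  also note C[of n]
  finally show ?thesis by (auto simp: top_unique)
qed

lemma leave_moment_summable: "summable (\<lambda>n. abs_moment (leave \<nu> A n))"
proof -
  obtain C where C: "0 < C" "\<And>n. (\<Sum>k\<le>n. nni (leave \<nu> A k) (\<lambda>y. ennreal \<bar>y\<bar>)) \<le> ennreal C" using sum_nni_leave_le by auto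
  have "(\<Sum>k\<le>n. abs_moment (leave \<nu> A k)) \<le> C" for n
  proof -
    have "ennreal (\<Sum>k\<le>n. abs_moment (leave \<nu> A k)) = (\<Sum>k\<le>n. nni (leave \<nu> A k) (\<lambda>y. ennreal \<bar>y\<bar>))"
      using leave_moment_finite by (simp add: ennreal_abs_moment flip: sum_ennreal)
    with C(2)[of n] have "ennreal (\<Sum>k\<le>n. abs_moment (leave \<nu> A k)) \<le> ennreal C" by simp
    then show ?thesis using C(1) by (subst (asm) ennreal_le_iff) auto
  qed
  then show ?thesis by (intro bounded_imp_summable[of _ C]) auto
qed

definition exit_mean :: real where "exit_mean = (\<Sum>n. abs_moment (leave \<nu> A n))"

lemma leave_id_int: "integrable (mea (leave \<nu> A n)) (\<lambda>y. y)"
  unfolding integrable_abs_iff by (rule leave_moment_finite)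

lemma ev_leave_id: "ev (leave \<nu> A n) (\<lambda>y. y) = - \<epsilon> * abs_moment (leave \<nu> A n)"
proof -
  have "ev (leave \<nu> A n) (\<lambda>y. y) = ev (leave \<nu> A n) (\<lambda>y. - \<epsilon> * \<bar>y\<bar>)"
  proof (rule ev_cong_conc[OF _ _ concentrated_leave_A])
    fix y assume "y \<in> B"
    then show "y = - \<epsilon> * \<bar>y\<bar>" using eps_B[of y] eps by auto
  qed auto
  then show ?thesis by (simp add: abs_moment_eq)
qed

text \<open>Derivative at 0 of the imaginary part of the characteristic function of the exit
  position, along t = 1/(m + 1). The first moment dominates; the sign reflects that exits lie in
  \<open>B\<close>.\<close>

lemma sin_quotient_tendsto:
  "(\<lambda>m. (\<Sum>n. ev (leave \<nu> A n) (\<lambda>y. sin (y / real (Suc m)))) * real (Suc m)) \<longlonglongrightarrow> - \<epsilon> * exit_mean"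
proof -
  have "(\<lambda>m. \<Sum>n. ev (leave \<nu> A n) (\<lambda>y. real (Suc m) * sin (y / real (Suc m)))) \<longlonglongrightarrow> (\<Sum>n. - \<epsilon> * abs_moment (leave \<nu> A n))"
  proof (rule tendsto_suminf_dominated[OF _ _ leave_moment_summable])
    have le: "\<bar>real (Suc m) * sin (y / real (Suc m))\<bar> \<le> \<bar>y\<bar>" for m y
      using abs_sin_x_le_abs_x[of "y / real (Suc m)"] by (simp add: abs_mult field_simps del: of_nat_Suc)
    fix n
    have "(\<lambda>m. ev (leave \<nu> A n) (\<lambda>y. real (Suc m) * sin (y / real (Suc m)))) \<longlonglongrightarrow> ev (leave \<nu> A n) (\<lambda>y. y)"
    proof (rule integral_dominated_convergence[where w = "\<lambda>y. \<bar>y\<bar>"])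
      show "integrable (mea (leave \<nu> A n)) (\<lambda>y. \<bar>y\<bar>)" using leave_id_int by simp
      show "AE y in mea (leave \<nu> A n). (\<lambda>m. real (Suc m) * sin (y / real (Suc m))) \<longlonglongrightarrow> y"
      proof (rule AE_I2)
        fix y :: real
        show "(\<lambda>m. real (Suc m) * sin (y / real (Suc m))) \<longlonglongrightarrow> y" by real_asymp
      qed
      show "AE y in mea (leave \<nu> A n). norm (real (Suc m) * sin (y / real (Suc m))) \<le> \<bar>y\<bar>" for m
        using le by (simp del: of_nat_Suc)
    qed auto
    then show "(\<lambda>m. ev (leave \<nu> A n) (\<lambda>y. real (Suc m) * sin (y / real (Suc m)))) \<longlonglongrightarrow> - \<epsilon> * abs_moment (leave \<nu> A n)"
      by (simp only: ev_leave_id)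
    fix m
    have "\<bar>ev (leave \<nu> A n) (\<lambda>y. real (Suc m) * sin (y / real (Suc m)))\<bar> \<le> ev (leave \<nu> A n) (\<lambda>y. \<bar>real (Suc m) * sin (y / real (Suc m))\<bar>)"
      by (rule integral_abs_bound)
    also have "\<dots> \<le> abs_moment (leave \<nu> A n)"
      unfolding abs_moment_eq
    proof (rule integral_mono[OF _ _ le])
      show "integrable (mea (leave \<nu> A n)) (\<lambda>y. \<bar>y\<bar>)" using leave_id_int by simp
      then show "integrable (mea (leave \<nu> A n)) (\<lambda>y. \<bar>real (Suc m) * sin (y / real (Suc m))\<bar>)"
        by (rule Bochner_Integration.integrable_bound) (use le in \<open>auto simp del: of_nat_Suc\<close>)
    qed
    finally show "\<bar>ev (leave \<nu> A n) (\<lambda>y. real (Suc m) * sin (y / real (Suc m)))\<bar> \<le> abs_moment (leave \<nu> A n)" .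
  qed
  moreover have "(\<Sum>n. ev (leave \<nu> A n) (\<lambda>y. real (Suc m) * sin (y / real (Suc m)))) = (\<Sum>n. ev (leave \<nu> A n) (\<lambda>y. sin (y / real (Suc m)))) * real (Suc m)" for m
  proof -
    have "summable (\<lambda>n. ev (leave \<nu> A n) (\<lambda>y. sin (y / real (Suc m))))"
    proof (rule summable_comparison_test'[of "\<lambda>n. mass (leave \<nu> A n)" 0])
      show "summable (\<lambda>n. mass (leave \<nu> A n))" using mass_leave_sums by (rule sums_summable)
      fix n
      have "\<bar>ev (leave \<nu> A n) (\<lambda>y. sin (y / real (Suc m)))\<bar> \<le> ev (leave \<nu> A n) (\<lambda>y. \<bar>sin (y / real (Suc m))\<bar>)"
        by (rule integral_abs_bound)
      also have "\<dots> \<le> 1 * mass (leave \<nu> A n)"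
        by (rule ev_le_mass) (auto intro!: nonneg_boundedI[of _ 1])
      finally show "norm (ev (leave \<nu> A n) (\<lambda>y. sin (y / real (Suc m)))) \<le> mass (leave \<nu> A n)" by simp
    qed
    then show ?thesis by (simp only: integral_mult_right_zero suminf_mult mult.commute[of _ "real (Suc m)"])
  qed
  moreover have "(\<Sum>n. - \<epsilon> * abs_moment (leave \<nu> A n)) = - \<epsilon> * exit_mean"
    unfolding exit_mean_def by (rule suminf_mult[OF leave_moment_summable])
  ultimately show ?thesis by (simp only:)
qed

lemma one_minus_cos_le: "1 - cos u \<le> \<bar>u\<bar>" for u :: real
proof -
  have c: "cos u = 1 - 2 * (sin (u / 2))\<^sup>2" using cos_double_sin[of "u / 2"] by simp
  have "(sin (u / 2))\<^sup>2 = \<bar>sin (u / 2)\<bar> * \<bar>sin (u / 2)\<bar>" by (simp add: power2_eq_square)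
  also have "\<dots> \<le> \<bar>u / 2\<bar> * 1"
    using abs_sin_x_le_abs_x[of "u / 2"] by (intro mult_mono) auto
  finally show ?thesis unfolding c by simp
qed

text \<open>The real part has derivative 0 at the origin: \<open>1 - cos u\<close> is of smaller
  order than u near 0, and at most \<open>\<bar>u\<bar>\<close> everywhere, so the first moment
  again dominates.\<close>

lemma cos_quotient_tendsto:
  "(\<lambda>m. (\<Sum>n. ev (leave \<nu> A n) (\<lambda>y. 1 - cos (y / real (Suc m)))) * real (Suc m)) \<longlonglongrightarrow> 0"
proof -
  have sm: "summable (\<lambda>n. ev (leave \<nu> A n) (\<lambda>y. 1 - cos (y / real (Suc m))))" for m
  proof (rule summable_comparison_test'[of "\<lambda>n. 2 * mass (leave \<nu> A n)" 0])
    show "summable (\<lambda>n. 2 * mass (leave \<nu> A n))" using mass_leave_sums by (intro summable_mult) (rule sums_summable)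
    fix n
    have nb: "nonneg_bounded (\<lambda>y. 1 - cos (y / real (Suc m)))"
      by (rule nonneg_boundedI[of _ 2]) (auto simp: algebra_simps add.commute[of "cos _"] intro: order_trans[OF _ add_left_mono[OF cos_ge_minus_one]])
    have "ev (leave \<nu> A n) (\<lambda>y. 1 - cos (y / real (Suc m))) \<le> 2 * mass (leave \<nu> A n)"
    proof (rule ev_le_mass[OF nb])
      fix y show "1 - cos (y / real (Suc m)) \<le> 2" using cos_ge_minus_one[of "y / real (Suc m)"] by linarith
    qed
    then show "norm (ev (leave \<nu> A n) (\<lambda>y. 1 - cos (y / real (Suc m)))) \<le> 2 * mass (leave \<nu> A n)"
      using ev_nonneg[OF nb] by simp
  qed
  have "(\<lambda>m. \<Sum>n. ev (leave \<nu> A n) (\<lambda>y. real (Suc m) * (1 - cos (y / real (Suc m))))) \<longlonglongrightarrow> (\<Sum>n. 0)"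
  proof (rule tendsto_suminf_dominated[OF _ _ leave_moment_summable])
    have le: "\<bar>real (Suc m) * (1 - cos (y / real (Suc m)))\<bar> \<le> \<bar>y\<bar>" for m y
      using one_minus_cos_le[of "y / real (Suc m)"] cos_le_one[of "y / real (Suc m)"]
      by (simp add: abs_mult field_simps del: of_nat_Suc)
    fix n
    have "(\<lambda>m. ev (leave \<nu> A n) (\<lambda>y. real (Suc m) * (1 - cos (y / real (Suc m))))) \<longlonglongrightarrow> ev (leave \<nu> A n) (\<lambda>y. 0)"
    proof (rule integral_dominated_convergence[where w = "\<lambda>y. \<bar>y\<bar>"])
      show "integrable (mea (leave \<nu> A n)) (\<lambda>y. \<bar>y\<bar>)" using leave_id_int by simp
      show "AE y in mea (leave \<nu> A n). (\<lambda>m. real (Suc m) * (1 - cos (y / real (Suc m)))) \<longlonglongrightarrow> 0"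
      proof (rule AE_I2)
        fix y :: real
        show "(\<lambda>m. real (Suc m) * (1 - cos (y / real (Suc m)))) \<longlonglongrightarrow> 0" by real_asymp
      qed
      show "AE y in mea (leave \<nu> A n). norm (real (Suc m) * (1 - cos (y / real (Suc m)))) \<le> \<bar>y\<bar>" for m
        using le by (simp del: of_nat_Suc)
    qed auto
    then show "(\<lambda>m. ev (leave \<nu> A n) (\<lambda>y. real (Suc m) * (1 - cos (y / real (Suc m))))) \<longlonglongrightarrow> 0" by simp
    fix m
    have "\<bar>ev (leave \<nu> A n) (\<lambda>y. real (Suc m) * (1 - cos (y / real (Suc m))))\<bar> \<le> ev (leave \<nu> A n) (\<lambda>y. \<bar>real (Suc m) * (1 - cos (y / real (Suc m)))\<bar>)"
      by (rule integral_abs_bound)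
    also have "\<dots> \<le> abs_moment (leave \<nu> A n)"
      unfolding abs_moment_eq
    proof (rule integral_mono[OF _ _ le])
      show "integrable (mea (leave \<nu> A n)) (\<lambda>y. \<bar>y\<bar>)" using leave_id_int by simp
      then show "integrable (mea (leave \<nu> A n)) (\<lambda>y. \<bar>real (Suc m) * (1 - cos (y / real (Suc m)))\<bar>)"
        by (rule Bochner_Integration.integrable_bound) (use le in \<open>auto simp del: of_nat_Suc\<close>)
    qed
    finally show "\<bar>ev (leave \<nu> A n) (\<lambda>y. real (Suc m) * (1 - cos (y / real (Suc m))))\<bar> \<le> abs_moment (leave \<nu> A n)" .
  qed
  moreover have "(\<Sum>n. ev (leave \<nu> A n) (\<lambda>y. real (Suc m) * (1 - cos (y / real (Suc m))))) = (\<Sum>n. ev (leave \<nu> A n) (\<lambda>y. 1 - cos (y / real (Suc m)))) * real (Suc m)" for m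
    using sm[of m] by (simp only: integral_mult_right_zero suminf_mult mult.commute[of _ "real (Suc m)"])
  ultimately show ?thesis by (simp only: suminf_zero)
qed

end

lemma one_minus_cos_add:
  "1 - cos (a + b) = (1 - cos a) + (1 - cos b) - (1 - cos a) * (1 - cos b) + sin a * sin (b::real)"
  by (simp add: cos_add algebra_simps)

lemma nonneg_bounded_one_minus_cos: "nonneg_bounded (\<lambda>y. 1 - cos (t * y))"
proof (rule nonneg_boundedI[of _ 2])
  fix y :: real show "1 - cos (t * y) \<le> 2" using cos_ge_minus_one[of "t * y"] by linarith
qed auto

lemma ev_times_one_minus_cos:
  "ev (P * Q) (\<lambda>y. 1 - cos (t * y))
    = ev P (\<lambda>y. 1 - cos (t * y)) * mass Q + mass P * ev Q (\<lambda>y. 1 - cos (t * y))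
      - ev P (\<lambda>y. 1 - cos (t * y)) * ev Q (\<lambda>y. 1 - cos (t * y)) + ev P (\<lambda>y. sin (t * y)) * ev Q (\<lambda>y. sin (t * y))"
proof -
  have ic: "integrable (mea E) (\<lambda>y. 1 - cos (t * y))" for E
    by (rule nonneg_bounded_integrable[OF nonneg_bounded_one_minus_cos])
  have isn: "integrable (mea E) (\<lambda>y. sin (t * y))" for E
    by (rule integrable_bounded[of _ 1]) auto
  have i1: "integrable (mea E) (\<lambda>y. c :: real)" for E c
    by (rule integrable_bounded[of _ "\<bar>c\<bar>"]) auto
  define a b where "a = ev Q (\<lambda>y. 1 - cos (t * y))" and "b = ev Q (\<lambda>y. sin (t * y))"
  have inner: "ev Q (\<lambda>y. 1 - cos (t * (x + y))) = (1 - cos (t * x)) * mass Q + a - (1 - cos (t * x)) * a + sin (t * x) * b" for x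
  proof -
    have "ev Q (\<lambda>y. 1 - cos (t * (x + y))) = ev Q (\<lambda>y. (1 - cos (t * x)) + (1 - cos (t * y)) - (1 - cos (t * x)) * (1 - cos (t * y)) + sin (t * x) * sin (t * y))"
      by (simp only: distrib_left one_minus_cos_add)
    also have "\<dots> = ev Q (\<lambda>y. (1 - cos (t * x)) + (1 - cos (t * y)) - (1 - cos (t * x)) * (1 - cos (t * y))) + ev Q (\<lambda>y. sin (t * x) * sin (t * y))"
      by (intro Bochner_Integration.integral_add Bochner_Integration.integrable_diff Bochner_Integration.integrable_add integrable_mult_right ic isn i1)
    also have "ev Q (\<lambda>y. (1 - cos (t * x)) + (1 - cos (t * y)) - (1 - cos (t * x)) * (1 - cos (t * y)))
        = ev Q (\<lambda>y. (1 - cos (t * x)) + (1 - cos (t * y))) - ev Q (\<lambda>y. (1 - cos (t * x)) * (1 - cos (t * y)))"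
      by (intro Bochner_Integration.integral_diff Bochner_Integration.integrable_add integrable_mult_right ic i1)
    also have "ev Q (\<lambda>y. (1 - cos (t * x)) + (1 - cos (t * y))) = ev Q (\<lambda>y. 1 - cos (t * x)) + a"
      unfolding a_def by (intro Bochner_Integration.integral_add ic i1)
    also have "ev Q (\<lambda>y. (1 - cos (t * x)) * (1 - cos (t * y))) = (1 - cos (t * x)) * a"
      unfolding a_def by (rule integral_mult_right_zero)
    also have "ev Q (\<lambda>y. sin (t * x) * sin (t * y)) = sin (t * x) * b"
      unfolding b_def by (rule integral_mult_right_zero)
    also have "ev Q (\<lambda>y. 1 - cos (t * x)) = (1 - cos (t * x)) * mass Q" by (rule ev_const)
    finally show ?thesis .
  qed
  have "ev (P * Q) (\<lambda>y. 1 - cos (t * y)) = ev P (\<lambda>x. (1 - cos (t * x)) * mass Q + a - (1 - cos (t * x)) * a + sin (t * x) * b)"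
    unfolding ev_times[OF nonneg_bounded_one_minus_cos] inner ..
  also have "\<dots> = ev P (\<lambda>x. (1 - cos (t * x)) * mass Q + a - (1 - cos (t * x)) * a) + ev P (\<lambda>x. sin (t * x) * b)"
    by (intro Bochner_Integration.integral_add Bochner_Integration.integrable_diff Bochner_Integration.integrable_add integrable_mult_left ic isn i1)
  also have "ev P (\<lambda>x. (1 - cos (t * x)) * mass Q + a - (1 - cos (t * x)) * a)
      = ev P (\<lambda>x. (1 - cos (t * x)) * mass Q + a) - ev P (\<lambda>x. (1 - cos (t * x)) * a)"
    by (intro Bochner_Integration.integral_diff Bochner_Integration.integrable_add integrable_mult_left ic i1)
  also have "ev P (\<lambda>x. (1 - cos (t * x)) * mass Q + a) = ev P (\<lambda>x. (1 - cos (t * x)) * mass Q) + ev P (\<lambda>x. a)"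
    by (intro Bochner_Integration.integral_add integrable_mult_left ic i1)
  also have "ev P (\<lambda>x. a) = a * mass P" by (rule ev_const)
  finally show ?thesis
    unfolding integral_mult_left_zero a_def b_def by (simp add: algebra_simps)
qed

context ladder
begin

lemma summable_mass_leave: "summable (\<lambda>n. mass (leave \<nu> A n))"
  using mass_leave_sums by (rule sums_summable)

lemma summable_ev_leave:
  assumes "f \<in> borel_measurable borel" "\<And>x. \<bar>f x\<bar> \<le> C"
  shows "summable (\<lambda>n. \<bar>ev (leave \<nu> A n) f\<bar>)"
proof (rule summable_comparison_test'[of "\<lambda>n. C * mass (leave \<nu> A n)" 0])
  show "summable (\<lambda>n. C * mass (leave \<nu> A n))" by (intro summable_mult summable_mass_leave)
  fix n
  have "\<bar>ev (leave \<nu> A n) f\<bar> \<le> ev (leave \<nu> A n) (\<lambda>y. \<bar>f y\<bar>)" by (rule integral_abs_bound)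
  also have "\<dots> \<le> C * mass (leave \<nu> A n)"
    using assms by (intro ev_le_mass) (auto intro!: nonneg_boundedI[of _ C])
  finally show "norm \<bar>ev (leave \<nu> A n) f\<bar> \<le> C * mass (leave \<nu> A n)" by simp
qed

end

context walk_law
begin

text \<open>The real part of the Wiener-Hopf factorisation of 1 minus the characteristic function:
  the two factors are P - i sP and Q - i sQ. The measure identity has no subtraction, so it is
  integrated against \<open>1 - cos\<close> and summed; since the exit masses sum to 1, the terms P
  and Q appear on both sides and cancel.\<close>

lemma one_minus_cos_identity:
  fixes t :: real
  defines "f \<equiv> \<lambda>y. 1 - cos (t * y)"
  shows "ev \<nu> f = (\<Sum>n. ev (leave \<nu> {0..} n) f) * (\<Sum>n. ev (leave \<nu> {..<0} n) f)
    - (\<Sum>n. ev (leave \<nu> {0..} n) (\<lambda>y. sin (t * y))) * (\<Sum>n. ev (leave \<nu> {..<0} n) (\<lambda>y. sin (t * y)))"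
proof -
  have nb: "nonneg_bounded f" unfolding f_def by (rule nonneg_bounded_one_minus_cos)
  define R S where "R = leave \<nu> {0..}" and "S = leave \<nu> {..<0}"
  define P Q sP sQ where "P = (\<lambda>n. ev (R n) f)" and "Q = (\<lambda>n. ev (S n) f)"
    and "sP = (\<lambda>n. ev (R n) (\<lambda>y. sin (t * y)))" and "sQ = (\<lambda>n. ev (S n) (\<lambda>y. sin (t * y)))"
  have fb: "f \<in> borel_measurable borel" "\<bar>f y\<bar> \<le> 2" for y
    using cos_ge_minus_one[of "t * y"] cos_le_one[of "t * y"] by (auto simp: f_def)
  have sumP: "summable (\<lambda>n. norm (P n))" and sumQ: "summable (\<lambda>n. norm (Q n))"
    unfolding P_def Q_def R_def S_def real_norm_def
    by (rule asc.summable_ev_leave[OF fb] desc.summable_ev_leave[OF fb])+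
  have sumsP: "summable (\<lambda>n. norm (sP n))" and sumsQ: "summable (\<lambda>n. norm (sQ n))"
    unfolding sP_def sQ_def R_def S_def real_norm_def
    by (rule asc.summable_ev_leave[of _ 1] desc.summable_ev_leave[of _ 1]; simp)+
  have mR: "(\<lambda>n. mass (R n)) sums 1" "summable (\<lambda>n. norm (mass (R n)))"
    using asc.mass_leave_sums sums_summable[OF asc.mass_leave_sums] by (simp_all add: R_def)
  have mS: "(\<lambda>n. mass (S n)) sums 1" "summable (\<lambda>n. norm (mass (S n)))"
    using desc.mass_leave_sums sums_summable[OF desc.mass_leave_sums] by (simp_all add: S_def)
  have rec: "Q n + P n = (if n = 1 then ev \<nu> f else 0)
    + ((\<Sum>i\<le>n. P i * mass (S (n - i))) + (\<Sum>i\<le>n. mass (R i) * Q (n - i)) - (\<Sum>i\<le>n. P i * Q (n - i)) + (\<Sum>i\<le>n. sP i * sQ (n - i)))" for n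
  proof -
    have X: "(fps_X * fps_const \<nu>) $ n = (if n = 1 then \<nu> else 0)"
      by (cases n) auto
    have "S n + R n = (leaveF \<nu> {..<0} + leaveF \<nu> {0..}) $ n" by (simp add: R_def S_def)
    also have "\<dots> = (if n = 1 then \<nu> else 0) + (leaveF \<nu> {0..} * leaveF \<nu> {..<0}) $ n"
      unfolding asc.wiener_hopf fps_add_nth X ..
    finally have "S n + R n = (if n = 1 then \<nu> else 0) + (\<Sum>i\<le>n. R i * S (n - i))"
      by (simp add: R_def S_def fps_mult_nth atLeast0AtMost)
    then have "ev (S n + R n) f = ev ((if n = 1 then \<nu> else 0) + (\<Sum>i\<le>n. R i * S (n - i))) f" by simp
    then have "Q n + P n = (if n = 1 then ev \<nu> f else 0) + (\<Sum>i\<le>n. ev (R i * S (n - i)) f)"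
      by (simp add: ev_plus[OF nb] ev_sum[OF nb] P_def Q_def)
    also have "(\<Sum>i\<le>n. ev (R i * S (n - i)) f) = (\<Sum>i\<le>n. P i * mass (S (n - i)) + mass (R i) * Q (n - i) - P i * Q (n - i) + sP i * sQ (n - i))"
      unfolding f_def P_def Q_def sP_def sQ_def ev_times_one_minus_cos ..
    finally show ?thesis by (simp add: sum.distrib sum_subtractf)
  qed
  have "(\<lambda>n. Q n + P n) sums (suminf Q + suminf P)"
    by (intro sums_add summable_sums summable_norm_cancel[OF sumQ] summable_norm_cancel[OF sumP])
  moreover have "(\<lambda>n. Q n + P n) sums (ev \<nu> f + ((suminf P * 1 + 1 * suminf Q) - suminf P * suminf Q + suminf sP * suminf sQ))"
    unfolding rec
  proof (intro sums_add sums_diff)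
    show "(\<lambda>n. if n = 1 then ev \<nu> f else 0) sums ev \<nu> f" by (rule sums_single)
    show "(\<lambda>n. \<Sum>i\<le>n. P i * mass (S (n - i))) sums (suminf P * 1)"
      using Cauchy_product_sums[OF sumP mS(2)] unfolding sums_unique[OF mS(1), symmetric] .
    show "(\<lambda>n. \<Sum>i\<le>n. mass (R i) * Q (n - i)) sums (1 * suminf Q)"
      using Cauchy_product_sums[OF mR(2) sumQ] unfolding sums_unique[OF mR(1), symmetric] .
    show "(\<lambda>n. \<Sum>i\<le>n. P i * Q (n - i)) sums (suminf P * suminf Q)" by (rule Cauchy_product_sums[OF sumP sumQ])
    show "(\<lambda>n. \<Sum>i\<le>n. sP i * sQ (n - i)) sums (suminf sP * suminf sQ)" by (rule Cauchy_product_sums[OF sumsP sumsQ])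
  qed
  ultimately have "suminf Q + suminf P = ev \<nu> f + ((suminf P * 1 + 1 * suminf Q) - suminf P * suminf Q + suminf sP * suminf sQ)"
    by (rule sums_unique2)
  then show ?thesis by (simp add: P_def Q_def sP_def sQ_def R_def S_def)
qed

text \<open>The second-order expansion at the origin of the Wiener--Hopf factorisation.\<close>

lemma exit_mean_product: "asc.exit_mean * desc.exit_mean = s2 / 2"
proof -
  define c where "c = (\<lambda>m. real (Suc m))"
  have "(\<lambda>m. ev \<nu> (\<lambda>y. (c m)\<^sup>2 * (1 - cos (1 / c m * y)))) \<longlonglongrightarrow> ev \<nu> (\<lambda>y. y\<^sup>2 / 2)"
  proof (rule integral_dominated_convergence[where w = "\<lambda>y. y\<^sup>2"])
    show "AE y in mea \<nu>. (\<lambda>m. (c m)\<^sup>2 * (1 - cos (1 / c m * y))) \<longlonglongrightarrow> y\<^sup>2 / 2"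
    proof (rule AE_I2)
      fix y :: real
      show "(\<lambda>m. (c m)\<^sup>2 * (1 - cos (1 / c m * y))) \<longlonglongrightarrow> y\<^sup>2 / 2"
        unfolding c_def power2_eq_square[of y] by real_asymp
    qed
    fix m
    show "AE y in mea \<nu>. norm ((c m)\<^sup>2 * (1 - cos (1 / c m * y))) \<le> y\<^sup>2"
    proof (rule AE_I2)
      fix y :: real
      define u where "u = 1 / c m * y"
      have c: "cos u = 1 - 2 * (sin (u / 2))\<^sup>2" using cos_double_sin[of "u / 2"] by simp
      have "(sin (u / 2))\<^sup>2 \<le> (u / 2)\<^sup>2"
        using abs_sin_x_le_abs_x[of "u / 2"] abs_le_square_iff by blast
      then have "4 * (sin (u / 2))\<^sup>2 \<le> u\<^sup>2" by (simp add: power_divide)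
      then have "1 - cos u \<le> u\<^sup>2" unfolding c using zero_le_power2[of "sin (u / 2)"] by linarith
      moreover have "0 \<le> 1 - cos u" by simp
      ultimately have "\<bar>(c m)\<^sup>2 * (1 - cos u)\<bar> \<le> (c m)\<^sup>2 * u\<^sup>2" by (simp add: abs_mult mult_left_mono)
      also have "(c m)\<^sup>2 * u\<^sup>2 = y\<^sup>2" by (simp add: u_def c_def power_divide power_mult_distrib del: of_nat_Suc)
      finally show "norm ((c m)\<^sup>2 * (1 - cos (1 / c m * y))) \<le> y\<^sup>2" unfolding u_def by simp
    qed
  qed (use sq_int in auto)
  then have L: "(\<lambda>m. ev \<nu> (\<lambda>y. 1 - cos (1 / c m * y)) * (c m)\<^sup>2) \<longlonglongrightarrow> s2 / 2"
    by (simp add: s2_def mult.commute)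
  have eq: "ev \<nu> (\<lambda>y. 1 - cos (1 / c m * y)) * (c m)\<^sup>2
    = ((\<Sum>n. ev (leave \<nu> {0..} n) (\<lambda>y. 1 - cos (y / c m))) * c m) * ((\<Sum>n. ev (leave \<nu> {..<0} n) (\<lambda>y. 1 - cos (y / c m))) * c m)
    - ((\<Sum>n. ev (leave \<nu> {0..} n) (\<lambda>y. sin (y / c m))) * c m) * ((\<Sum>n. ev (leave \<nu> {..<0} n) (\<lambda>y. sin (y / c m))) * c m)" for m
    unfolding one_minus_cos_identity by (simp add: power2_eq_square algebra_simps)
  \<comment> \<open>After multiplication by the square of \<open>c m\<close> the cosine quotients
    vanish in the limit, while the product of the two sine quotients tends to minus the product of
    the mean exit heights.\<close>
  have "(\<lambda>m. ev \<nu> (\<lambda>y. 1 - cos (1 / c m * y)) * (c m)\<^sup>2) \<longlonglongrightarrow> 0 * 0 - (- 1 * asc.exit_mean) * (- (-1) * desc.exit_mean)"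
    unfolding eq unfolding c_def
    by (intro tendsto_diff tendsto_mult[of _ 0 _ _ 0] tendsto_mult asc.cos_quotient_tendsto desc.cos_quotient_tendsto asc.sin_quotient_tendsto desc.sin_quotient_tendsto)
  from LIMSEQ_unique[OF L this] show ?thesis by simp
qed

end

context ladder
begin

text \<open>The walk killed outside \<open>D\<close> is decomposed at its extremum.\<close>

lemma leave_moment:
  assumes D: "admissible D" and bd: "\<And>y. y \<in> D \<Longrightarrow> y \<in> insert 0 B \<Longrightarrow> \<bar>y\<bar> \<le> x"
    and sm: "summable (\<lambda>n. mass (restr D (stay \<nu> B n)))" and out: "\<And>y. y \<notin> D \<Longrightarrow> x \<le> \<bar>y\<bar>" and x: "0 \<le> x"
  defines "W \<equiv> (\<Sum>n. mass (restr D (stay \<nu> B n)))"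
  shows "enn2real (\<Sum>n. nni (leave \<nu> D n) (\<lambda>y. ennreal \<bar>y\<bar>)) = exit_mean * W" and "x \<le> exit_mean * W" "1 \<le> W"
proof -
  have Db [measurable, simp]: "D \<in> sets borel" and D0: "0 \<in> D" using D by (auto simp: admissible_def)
  define Q where "Q = (\<lambda>n. restr D (stay \<nu> B n))"
  define L where "L = leave \<nu> D"
  define N where "N = (\<lambda>E. nni E (\<lambda>y. ennreal \<bar>y\<bar>))"
  have W: "(\<lambda>n. mass (Q n)) sums W" unfolding W_def Q_def by (rule summable_sums[OF sm])
  have Wn: "summable (\<lambda>n. norm (mass (Q n)))" using sm by (simp add: Q_def)
  have cQ: "concentrated (Q n) (insert 0 B)" for n
  proof -
    have "nni (Q n) (indicator (- insert 0 B)) \<le> nni (stay \<nu> B n) (indicator (- insert 0 B))"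
      unfolding Q_def by (subst nni_restr) (auto intro!: nn_integral_mono simp: indicator_def simp del: nn_integral_indicator)
    also have "\<dots> = 0" using concentrated_stay0[OF B_sets, of \<nu> n] by (subst concentrated_iff[symmetric]) auto
    finally show ?thesis by (subst concentrated_iff) auto
  qed
  have cQD: "concentrated (Q n) D" for n unfolding Q_def by (rule concentrated_restr) simp
  have NQ: "N (Q n) \<le> ennreal (x * mass (Q n))" for n
  proof -
    have "N (Q n) = nni (Q n) (\<lambda>y. indicator D y * (indicator (insert 0 B) y * ennreal \<bar>y\<bar>))"
      unfolding N_def
      by (subst concentrated_nni_cong[OF cQ, where g = "\<lambda>y. indicator (insert 0 B) y * ennreal \<bar>y\<bar>"], simp)
         (rule concentrated_nni_cong[OF cQD], simp)
    also have "\<dots> \<le> nni (Q n) (\<lambda>_. ennreal x)"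
      by (intro nn_integral_mono) (use bd in \<open>auto simp: indicator_def ennreal_leI\<close>)
    also have "\<dots> = ennreal (x * mass (Q n))"
      using x by (simp add: ennreal_mult finite_measure.emeasure_eq_measure[OF finite_mea])
    finally show ?thesis .
  qed
  have NQf: "N (Q n) \<noteq> \<infinity>" for n using NQ[of n] by (auto simp: top_unique)
  have NLf: "N (leave \<nu> A n) \<noteq> \<infinity>" for n unfolding N_def by (rule leave_moment_finite)
  \<comment> \<open>Up to the value 0 both factors are concentrated on \<open>B\<close>, so the two
    summands have the same sign and their absolute values add.\<close>
  have prod: "N (Q i * leave \<nu> A j) = ennreal (abs_moment (Q i) * mass (leave \<nu> A j) + mass (Q i) * abs_moment (leave \<nu> A j))" for i j
  proof -
    have "N (Q i * leave \<nu> A j) = (\<integral>\<^sup>+x. \<integral>\<^sup>+w. ennreal \<bar>x + w\<bar> \<partial>mea (leave \<nu> A j) \<partial>mea (Q i))"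
      unfolding N_def by (rule nni_times) simp
    also have "\<dots> = (\<integral>\<^sup>+x. ennreal \<bar>x\<bar> * ennreal (mass (leave \<nu> A j)) + N (leave \<nu> A j) \<partial>mea (Q i))"
    proof (rule concentrated_nni_cong[OF cQ])
      fix x assume x: "x \<in> insert 0 B"
      have "(\<integral>\<^sup>+w. ennreal \<bar>x + w\<bar> \<partial>mea (leave \<nu> A j)) = (\<integral>\<^sup>+w. ennreal \<bar>x\<bar> + ennreal \<bar>w\<bar> \<partial>mea (leave \<nu> A j))"
      proof (rule concentrated_nni_cong[OF concentrated_leave_A])
        fix w assume w: "w \<in> B"
        have "\<bar>x + w\<bar> = \<bar>x\<bar> + \<bar>w\<bar>"
          using x eps_B[OF w] eps_B[of x] eps by (cases "x = 0") auto
        then show "ennreal \<bar>x + w\<bar> = ennreal \<bar>x\<bar> + ennreal \<bar>w\<bar>" by simp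
      qed
      also have "\<dots> = ennreal \<bar>x\<bar> * ennreal (mass (leave \<nu> A j)) + N (leave \<nu> A j)"
        unfolding N_def by (subst nn_integral_add) (auto simp: finite_measure.emeasure_eq_measure[OF finite_mea])
      finally show "(\<integral>\<^sup>+w. ennreal \<bar>x + w\<bar> \<partial>mea (leave \<nu> A j)) = ennreal \<bar>x\<bar> * ennreal (mass (leave \<nu> A j)) + N (leave \<nu> A j)" .
    qed
    also have "\<dots> = N (Q i) * ennreal (mass (leave \<nu> A j)) + ennreal (mass (Q i)) * N (leave \<nu> A j)"
      unfolding N_def by (subst nn_integral_add) (auto simp: nn_integral_multc finite_measure.emeasure_eq_measure[OF finite_mea] mult.commute)
    also have "\<dots> = ennreal (abs_moment (Q i)) * ennreal (mass (leave \<nu> A j)) + ennreal (mass (Q i)) * ennreal (abs_moment (leave \<nu> A j))"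
      by (simp only: ennreal_abs_moment[OF NQf[of i, unfolded N_def]] ennreal_abs_moment[OF NLf[of j, unfolded N_def]] N_def)
    finally show ?thesis by (simp add: ennreal_mult)
  qed
  have fact: "L n + Q n = (if n = 0 then 1 else 0) + (\<Sum>i\<le>n. Q i * leave \<nu> A (n - i))" for n
    using arg_cong[OF leave_factorisation[OF D, of \<nu>], of "\<lambda>F. F $ n"]
    by (simp add: L_def Q_def fps_mult_nth atLeast0AtMost)
  have sumN: "N (L n) + N (Q n) = ennreal (\<Sum>i\<le>n. abs_moment (Q i) * mass (leave \<nu> A (n - i)) + mass (Q i) * abs_moment (leave \<nu> A (n - i)))" for n
  proof -
    have "N (L n) + N (Q n) = N (L n + Q n)" unfolding N_def by simp
    also have "\<dots> = (\<Sum>i\<le>n. N (Q i * leave \<nu> A (n - i)))"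
      unfolding fact N_def by (simp add: nni_sum)
    also have "\<dots> = ennreal (\<Sum>i\<le>n. abs_moment (Q i) * mass (leave \<nu> A (n - i)) + mass (Q i) * abs_moment (leave \<nu> A (n - i)))"
      unfolding prod by (rule sum_ennreal) (auto intro!: add_nonneg_nonneg mult_nonneg_nonneg simp: abs_moment_def)
    finally show ?thesis .
  qed
  have NLD: "N (L n) \<noteq> \<infinity>" for n
  proof
    assume "N (L n) = \<infinity>"
    with sumN[of n] show False by simp
  qed
  have eq: "abs_moment (L n) + abs_moment (Q n) = (\<Sum>i\<le>n. abs_moment (Q i) * mass (leave \<nu> A (n - i))) + (\<Sum>i\<le>n. mass (Q i) * abs_moment (leave \<nu> A (n - i)))" for n
  proof -
    have "ennreal (abs_moment (L n) + abs_moment (Q n)) = N (L n) + N (Q n)"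
      using NLD[of n] NQf[of n] by (simp add: ennreal_abs_moment N_def)
    also note sumN[of n]
    finally show ?thesis
      by (subst (asm) ennreal_inj) (auto intro!: sum_nonneg add_nonneg_nonneg simp: sum.distrib)
  qed
  have sQ: "summable (\<lambda>n. norm (abs_moment (Q n)))"
  proof (rule summable_comparison_test'[of "\<lambda>n. x * mass (Q n)" 0])
    show "summable (\<lambda>n. x * mass (Q n))" using W by (intro summable_mult) (rule sums_summable)
    fix n
    have "ennreal (abs_moment (Q n)) \<le> ennreal (x * mass (Q n))"
      using NQ[of n] NQf[of n] by (simp add: ennreal_abs_moment N_def)
    then show "norm (norm (abs_moment (Q n))) \<le> x * mass (Q n)" using x by (subst (asm) ennreal_le_iff) auto
  qed
  have sA: "summable (\<lambda>n. norm (mass (leave \<nu> A n)))" using summable_mass_leave by simp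
  have sM: "summable (\<lambda>n. norm (abs_moment (leave \<nu> A n)))" using leave_moment_summable by simp
  \<comment> \<open>The moments of \<open>Q\<close> occur on both sides and cancel, because the
    masses of \<open>leave \<nu> A\<close> sum to 1. What remains is Wald's identity: mean exit
    height times the mean number \<open>W\<close> of extrema inside \<open>D\<close>.\<close>
  have "(\<lambda>n. abs_moment (L n) + abs_moment (Q n)) sums ((\<Sum>n. abs_moment (Q n)) * (\<Sum>n. mass (leave \<nu> A n)) + (\<Sum>n. mass (Q n)) * (\<Sum>n. abs_moment (leave \<nu> A n)))"
    unfolding eq by (intro sums_add Cauchy_product_sums sQ sA Wn sM)
  then have "(\<lambda>n. abs_moment (L n) + abs_moment (Q n)) sums ((\<Sum>n. abs_moment (Q n)) + W * exit_mean)"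
    using sums_unique[OF mass_leave_sums] sums_unique[OF W] by (simp add: exit_mean_def)
  from sums_diff[OF this summable_sums[OF summable_norm_cancel[OF sQ]]]
  have Ls: "(\<lambda>n. abs_moment (L n)) sums (exit_mean * W)" by (simp add: mult.commute)
  have Lp: "0 \<le> exit_mean * W" by (rule sums_le[OF _ sums_zero Ls]) simp
  have "(\<Sum>n. N (L n)) = (\<Sum>n. ennreal (abs_moment (L n)))"
    by (simp only: ennreal_abs_moment[OF NLD[unfolded N_def]] N_def)
  also have "\<dots> = ennreal (exit_mean * W)"
    by (rule suminf_ennreal_eq[OF abs_moment_nonneg Ls])
  finally show "enn2real (\<Sum>n. nni (leave \<nu> D n) (\<lambda>y. ennreal \<bar>y\<bar>)) = exit_mean * W"
    using Lp by (simp add: N_def L_def)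
  have meq: "mass (L n) + mass (Q n) = (if n = 0 then 1 else 0) + (\<Sum>i\<le>n. mass (Q i) * mass (leave \<nu> A (n - i)))" for n
  proof -
    have "mass (L n) + mass (Q n) = mass ((if n = 0 then 1 else 0) + (\<Sum>i\<le>n. Q i * leave \<nu> A (n - i)))"
      unfolding mass_plus[symmetric] fact ..
    also have "\<dots> = (if n = 0 then 1 else 0) + ev (\<Sum>i\<le>n. Q i * leave \<nu> A (n - i)) (\<lambda>_. 1)"
      by (simp add: mass_plus)
    also have "ev (\<Sum>i\<le>n. Q i * leave \<nu> A (n - i)) (\<lambda>_. 1) = (\<Sum>i\<le>n. mass (Q i) * mass (leave \<nu> A (n - i)))"
      by (subst ev_sum) (simp_all add: mass_times)
    finally show ?thesis .
  qed
  have "(\<lambda>n. mass (L n) + mass (Q n)) sums (1 + (\<Sum>n. mass (Q n)) * (\<Sum>n. mass (leave \<nu> A n)))"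
    unfolding meq by (intro sums_add Cauchy_product_sums Wn sA) (rule sums_single)
  then have "(\<lambda>n. mass (L n) + mass (Q n)) sums (1 + W)"
    using sums_unique[OF mass_leave_sums] sums_unique[OF W] by simp
  from sums_diff[OF this W] have Lm: "(\<lambda>n. mass (L n)) sums 1" by simp
  \<comment> \<open>The exit from \<open>D\<close> is almost sure and ends at distance at least x
    from the origin, whence the lower bound for \<open>exit_mean * W\<close>.\<close>
  have "x * mass (L n) \<le> abs_moment (L n)" for n
  proof -
    have cL: "concentrated (L n) (- D)" unfolding L_def by (rule concentrated_leave) simp
    have "ennreal (x * mass (L n)) = nni (L n) (\<lambda>_. ennreal x)"
      using x by (simp add: ennreal_mult finite_measure.emeasure_eq_measure[OF finite_mea])
    also have "\<dots> = nni (L n) (\<lambda>y. indicator (- D) y * ennreal x)"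
      by (rule concentrated_nni_cong[OF cL]) simp
    also have "\<dots> \<le> N (L n)" unfolding N_def
      by (intro nn_integral_mono) (use out in \<open>auto simp: indicator_def ennreal_leI\<close>)
    also have "\<dots> = ennreal (abs_moment (L n))" using NLD[of n] by (simp add: ennreal_abs_moment N_def)
    finally show ?thesis by (subst (asm) ennreal_le_iff) auto
  qed
  from sums_le[OF this sums_mult[OF Lm, of x] Ls] show "x \<le> exit_mean * W" by simp
  have "mass (Q 0) = 1"
    using D0 restr_concentrated[of 1 D] by (simp add: Q_def)
  moreover have "mass (Q 0) \<le> (\<Sum>n. mass (Q n))"
    using sum_le_suminf[OF sums_summable[OF W], of "{0}"] by simp
  ultimately show "1 \<le> W" using sums_unique[OF W] by simp
qed

end

section \<open>Asymptotics of the killed walk\<close>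

lemma sum_reverse_pairs: "(\<Sum>k=1..n. g (n - k) k) = (\<Sum>j<n. g j (n - j))" for n :: nat
  by (rule sum.reindex_bij_witness[of _ "\<lambda>j. n - j" "\<lambda>k. n - k"]) auto

context walk_law
begin

section \<open>Scalar factors of the killed walk and their rates\<close>

definition llt_const :: "real \<Rightarrow> real" where "llt_const l = 1 / (l * sqrt (2 * pi * s2))"

text \<open>\<open>up\<close> is the factor of the path after its minimum, and \<open>down\<close>
  below, by time reversal, the factor before it. In \<open>down\<close> the cut-off at -x is
  contained in \<open>expo\<close>, which vanishes on negative arguments.\<close>

definition up :: "real \<Rightarrow> nat \<Rightarrow> real" where "up l n = ev (stay \<nu> {0..} n) (expo l)"

definition down :: "real \<Rightarrow> real \<Rightarrow> nat \<Rightarrow> real" where "down l x n = ev (stay \<nu> {..<0} n) (\<lambda>y. expo l (x + y))"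

text \<open>By time reversal, the expected number of strict descending records at or above -x, the
  starting point included. \<open>V\<close> will be a multiple of it.\<close>

definition renewal :: "real \<Rightarrow> real" where "renewal x = (\<Sum>n. ev (stay \<nu> {..<0} n) (desc.below x))"

lemma conc_nonneg: "concentrated (stay \<nu> {0..} n) {0..}"
  using concentrated_stay0[of "{0..}" \<nu> n] by (simp add: insert_absorb)

lemma conc_nonpos: "concentrated (stay \<nu> {..<0} n) {..0}"
proof -
  have "insert 0 {..<0} = {..0 :: real}" by auto
  then show ?thesis using concentrated_stay0[of "{..<0}" \<nu> n] by simp
qed

lemma below_indicator: "desc.below x y = indicator {0..} (x + y)"
  by (auto simp: desc.below_eq)

lemma summable_renewal: "0 \<le> x \<Longrightarrow> summable (\<lambda>n. ev (stay \<nu> {..<0} n) (desc.below x))"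
proof -
  assume x: "0 \<le> x"
  obtain C where "\<And>n. (\<Sum>k\<le>n. ev (stay \<nu> {..<0} k) (desc.below x)) \<le> C * (1 + x)"
    using desc.renewal_le x by blast
  then show ?thesis by (intro bounded_imp_summable[of _ "C * (1 + x)"]) (auto intro: ev_nonneg)
qed

lemma admissible_half_line: "0 \<le> x \<Longrightarrow> asc.admissible {y. 0 \<le> x + y}"
  by (auto simp: asc.admissible_def)

context
  fixes l :: real assumes l: "0 < l"
begin

lemma llt_const_pos: "0 < llt_const l" using l s2_pos by (simp add: llt_const_def)

lemma nonneg_bounded_expo': "nonneg_bounded (expo l)" using l by (intro nonneg_bounded_expo) simp

lemma nonneg_bounded_expo_shift': "nonneg_bounded (\<lambda>y. expo l (x + y))"
  by (rule nonneg_bounded_shift[OF nonneg_bounded_expo'])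

lemma up_nonneg: "0 \<le> up l n" unfolding up_def by (rule ev_nonneg[OF nonneg_bounded_expo'])

lemma down_nonneg: "0 \<le> down l x n" unfolding down_def by (rule ev_nonneg[OF nonneg_bounded_expo_shift'])

text \<open>Since \<open>expo l\<close> is multiplicative on the nonnegative half-line, Spitzer's
  identity becomes a scalar recursion whose coefficients are governed by the local limit theorem at
  0.\<close>

lemma up_spitzer: "real n * up l n = (\<Sum>j<n. up l j * expo_ev l (n - j) 0)"
proof -
  have "ev (stay \<nu> {0..} j) (\<lambda>y. ev (\<nu> ^ k) (\<lambda>z. indicator {0..} z * expo l (y + z))) = up l j * expo_ev l k 0" for j k
  proof -
    have nb: "nonneg_bounded (\<lambda>z. indicator {0..} z * expo l (y + z))" for y
      by (intro nonneg_bounded_mult nonneg_bounded_expo_shift' nonneg_bounded_indicator) simp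
    have "ev (stay \<nu> {0..} j) (\<lambda>y. ev (\<nu> ^ k) (\<lambda>z. indicator {0..} z * expo l (y + z))) = ev (stay \<nu> {0..} j) (\<lambda>y. expo l y * expo_ev l k 0)"
    proof (rule ev_cong_conc[OF _ _ conc_nonneg])
      fix y :: real assume y: "y \<in> {0..}"
      have "(\<lambda>z. indicator {0..} z * expo l (y + z)) = (\<lambda>z. expo l y * expo l (z + 0))"
        using y by (auto simp: expo_eq indicator_def algebra_simps exp_add[symmetric] fun_eq_iff)
      then show "ev (\<nu> ^ k) (\<lambda>z. indicator {0..} z * expo l (y + z)) = expo l y * expo_ev l k 0"
        unfolding expo_ev_def by simp
    next
      show "(\<lambda>y. expo l y * expo_ev l k 0) \<in> borel_measurable borel" by simp
      show "(\<lambda>y. ev (\<nu> ^ k) (\<lambda>z. indicator {0..} z * expo l (y + z))) \<in> borel_measurable borel"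
      proof (rule sigma_finite_measure.borel_measurable_lebesgue_integral[OF sigma_finite_mea])
        have "(\<lambda>p. indicator {0..} (snd p) * expo l (fst p + snd p)) \<in> borel_measurable (borel \<Otimes>\<^sub>M mea (\<nu> ^ k))"
          by measurable
        then show "(\<lambda>(y, z). indicator {0..} z * expo l (y + z)) \<in> borel_measurable (borel \<Otimes>\<^sub>M mea (\<nu> ^ k))"
          by (simp add: case_prod_beta)
      qed
    qed
    then show ?thesis by (simp add: up_def)
  qed
  then have "real n * up l n = (\<Sum>k=1..n. up l (n - k) * expo_ev l k 0)"
    unfolding up_def asc.ev_spitzer[OF nonneg_bounded_expo'] by (simp add: up_def)
  then show ?thesis unfolding sum_reverse_pairs[of "\<lambda>j k. up l j * expo_ev l k 0"] .
qed

lemma up_sum_le: "\<exists>C>0. \<forall>m. (\<Sum>j<m. up l j) \<le> C"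
proof -
  \<comment> \<open>The transform bound holds for parameters up to 1; replacing \<open>l\<close> by
    a smaller one only enlarges the integrand.\<close>
  define b where "b = min 1 l"
  have b: "0 < b" "b \<le> 1" "b \<le> l" using l by (auto simp: b_def)
  obtain C where C: "0 < C" "\<And>n. (\<Sum>k\<le>n. ev (stay \<nu> {0..} k) (asc.damp b)) \<le> C / b"
    using asc.renewal_transform_le b by blast
  have le: "up l j \<le> ev (stay \<nu> {0..} j) (asc.damp b)" for j
    unfolding up_def
    by (rule ev_mono[OF nonneg_bounded_expo' asc.nonneg_bounded_damp])
       (use b in \<open>auto simp: expo_eq asc.damp_def intro: mult_right_mono\<close>)
  have "(\<Sum>j<m. up l j) \<le> C / b" for m
  proof -
    have "(\<Sum>j<m. up l j) \<le> (\<Sum>j\<le>m. up l j)" by (rule sum_mono2) (auto simp: up_nonneg)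
    also have "\<dots> \<le> (\<Sum>j\<le>m. ev (stay \<nu> {0..} j) (asc.damp b))" by (rule sum_mono) (rule le)
    finally show ?thesis using C(2)[of m] by simp
  qed
  moreover have "0 < C / b" using C b by simp
  ultimately show ?thesis by blast
qed

lemma up_bound: "\<exists>C>0. \<forall>n\<ge>1. up l n \<le> C / (real n * sqrt (real n))"
proof -
  obtain C where C: "C > 0" "\<And>k y. 1 \<le> k \<Longrightarrow> expo_ev l k y \<le> C / sqrt (real k)"
    using expo_ev_bound[OF l] by auto
  obtain W where W: "0 < W" "\<And>m. (\<Sum>j<m. up l j) \<le> W" using up_sum_le by auto
  obtain K where K: "0 < K" "\<And>f c n. 1 \<le> n \<Longrightarrow> nonneg_bounded f \<Longrightarrow> 0 \<le> c \<Longrightarrow>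
    (\<And>k y. 1 \<le> k \<Longrightarrow> ev (\<nu> ^ k) (\<lambda>s. f (y + s)) \<le> c / sqrt (real k)) \<Longrightarrow> ev (stay \<nu> {0..} n) f \<le> K * c / real n"
    using asc.ev_stay_le by metis
  have E: "up l n \<le> K * C / real n" if "1 \<le> n" for n
    unfolding up_def
  proof (rule K(2)[OF that nonneg_bounded_expo'])
    fix k :: nat and y :: real assume "1 \<le> k"
    then show "ev (\<nu> ^ k) (\<lambda>s. expo l (y + s)) \<le> C / sqrt (real k)"
      using C(2)[of k y] by (simp add: expo_ev_def add.commute)
  qed (use C in simp)
  have "up l n \<le> C * (2 * W + 4 * (K * C)) / (real n * sqrt (real n))" if n: "1 \<le> n" for n
  proof (rule three_halves_bound[OF up_nonneg _ _ _ E n])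
    fix n
    have "real n * up l n \<le> (\<Sum>j<n. up l j * (C / sqrt (real (n - j))))"
      unfolding up_spitzer by (intro sum_mono mult_left_mono up_nonneg C(2)) auto
    also have "\<dots> = C * (\<Sum>k=1..n. up l (n - k) / sqrt (real k))"
      unfolding sum_distrib_left sum_reverse_pairs[of "\<lambda>j k. C * (up l j / sqrt (real k))"] by (simp add: mult.commute)
    finally show "real n * up l n \<le> C * (\<Sum>k=1..n. up l (n - k) / sqrt (real k))" .
    show "(\<Sum>j\<le>n. up l j) \<le> W" using W(2)[of "Suc n"] unfolding lessThan_Suc_atMost .
  qed (use C in auto)
  moreover have "0 < C * (2 * W + 4 * (K * C))" using C W K by (simp add: add_pos_pos)
  ultimately show ?thesis by blast
qed

lemma summable_up: "summable (up l)"
  using up_sum_le up_nonneg bounded_imp_summable[of "up l"] unfolding lessThan_Suc_atMost[symmetric] by blast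

text \<open>\<open>conv_limit\<close> at scale 1, with \<open>up l\<close> itself as the weight
  sequence: n times \<open>up l n\<close> is the convolution, so the additional factor sqrt n gives
  the rate n^(3/2).\<close>

lemma up_limit:
  assumes e: "0 < e"
  shows "\<exists>N. \<forall>n\<ge>N. \<bar>real n * sqrt (real n) * up l n - llt_const l * (\<Sum>j. up l j)\<bar> \<le> e"
proof -
  obtain C1 where C1: "C1 > 0" "\<And>k y. 1 \<le> k \<Longrightarrow> expo_ev l k y \<le> C1 / sqrt (real k)"
    using expo_ev_bound[OF l] by auto
  obtain C2 where C2: "0 < C2" "\<And>m. (\<Sum>j<m. up l j) \<le> C2" using up_sum_le by auto
  obtain C3 where C3: "0 < C3" "\<And>n. 1 \<le> n \<Longrightarrow> up l n \<le> C3 / (real n * sqrt (real n))" using up_bound by auto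
  define C where "C = 1 + C1 + C2 + C3 + llt_const l"
  have C: "1 \<le> C" "C1 \<le> C" "C2 \<le> C" "C3 \<le> C" "llt_const l \<le> C"
    using C1 C2 C3 llt_const_pos by (auto simp: C_def)
  from conv_limit[OF e C(1)] show ?thesis
  proof (elim exE conjE, goal_cases)
    case (1 e' \<eta> N)
    note e' = 1(1) and \<eta> = 1(2) and conv = 1(3)[rule_format]
    obtain N1 \<eta>1 where \<eta>1: "0 < \<eta>1" and N1: "\<And>k y. N1 \<le> k \<Longrightarrow> \<bar>y\<bar> \<le> \<eta>1 * sqrt (real k) \<Longrightarrow> \<bar>sqrt (real k) * expo_ev l k y - llt_const l\<bar> \<le> e'"
      using local_limit[OF l e'] unfolding llt_const_def by blast
    \<comment> \<open>Beyond \<open>N2\<close> the side condition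
      \<open>1 \<le> \<eta> * sqrt (real n)\<close> of the scale 1 holds.\<close>
    obtain N2 where N2: "1 / \<eta>\<^sup>2 \<le> real N2" using real_arch_simple by blast
    have "\<bar>real n * sqrt (real n) * up l n - llt_const l * (\<Sum>j. up l j)\<bar> \<le> e" if n: "max N (max (2 * N1) N2) \<le> n" for n
    proof -
      have n': "N \<le> n" "2 * N1 \<le> n" "N2 \<le> n" using n by auto
      have "1 \<le> \<eta>\<^sup>2 * real n" using N2 n'(3) \<eta> using order_trans[of "1 / \<eta>\<^sup>2" "real N2" "real n"] by (simp add: field_simps)
      then have "1 \<le> sqrt (\<eta>\<^sup>2 * real n)" by simp
      then have root: "1 \<le> \<eta> * sqrt (real n)" using \<eta> by (simp add: real_sqrt_mult)
      have "\<bar>sqrt (real n) * (\<Sum>j<n. up l j * expo_ev l (n - j) 0) - (\<Sum>j. llt_const l * up l j)\<bar> \<le> e * 1"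
      proof (rule conv[where t = "\<lambda>j k. up l j * expo_ev l k 0" and w = "up l", OF n'(1) _ root up_nonneg])
        fix j k :: nat
        show "\<bar>up l j * expo_ev l k 0\<bar> \<le> C * up l j / sqrt (real k)" if "1 \<le> k"
        proof -
          have "up l j * expo_ev l k 0 \<le> up l j * (C / sqrt (real k))"
            using C1(2)[OF that, of 0] C(2) by (intro mult_left_mono up_nonneg) (auto elim!: order_trans intro!: divide_right_mono)
          then show ?thesis using up_nonneg[of j] expo_ev_nonneg[OF l, of k 0] by (simp add: mult.commute)
        qed
        show "\<bar>sqrt (real k) * (up l j * expo_ev l k 0) - llt_const l * up l j\<bar> \<le> e' * up l j" if "n \<le> 2 * k"
        proof -
          have "N1 \<le> k" using that n'(2) by simp
          then have "up l j * \<bar>sqrt (real k) * expo_ev l k 0 - llt_const l\<bar> \<le> up l j * e'"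
            using \<eta>1 by (intro mult_left_mono up_nonneg N1) auto
          moreover have "sqrt (real k) * (up l j * expo_ev l k 0) - llt_const l * up l j = up l j * (sqrt (real k) * expo_ev l k 0 - llt_const l)"
            by (simp add: algebra_simps)
          ultimately show ?thesis using up_nonneg[of j] by (simp add: abs_mult mult.commute)
        qed
        show "\<bar>llt_const l * up l j\<bar> \<le> C * up l j"
          using C(5) llt_const_pos up_nonneg[of j] by (simp add: abs_mult mult_right_mono)
        show "(\<Sum>j<m. up l j) \<le> C * 1" for m using C2(2)[of m] C(3) by simp
        show "up l j \<le> C * 1\<^sup>2 / (real j * sqrt (real j))" if "1 \<le> j"
          using C3(2)[OF that] C(4) by (auto elim!: order_trans intro!: divide_right_mono)
      qed simp
      then show ?thesis unfolding up_spitzer[symmetric] suminf_mult[OF summable_up] by (simp add: ac_simps)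
    qed
    then show ?case by blast
  qed
qed

text \<open>The k-step factor in Spitzer's identity for \<open>down\<close>, with \<open>v\<close>
  the height x + y before the increment. The increments are negative, where \<open>expo\<close> is
  not multiplicative, so a function of the height remains in place of a scalar.\<close>

definition kernel :: "nat \<Rightarrow> real \<Rightarrow> real" where
  "kernel k v = ev (\<nu> ^ k) (\<lambda>z. indicator {..<0} z * expo l (v + z))"

lemma nonneg_bounded_kernel_integrand: "nonneg_bounded (\<lambda>z. indicator {..<0} z * expo l (v + z))"
  by (intro nonneg_bounded_mult nonneg_bounded_expo_shift' nonneg_bounded_indicator) simp

text \<open>The contribution of increments z \<ge> 0 is subtracted; there the exponential does
  factorise. Both remaining terms are expectations of the unrestricted walk.\<close>

lemma kernel_eq: "kernel k v = (if 0 \<le> v then expo_ev l k v - exp (- l * v) * expo_ev l k 0 else 0)"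
proof (cases "0 \<le> v")
  case True
  have "expo_ev l k v = ev (\<nu> ^ k) (\<lambda>z. indicator {..<0} z * expo l (v + z) + exp (- l * v) * expo l (z + 0))"
    unfolding expo_ev_def
    by (rule arg_cong[of _ _ "ev (\<nu> ^ k)"]) (use True in \<open>auto simp: expo_eq indicator_def algebra_simps exp_add[symmetric] fun_eq_iff\<close>)
  also have "\<dots> = kernel k v + exp (- l * v) * expo_ev l k 0"
    unfolding kernel_def expo_ev_def
    by (subst Bochner_Integration.integral_add)
       (auto intro!: nonneg_bounded_integrable nonneg_bounded_kernel_integrand integrable_mult_right nonneg_bounded_expo' simp del: integrable_mult_right_iff)
  finally show ?thesis using True by simp
next
  case False
  then have "(\<lambda>z. indicator {..<0} z * expo l (v + z)) = (\<lambda>_. 0)" by (auto simp: expo_eq indicator_def)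
  then show ?thesis using False by (simp add: kernel_def)
qed

lemma kernel_bounds: "0 \<le> kernel k v" "kernel k v \<le> indicator {0..} v * expo_ev l k v"
proof -
  show "0 \<le> kernel k v" unfolding kernel_def by (rule ev_nonneg[OF nonneg_bounded_kernel_integrand])
  show "kernel k v \<le> indicator {0..} v * expo_ev l k v"
    using expo_ev_nonneg[OF l, of k 0] by (auto simp: kernel_eq)
qed

lemma measurable_kernel [measurable]: "kernel k \<in> borel_measurable borel"
proof -
  have "nonneg_bounded (\<lambda>x. ev (\<nu> ^ k) (\<lambda>y. expo l (x + y)))"
    by (rule nonneg_bounded_ev_shift[OF nonneg_bounded_expo'])
  then have [measurable]: "expo_ev l k \<in> borel_measurable borel"
    by (auto simp: expo_ev_def add.commute dest!: nonneg_bounded_measurable intro: measurable_cong[THEN iffD1, rotated])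
  show ?thesis unfolding kernel_eq[abs_def] by measurable
qed

lemma nonneg_bounded_kernel: "1 \<le> k \<Longrightarrow> nonneg_bounded (kernel k)"
proof -
  assume k: "1 \<le> k"
  obtain C where C: "C > 0" "\<And>k y. 1 \<le> k \<Longrightarrow> expo_ev l k y \<le> C / sqrt (real k)"
    using expo_ev_bound[OF l] by auto
  have "kernel k v \<le> C / sqrt (real k)" for v
    using kernel_bounds(2)[of k v] C(2)[OF k, of v] C(1) by (cases "0 \<le> v") (auto intro: order_trans[of _ 0])
  then show ?thesis using kernel_bounds(1) by (intro nonneg_boundedI) auto
qed

lemma down_spitzer: "real n * down l x n = (\<Sum>j<n. ev (stay \<nu> {..<0} j) (\<lambda>y. kernel (n - j) (x + y)))"
  unfolding down_def desc.ev_spitzer[OF nonneg_bounded_expo_shift']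
  by (subst sum_reverse_pairs[of "\<lambda>j k. ev (stay \<nu> {..<0} j) (\<lambda>y. kernel k (x + y))", symmetric])
     (simp add: kernel_def add.assoc)

text \<open>The shape of the limit of \<open>sqrt k * kernel k v\<close>: for heights within the
  range of the local limit theorem both expectations in \<open>kernel_eq\<close> have the asymptotic
  constant \<open>llt_const l\<close>.\<close>

definition gap :: "real \<Rightarrow> real" where "gap v = indicator {0..} v - expo l v"

lemma gap_bounds: "0 \<le> gap v" "gap v \<le> indicator {0..} v"
  using l by (auto simp: gap_def expo_eq indicator_def)

lemma nonneg_bounded_gap: "nonneg_bounded (\<lambda>y. gap (x + y))"
proof (rule nonneg_boundedI[of _ 1])
  fix y show "gap (x + y) \<le> 1" using gap_bounds(2)[of "x + y"] by (cases "0 \<le> x + y") auto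
  show "0 \<le> gap (x + y)" by (rule gap_bounds)
qed (simp add: gap_def)

lemma ev_gap: "ev E (\<lambda>y. gap (x + y)) = ev E (desc.below x) - ev E (\<lambda>y. expo l (x + y))"
proof -
  have "(\<lambda>y. gap (x + y)) = (\<lambda>y. desc.below x y - expo l (x + y))" by (simp add: gap_def below_indicator)
  then show ?thesis
    by (simp add: Bochner_Integration.integral_diff nonneg_bounded_integrable nonneg_bounded_expo_shift')
qed

lemma down_le: "down l x n \<le> ev (stay \<nu> {..<0} n) (desc.below x)"
  using ev_gap[of "stay \<nu> {..<0} n" x] ev_nonneg[OF nonneg_bounded_gap, of "stay \<nu> {..<0} n" x] by (simp add: down_def)

lemma summable_down: "0 \<le> x \<Longrightarrow> summable (down l x)"
  by (rule summable_comparison_test'[OF summable_renewal]) (auto simp: down_nonneg down_le)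

text \<open>\<open>conv_limit\<close> at scale 1 + x, weighted by the probabilities of staying
  negative yet not below -x. The limit series sums \<open>gap\<close>, that is, the renewal function
  minus the sum of \<open>down\<close>.\<close>

lemma down_limit:
  assumes e: "0 < e"
  shows "\<exists>\<eta>>0. \<exists>N. \<forall>n\<ge>N. \<forall>x\<ge>0. 1 + x \<le> \<eta> * sqrt (real n) \<longrightarrow>
    \<bar>real n * sqrt (real n) * down l x n - llt_const l * (renewal x - (\<Sum>j. down l x j))\<bar> \<le> e * (1 + x)"
proof -
  obtain C1 where C1: "C1 > 0" "\<And>k y. 1 \<le> k \<Longrightarrow> expo_ev l k y \<le> C1 / sqrt (real k)"
    using expo_ev_bound[OF l] by auto
  obtain C2 where C2: "0 < C2" "\<And>x n. 0 \<le> x \<Longrightarrow> (\<Sum>k\<le>n. ev (stay \<nu> {..<0} k) (desc.below x)) \<le> C2 * (1 + x)"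
    using desc.renewal_le by blast
  obtain C3 where C3: "0 < C3" "\<And>x n. 0 \<le> x \<Longrightarrow> 1 \<le> n \<Longrightarrow> ev (stay \<nu> {..<0} n) (desc.below x) \<le> C3 * (1 + x)\<^sup>2 / (real n * sqrt (real n))"
    using desc.ev_below_le by blast
  define C where "C = 1 + C1 + C2 + C3 + llt_const l"
  have C: "1 \<le> C" "C1 \<le> C" "C2 \<le> C" "C3 \<le> C" "llt_const l \<le> C"
    using C1 C2 C3 llt_const_pos by (auto simp: C_def)
  from conv_limit[OF e C(1)] show ?thesis
  proof (elim exE conjE, goal_cases)
    case (1 e' \<eta>0 N)
    note e' = 1(1) and \<eta>0 = 1(2) and conv = 1(3)[rule_format]
    obtain N1 \<eta>1 where \<eta>1: "0 < \<eta>1" and N1: "\<And>k y. N1 \<le> k \<Longrightarrow> \<bar>y\<bar> \<le> \<eta>1 * sqrt (real k) \<Longrightarrow> \<bar>sqrt (real k) * expo_ev l k y - llt_const l\<bar> \<le> e' / 2"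
      using local_limit[OF l, of "e' / 2"] e' unfolding llt_const_def by (metis half_gt_zero)
    \<comment> \<open>Half of \<open>\<eta>1\<close>, since k may be as small as n/2, where sqrt n
      is at most 2 sqrt k.\<close>
    define \<eta> where "\<eta> = min \<eta>0 (\<eta>1 / 2)"
    have \<eta>: "0 < \<eta>" "\<eta> \<le> \<eta>0" "\<eta> \<le> \<eta>1 / 2" using \<eta>0 \<eta>1 by (auto simp: \<eta>_def)
    have "\<bar>real n * sqrt (real n) * down l x n - llt_const l * (renewal x - (\<Sum>j. down l x j))\<bar> \<le> e * (1 + x)"
      if n: "max N (2 * N1 + 1) \<le> n" and x: "0 \<le> x" and xn: "1 + x \<le> \<eta> * sqrt (real n)" for n x
    proof -
      define w where "w = (\<lambda>j. ev (stay \<nu> {..<0} j) (desc.below x))"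
      define t where "t = (\<lambda>j k. ev (stay \<nu> {..<0} j) (\<lambda>y. kernel k (x + y)))"
      define \<tau> where "\<tau> = (\<lambda>j. ev (stay \<nu> {..<0} j) (\<lambda>y. llt_const l * gap (x + y)))"
      have n': "N \<le> n" "2 * N1 \<le> n" "1 \<le> n" using n by auto
      have w0: "0 \<le> w j" for j unfolding w_def by (rule ev_nonneg) simp
      have nbc: "nonneg_bounded (\<lambda>y. c * desc.below x y)" if "0 \<le> c" for c
        using that by (intro nonneg_bounded_mult) auto
      have evc: "ev (stay \<nu> {..<0} j) (\<lambda>y. c * desc.below x y) = c * w j" for c j
        unfolding w_def by simp
      have nbk: "nonneg_bounded (\<lambda>y. kernel k (x + y))" if "1 \<le> k" for k
        by (rule nonneg_bounded_shift[OF nonneg_bounded_kernel[OF that]])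
      have nbg: "nonneg_bounded (\<lambda>y. llt_const l * gap (x + y))"
        using llt_const_pos by (intro nonneg_bounded_mult nonneg_bounded_gap) auto
      have "\<bar>sqrt (real n) * (\<Sum>j<n. t j (n - j)) - (\<Sum>j. \<tau> j)\<bar> \<le> e * (1 + x)"
      proof (rule conv[where w = w, OF n'(1) _ _ w0])
        show "1 + x \<le> \<eta>0 * sqrt (real n)" by (rule order_trans[OF xn]) (use \<eta> in \<open>simp add: mult_right_mono\<close>)
        show "1 \<le> 1 + x" using x by simp
        fix j k :: nat
        show "\<bar>t j k\<bar> \<le> C * w j / sqrt (real k)" if k: "1 \<le> k"
        proof -
          have "t j k \<le> ev (stay \<nu> {..<0} j) (\<lambda>y. C / sqrt (real k) * desc.below x y)"
            unfolding t_def
          proof (rule ev_mono[OF nbk[OF k] nbc])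
            fix y
            have "expo_ev l k (x + y) \<le> C / sqrt (real k)"
              by (rule order_trans[OF C1(2)[OF k]]) (use C in \<open>auto intro: divide_right_mono\<close>)
            then show "kernel k (x + y) \<le> C / sqrt (real k) * desc.below x y"
              using kernel_bounds(2)[of k "x + y"] by (cases "0 \<le> x + y") (auto simp: below_indicator)
          qed (use C in simp)
          moreover have "0 \<le> t j k" unfolding t_def by (rule ev_nonneg[OF nbk[OF k]])
          ultimately show ?thesis unfolding evc by simp
        qed
        show "\<bar>sqrt (real k) * t j k - \<tau> j\<bar> \<le> e' * w j" if nk: "n \<le> 2 * k"
        proof -
          have k: "1 \<le> k" "N1 \<le> k" using nk n' by auto
          have "sqrt (real n) \<le> sqrt (4 * real k)" using nk by (intro real_sqrt_le_mono) simp
          then have nk': "sqrt (real n) \<le> 2 * sqrt (real k)" by (simp add: real_sqrt_mult)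
          have "\<eta> * sqrt (real n) \<le> \<eta>1 / 2 * (2 * sqrt (real k))"
            using \<eta> nk' by (intro mult_mono) auto
          then have xk: "x \<le> \<eta>1 * sqrt (real k)" using xn by simp
          have i1: "integrable (mea (stay \<nu> {..<0} j)) (\<lambda>y. sqrt (real k) * kernel k (x + y))"
            by (intro integrable_mult_right nonneg_bounded_integrable nbk k)
          have i2: "integrable (mea (stay \<nu> {..<0} j)) (\<lambda>y. llt_const l * gap (x + y))"
            by (intro nonneg_bounded_integrable nbg)
          have "sqrt (real k) * t j k - \<tau> j = ev (stay \<nu> {..<0} j) (\<lambda>y. sqrt (real k) * kernel k (x + y) - llt_const l * gap (x + y))"
            unfolding t_def \<tau>_def Bochner_Integration.integral_diff[OF i1 i2] by simp
          then have "\<bar>sqrt (real k) * t j k - \<tau> j\<bar> \<le> ev (stay \<nu> {..<0} j) (\<lambda>y. \<bar>sqrt (real k) * kernel k (x + y) - llt_const l * gap (x + y)\<bar>)"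
            by (simp only: integral_abs_bound)
          also have "\<dots> \<le> ev (stay \<nu> {..<0} j) (\<lambda>y. e' * desc.below x y)"
          proof (rule integral_mono_AE)
            show "integrable (mea (stay \<nu> {..<0} j)) (\<lambda>y. \<bar>sqrt (real k) * kernel k (x + y) - llt_const l * gap (x + y)\<bar>)"
              by (intro integrable_abs Bochner_Integration.integrable_diff i1 i2)
            show "integrable (mea (stay \<nu> {..<0} j)) (\<lambda>y. e' * desc.below x y)"
              by (rule nonneg_bounded_integrable[OF nbc]) (use e' in simp)
            \<comment> \<open>The position is nonpositive here, so a height x + y at which the
              integrand does not vanish lies in [0, x], within the range of the local limit
              theorem.\<close>
            have "AE y in mea (stay \<nu> {..<0} j). y \<in> {..0}" using conc_nonpos by (simp add: concentrated_def)
            then show "AE y in mea (stay \<nu> {..<0} j). \<bar>sqrt (real k) * kernel k (x + y) - llt_const l * gap (x + y)\<bar> \<le> e' * desc.below x y"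
            proof eventually_elim
              case (elim y)
              show ?case
              proof (cases "0 \<le> x + y")
                case True
                define v where "v = x + y"
                have v: "0 \<le> v" "v \<le> \<eta>1 * sqrt (real k)" using True elim xk by (auto simp: v_def)
                define q where "q = exp (- l * v)"
                have q: "0 \<le> q" "q \<le> 1" using v l by (auto simp: q_def)
                have a: "\<bar>sqrt (real k) * expo_ev l k v - llt_const l\<bar> \<le> e' / 2" using v by (intro N1 k) simp
                have b: "\<bar>sqrt (real k) * expo_ev l k 0 - llt_const l\<bar> \<le> e' / 2" using \<eta>1 by (intro N1 k) simp
                have "sqrt (real k) * kernel k v - llt_const l * gap v
                  = (sqrt (real k) * expo_ev l k v - llt_const l) - q * (sqrt (real k) * expo_ev l k 0 - llt_const l)"
                  using v by (simp add: kernel_eq gap_def expo_eq q_def algebra_simps)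
                also have "\<bar>\<dots>\<bar> \<le> \<bar>sqrt (real k) * expo_ev l k v - llt_const l\<bar> + q * \<bar>sqrt (real k) * expo_ev l k 0 - llt_const l\<bar>"
                  using q abs_triangle_ineq4 by (metis abs_mult abs_of_nonneg)
                also have "\<dots> \<le> e' / 2 + 1 * (e' / 2)" by (intro add_mono mult_mono a b q) auto
                finally show ?thesis using True by (simp add: v_def below_indicator)
              qed (simp add: kernel_eq gap_def expo_eq below_indicator)
            qed
          qed
          finally show ?thesis unfolding evc .
        qed
        show "\<bar>\<tau> j\<bar> \<le> C * w j"
        proof -
          have "\<tau> j \<le> ev (stay \<nu> {..<0} j) (\<lambda>y. C * desc.below x y)"
            unfolding \<tau>_def
            by (rule ev_mono[OF nbg nbc]) (use C llt_const_pos gap_bounds in \<open>auto simp: below_indicator intro!: mult_mono\<close>)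
          moreover have "0 \<le> \<tau> j" unfolding \<tau>_def by (rule ev_nonneg[OF nbg])
          ultimately show ?thesis unfolding evc by simp
        qed
        show "(\<Sum>j<m. w j) \<le> C * (1 + x)" for m
        proof -
          have "(\<Sum>j<m. w j) \<le> (\<Sum>j\<le>m. w j)" by (rule sum_mono2) (auto simp: w0)
          also have "\<dots> \<le> C2 * (1 + x)" unfolding w_def by (rule C2(2)[OF x])
          also have "\<dots> \<le> C * (1 + x)" using C x by (intro mult_right_mono) auto
          finally show ?thesis .
        qed
        show "w j \<le> C * (1 + x)\<^sup>2 / (real j * sqrt (real j))" if j: "1 \<le> j"
          unfolding w_def
          by (rule order_trans[OF C3(2)[OF x j]]) (use C in \<open>auto intro!: divide_right_mono mult_right_mono\<close>)
      qed
      moreover have "(\<Sum>j<n. t j (n - j)) = real n * down l x n" unfolding t_def down_spitzer ..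
      moreover have "(\<Sum>j. \<tau> j) = llt_const l * (renewal x - (\<Sum>j. down l x j))"
      proof -
        have "\<tau> j = llt_const l * (w j - down l x j)" for j unfolding \<tau>_def w_def down_def ev_gap[symmetric] by simp
        then have "(\<Sum>j. \<tau> j) = llt_const l * (\<Sum>j. w j - down l x j)"
          using summable_renewal[OF x] summable_down[OF x] by (simp add: w_def suminf_mult summable_diff)
        then show ?thesis
          using summable_renewal[OF x] summable_down[OF x] by (simp add: w_def renewal_def suminf_diff)
      qed
      ultimately show ?thesis by (simp add: ac_simps)
    qed
    with \<eta>(1) show ?case by blast
  qed
qed

definition killed :: "real \<Rightarrow> nat \<Rightarrow> real" where
  "killed x n = ev (stay \<nu> {y. 0 \<le> x + y} n) (\<lambda>y. expo l (x + y))"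

text \<open>The height at time n is the height of the minimum plus the climb after it, both
  nonnegative. The exponential factorises over them, and the measure factorisation becomes a
  convolution of numbers.\<close>

lemma killed_eq: "0 \<le> x \<Longrightarrow> killed x n = (\<Sum>k\<le>n. down l x k * up l (n - k))"
proof -
  assume x: "0 \<le> x"
  define D where "D = {y. 0 \<le> x + y}"
  have D [measurable, simp]: "D \<in> sets borel" by (simp add: D_def)
  have "stay \<nu> D n = (stayF \<nu> D) $ n" by simp
  also have "\<dots> = (\<Sum>k\<le>n. restr D (stay \<nu> {..<0} k) * stay \<nu> {0..} (n - k))"
    unfolding asc.stay_factorisation[OF admissible_half_line[OF x, folded D_def]] by (simp add: fps_mult_nth atLeast0AtMost)
  finally have "killed x n = (\<Sum>k\<le>n. ev (restr D (stay \<nu> {..<0} k) * stay \<nu> {0..} (n - k)) (\<lambda>y. expo l (x + y)))"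
    unfolding killed_def D_def[symmetric] by (simp add: ev_sum[OF nonneg_bounded_expo_shift'])
  moreover have "ev (restr D (stay \<nu> {..<0} k) * stay \<nu> {0..} m) (\<lambda>y. expo l (x + y)) = down l x k * up l m" for k m
  proof -
    have "ev (restr D (stay \<nu> {..<0} k) * stay \<nu> {0..} m) (\<lambda>y. expo l (x + y))
        = ev (restr D (stay \<nu> {..<0} k)) (\<lambda>y. ev (stay \<nu> {0..} m) (\<lambda>z. expo l (x + (y + z))))"
      by (rule ev_times[OF nonneg_bounded_expo_shift'])
    also have "\<dots> = ev (restr D (stay \<nu> {..<0} k)) (\<lambda>y. expo l (x + y) * up l m)"
    proof (rule ev_cong_conc[OF _ _ concentrated_restr[OF D]])
      fix y assume y: "y \<in> D"
      have "ev (stay \<nu> {0..} m) (\<lambda>z. expo l (x + (y + z))) = ev (stay \<nu> {0..} m) (\<lambda>z. expo l (x + y) * expo l z)"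
        by (rule ev_cong_conc[OF _ _ conc_nonneg]) (use y in \<open>auto simp: D_def expo_eq algebra_simps exp_add[symmetric]\<close>)
      then show "ev (stay \<nu> {0..} m) (\<lambda>z. expo l (x + (y + z))) = expo l (x + y) * up l m" by (simp add: up_def)
    qed (use nonneg_bounded_measurable[OF nonneg_bounded_ev_shift[OF nonneg_bounded_expo_shift', of "stay \<nu> {0..} m" x]] in measurable)
    also have "\<dots> = ev (restr D (stay \<nu> {..<0} k)) (\<lambda>y. expo l (x + y)) * up l m" by simp
    also have "ev (restr D (stay \<nu> {..<0} k)) (\<lambda>y. expo l (x + y)) = ev (stay \<nu> {..<0} k) (\<lambda>y. indicator D y * expo l (x + y))"
      by (rule ev_restr) auto
    also have "(\<lambda>y. indicator D y * expo l (x + y)) = (\<lambda>y. expo l (x + y))"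
      by (auto simp: D_def expo_eq indicator_def)
    finally show ?thesis by (simp add: down_def)
  qed
  ultimately show ?thesis by simp
qed

text \<open>Of the two contributions to the limit, one has the sum of \<open>down\<close> as a
  factor and the other the renewal function minus this sum, so the sum of \<open>down\<close>
  cancels and the renewal function remains.\<close>

theorem killed_limit:
  assumes e: "0 < e"
  shows "\<exists>\<eta>>0. \<exists>N. \<forall>n\<ge>N. \<forall>x\<ge>0. 1 + x \<le> \<eta> * sqrt (real n) \<longrightarrow>
    \<bar>real n * sqrt (real n) * killed x n - llt_const l * (\<Sum>j. up l j) * renewal x\<bar> \<le> e * (1 + x)"
proof -
  define c where "c = llt_const l"
  have c: "0 < c" using llt_const_pos by (simp add: c_def)
  obtain C1 where C1: "0 < C1" "\<And>m. (\<Sum>j<m. up l j) \<le> C1" using up_sum_le by auto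
  obtain C2 where C2: "0 < C2" "\<And>x n. 0 \<le> x \<Longrightarrow> (\<Sum>k\<le>n. ev (stay \<nu> {..<0} k) (desc.below x)) \<le> C2 * (1 + x)"
    using desc.renewal_le by blast
  define C where "C = 1 + C1 + C2 + c * C1 + c * C2"
  have C: "1 \<le> C" "C1 \<le> C" "C2 \<le> C" "c * C1 \<le> C" "c * C2 \<le> C"
    using C1 C2 c by (auto simp: C_def)
  from conv_two_sided[OF e C(1)] show ?thesis
  proof (elim exE conjE, goal_cases)
    case (1 e' \<kappa> N)
    note e' = 1(1) and \<kappa> = 1(2) and conv = 1(3)[rule_format]
    obtain N1 where N1: "\<And>n. N1 \<le> n \<Longrightarrow> \<bar>real n * sqrt (real n) * up l n - c * (\<Sum>j. up l j)\<bar> \<le> e'"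
      using up_limit[OF e'] unfolding c_def by blast
    obtain \<eta>1 N2 where \<eta>1: "0 < \<eta>1" and N2: "\<And>n x. N2 \<le> n \<Longrightarrow> 0 \<le> x \<Longrightarrow> 1 + x \<le> \<eta>1 * sqrt (real n) \<Longrightarrow>
      \<bar>real n * sqrt (real n) * down l x n - c * (renewal x - (\<Sum>j. down l x j))\<bar> \<le> e' * (1 + x)"
      using down_limit[OF e'] unfolding c_def by blast
    obtain N3 where N3: "(real N1 + real N2) / \<kappa> \<le> real N3" using real_arch_simple by blast
    \<comment> \<open>The limit of \<open>down\<close> is needed at all times k \<ge>
      \<open>\<kappa> * n\<close>, which costs the factor \<open>sqrt \<kappa>\<close>.\<close>
    define \<eta> where "\<eta> = \<eta>1 * sqrt \<kappa>"
    have "\<bar>real n * sqrt (real n) * killed x n - c * (\<Sum>j. up l j) * renewal x\<bar> \<le> e * (1 + x)"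
      if n: "max N N3 \<le> n" and x: "0 \<le> x" and xn: "1 + x \<le> \<eta> * sqrt (real n)" for n x
    proof -
      define \<Psi> where "\<Psi> = c * (renewal x - (\<Sum>j. down l x j))"
      define A where "A = c * (\<Sum>j. up l j)"
      have n': "N \<le> n" "N3 \<le> n" using n by auto
      have big: "N1 \<le> k" "N2 \<le> k" "sqrt \<kappa> * sqrt (real n) \<le> sqrt (real k)" if k: "\<kappa> * real n \<le> real k" for k
      proof -
        have "real N1 + real N2 \<le> \<kappa> * real N3" using N3 \<kappa> by (simp add: field_simps)
        also have "\<dots> \<le> \<kappa> * real n" using n' \<kappa> by (intro mult_left_mono) auto
        also note k
        finally show "N1 \<le> k" "N2 \<le> k" by auto
        show "sqrt \<kappa> * sqrt (real n) \<le> sqrt (real k)" using k by (simp flip: real_sqrt_mult)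
      qed
      have sd: "(\<Sum>j. down l x j) \<le> renewal x"
        unfolding renewal_def by (rule suminf_le[OF down_le summable_down[OF x] summable_renewal[OF x]])
      have sd0: "0 \<le> (\<Sum>j. down l x j)" by (rule suminf_nonneg[OF summable_down[OF x] down_nonneg])
      have ren: "renewal x \<le> C2 * (1 + x)"
        unfolding renewal_def
      proof (rule suminf_le_const[OF summable_renewal[OF x]])
        fix n
        have "(\<Sum>j<n. ev (stay \<nu> {..<0} j) (desc.below x)) \<le> (\<Sum>j\<le>n. ev (stay \<nu> {..<0} j) (desc.below x))"
          by (rule sum_mono2) (auto intro: ev_nonneg)
        then show "(\<Sum>j<n. ev (stay \<nu> {..<0} j) (desc.below x)) \<le> C2 * (1 + x)"
          using C2(2)[OF x, of n] by linarith
      qed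
      have ups: "(\<Sum>j. up l j) \<le> C1" by (rule suminf_le_const[OF summable_up C1(2)])
      have "\<bar>real n * sqrt (real n) * (\<Sum>k\<le>n. down l x k * up l (n - k)) - (A * (\<Sum>k. down l x k) + \<Psi> * (\<Sum>j. up l j))\<bar> \<le> e * (1 + x)"
      proof (rule conv[OF n'(1) _ down_nonneg up_nonneg])
        show "1 \<le> 1 + x" using x by simp
        fix k
        show "\<bar>real k * sqrt (real k) * down l x k - \<Psi>\<bar> \<le> e' * (1 + x)" if k: "\<kappa> * real n \<le> real k"
        proof -
          have "\<eta> * sqrt (real n) \<le> \<eta>1 * sqrt (real k)"
            unfolding \<eta>_def mult.assoc using \<eta>1 big(3)[OF k] by (intro mult_left_mono) auto
          with xn have "1 + x \<le> \<eta>1 * sqrt (real k)" by linarith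
          from N2[OF big(2)[OF k] x this] show ?thesis unfolding \<Psi>_def .
        qed
        show "\<bar>real k * sqrt (real k) * up l k - A\<bar> \<le> e'" if k: "\<kappa> * real n \<le> real k"
          unfolding A_def by (rule N1[OF big(1)[OF k]])
      next
        show "0 \<le> \<Psi>" unfolding \<Psi>_def using c sd by simp
        have "\<Psi> \<le> c * (C2 * (1 + x))" unfolding \<Psi>_def using c sd0 ren by (intro mult_left_mono) auto
        also have "\<dots> = (c * C2) * (1 + x)" by simp
        also have "\<dots> \<le> C * (1 + x)" using C x by (intro mult_right_mono) auto
        finally show "\<Psi> \<le> C * (1 + x)" .
        show "0 \<le> A" unfolding A_def using c suminf_nonneg[OF summable_up up_nonneg] by simp
        have "A \<le> c * C1" unfolding A_def using c ups by (intro mult_left_mono) auto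
        then show "A \<le> C" using C by simp
        show "(\<Sum>j<m. up l j) \<le> C" for m using C1(2)[of m] C by simp
        show "(\<Sum>j<m. down l x j) \<le> C * (1 + x)" for m
        proof -
          have "(\<Sum>j<m. down l x j) \<le> (\<Sum>j. down l x j)"
            by (rule sum_le_suminf[OF summable_down[OF x]]) (auto simp: down_nonneg)
          also note sd also note ren
          also have "C2 * (1 + x) \<le> C * (1 + x)" using C x by (intro mult_right_mono) auto
          finally show ?thesis .
        qed
      qed
      moreover have "A * (\<Sum>k. down l x k) + \<Psi> * (\<Sum>j. up l j) = c * (\<Sum>j. up l j) * renewal x"
        by (simp add: A_def \<Psi>_def algebra_simps)
      ultimately show ?thesis unfolding killed_eq[OF x] by simp
    qed
    moreover have "0 < \<eta>" using \<eta>1 \<kappa> by (simp add: \<eta>_def)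
    ultimately show ?case unfolding c_def by blast
  qed
qed

end

end

section \<open>Identification of the limit\<close>

context walk_law
begin

lemma mass_restr_half_line: "mass (restr {y. 0 \<le> x + y} E) = ev E (desc.below x)"
proof -
  have "mass (restr {y. 0 \<le> x + y} E) = ev (restr {y. 0 \<le> x + y} E) (\<lambda>_. 1)" by (simp add: ev_const)
  also have "\<dots> = ev E (\<lambda>y. indicator {y. 0 \<le> x + y} y * 1)" by (rule ev_restr) auto
  also have "(\<lambda>y. indicator {y. 0 \<le> x + y} y * 1) = desc.below x" by (auto simp: desc.below_eq indicator_def)
  finally show ?thesis .
qed

text \<open>\<open>leave_moment\<close> for the half-line from -x upwards: the left side is
  \<open>V\<close>, a mean exit height times a mean number of records. The two lower bounds later
  turn errors of size 1 + x into relative ones.\<close>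

lemma exit_value:
  assumes x: "0 \<le> x"
  shows "- (\<integral>\<omega>. stopped_value (walk coord) (exit_time (walk coord) x) \<omega> \<partial>PiM {1..} (\<lambda>_. mea \<nu>)) = asc.exit_mean * renewal x"
    and "x \<le> asc.exit_mean * renewal x" "1 \<le> renewal x"
proof -
  interpret W: iid_walk "PiM {1..} (\<lambda>_. mea \<nu>)" coord \<nu> by (rule iid_walk_coord) simp
  note L = asc.leave_moment[OF admissible_half_line[OF x], of x, unfolded mass_restr_half_line, folded renewal_def]
  have "- (\<integral>\<omega>. stopped_value (walk coord) (exit_time (walk coord) x) \<omega> \<partial>PiM {1..} (\<lambda>_. mea \<nu>))
      = enn2real (\<Sum>n. nni (leave \<nu> {y. 0 \<le> x + y} n) (\<lambda>y. ennreal \<bar>y\<bar>))"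
    by (rule W.integral_stopped_value[of 1]) (use x in \<open>auto simp: fun_eq_iff\<close>)
  also have "\<dots> = asc.exit_mean * renewal x" by (rule L(1)) (use x summable_renewal[OF x] in auto)
  finally show "- (\<integral>\<omega>. stopped_value (walk coord) (exit_time (walk coord) x) \<omega> \<partial>PiM {1..} (\<lambda>_. mea \<nu>)) = asc.exit_mean * renewal x" .
  show "x \<le> asc.exit_mean * renewal x" by (rule L(2)) (use x summable_renewal[OF x] in auto)
  show "1 \<le> renewal x" by (rule L(3)) (use x summable_renewal[OF x] in auto)
qed

lemma summable_dual_renewal: "0 \<le> t \<Longrightarrow> summable (\<lambda>n. ev (stay \<nu> {0..} n) (asc.below t))"
proof -
  assume x: "0 \<le> t"
  obtain C where "\<And>n. (\<Sum>k\<le>n. ev (stay \<nu> {0..} k) (asc.below t)) \<le> C * (1 + t)"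
    using asc.renewal_le x by blast
  then show ?thesis by (intro bounded_imp_summable[of _ "C * (1 + t)"]) (auto intro: ev_nonneg)
qed

lemma dual_exit_value:
  assumes t: "0 \<le> t"
  shows "- (\<integral>\<omega>. stopped_value (dual_walk coord) (exit_time (dual_walk coord) t) \<omega> \<partial>PiM {1..} (\<lambda>_. mea \<nu>))
    = desc.exit_mean * (\<Sum>n. ev (stay \<nu> {0..} n) (asc.below t))"
proof -
  interpret W: iid_walk "PiM {1..} (\<lambda>_. mea \<nu>)" coord \<nu> by (rule iid_walk_coord) simp
  define D where "D = {y. 0 \<le> t + -1 * y}"
  have D: "desc.admissible D" using t by (auto simp: desc.admissible_def D_def)
  have m: "mass (restr D E) = ev E (asc.below t)" for E
  proof -
    have "mass (restr D E) = ev (restr D E) (\<lambda>_. 1)" by (simp add: ev_const)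
    also have "\<dots> = ev E (\<lambda>y. indicator D y * 1)" by (rule ev_restr) (auto simp: D_def)
    also have "(\<lambda>y. indicator D y * 1) = asc.below t" by (auto simp: asc.below_eq indicator_def D_def)
    finally show ?thesis .
  qed
  have "- (\<integral>\<omega>. stopped_value (dual_walk coord) (exit_time (dual_walk coord) t) \<omega> \<partial>PiM {1..} (\<lambda>_. mea \<nu>))
      = enn2real (\<Sum>n. nni (leave \<nu> D n) (\<lambda>y. ennreal \<bar>y\<bar>))"
    by (rule W.integral_stopped_value[of "-1"]) (use t in \<open>auto simp: fun_eq_iff dual_walk_def D_def\<close>)
  also have "\<dots> = desc.exit_mean * (\<Sum>n. mass (restr D (stay \<nu> {0..} n)))"
    by (rule desc.leave_moment(1)[OF D, of t]) (use t summable_dual_renewal[OF t] in \<open>auto simp: D_def[symmetric] m, auto simp: D_def\<close>)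
  finally show ?thesis by (simp add: m)
qed

context
  fixes l :: real assumes l: "0 < l"
begin

lemma measurable_dual_renewal [measurable]: "(\<lambda>t. ev E (asc.below t)) \<in> borel_measurable borel"
proof (rule sigma_finite_measure.borel_measurable_lebesgue_integral[OF sigma_finite_mea])
  have "(\<lambda>p. if snd p \<le> fst p then 1 else 0 :: real) \<in> borel_measurable (borel \<Otimes>\<^sub>M mea E)" by measurable
  then show "(\<lambda>(t, y). asc.below t y) \<in> borel_measurable (borel \<Otimes>\<^sub>M mea E)"
    by (simp add: case_prod_beta asc.below_eq)
qed

lemma nn_integral_expo_shift: "(\<integral>\<^sup>+t. ennreal (expo l (t - y)) \<partial>lborel) = ennreal (1 / l)"
proof -
  have "(\<integral>\<^sup>+t. ennreal (expo l (t - y)) \<partial>lborel) = (\<integral>\<^sup>+t. ennreal (expo l t) \<partial>lborel)"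
    by (subst nn_integral_real_affine[where c = 1 and t = y]) auto
  also have "\<dots> = ennreal (integral\<^sup>L lborel (expo l))"
    using expo_integral[OF l] by (intro nn_integral_eq_integral) (auto simp: has_bochner_integral_iff)
  finally show ?thesis using expo_integral[OF l] by (simp add: has_bochner_integral_iff)
qed

text \<open>Fubini: integrating \<open>exp (- l * t)\<close> over t \<ge> y gives
  \<open>exp (- l * y) / l\<close>. Summed over n, this identifies the sum of \<open>up\<close> with
  the Laplace integral of the dual renewal function.\<close>

lemma nn_integral_expo_below:
  "(\<integral>\<^sup>+t. ennreal (expo l t * ev (stay \<nu> {0..} n) (asc.below t)) \<partial>lborel) = ennreal (up l n / l)"
proof -
  define E where "E = stay \<nu> {0..} n"
  interpret E: finite_measure "mea E" by simp
  interpret P: pair_sigma_finite "mea E" lborel ..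
  have [measurable]: "(\<lambda>p. asc.below (snd p) (fst p)) \<in> borel_measurable (mea E \<Otimes>\<^sub>M lborel)"
    unfolding asc.below_eq by measurable
  have "(\<integral>\<^sup>+t. ennreal (expo l t * ev E (asc.below t)) \<partial>lborel) = (\<integral>\<^sup>+t. \<integral>\<^sup>+y. ennreal (expo l t * asc.below t y) \<partial>mea E \<partial>lborel)"
  proof (rule nn_integral_cong)
    fix t
    have "ennreal (expo l t * ev E (asc.below t)) = ennreal (ev E (\<lambda>y. expo l t * asc.below t y))" by simp
    also have "\<dots> = nni E (\<lambda>y. ennreal (expo l t * asc.below t y))"
      by (intro ennreal_ev nonneg_bounded_mult) auto
    finally show "ennreal (expo l t * ev E (asc.below t)) = nni E (\<lambda>y. ennreal (expo l t * asc.below t y))" .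
  qed
  also have "\<dots> = (\<integral>\<^sup>+y. \<integral>\<^sup>+t. ennreal (expo l t * asc.below t y) \<partial>lborel \<partial>mea E)"
    by (rule P.Fubini') measurable
  also have "\<dots> = (\<integral>\<^sup>+y. ennreal (expo l y) * ennreal (1 / l) \<partial>mea E)"
  proof (rule concentrated_nni_cong[OF conc_nonneg[of n, folded E_def]])
    fix y :: real assume y: "y \<in> {0..}"
    have "expo l t * asc.below t y = expo l y * expo l (t - y)" for t
      using y by (auto simp: expo_eq asc.below_eq algebra_simps exp_add[symmetric])
    then have "(\<integral>\<^sup>+t. ennreal (expo l t * asc.below t y) \<partial>lborel) = (\<integral>\<^sup>+t. ennreal (expo l y) * ennreal (expo l (t - y)) \<partial>lborel)"
      by (simp add: ennreal_mult)
    also have "\<dots> = ennreal (expo l y) * ennreal (1 / l)"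
      by (subst nn_integral_cmult) (auto simp: nn_integral_expo_shift)
    finally show "(\<integral>\<^sup>+t. ennreal (expo l t * asc.below t y) \<partial>lborel) = ennreal (expo l y) * ennreal (1 / l)" .
  qed
  also have "\<dots> = nni E (\<lambda>y. ennreal (expo l y)) * ennreal (1 / l)" by (rule nn_integral_multc) simp
  also have "nni E (\<lambda>y. ennreal (expo l y)) = ennreal (up l n)"
    unfolding up_def E_def by (rule ennreal_ev[symmetric]) (rule nonneg_bounded_expo'[OF l])
  also have "\<dots> * ennreal (1 / l) = ennreal (up l n / l)"
    using l up_nonneg[OF l, of n] by (simp flip: ennreal_mult)
  finally show ?thesis unfolding E_def .
qed

lemma dual_exit_integral:
  assumes g: "\<And>t. 0 \<le> t \<Longrightarrow> g t = desc.exit_mean * (\<Sum>n. ev (stay \<nu> {0..} n) (asc.below t))"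
  shows "(LBINT t:{0..}. exp (- l * t) * g t) = desc.exit_mean * (\<Sum>n. up l n) / l"
proof -
  define r where "r = (\<lambda>n t. ev (stay \<nu> {0..} n) (asc.below t))"
  have r0: "0 \<le> r n t" for n t unfolding r_def by (rule ev_nonneg) simp
  have [measurable]: "r n \<in> borel_measurable borel" for n unfolding r_def by measurable
  have sum: "summable (\<lambda>n. expo l t * r n t)" for t
    using summable_dual_renewal[of t] by (cases "0 \<le> t") (auto simp: r_def expo_eq intro: summable_mult)
  have "(\<integral>\<^sup>+t. ennreal (\<Sum>n. expo l t * r n t) \<partial>lborel) = (\<integral>\<^sup>+t. (\<Sum>n. ennreal (expo l t * r n t)) \<partial>lborel)"
    using sum r0 by (intro nn_integral_cong suminf_ennreal2[symmetric]) auto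
  also have "\<dots> = (\<Sum>n. \<integral>\<^sup>+t. ennreal (expo l t * r n t) \<partial>lborel)"
    by (rule nn_integral_suminf) measurable
  also have "\<dots> = (\<Sum>n. ennreal (up l n / l))" unfolding r_def nn_integral_expo_below ..
  also have "\<dots> = ennreal (\<Sum>n. up l n / l)"
    using l by (intro suminf_ennreal2 summable_divide summable_up[OF l]) (auto simp: up_nonneg[OF l])
  finally have nn: "(\<integral>\<^sup>+t. ennreal (\<Sum>n. expo l t * r n t) \<partial>lborel) = ennreal ((\<Sum>n. up l n) / l)"
    by (simp add: suminf_divide[OF summable_up[OF l]])
  have "(\<lambda>t. indicator {0..} t *\<^sub>R (exp (- l * t) * g t)) = (\<lambda>t. desc.exit_mean * (\<Sum>n. expo l t * r n t))"
  proof
    fix t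
    show "indicator {0..} t *\<^sub>R (exp (- l * t) * g t) = desc.exit_mean * (\<Sum>n. expo l t * r n t)"
    proof (cases "0 \<le> t")
      case True
      then show ?thesis using g[OF True] suminf_mult[OF summable_dual_renewal[OF True]] by (simp add: expo_eq r_def)
    qed (simp add: expo_eq)
  qed
  then have "(LBINT t:{0..}. exp (- l * t) * g t) = desc.exit_mean * (\<integral>t. (\<Sum>n. expo l t * r n t) \<partial>lborel)"
    unfolding set_lebesgue_integral_def by simp
  also have "(\<integral>t. (\<Sum>n. expo l t * r n t) \<partial>lborel) = enn2real (\<integral>\<^sup>+t. ennreal (\<Sum>n. expo l t * r n t) \<partial>lborel)"
    by (rule integral_eq_nn_integral) (auto intro!: suminf_nonneg sum r0 mult_nonneg_nonneg)
  also have "\<dots> = (\<Sum>n. up l n) / l"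
    unfolding nn using l by (simp add: suminf_nonneg[OF summable_up[OF l]] up_nonneg[OF l])
  finally show ?thesis by simp
qed

lemma suminf_up_ge_1: "1 \<le> (\<Sum>n. up l n)"
proof -
  have "up l 0 \<le> (\<Sum>n. up l n)"
    using sum_le_suminf[OF summable_up[OF l], of "{0}"] up_nonneg[OF l] by auto
  then show ?thesis by (simp add: up_def expo_eq)
qed

lemma killed_equiv:
  assumes e: "0 < e"
  shows "\<exists>\<eta>>0. \<exists>N. \<forall>n\<ge>N. \<forall>x\<ge>0. 1 + x \<le> \<eta> * sqrt (real n) \<longrightarrow>
    \<bar>real n * sqrt (real n) * killed l x n / (llt_const l * (\<Sum>j. up l j) * renewal x) - 1\<bar> \<le> e"
proof -
  \<comment> \<open>\<open>m\<close> is such that \<open>1 + x \<le> m * renewal x\<close>, which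
    combines the two lower bounds on the renewal function.\<close>
  define c m where "c = llt_const l * (\<Sum>j. up l j)" and "m = 1 + \<bar>asc.exit_mean\<bar>"
  have c: "0 < c" using llt_const_pos[OF l] suminf_up_ge_1 by (simp add: c_def)
  have m: "0 < m" by (simp add: m_def)
  have "0 < e * c / m" using e c m by simp
  from killed_limit[OF l this] obtain \<eta> N where "0 < \<eta>" and
    lim: "\<And>n x. N \<le> n \<Longrightarrow> 0 \<le> x \<Longrightarrow> 1 + x \<le> \<eta> * sqrt (real n) \<Longrightarrow>
      \<bar>real n * sqrt (real n) * killed l x n - c * renewal x\<bar> \<le> e * c / m * (1 + x)"
    unfolding c_def by blast
  have "\<bar>real n * sqrt (real n) * killed l x n / (c * renewal x) - 1\<bar> \<le> e"
    if "N \<le> n" "0 \<le> x" "1 + x \<le> \<eta> * sqrt (real n)" for n x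
  proof -
    have r: "1 \<le> renewal x" by (rule exit_value(3)[OF that(2)])
    have "asc.exit_mean * renewal x \<le> \<bar>asc.exit_mean\<bar> * renewal x" using r by (intro mult_right_mono) auto
    with exit_value(2,3)[OF that(2)] have "1 + x \<le> renewal x + \<bar>asc.exit_mean\<bar> * renewal x" by linarith
    then have "1 + x \<le> m * renewal x" by (simp add: m_def distrib_right)
    then have "e * c / m * (1 + x) \<le> e * c / m * (m * renewal x)" using e c m by (intro mult_left_mono) auto
    also have "\<dots> = e * (c * renewal x)" using m by simp
    finally have "\<bar>real n * sqrt (real n) * killed l x n - c * renewal x\<bar> \<le> e * (c * renewal x)"
      using lim[OF that] by linarith
    moreover have cr: "0 < c * renewal x" using c r by simp
    moreover have "real n * sqrt (real n) * killed l x n / (c * renewal x) - 1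
      = (real n * sqrt (real n) * killed l x n - c * renewal x) / (c * renewal x)"
      using c r by (simp add: field_simps)
    ultimately show ?thesis by (simp add: pos_divide_le_eq)
  qed
  then show ?thesis using \<open>0 < \<eta>\<close> unfolding c_def by blast
qed

text \<open>The two mean exit heights enter through their product \<open>s2 / 2\<close>, which turns
  the third power of the standard deviation into the first power in the constant of the local limit
  theorem.\<close>

lemma constant_eq:
  "2 * (asc.exit_mean * w) / (sqrt (2 * pi) * sqrt s2 ^ 3) * (desc.exit_mean * u / l) = llt_const l * u * w"
proof -
  define r p where "r = sqrt s2" and "p = sqrt (2 * pi)"
  have r: "0 < r" "r\<^sup>2 = s2" and p: "0 < p" using s2_pos by (auto simp: r_def p_def)
  have prod: "asc.exit_mean * desc.exit_mean = r\<^sup>2 / 2" unfolding exit_mean_product r ..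
  have "2 * (asc.exit_mean * w) / (p * r ^ 3) * (desc.exit_mean * u / l)
    = 2 * (asc.exit_mean * desc.exit_mean) * (w * u) / (p * r ^ 3 * l)" by (simp only: times_divide_times_eq ac_simps)
  also have "\<dots> = u * w / (l * (p * r))"
    unfolding prod using r(1) p l by (simp add: field_simps power2_eq_square power3_eq_cube)
  finally show ?thesis by (simp add: llt_const_def real_sqrt_mult p_def r_def)
qed

end

end

section \<open>Exponential change of measure\<close>

lemma mea_Abs_fmeas: "sets A = sets borel \<Longrightarrow> finite_measure A \<Longrightarrow> mea (Abs_fmeas A) = A"
  by (simp add: Abs_fmeas_inverse)

context
  fixes \<mu> \<nu> :: fmeas and l \<kappa> :: real
  assumes tilt: "mea \<nu> = density (mea \<mu>) (\<lambda>y. ennreal (exp (l * y - \<kappa>)))"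
begin

lemma nni_tilt:
  assumes [measurable]: "f \<in> borel_measurable borel"
  shows "nni \<mu> f = nni \<nu> (\<lambda>y. ennreal (exp (\<kappa> - l * y)) * f y)"
proof -
  have "nni \<nu> (\<lambda>y. ennreal (exp (\<kappa> - l * y)) * f y)
      = nni \<mu> (\<lambda>y. ennreal (exp (l * y - \<kappa>)) * (ennreal (exp (\<kappa> - l * y)) * f y))"
    unfolding tilt by (rule nn_integral_density) measurable
  also have "\<dots> = nni \<mu> f"
    by (rule nn_integral_cong) (simp add: mult.assoc[symmetric] ennreal_mult[symmetric] exp_add[symmetric])
  finally show ?thesis ..
qed

text \<open>The density of the first n steps depends on the path through the sum of the steps alone,
  so it passes to the law of the n-th position and commutes with the killing.\<close>

lemma nni_stay_tilt:
  assumes D [measurable]: "D \<in> sets borel" and "f \<in> borel_measurable borel"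
  shows "nni (stay \<mu> D n) f = nni (stay \<nu> D n) (\<lambda>y. ennreal (exp (real n * \<kappa> - l * y)) * f y)"
  using assms(2)
proof (induction n arbitrary: f)
  case 0
  then show ?case by simp
next
  case (Suc n)
  note [measurable] = Suc.prems
  define g where "g = (\<lambda>y. indicator D y * f y)"
  have [measurable]: "g \<in> borel_measurable borel" unfolding g_def by measurable
  have "nni (stay \<mu> D (Suc n)) f = nni (stay \<mu> D n * \<mu>) g" by (simp add: nni_restr g_def)
  also have "\<dots> = (\<integral>\<^sup>+x. nni \<mu> (\<lambda>y. g (x + y)) \<partial>mea (stay \<mu> D n))" by (rule nni_times) measurable
  also have "\<dots> = (\<integral>\<^sup>+x. ennreal (exp (real n * \<kappa> - l * x)) * nni \<mu> (\<lambda>y. g (x + y)) \<partial>mea (stay \<nu> D n))"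
    by (rule Suc.IH) measurable
  also have "\<dots> = (\<integral>\<^sup>+x. \<integral>\<^sup>+y. ennreal (exp (real (Suc n) * \<kappa> - l * (x + y))) * g (x + y) \<partial>mea \<nu> \<partial>mea (stay \<nu> D n))"
  proof (rule nn_integral_cong)
    fix x
    have "ennreal (exp (real n * \<kappa> - l * x)) * nni \<mu> (\<lambda>y. g (x + y))
        = ennreal (exp (real n * \<kappa> - l * x)) * nni \<nu> (\<lambda>y. ennreal (exp (\<kappa> - l * y)) * g (x + y))"
      by (subst nni_tilt) auto
    also have "\<dots> = nni \<nu> (\<lambda>y. ennreal (exp (real n * \<kappa> - l * x)) * (ennreal (exp (\<kappa> - l * y)) * g (x + y)))"
      by (rule nn_integral_cmult[symmetric]) measurable
    also have "\<dots> = nni \<nu> (\<lambda>y. ennreal (exp (real (Suc n) * \<kappa> - l * (x + y))) * g (x + y))"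
    proof (rule nn_integral_cong)
      fix y
      have "exp (real n * \<kappa> - l * x) * exp (\<kappa> - l * y) = exp (real (Suc n) * \<kappa> - l * (x + y))"
        unfolding exp_add[symmetric] by (simp add: algebra_simps)
      then show "ennreal (exp (real n * \<kappa> - l * x)) * (ennreal (exp (\<kappa> - l * y)) * g (x + y)) = ennreal (exp (real (Suc n) * \<kappa> - l * (x + y))) * g (x + y)"
        by (simp only: mult.assoc[symmetric] ennreal_mult[OF exp_ge_zero exp_ge_zero, symmetric])
    qed
    finally show "ennreal (exp (real n * \<kappa> - l * x)) * nni \<mu> (\<lambda>y. g (x + y)) = \<dots>" .
  qed
  also have "\<dots> = nni (stay \<nu> D n * \<nu>) (\<lambda>y. ennreal (exp (real (Suc n) * \<kappa> - l * y)) * g y)"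
    by (rule nni_times[symmetric]) measurable
  also have "\<dots> = nni (stay \<nu> D (Suc n)) (\<lambda>y. ennreal (exp (real (Suc n) * \<kappa> - l * y)) * f y)"
    by (simp add: nni_restr g_def mult.left_commute del: of_nat_Suc)
  finally show ?case .
qed

lemma mass_stay_tilt:
  assumes x: "0 \<le> x" and l: "0 < l"
  shows "mass (stay \<mu> {y. 0 \<le> x + y} n) = exp (real n * \<kappa> + l * x) * ev (stay \<nu> {y. 0 \<le> x + y} n) (\<lambda>y. expo l (x + y))"
proof -
  define D where "D = {y. 0 \<le> x + y}"
  have D: "D \<in> sets borel" "insert 0 D = D" using x by (auto simp: D_def)
  have c: "concentrated (stay \<nu> D n) D" using concentrated_stay0[OF D(1), of \<nu> n] unfolding D(2) .
  have nb: "nonneg_bounded (\<lambda>y. expo l (x + y))"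
    by (intro nonneg_bounded_shift nonneg_bounded_expo) (use l in simp)
  have "ennreal (mass (stay \<mu> D n)) = nni (stay \<mu> D n) (\<lambda>_. 1)"
    by (simp add: finite_measure.emeasure_eq_measure[OF finite_mea])
  also have "\<dots> = nni (stay \<nu> D n) (\<lambda>y. ennreal (exp (real n * \<kappa> - l * y)) * 1)"
    by (rule nni_stay_tilt[OF D(1)]) simp
  \<comment> \<open>On \<open>D\<close> the height x + y is nonnegative, so
    \<open>exp (- l * y)\<close> may be written as
    \<open>exp (l * x) * expo l (x + y)\<close>.\<close>
  also have "\<dots> = nni (stay \<nu> D n) (\<lambda>y. ennreal (exp (real n * \<kappa> + l * x)) * ennreal (expo l (x + y)))"
    by (rule concentrated_nni_cong[OF c])
       (simp add: D_def expo_eq ennreal_mult[symmetric] exp_add[symmetric] algebra_simps)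
  also have "\<dots> = ennreal (exp (real n * \<kappa> + l * x)) * nni (stay \<nu> D n) (\<lambda>y. ennreal (expo l (x + y)))"
    by (rule nn_integral_cmult) measurable
  also have "\<dots> = ennreal (exp (real n * \<kappa> + l * x) * ev (stay \<nu> D n) (\<lambda>y. expo l (x + y)))"
    by (simp add: ennreal_ev[OF nb] ennreal_mult ev_nonneg[OF nb])
  finally show ?thesis
    unfolding D_def[symmetric] by (subst (asm) ennreal_inj) (auto intro: ev_nonneg[OF nb])
qed

end

text \<open>If the modulus were 1, with argument \<theta>, then
  \<open>cos (t * y - \<theta>)\<close> would have mean 1 and hence equal 1 almost surely, which
  puts the steps on a lattice of span \<open>2 * pi / \<bar>t\<bar>\<close>. The assumption
  \<open>ac\<close> carries null sets from the tilted law to \<open>M\<close>; it will hold because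
  the tilting density is positive.\<close>

lemma non_lattice_char:
  assumes "prob_space M" and Y [measurable]: "Y \<in> borel_measurable M" and nl: "non_lattice M Y" and m: "mass \<nu> = 1"
    and ac: "\<And>P. AE y in mea \<nu>. P y \<Longrightarrow> AE \<omega> in M. P (Y \<omega>)" and t: "t \<noteq> 0"
  shows "norm (char (mea \<nu>) t) < 1"
proof (rule ccontr)
  interpret M: prob_space M by fact
  interpret N: prob_space "mea \<nu>"
    by (rule prob_spaceI) (simp add: finite_measure.emeasure_eq_measure[OF finite_mea] m)
  interpret N: real_distribution "mea \<nu>" by unfold_locales simp_all
  assume "\<not> norm (char (mea \<nu>) t) < 1"
  with N.cmod_char_le_1[of t] have n1: "norm (char (mea \<nu>) t) = 1" by simp
  define \<theta> where "\<theta> = Arg2pi (char (mea \<nu>) t)"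
  have th: "char (mea \<nu>) t = iexp \<theta>"
    using n1 unfolding \<theta>_def complex_norm_eq_1_exp by simp
  have int: "integrable (mea \<nu>) (\<lambda>y. iexp (t * y))" by (rule N.integrable_iexp) simp_all
  have "ev \<nu> (\<lambda>y. Re (iexp (t * y) * iexp (- \<theta>))) = Re (integral\<^sup>L (mea \<nu>) (\<lambda>y. iexp (t * y) * iexp (- \<theta>)))"
    by (rule integral_Re) (intro integrable_mult_left int)
  also have "integral\<^sup>L (mea \<nu>) (\<lambda>y. iexp (t * y) * iexp (- \<theta>)) = char (mea \<nu>) t * iexp (- \<theta>)"
    unfolding char_def by (rule integral_mult_left_zero)
  also have "\<dots> = 1" unfolding th by (simp flip: exp_add)
  finally have "ev \<nu> (\<lambda>y. Re (iexp (t * y) * iexp (- \<theta>))) = 1" by simp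
  moreover have re: "Re (iexp (t * y) * iexp (- \<theta>)) = cos (t * y - \<theta>)" for y
    unfolding exp_add[symmetric] by (simp add: Re_exp)
  ultimately have c1: "ev \<nu> (\<lambda>y. cos (t * y - \<theta>)) = 1" by (simp only:)
  have ic: "integrable (mea \<nu>) (\<lambda>y. cos (t * y - \<theta>))" by (rule integrable_bounded[of _ 1]) auto
  have "ev \<nu> (\<lambda>y. 1 - cos (t * y - \<theta>)) = 0"
    by (subst Bochner_Integration.integral_diff) (auto simp: ic c1 m)
  then have "AE y in mea \<nu>. 1 - cos (t * y - \<theta>) = 0"
    by (subst (asm) integral_nonneg_eq_0_iff_AE) (auto intro!: Bochner_Integration.integrable_diff ic)
  then have ae: "AE \<omega> in M. 1 - cos (t * Y \<omega> - \<theta>) = 0" by (rule ac)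
  define h where "h = 2 * pi / \<bar>t\<bar>"
  define q where "q = \<theta> / t"
  \<comment> \<open>Reduction modulo the span, because lattices are defined with offsets in
    \<open>{0..<h}\<close>.\<close>
  define a where "a = q - h * \<lfloor>q / h\<rfloor>"
  have h: "0 < h" using t by (simp add: h_def)
  have a: "a \<in> {0..<h}"
  proof -
    have "\<lfloor>q / h\<rfloor> \<le> q / h" "q / h < \<lfloor>q / h\<rfloor> + 1" by linarith+
    then have "\<lfloor>q / h\<rfloor> * h \<le> q" "q < (\<lfloor>q / h\<rfloor> + 1) * h"
      unfolding pos_le_divide_eq[OF h] pos_divide_less_eq[OF h] by simp_all
    then show ?thesis by (simp add: a_def algebra_simps)
  qed
  have "AE \<omega> in M. \<exists>k::int. Y \<omega> = h * of_int k + a"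
    using ae
  proof eventually_elim
    case (elim \<omega>)
    then have "cos (t * Y \<omega> - \<theta>) = 1" by simp
    then obtain k :: int where "t * Y \<omega> - \<theta> = of_int k * 2 * pi"
      unfolding cos_one_2pi_int by blast
    then have "t * Y \<omega> = of_int k * (2 * pi) + \<theta>" by linarith
    then have "Y \<omega> = (of_int k * (2 * pi) + \<theta>) / t" using t by (simp add: eq_divide_eq mult.commute)
    also have "\<dots> = of_int k * (2 * pi / t) + q" by (simp add: q_def add_divide_distrib)
    also have "2 * pi / t = h * sgn t" using t by (simp add: h_def sgn_if)
    also have "of_int k * (h * sgn t) + q = h * of_int (k * (if 0 < t then 1 else -1) + \<lfloor>q / h\<rfloor>) + a"
      using t by (simp add: a_def sgn_if algebra_simps)
    finally show ?case by blast
  qed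
  then have "measure M {\<omega> \<in> space M. \<exists>k::int. Y \<omega> = h * of_int k + a} = 1"
    by (subst M.prob_Collect_eq_1) measurable
  with nl h a show False unfolding non_lattice_def by blast
qed

lemma walk_law_tilted:
  fixes M :: "'a measure" and Y :: "'a \<Rightarrow> real" and l \<delta> :: real
  defines "\<mu> \<equiv> distr M borel Y"
  assumes M: "prob_space M" and Y [measurable]: "Y \<in> borel_measurable M"
    and sq: "(\<integral>\<omega>. (Y \<omega>)\<^sup>2 \<partial>M) > 0" and nl: "non_lattice M Y" and l: "0 < l" and d: "0 < \<delta>"
    and mean: "has_bochner_integral M (\<lambda>\<omega>. Y \<omega> * exp (l * Y \<omega>)) 0"
    and mom: "integrable M (\<lambda>\<omega>. \<bar>Y \<omega>\<bar> powr (2 + \<delta>) * exp (l * Y \<omega>))"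
  shows "walk_law (Abs_fmeas (tilted_law \<mu> l))" "mea (Abs_fmeas (tilted_law \<mu> l)) = tilted_law \<mu> l"
proof -
  interpret M: prob_space M by fact
  have sets_mu [measurable_cong, simp]: "sets \<mu> = sets borel" by (simp add: \<mu>_def)
  interpret mu: prob_space \<mu> unfolding \<mu>_def by (rule M.prob_space_distr) simp
  define \<kappa> where "\<kappa> = log_mgf \<mu> l"
  \<comment> \<open>Moments of order 0 and 2 are dominated by the given one of order
    \<open>2 + \<delta>\<close>; for \<open>\<bar>y\<bar> \<le> 1\<close> the exponential is at most
    \<open>exp l\<close> because l is positive.\<close>
  have dom: "exp (l * y) \<le> exp l + \<bar>y\<bar> powr (2 + \<delta>) * exp (l * y)" (is ?A)
    "y\<^sup>2 * exp (l * y) \<le> exp l + \<bar>y\<bar> powr (2 + \<delta>) * exp (l * y)" (is ?B) for y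
  proof -
    have "?A \<and> ?B"
    proof (cases "\<bar>y\<bar> \<le> 1")
      case True
      then have e: "exp (l * y) \<le> exp l" using l by (simp add: abs_le_iff)
      have "y\<^sup>2 \<le> 1" using True by (simp add: abs_square_le_1)
      then have "y\<^sup>2 * exp (l * y) \<le> 1 * exp (l * y)" by (intro mult_right_mono) auto
      moreover have "0 \<le> \<bar>y\<bar> powr (2 + \<delta>) * exp (l * y)" by simp
      ultimately show ?thesis using e by linarith
    next
      case False
      then have y: "1 \<le> \<bar>y\<bar>" by simp
      then have p: "\<bar>y\<bar> powr 2 = y\<^sup>2" "\<bar>y\<bar> powr 0 = 1" by (auto simp: powr_numeral)
      have "1 \<le> \<bar>y\<bar> powr (2 + \<delta>)" "y\<^sup>2 \<le> \<bar>y\<bar> powr (2 + \<delta>)"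
        using powr_mono[of 0 "2 + \<delta>" "\<bar>y\<bar>"] powr_mono[of 2 "2 + \<delta>" "\<bar>y\<bar>"] y d p by simp_all
      then have "1 * exp (l * y) \<le> \<bar>y\<bar> powr (2 + \<delta>) * exp (l * y)" "y\<^sup>2 * exp (l * y) \<le> \<bar>y\<bar> powr (2 + \<delta>) * exp (l * y)"
        by (intro mult_right_mono; simp)+
      moreover have "0 < exp l" by simp
      ultimately show ?thesis by linarith
    qed
    then show ?A ?B by auto
  qed
  have domi: "integrable M (\<lambda>\<omega>. exp l + \<bar>Y \<omega>\<bar> powr (2 + \<delta>) * exp (l * Y \<omega>))"
    by (intro Bochner_Integration.integrable_add mom) simp
  have "integrable M (\<lambda>\<omega>. exp (l * Y \<omega>))"
    by (rule Bochner_Integration.integrable_bound[OF domi]) (use dom(1) in \<open>auto intro!: AE_I2\<close>)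
  then have i1: "integrable \<mu> (\<lambda>y. exp (l * y))" unfolding \<mu>_def by (subst integrable_distr_eq) auto
  have "integrable M (\<lambda>\<omega>. (Y \<omega>)\<^sup>2 * exp (l * Y \<omega>))"
    by (rule Bochner_Integration.integrable_bound[OF domi]) (use dom(2) in \<open>auto intro!: AE_I2\<close>)
  then have i2: "integrable \<mu> (\<lambda>y. y\<^sup>2 * exp (l * y))" unfolding \<mu>_def by (subst integrable_distr_eq) auto
  have i3: "integral\<^sup>L \<mu> (\<lambda>y. y * exp (l * y)) = 0"
    using mean unfolding \<mu>_def by (subst integral_distr) (auto simp: has_bochner_integral_iff)
  have pos: "0 < integral\<^sup>L \<mu> (\<lambda>y. exp (l * y))"
  proof -
    have "integral\<^sup>L \<mu> (\<lambda>y. exp (l * y)) \<noteq> 0"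
    proof
      assume "integral\<^sup>L \<mu> (\<lambda>y. exp (l * y)) = 0"
      then have "AE y in \<mu>. exp (l * y) = 0" using i1 by (subst (asm) integral_nonneg_eq_0_iff_AE) auto
      then have "AE y in \<mu>. False" by simp
      then show False using mu.AE_False by simp
    qed
    then show ?thesis by (simp add: order_less_le integral_nonneg)
  qed
  have ek: "exp (l * y - \<kappa>) = exp (l * y) / integral\<^sup>L \<mu> (\<lambda>y. exp (l * y))" for y
    using pos by (simp add: exp_diff \<kappa>_def log_mgf_def)
  define N where "N = tilted_law \<mu> l"
  have N: "N = density \<mu> (\<lambda>y. ennreal (exp (l * y - \<kappa>)))" by (simp add: N_def tilted_law_def \<kappa>_def)
  have sN: "sets N = sets borel" by (simp add: N)
  have spN: "space N = UNIV" using sets_eq_imp_space_eq[OF sN] by simp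
  have "emeasure N (space N) = (\<integral>\<^sup>+y. ennreal (exp (l * y - \<kappa>)) \<partial>\<mu>)"
    unfolding spN unfolding N by (subst emeasure_density) auto
  also have "\<dots> = ennreal (integral\<^sup>L \<mu> (\<lambda>y. exp (l * y - \<kappa>)))"
    using i1 by (intro nn_integral_eq_integral) (auto simp: ek)
  also have "integral\<^sup>L \<mu> (\<lambda>y. exp (l * y - \<kappa>)) = 1" using pos by (simp add: ek)
  finally have N1: "emeasure N (space N) = 1" by simp
  interpret N: prob_space N by (rule prob_spaceI) (rule N1)
  define \<nu> where "\<nu> = Abs_fmeas N"
  have mea: "mea \<nu> = N" unfolding \<nu>_def by (rule mea_Abs_fmeas[OF sN]) unfold_locales
  then show "mea (Abs_fmeas (tilted_law \<mu> l)) = tilted_law \<mu> l" by (simp add: \<nu>_def N_def)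
  have mass: "mass \<nu> = 1" using N.prob_space by (simp add: mea spN)
  have evN: "ev \<nu> f = integral\<^sup>L \<mu> (\<lambda>y. f y * exp (l * y)) / integral\<^sup>L \<mu> (\<lambda>y. exp (l * y))"
    if [measurable]: "f \<in> borel_measurable borel" for f
  proof -
    have "ev \<nu> f = integral\<^sup>L \<mu> (\<lambda>y. exp (l * y - \<kappa>) *\<^sub>R f y)"
      unfolding mea N by (rule integral_density) auto
    also have "(\<lambda>y. exp (l * y - \<kappa>) *\<^sub>R f y) = (\<lambda>y. f y * exp (l * y) / integral\<^sup>L \<mu> (\<lambda>y. exp (l * y)))"
      unfolding ek by (simp add: mult.commute)
    finally show ?thesis by simp
  qed
  have ac: "AE \<omega> in M. P (Y \<omega>)" if "AE y in mea \<nu>. P y" for P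
  proof -
    have "AE y in \<mu>. P y" using that unfolding mea N by (subst (asm) AE_density) auto
    then show ?thesis unfolding \<mu>_def by (rule AE_distrD[rotated]) simp
  qed
  have sqi: "integrable (mea \<nu>) (\<lambda>y. y\<^sup>2)"
  proof -
    have "(\<lambda>y. exp (l * y - \<kappa>) *\<^sub>R y\<^sup>2) = (\<lambda>y. y\<^sup>2 * exp (l * y) / integral\<^sup>L \<mu> (\<lambda>y. exp (l * y)))"
      unfolding ek by (simp add: mult.commute)
    then have "integrable \<mu> (\<lambda>y. exp (l * y - \<kappa>) *\<^sub>R y\<^sup>2)" using i2 by simp
    then show ?thesis unfolding mea N by (subst integrable_density) auto
  qed
  have "walk_law \<nu>"
  proof
    show "mass \<nu> = 1" by fact
    show "integrable (mea \<nu>) (\<lambda>y. y\<^sup>2)" by fact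
    show "ev \<nu> (\<lambda>y. y) = 0" by (simp add: evN i3)
    \<comment> \<open>A vanishing second moment would make the original step 0 almost surely, by
      \<open>ac\<close>.\<close>
    have "ev \<nu> (\<lambda>y. y\<^sup>2) \<noteq> 0"
    proof
      assume "ev \<nu> (\<lambda>y. y\<^sup>2) = 0"
      then have "AE y in mea \<nu>. y\<^sup>2 = 0" using sqi by (subst (asm) integral_nonneg_eq_0_iff_AE) auto
      then have "AE \<omega> in M. (Y \<omega>)\<^sup>2 = 0" by (rule ac)
      then have "(\<integral>\<omega>. (Y \<omega>)\<^sup>2 \<partial>M) = 0" by (rule integral_eq_zero_AE)
      with sq show False by simp
    qed
    moreover have "0 \<le> ev \<nu> (\<lambda>y. y\<^sup>2)" by (rule Bochner_Integration.integral_nonneg) simp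
    ultimately show "0 < ev \<nu> (\<lambda>y. y\<^sup>2)" unfolding order_less_le by metis
    show "norm (char (mea \<nu>) t) < 1" if "t \<noteq> 0" for t
      by (rule non_lattice_char[OF M Y nl mass _ that]) (rule ac)
  qed
  then show "walk_law (Abs_fmeas (tilted_law \<mu> l))" by (simp add: \<nu>_def N_def)
qed

text \<open>The supremum over the empty set in \<open>ereal\<close> is minus infinity, so nonempty
  index sets are what keeps the suprema from falling below 0.\<close>

lemma unif_asymp_equivI:
  assumes "\<And>e. 0 < e \<Longrightarrow> \<forall>\<^sub>F n in sequentially. A n \<noteq> {} \<and> (\<forall>\<theta>\<in>A n. \<bar>a n \<theta> / b n \<theta> - 1\<bar> \<le> e)"
  shows "unif_asymp_equiv a b A"
  unfolding unif_asymp_equiv_def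
proof (rule order_tendstoI)
  fix c :: ereal assume c: "c < 0"
  show "\<forall>\<^sub>F n in sequentially. c < (SUP \<theta>\<in>A n. ereal \<bar>a n \<theta> / b n \<theta> - 1\<bar>)"
    using assms[of 1, simplified]
  proof eventually_elim
    case (elim n)
    then obtain \<theta> where "\<theta> \<in> A n" by auto
    then have "ereal \<bar>a n \<theta> / b n \<theta> - 1\<bar> \<le> (SUP \<theta>\<in>A n. ereal \<bar>a n \<theta> / b n \<theta> - 1\<bar>)" by (rule SUP_upper)
    moreover have "c < ereal \<bar>a n \<theta> / b n \<theta> - 1\<bar>" using c by (rule less_le_trans) simp
    ultimately show ?case by order
  qed
next
  fix c :: ereal assume "0 < c"
  then obtain e where e: "0 < ereal e" "ereal e < c" using ereal_dense2 by blast
  then have "0 < e" by simp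
  from assms[OF this] show "\<forall>\<^sub>F n in sequentially. (SUP \<theta>\<in>A n. ereal \<bar>a n \<theta> / b n \<theta> - 1\<bar>) < c"
  proof eventually_elim
    case (elim n)
    then have "(SUP \<theta>\<in>A n. ereal \<bar>a n \<theta> / b n \<theta> - 1\<bar>) \<le> ereal e" by (intro SUP_least) auto
    with e(2) show ?case by order
  qed
qed

theorem theorem1p9:
  fixes M :: "'a measure" and X :: "nat \<Rightarrow> 'a \<Rightarrow> real"
    and l \<delta> :: real and \<alpha> :: "nat \<Rightarrow> real" and \<mu> :: "real measure"
  defines "\<mu> \<equiv> distr M borel (X 1)"
  assumes "prob_space M"
    and "prob_space.indep_vars M (\<lambda>_. borel) X {1..}"
    and "\<And>i. i \<ge> 1 \<Longrightarrow> distr M borel (X i) = distr M borel (X 1)"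
    and "integrable M (\<lambda>\<omega>. (X 1 \<omega>)\<^sup>2)"
    and "(\<integral>\<omega>. (X 1 \<omega>)\<^sup>2 \<partial>M) > 0"
    and "non_lattice M (X 1)"
    and "l > 0" and "\<delta> > 0"
    and "has_bochner_integral M (\<lambda>\<omega>. X 1 \<omega> * exp (l * X 1 \<omega>)) 0"
    and "integrable M (\<lambda>\<omega>. \<bar>X 1 \<omega>\<bar> powr (2 + \<delta>) * exp (l * X 1 \<omega>))"
    and "\<And>n. n \<ge> 1 \<Longrightarrow> \<alpha> n > 0"
    and "\<alpha> \<longlonglongrightarrow> 0"
  shows "unif_asymp_equiv
    (\<lambda>n x. measure M {\<omega> \<in> space M. exit_time (walk X) x \<omega> > enat n})
    (\<lambda>n x. 2 * V \<mu> l x * exp (real n * log_mgf \<mu> l + l * x)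
             / (sqrt (2 * pi) * tilted_sd \<mu> l ^ 3 * real n powr (3 / 2))
           * (LBINT t:{0..}. exp (- l * t) * V_dual \<mu> l t))
    (\<lambda>n. {0..\<alpha> n * sqrt (real n)})"
proof -
  interpret M: prob_space M by fact
  have X1 [measurable]: "X 1 \<in> borel_measurable M"
    using assms(3) unfolding M.indep_vars_def2 by (metis atLeast_iff order_refl)
  have pm: "prob_space \<mu>" unfolding \<mu>_def by (rule M.prob_space_distr[OF X1])
  define m \<nu> where "m = Abs_fmeas \<mu>" and "\<nu> = Abs_fmeas (tilted_law \<mu> l)"
  have m: "mea m = \<mu>"
    unfolding m_def by (rule mea_Abs_fmeas) (use pm in \<open>auto simp: \<mu>_def prob_space.finite_measure\<close>)
  have m1: "mass m = 1" using prob_space.prob_space[OF pm] by (simp add: m \<mu>_def)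
  note T = walk_law_tilted[OF assms(2) X1 assms(6,7,8,9,10,11), folded \<mu>_def, folded \<nu>_def]
  interpret N: walk_law \<nu> by (rule T(1))
  interpret X: iid_walk M X m
    by (rule iid_walk_indep_vars[OF assms(2,3) _ m1]) (unfold m \<mu>_def, rule assms(4))
  have tm: "tilted_measure \<mu> l = PiM {1..} (\<lambda>_. mea \<nu>)" by (simp add: tilted_measure_def T(2))
  have V: "V \<mu> l x = N.asc.exit_mean * N.renewal x" if "0 \<le> x" for x
    unfolding V_def tm by (rule N.exit_value(1)[OF that])
  have J: "(LBINT t:{0..}. exp (- l * t) * V_dual \<mu> l t) = N.desc.exit_mean * (\<Sum>n. N.up l n) / l"
    by (rule N.dual_exit_integral[OF assms(8)]) (unfold V_dual_def tm, rule N.dual_exit_value)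
  have sd: "tilted_sd \<mu> l = sqrt N.s2"
  proof -
    have "(\<integral>\<omega>. (coord 1 \<omega>)\<^sup>2 \<partial>tilted_measure \<mu> l) = (\<integral>y. y\<^sup>2 \<partial>distr (PiM {1::nat..} (\<lambda>_. mea \<nu>)) (mea \<nu>) (\<lambda>\<omega>. \<omega> 1))"
      unfolding tm coord_def by (subst integral_distr, rule measurable_component_singleton) simp_all
    also have "distr (PiM {1::nat..} (\<lambda>_. mea \<nu>)) (mea \<nu>) (\<lambda>\<omega>. \<omega> 1) = mea \<nu>"
      by (rule distr_PiM_component) (auto intro: prob_space_mu)
    finally show ?thesis by (simp add: tilted_sd_def N.s2_def)
  qed
  have P: "measure M {\<omega> \<in> space M. exit_time (walk X) x \<omega> > enat n} = exp (real n * log_mgf \<mu> l + l * x) * N.killed l x n"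
    if "0 \<le> x" for n x
  proof -
    have "measure M {\<omega> \<in> space M. exit_time (walk X) x \<omega> > enat n} = mass (stay m {y. 0 \<le> x + y} n)"
      by (rule X.measure_exit_time_gt) auto
    also have "\<dots> = exp (real n * log_mgf \<mu> l + l * x) * N.killed l x n"
      unfolding N.killed_def[OF assms(8)]
      by (rule mass_stay_tilt[OF _ that assms(8)]) (simp add: T(2) m tilted_law_def)
    finally show ?thesis .
  qed
  show ?thesis
  proof (rule unif_asymp_equivI)
    fix e :: real assume "0 < e"
    from N.killed_equiv[OF assms(8) this] obtain \<eta> n0 where \<eta>: "0 < \<eta>" and
      lim: "\<And>n x. n0 \<le> n \<Longrightarrow> 0 \<le> x \<Longrightarrow> 1 + x \<le> \<eta> * sqrt (real n) \<Longrightarrow>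
        \<bar>real n * sqrt (real n) * N.killed l x n / (N.llt_const l * (\<Sum>j. N.up l j) * N.renewal x) - 1\<bar> \<le> e"
      by blast
    \<comment> \<open>Half of \<open>\<eta> * sqrt (real n)\<close> is reserved for x, the other
      half for the summand 1.\<close>
    have "\<forall>\<^sub>F n in sequentially. \<alpha> n < \<eta> / 2" using assms(13) \<eta> by (intro order_tendstoD) auto
    moreover have "\<forall>\<^sub>F n in sequentially. 2 / \<eta> \<le> sqrt (real n)"
      by (rule filterlim_at_top[THEN iffD1, rule_format]) real_asymp
    moreover have "\<forall>\<^sub>F n in sequentially. max 1 n0 \<le> n" by (rule eventually_ge_at_top)
    ultimately show "\<forall>\<^sub>F n in sequentially. {0..\<alpha> n * sqrt (real n)} \<noteq> {} \<and> (\<forall>x\<in>{0..\<alpha> n * sqrt (real n)}.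
      \<bar>measure M {\<omega> \<in> space M. exit_time (walk X) x \<omega> > enat n} /
        (2 * V \<mu> l x * exp (real n * log_mgf \<mu> l + l * x)
             / (sqrt (2 * pi) * tilted_sd \<mu> l ^ 3 * real n powr (3 / 2))
           * (LBINT t:{0..}. exp (- l * t) * V_dual \<mu> l t)) - 1\<bar> \<le> e)"
    proof eventually_elim
      case (elim n)
      have n: "1 \<le> n" "n0 \<le> n" using elim by auto
      have "{0..\<alpha> n * sqrt (real n)} \<noteq> {}" using assms(12)[OF n(1)] by simp
      moreover have "\<bar>measure M {\<omega> \<in> space M. exit_time (walk X) x \<omega> > enat n} /
        (2 * V \<mu> l x * exp (real n * log_mgf \<mu> l + l * x)
             / (sqrt (2 * pi) * tilted_sd \<mu> l ^ 3 * real n powr (3 / 2))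
           * (LBINT t:{0..}. exp (- l * t) * V_dual \<mu> l t)) - 1\<bar> \<le> e" if x: "x \<in> {0..\<alpha> n * sqrt (real n)}" for x
      proof -
        have x0: "0 \<le> x" using x by simp
        have "\<alpha> n * sqrt (real n) \<le> \<eta> / 2 * sqrt (real n)"
          using elim(1) by (intro mult_right_mono) auto
        then have "x \<le> \<eta> / 2 * sqrt (real n)" using x by simp
        moreover have "1 \<le> \<eta> / 2 * sqrt (real n)" using elim(2) \<eta> by (simp add: field_simps)
        ultimately have xn: "1 + x \<le> \<eta> * sqrt (real n)" by simp
        define E where "E = exp (real n * log_mgf \<mu> l + l * x)"
        have E: "0 < E" by (simp add: E_def)
        have pw: "real n powr (3 / 2) = real n * sqrt (real n)"
          using n powr_add[of "real n" 1 "1 / 2"] by (simp add: powr_half_sqrt)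
        have "2 * V \<mu> l x * E / (sqrt (2 * pi) * tilted_sd \<mu> l ^ 3 * real n powr (3 / 2))
           * (LBINT t:{0..}. exp (- l * t) * V_dual \<mu> l t)
          = E / (real n * sqrt (real n)) * (2 * (N.asc.exit_mean * N.renewal x) / (sqrt (2 * pi) * sqrt N.s2 ^ 3) * (N.desc.exit_mean * (\<Sum>n. N.up l n) / l))"
          unfolding V[OF x0] J sd pw by (simp add: ac_simps)
        also have "\<dots> = E / (real n * sqrt (real n)) * (N.llt_const l * (\<Sum>n. N.up l n) * N.renewal x)"
          unfolding N.constant_eq[OF assms(8)] ..
        finally have b: "2 * V \<mu> l x * E / (sqrt (2 * pi) * tilted_sd \<mu> l ^ 3 * real n powr (3 / 2))
           * (LBINT t:{0..}. exp (- l * t) * V_dual \<mu> l t)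
          = E / (real n * sqrt (real n)) * (N.llt_const l * (\<Sum>n. N.up l n) * N.renewal x)" .
        \<comment> \<open>The tilting factor is common to the survival probability and the
          asymptotic expression; only the power of n is left of the prefactor.\<close>
        have "E * k / (E / (real n * sqrt (real n)) * K) = real n * sqrt (real n) * k / K" for k K
          using E n by simp
        then have "measure M {\<omega> \<in> space M. exit_time (walk X) x \<omega> > enat n} /
            (2 * V \<mu> l x * E / (sqrt (2 * pi) * tilted_sd \<mu> l ^ 3 * real n powr (3 / 2))
           * (LBINT t:{0..}. exp (- l * t) * V_dual \<mu> l t))
          = real n * sqrt (real n) * N.killed l x n / (N.llt_const l * (\<Sum>j. N.up l j) * N.renewal x)"
          unfolding P[OF x0] E_def[symmetric] b .
        with lim[OF n(2) x0 xn] show ?thesis unfolding E_def by simp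
      qed
      ultimately show ?case by blast
    qed
  qed
qed

end
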